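(* Let $m\ge 2$ and let $P_1,P_2,\ldots,P_m\in\mathbb{C}$ satisfy $P_j\neq P_{j+1}$ for $j=1,\ldots,m-1$. The set $\mathcal{A}_{\pi/2}(P_1,P_2,\ldots,P_m)$ contains a curve $F_{opt}$ with minimal bending energy (among all curves in $\mathcal{A}_{\pi/2}(P_1,\ldots,P_m)$). Moreover, if $F\in\mathcal{A}_{\pi/2}(P_1,P_2,\ldots,P_m)$ has minimal bending energy, then each piece of $F$ is $G^2$.
   Context: A curve is a function $f:[a,b]\to\mathbb{C}$ whose derivative $f'$ is absolutely continuous and non-vanishing. Its bending energy is $\|f\|^2:=\frac14\int_0^{\mathcal{L}}\kappa^2\,ds$, where $\mathcal{L}$ is the arclength of $f$ and $\kappa$ its signed curvature as a function of arclength $s$ (the value $+\infty$ is allowed). A curve is $G^2$ if its unit tangent direction and its signed curvature both change continuously with respect to arclength. An s-curve is a curve which first turns monotonically at most $180^\circ$ in one direction (either counter-clockwise or clockwise) and then turns monotonically at most $180^\circ$ in the opposite direction; that is, for a continuous tangent angle $\theta$ of $f'$ there is $c\in[a,b]$ such that $\theta$ is monotone on $[a,c]$ and monotone in the opposite sense on $[c,b]$, with total change at most $\pi$ in magnitude on each of the two intervals. The chord angles $(\alpha,\beta)$ of an s-curve $f:[a,b]\to\mathbb{C}$ are $\alpha=\arg\frac{f'(a)}{f(b)-f(a)}$, $\beta=\arg\frac{f'(b)}{f(b)-f(a)}$, where $\arg$ takes values in $(-\pi,\pi]$. An interpolating curve for $P_1,\ldots,P_m$ is a curve $F:[a,b]\to\mathbb{C}$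 for which there are times $a=t_1<t_2<\cdots<t_m=b$ with $F(t_j)=P_j$; its $j$-th piece is the restriction $F_{[t_j,t_{j+1}]}$, which runs from $P_j$ to $P_{j+1}$. $\mathcal{A}_{\pi/2}(P_1,\ldots,P_m)$ is the set of all interpolating curves all of whose pieces are s-curves with chord angles $(\alpha,\beta)$ satisfying $|\alpha|,|\beta|\le\frac{\pi}{2}$. *)

theory Defs
  imports "HOL-Analysis.Analysis"
begin

text \<open>
  A curve \<open>f : [a,b] \<rightarrow> \<complex>\<close> is represented by a function on \<^typ>\<open>real\<close> together with \<open>a\<close> and \<open>b\<close>.
  All derivatives are taken within \<open>[a,b]\<close>, hence one-sided at the end points, so nothing below
  depends on the values of \<open>f\<close> outside \<open>[a,b]\<close>, and the restriction of \<open>f\<close> to a subinterval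
  is obtained by changing \<open>a\<close> and \<open>b\<close> only.
\<close>

text \<open>
  Absolute continuity in the \<open>\<epsilon>\<close>-\<open>\<delta>\<close> sense; a finite family \<open>D\<close> of non-overlapping compact
  intervals is a division of its own union.
\<close>

definition absolutely_continuous_on_interval ::
    "real \<Rightarrow> real \<Rightarrow> (real \<Rightarrow> 'v::real_normed_vector) \<Rightarrow> bool" where
  "absolutely_continuous_on_interval a b g \<longleftrightarrow>
     (\<forall>\<epsilon>>0. \<exists>\<delta>>0. \<forall>D. D division_of \<Union>D \<longrightarrow> \<Union>D \<subseteq> {a..b} \<longrightarrow>
        (\<Sum>K\<in>D. Sup K - Inf K) < \<delta> \<longrightarrow> (\<Sum>K\<in>D. norm (g (Sup K) - g (Inf K))) < \<epsilon>)"

definition velocity :: "real \<Rightarrow> real \<Rightarrow> (real \<Rightarrow> complex) \<Rightarrow> real \<Rightarrow> complex" where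
  "velocity a b f t = vector_derivative f (at t within {a..b})"

definition curve :: "real \<Rightarrow> real \<Rightarrow> (real \<Rightarrow> complex) \<Rightarrow> bool" where
  "curve a b f \<longleftrightarrow> a < b \<and> f differentiable_on {a..b} \<and>
     absolutely_continuous_on_interval a b (velocity a b f) \<and>
     (\<forall>t\<in>{a..b}. velocity a b f t \<noteq> 0)"

definition arclength_upto :: "real \<Rightarrow> real \<Rightarrow> (real \<Rightarrow> complex) \<Rightarrow> real \<Rightarrow> real" where
  "arclength_upto a b f t = integral {a..t} (\<lambda>u. norm (velocity a b f u))"

definition arclength :: "real \<Rightarrow> real \<Rightarrow> (real \<Rightarrow> complex) \<Rightarrow> real" where
  "arclength a b f = arclength_upto a b f b"

definition time_at_arclength :: "real \<Rightarrow> real \<Rightarrow> (real \<Rightarrow> complex) \<Rightarrow> real \<Rightarrow> real" where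
  "time_at_arclength a b f = the_inv_into {a..b} (arclength_upto a b f)"

definition unit_tangent :: "real \<Rightarrow> real \<Rightarrow> (real \<Rightarrow> complex) \<Rightarrow> real \<Rightarrow> complex" where
  "unit_tangent a b f s = sgn (velocity a b f (time_at_arclength a b f s))"

text \<open>
  With \<open>T\<close> the unit tangent as a function of arclength \<open>s\<close>, the signed curvature \<open>\<kappa>\<close> is given by
  \<open>T'(s) = \<i> \<kappa>(s) T(s)\<close>, that is, \<open>\<i> \<kappa>(s)\<close> is the conjugate of \<open>T(s)\<close> times \<open>T'(s)\<close>. For a curve,
  \<open>T\<close> is absolutely continuous, so \<open>\<kappa>\<close> is meaningful for almost every \<open>s\<close>; the remaining \<open>s\<close> are
  irrelevant for the bending energy.
\<close>

definition signed_curvature :: "real \<Rightarrow> real \<Rightarrow> (real \<Rightarrow> complex) \<Rightarrow> real \<Rightarrow> real" where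
  "signed_curvature a b f s =
     Im (cnj (unit_tangent a b f s) *
         vector_derivative (unit_tangent a b f) (at s within {0..arclength a b f}))"

definition bending_energy :: "real \<Rightarrow> real \<Rightarrow> (real \<Rightarrow> complex) \<Rightarrow> ennreal" where
  "bending_energy a b f =
     (\<integral>\<^sup>+ s\<in>{0..arclength a b f}. ennreal ((signed_curvature a b f s)\<^sup>2) \<partial>lebesgue) / 4"

text \<open>Differentiability of the unit tangent says that the signed curvature exists everywhere.\<close>

definition G2 :: "real \<Rightarrow> real \<Rightarrow> (real \<Rightarrow> complex) \<Rightarrow> bool" where
  "G2 a b f \<longleftrightarrow>
     continuous_on {0..arclength a b f} (unit_tangent a b f) \<and>
     unit_tangent a b f differentiable_on {0..arclength a b f} \<and>
     continuous_on {0..arclength a b f} (signed_curvature a b f)"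

definition tangent_angle ::
    "real \<Rightarrow> real \<Rightarrow> (real \<Rightarrow> complex) \<Rightarrow> (real \<Rightarrow> real) \<Rightarrow> bool" where
  "tangent_angle a b f \<theta> \<longleftrightarrow> continuous_on {a..b} \<theta> \<and>
     (\<forall>t\<in>{a..b}. velocity a b f t = of_real (norm (velocity a b f t)) * cis (\<theta> t))"

definition s_curve :: "real \<Rightarrow> real \<Rightarrow> (real \<Rightarrow> complex) \<Rightarrow> bool" where
  "s_curve a b f \<longleftrightarrow> curve a b f \<and>
     (\<exists>\<theta> c. tangent_angle a b f \<theta> \<and> c \<in> {a..b} \<and>
        (mono_on {a..c} \<theta> \<and> antimono_on {c..b} \<theta> \<or>
         antimono_on {a..c} \<theta> \<and> mono_on {c..b} \<theta>) \<and>
        \<bar>\<theta> c - \<theta> a\<bar> \<le> pi \<and> \<bar>\<theta> b - \<theta> c\<bar> \<le> pi)"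

definition chord_angles :: "real \<Rightarrow> real \<Rightarrow> (real \<Rightarrow> complex) \<Rightarrow> real \<times> real" where
  "chord_angles a b f =
     (Arg (velocity a b f a / (f b - f a)), Arg (velocity a b f b / (f b - f a)))"

definition interpolating ::
    "(nat \<Rightarrow> complex) \<Rightarrow> nat \<Rightarrow> real \<Rightarrow> real \<Rightarrow> (real \<Rightarrow> complex) \<Rightarrow> (nat \<Rightarrow> real) \<Rightarrow> bool" where
  "interpolating P m a b F t \<longleftrightarrow> curve a b F \<and>
     strict_mono_on {1..m} t \<and> t 1 = a \<and> t m = b \<and> (\<forall>j\<in>{1..m}. F (t j) = P j)"

text \<open>
  A curve may pass through the points \<open>P\<^sub>j\<close> at several admissible sequences of times, and
  its pieces depend on that choice.
\<close>

definition admissible_times ::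
    "real \<Rightarrow> (nat \<Rightarrow> complex) \<Rightarrow> nat \<Rightarrow> real \<Rightarrow> real \<Rightarrow> (real \<Rightarrow> complex) \<Rightarrow> (nat \<Rightarrow> real) \<Rightarrow> bool" where
  "admissible_times \<omega> P m a b F t \<longleftrightarrow> interpolating P m a b F t \<and>
     (\<forall>j\<in>{1..<m}. s_curve (t j) (t (Suc j)) F \<and>
        (case chord_angles (t j) (t (Suc j)) F of (\<alpha>, \<beta>) \<Rightarrow> \<bar>\<alpha>\<bar> \<le> \<omega> \<and> \<bar>\<beta>\<bar> \<le> \<omega>))"

definition admissible_curves ::
    "real \<Rightarrow> (nat \<Rightarrow> complex) \<Rightarrow> nat \<Rightarrow> (real \<times> real \<times> (real \<Rightarrow> complex)) set" where
  "admissible_curves \<omega> P m = {(a, b, F). \<exists>t. admissible_times \<omega> P m a b F t}"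

definition energy_minimal ::
    "(real \<times> real \<times> (real \<Rightarrow> complex)) set \<Rightarrow> real \<Rightarrow> real \<Rightarrow> (real \<Rightarrow> complex) \<Rightarrow> bool" where
  "energy_minimal A a b F \<longleftrightarrow> (a, b, F) \<in> A \<and>
     (\<forall>(a', b', F')\<in>A. bending_energy a b F \<le> bending_energy a' b' F')"

end

theory Submission
  imports Defs "HOL-Complex_Analysis.Great_Picard"
begin

text \<open>
  Parametrized by arclength, a piece is given by its tangent angle \<open>\<theta>\<close>, which is monotone and then
  monotone in the opposite sense; its curvature is \<open>k = \<theta>'\<close> and its chord is \<open>\<integral> cis \<theta>\<close>. The main device
  is to stretch a piece by a weight \<open>w \<ge> 0\<close>: the element of arclength \<open>ds\<close> becomes \<open>w ds\<close>, the angles and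
  their order are kept, the chord becomes \<open>\<integral> w cis \<theta>\<close>, and the integral of the squared curvature becomes
  \<open>\<integral> k\<^sup>2 / w\<close>, which is convex in \<open>w\<close>.

  Existence. In a minimizing sequence the lengths of the pieces need not be bounded, because long nearly
  straight parts that run forwards and backwards cost little. Weights proportional to
  \<open>\<bar>k\<bar> / \<surd>(sin \<phi>)\<close>, which turn such parts into arcs of the rectangular elastica, shorten them without
  changing the chord and the end directions and without increasing the energy. Then all lengths are
  bounded by a multiple of the chord, the Arzela-Ascoli theorem gives a limit, and Fatou's lemma for
  difference quotients of \<open>\<theta>\<close> shows that the energy is lower semicontinuous.

  Regularity. Every piece of a minimizer minimizes the energy for its chord and end directions. The
  first variation in \<open>w\<close> yields \<open>k\<^sup>2 = \<alpha> cos \<theta> + \<beta> sin \<theta>\<close> almost everywhere. Hence \<open>\<bar>k\<bar>\<close> is continuous and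
  \<open>k\<close> can jump only where it changes sign, at the extremum of \<open>\<theta>\<close>. If it did, cutting off the tip of the
  graph of \<open>\<theta>\<close> at height \<open>\<delta>\<close> would save energy of order \<open>\<delta>\<close>, whereas restoring the chord costs only
  \<open>O(\<delta>\<^sup>2)\<close>.
\<close>

section \<open>Absolutely continuous functions of one variable\<close>

text \<open>Pieces interact only through the directions at the interpolation points. With these
  fixed, each piece can be minimized separately, and what remains is a minimum over finitely many
  unit vectors and energy bounds. The bound \<pi>/2 on the chord angles says that direction and
  chord have nonnegative inner product. This condition is closed, and two consecutive chords always
  admit a common direction that satisfies it, so curves of finite energy exist.

  Energy is controlled through increments of the angle. The inequality (\<theta> t - \<theta> s)^2
  \<le> (t - s) (\<Phi> t - \<Phi> s), with \<Phi> an accumulated energy, is kept by reweighting,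
  and its consequences for finite sums and difference quotients pass to pointwise limits. It gives
  absolute continuity and returns the energy bound. This is needed because a weight may vanish on
  straight parts, where the new arclength is not invertible.

  The turning bound of 180 degrees makes shortening possible: measured from the end direction
  farther from the extremum, the angle stays in [0, \<pi>]. There the sine is nonnegative, so only
  forward and backward motion can cancel.\<close>

lemma sum_mono_increments_le:
  fixes f :: "real \<Rightarrow> real"
  assumes D: "D division_of \<Union>D" "\<Union>D \<subseteq> {a..b}" and "a \<le> b" and f: "mono_on {a..b} f"
  shows "(\<Sum>K\<in>D. f (Sup K) - f (Inf K)) \<le> f b - f a"
proof -
  obtain q where q: "D \<subseteq> q" "q division_of {a..b}"
    using partial_division_extend_interval[of D a b] D by auto
  have K: "\<exists>l u. K = {l..u} \<and> l \<le> u \<and> a \<le> l \<and> u \<le> b" if "K \<in> q" for K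
  proof -
    obtain l u where "K = cbox l u" "K \<noteq> {}" "K \<subseteq> {a..b}"
      using division_ofD(2,3,4)[OF q(2) \<open>K \<in> q\<close>] by blast
    thus ?thesis by (intro exI[of _ l] exI[of _ u]) auto
  qed
  have pos: "0 \<le> f (Sup K) - f (Inf K)" if "K \<in> q" for K
    using K[OF that] f by (auto simp: mono_on_def)
  \<comment> \<open>Increments over a division of the whole interval telescope; the tags
    \<open>Inf K\<close> are arbitrary and only give access to the telescoping sum for tagged
    divisions. The intervals added to D contribute nonnegative terms.\<close>
  have inj: "inj_on (\<lambda>K::real set. (Inf K, K)) q" by (auto simp: inj_on_def)
  have "(\<lambda>K. (Inf K, K)) ` q tagged_division_of {a..b}"
    unfolding tagged_division_of
  proof (intro conjI allI impI)
    show "finite ((\<lambda>K. (Inf K, K)) ` q)" using q(2) by (simp add: division_ofD(1))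
    fix x K assume "(x, K) \<in> (\<lambda>K. (Inf K, K)) ` q"
    hence xK: "x = Inf K" "K \<in> q" by auto
    show "x \<in> K" using K[OF xK(2)] xK by auto
    show "K \<subseteq> {a..b}" using K[OF xK(2)] by auto
    show "\<exists>l u. K = cbox l u" using K[OF xK(2)] by auto
  next
    fix x K x' K'
    assume "(x, K) \<in> (\<lambda>K. (Inf K, K)) ` q \<and> (x', K') \<in> (\<lambda>K. (Inf K, K)) ` q \<and> (x, K) \<noteq> (x', K')"
    hence "K \<in> q" "K' \<in> q" "K \<noteq> K'" by auto
    thus "interior K \<inter> interior K' = {}" using q(2) division_ofD(5) by blast
  next
    show "\<Union> {K. \<exists>x. (x, K) \<in> (\<lambda>K. (Inf K, K)) ` q} = {a..b}"
    proof -
      have "{K. \<exists>x. (x, K) \<in> (\<lambda>K. (Inf K, K)) ` q} = q" by auto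
      thus ?thesis using q(2) by (simp add: division_ofD(6))
    qed
  qed
  from additive_tagged_division_1[OF \<open>a \<le> b\<close> this, of f]
  have "(\<Sum>K\<in>q. f (Sup K) - f (Inf K)) = f b - f a"
    by (simp add: sum.reindex[OF inj] o_def)
  moreover have "(\<Sum>K\<in>D. f (Sup K) - f (Inf K)) \<le> (\<Sum>K\<in>q. f (Sup K) - f (Inf K))"
    by (rule sum_mono2) (use q pos in \<open>auto simp: division_ofD(1)\<close>)
  ultimately show ?thesis by simp
qed

lemma division_interval_cases:
  fixes a b :: real
  assumes "D division_of \<Union>D" "\<Union>D \<subseteq> {a..b}" "K \<in> D"
  obtains l u where "K = {l..u}" "l \<le> u" "a \<le> l" "u \<le> b"
proof -
  obtain l u where *: "K = cbox l u" "K \<noteq> {}"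
    using division_ofD(3,4)[OF assms(1,3)] by blast
  have "K \<subseteq> {a..b}" using assms by auto
  with * that[of l u] show ?thesis by auto
qed

text \<open>Cauchy-Schwarz over the intervals of the division, with \<Phi> as accumulated energy.
  The bound is left in squared form, with the total increment of \<Phi>, so that it passes to
  pointwise limits of g.\<close>

lemma sum_increments_square_le:
  fixes g :: "real \<Rightarrow> 'v::real_normed_vector" and \<Phi> :: "real \<Rightarrow> real"
  assumes "a \<le> b"
    and bd: "\<And>s t. a \<le> s \<Longrightarrow> s \<le> t \<Longrightarrow> t \<le> b \<Longrightarrow> (norm (g t - g s))\<^sup>2 \<le> (t - s) * (\<Phi> t - \<Phi> s)"
    and mono: "mono_on {a..b} \<Phi>"
    and D: "D division_of \<Union> D" "\<Union> D \<subseteq> {a..b}"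
  shows "(\<Sum>K\<in>D. norm (g (Sup K) - g (Inf K)))\<^sup>2 \<le> (\<Sum>K\<in>D. Sup K - Inf K) * (\<Phi> b - \<Phi> a)"
proof -
  have pos: "0 \<le> Sup K - Inf K" "0 \<le> \<Phi> (Sup K) - \<Phi> (Inf K)"
    and le: "norm (g (Sup K) - g (Inf K)) \<le> sqrt (Sup K - Inf K) * sqrt (\<Phi> (Sup K) - \<Phi> (Inf K))"
    if KD: "K \<in> D" for K
  proof -
    obtain l u where "K = {l..u}" "l \<le> u" "a \<le> l" "u \<le> b"
      by (rule division_interval_cases[OF D KD])
    thus "0 \<le> Sup K - Inf K" "0 \<le> \<Phi> (Sup K) - \<Phi> (Inf K)"
      "norm (g (Sup K) - g (Inf K)) \<le> sqrt (Sup K - Inf K) * sqrt (\<Phi> (Sup K) - \<Phi> (Inf K))"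
      using mono bd[of l u] by (auto simp: mono_on_def simp flip: real_sqrt_mult intro!: real_le_rsqrt)
  qed
  have "(\<Sum>K\<in>D. norm (g (Sup K) - g (Inf K)))\<^sup>2
     \<le> (\<Sum>K\<in>D. sqrt (Sup K - Inf K) * sqrt (\<Phi> (Sup K) - \<Phi> (Inf K)))\<^sup>2"
    by (intro power_mono sum_mono le sum_nonneg) auto
  also have "\<dots> \<le> (\<Sum>K\<in>D. (sqrt (Sup K - Inf K))\<^sup>2) * (\<Sum>K\<in>D. (sqrt (\<Phi> (Sup K) - \<Phi> (Inf K)))\<^sup>2)"
    by (rule Cauchy_Schwarz_ineq_sum)
  also have "\<dots> = (\<Sum>K\<in>D. Sup K - Inf K) * (\<Sum>K\<in>D. \<Phi> (Sup K) - \<Phi> (Inf K))"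
    using pos by simp
  also have "\<dots> \<le> (\<Sum>K\<in>D. Sup K - Inf K) * (\<Phi> b - \<Phi> a)"
    using sum_mono_increments_le[OF D \<open>a \<le> b\<close> mono] pos
    by (intro mult_left_mono sum_nonneg) auto
  finally show ?thesis .
qed

lemma absolutely_continuous_if_sum_square_le:
  fixes g :: "real \<Rightarrow> 'v::real_normed_vector"
  assumes "0 \<le> E" and le: "\<And>D. D division_of \<Union> D \<Longrightarrow> \<Union> D \<subseteq> {a..b} \<Longrightarrow>
      (\<Sum>K\<in>D. norm (g (Sup K) - g (Inf K)))\<^sup>2 \<le> (\<Sum>K\<in>D. Sup K - Inf K) * E"
  shows "absolutely_continuous_on_interval a b g"
  unfolding absolutely_continuous_on_interval_def
proof (intro allI impI)
  fix \<epsilon> :: real assume "\<epsilon> > 0"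
  show "\<exists>\<delta>>0. \<forall>D. D division_of \<Union> D \<longrightarrow> \<Union> D \<subseteq> {a..b} \<longrightarrow> (\<Sum>K\<in>D. Sup K - Inf K) < \<delta> \<longrightarrow>
     (\<Sum>K\<in>D. norm (g (Sup K) - g (Inf K))) < \<epsilon>"
  \<comment> \<open>Adding 1 to E covers the case E = 0.\<close>
  proof (intro exI[of _ "\<epsilon>\<^sup>2 / (E + 1)"] conjI allI impI)
    show "0 < \<epsilon>\<^sup>2 / (E + 1)" using \<open>\<epsilon> > 0\<close> \<open>0 \<le> E\<close> by simp
    fix D :: "real set set"
    assume D: "D division_of \<Union> D" "\<Union> D \<subseteq> {a..b}" and lt: "(\<Sum>K\<in>D. Sup K - Inf K) < \<epsilon>\<^sup>2 / (E + 1)"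
    have pos: "0 \<le> Sup K - Inf K" if KD: "K \<in> D" for K
    proof -
      obtain l u where "K = {l..u}" "l \<le> u" "a \<le> l" "u \<le> b"
        by (rule division_interval_cases[OF D KD])
      thus ?thesis by simp
    qed
    have "(\<Sum>K\<in>D. norm (g (Sup K) - g (Inf K)))\<^sup>2 \<le> (\<Sum>K\<in>D. Sup K - Inf K) * E" by (rule le[OF D])
    also have "\<dots> \<le> (\<Sum>K\<in>D. Sup K - Inf K) * (E + 1)"
      using pos by (intro mult_left_mono sum_nonneg) auto
    also have "\<dots> < \<epsilon>\<^sup>2 / (E + 1) * (E + 1)" using lt \<open>0 \<le> E\<close> by (intro mult_strict_right_mono) auto
    also have "\<dots> = \<epsilon>\<^sup>2" using \<open>0 \<le> E\<close> by simp
    finally show "(\<Sum>K\<in>D. norm (g (Sup K) - g (Inf K))) < \<epsilon>"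
      using \<open>\<epsilon> > 0\<close> power2_less_imp_less by (smt (verit))
  qed
qed

lemma absolutely_continuous_if_energy_bound:
  fixes g :: "real \<Rightarrow> 'v::real_normed_vector" and \<Phi> :: "real \<Rightarrow> real"
  assumes "a \<le> b"
    and bd: "\<And>s t. a \<le> s \<Longrightarrow> s \<le> t \<Longrightarrow> t \<le> b \<Longrightarrow> (norm (g t - g s))\<^sup>2 \<le> (t - s) * (\<Phi> t - \<Phi> s)"
    and mono: "mono_on {a..b} \<Phi>"
  shows "absolutely_continuous_on_interval a b g"
proof (rule absolutely_continuous_if_sum_square_le)
  show "0 \<le> \<Phi> b - \<Phi> a" using mono \<open>a \<le> b\<close> by (auto simp: mono_on_def)
qed (rule sum_increments_square_le[OF assms])

lemma borel_measurable_cis [measurable]: "cis \<in> borel_measurable borel"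
  by (intro borel_measurable_continuous_onI continuous_on_cis continuous_on_id)

section \<open>Primitives of integrable functions and their derivatives\<close>

definition primitive :: "(real \<Rightarrow> real) \<Rightarrow> real \<Rightarrow> real" where
  "primitive k s = (LINT u:{..s}|lborel. k u)"

lemma set_integrable_of_integrable:
  fixes k :: "real \<Rightarrow> 'a::{banach,second_countable_topology}"
  shows "integrable lborel k \<Longrightarrow> A \<in> sets borel \<Longrightarrow> set_integrable lborel A k"
  by (auto simp: set_integrable_def integrable_mult_indicator)

lemma primitive_diff:
  assumes "integrable lborel k" "s \<le> t"
  shows "primitive k t - primitive k s = (LINT u:{s<..t}|lborel. k u)"
proof -
  have eq: "{..t} = {..s} \<union> {s<..t}" using assms by auto
  have "primitive k t = primitive k s + (LINT u:{s<..t}|lborel. k u)"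
    unfolding primitive_def eq
    by (rule set_integral_Un) (use assms in \<open>auto intro: set_integrable_of_integrable\<close>)
  thus ?thesis by simp
qed

lemma primitive_diff_integral:
  assumes "integrable lborel k" "s \<le> t"
  shows "primitive k t - primitive k s = integral {s..t} k"
proof -
  have "primitive k t - primitive k s = (LINT u:{s<..t}|lborel. k u)"
    using assms by (rule primitive_diff)
  also have "\<dots> = (LINT u:{s..t}|lborel. k u)"
    unfolding set_lebesgue_integral_def
  proof (rule integral_cong_AE)
    have "AE x in lborel. x \<noteq> s" by (rule AE_lborel_singleton)
    thus "AE x in lborel. indicat_real {s<..t} x *\<^sub>R k x = indicat_real {s..t} x *\<^sub>R k x"
      by eventually_elim (auto simp: indicator_def)
  qed (use assms in \<open>auto\<close>)
  also have "\<dots> = integral {s..t} k"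
    using assms by (intro set_borel_integral_eq_integral set_integrable_of_integrable) auto
  finally show ?thesis .
qed

lemma primitive_cmult: "primitive (\<lambda>u. r * k u) s = r * primitive k s"
  by (simp add: primitive_def)

lemma primitive_eq_0:
  assumes "\<And>u. u \<le> s \<Longrightarrow> k u = 0"
  shows "primitive k s = 0"
proof -
  have "primitive k s = (LINT u::real|lborel. 0)" unfolding primitive_def set_lebesgue_integral_def
    by (rule Bochner_Integration.integral_cong) (use assms in \<open>auto simp: indicator_def\<close>)
  thus ?thesis by simp
qed

lemma primitive_mono:
  assumes "integrable lborel k" "s \<le> t" "\<And>u. s < u \<Longrightarrow> u \<le> t \<Longrightarrow> 0 \<le> k u"
  shows "primitive k s \<le> primitive k t"
proof -
  have "0 \<le> (LINT u:{s<..t}|lborel. k u)" unfolding set_lebesgue_integral_def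
    using assms by (intro integral_nonneg_AE) (auto simp: indicator_def)
  thus ?thesis using primitive_diff[OF assms(1,2)] by simp
qed

lemma primitive_const:
  assumes "integrable lborel k" "s \<le> t" "\<And>u. s < u \<Longrightarrow> u < t \<Longrightarrow> k u = 0"
  shows "primitive k s = primitive k t"
proof -
  have "integral {s..t} k = integral {s..t} (\<lambda>_. 0::real)"
    by (rule integral_spike[of "{s,t}"]) (use assms in \<open>auto\<close>)
  thus ?thesis using primitive_diff_integral[OF assms(1,2)] by simp
qed

lemma continuous_primitive:
  assumes "integrable lborel k"
  shows "continuous_on UNIV (primitive k)"
proof -
  have "isCont (primitive k) x" for x
  proof -
    have "continuous_on {x-1..x+1} (\<lambda>s. integral {x-1..s} k)"
      by (rule indefinite_integral_continuous_1)
         (use assms in \<open>auto intro: integrable_on_lborel integrable_on_subinterval\<close>)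
    hence "continuous_on {x-1..x+1} (\<lambda>s. primitive k (x-1) + integral {x-1..s} k)"
      by (intro continuous_intros)
    hence "continuous_on {x-1..x+1} (primitive k)"
    proof (rule continuous_on_eq)
      fix s assume "s \<in> {x-1..x+1}"
      thus "primitive k (x-1) + integral {x-1..s} k = primitive k s"
        using primitive_diff_integral[OF assms, of "x-1" s] by simp
    qed
    thus ?thesis by (rule continuous_on_interior) auto
  qed
  thus ?thesis by (simp add: continuous_at_imp_continuous_on)
qed

text \<open>Lebesgue's differentiation theorem for averages over boxes with lower corner x, which is
  why only the right derivative appears.\<close>

lemma AE_primitive_right_derivative:
  assumes k: "integrable lborel k"
  shows "AE x in lborel. (\<forall>e>0. \<exists>d>0. \<forall>h. 0 < h \<and> h < d \<longrightarrow>
     \<bar>(primitive k (x + h) - primitive k x) / h - k x\<bar> < e)"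
proof -
  have "k integrable_on cbox a b" for a b :: real
    using k by (auto intro: integrable_on_lborel integrable_on_subinterval)
  then obtain N where N: "negligible N" and
    d: "\<And>x e. \<lbrakk>x \<notin> N; 0 < e\<rbrakk> \<Longrightarrow> \<exists>d>0. \<forall>h. 0 < h \<and> h < d \<longrightarrow>
           norm(integral (cbox x (x + h *\<^sub>R One)) k /\<^sub>R h ^ DIM(real) - k x) < e"
    using integrable_ccontinuous_explicit[of k] by blast
  have "AE x in lebesgue. x \<notin> N" using N by (intro AE_not_in) (simp add: negligible_iff_null_sets)
  hence "AE x in lebesgue. \<forall>e>0. \<exists>d>0. \<forall>h. 0 < h \<and> h < d \<longrightarrow>
     \<bar>(primitive k (x + h) - primitive k x) / h - k x\<bar> < e"
  proof eventually_elim
    case (elim x)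
    show ?case
    proof (intro allI impI)
      fix e :: real assume "e > 0"
      obtain d where "d > 0" and dd: "\<And>h. 0 < h \<and> h < d \<Longrightarrow>
           norm(integral (cbox x (x + h *\<^sub>R One)) k /\<^sub>R h ^ DIM(real) - k x) < e"
        using d[OF elim \<open>e > 0\<close>] by blast
      show "\<exists>d>0. \<forall>h. 0 < h \<and> h < d \<longrightarrow> \<bar>(primitive k (x + h) - primitive k x) / h - k x\<bar> < e"
      proof (intro exI[of _ d] conjI allI impI \<open>d > 0\<close>)
        fix h assume h: "0 < h \<and> h < d"
        have "primitive k (x + h) - primitive k x = integral {x..x+h} k"
          using h by (intro primitive_diff_integral k) auto
        thus "\<bar>(primitive k (x + h) - primitive k x) / h - k x\<bar> < e"
          using dd[OF h] by (simp add: divide_inverse mult.commute)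
      qed
    qed
  qed
  thus ?thesis by (simp add: AE_completion_iff)
qed

text \<open>Reflection turns left difference quotients into right ones and so supplies the other
  half of the differentiation theorem.\<close>

lemma primitive_reflect:
  assumes k: "integrable lborel k"
  shows "primitive (\<lambda>u. k (- u)) s = (LINT u|lborel. k u) - primitive k (- s)"
proof -
  have km[measurable]: "k \<in> borel_measurable borel" using k by auto
  have "primitive (\<lambda>u. k (- u)) s = (LINT u|lborel. indicator {..s} u *\<^sub>R k (- u))"
    by (simp add: primitive_def set_lebesgue_integral_def)
  also have "\<dots> = (LINT u|lborel. indicator {..s} (- u) *\<^sub>R k u)"
    using lborel_integral_real_affine[of "-1" "\<lambda>u. indicator {..s} u *\<^sub>R k (- u)" 0] by simp
  also have "\<dots> = (LINT u:{-s..}|lborel. k u)"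
    unfolding set_lebesgue_integral_def by (rule Bochner_Integration.integral_cong) (auto simp: indicator_def)
  also have "\<dots> = (LINT u:{-s<..}|lborel. k u)"
    unfolding set_lebesgue_integral_def
  proof (rule integral_cong_AE)
    have "AE x in lborel. x \<noteq> -s" by (rule AE_lborel_singleton)
    thus "AE x in lborel. indicat_real {-s..} x *\<^sub>R k x = indicat_real {-s<..} x *\<^sub>R k x"
      by eventually_elim (auto simp: indicator_def)
  qed auto
  also have "\<dots> = (LINT u|lborel. k u) - primitive k (- s)"
  proof -
    have "(LINT u:{..-s} \<union> {-s<..}|lborel. k u) = primitive k (- s) + (LINT u:{-s<..}|lborel. k u)"
      unfolding primitive_def
      by (rule set_integral_Un) (use k in \<open>auto intro: set_integrable_of_integrable\<close>)
    moreover have "{..-s} \<union> {-s<..} = UNIV" by auto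
    ultimately show ?thesis by (simp add: set_lebesgue_integral_def)
  qed
  finally show ?thesis .
qed

lemma AE_primitive_derivative:
  assumes k: "integrable lborel k"
  shows "AE x in lborel. (primitive k has_real_derivative k x) (at x)"
proof -
  have km[measurable]: "k \<in> borel_measurable borel" using k by auto
  have k': "integrable lborel (\<lambda>u. k (- u))"
    using lborel_integrable_real_affine[OF k, of "-1" 0] by simp
  let ?P = "\<lambda>k x. (\<forall>e>0. \<exists>d>0. \<forall>h. 0 < h \<and> h < d \<longrightarrow>
     \<bar>(primitive k (x + h) - primitive k x) / h - k x\<bar> < e)"
  have R: "AE x in lborel. ?P k x" by (rule AE_primitive_right_derivative[OF k])
  have "AE x in lborel. ?P (\<lambda>u. k (- u)) x" by (rule AE_primitive_right_derivative[OF k'])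
  then obtain N where N: "N \<in> null_sets lborel" "\<And>x. x \<notin> N \<Longrightarrow> ?P (\<lambda>u. k (- u)) x"
    by (auto elim!: AE_E3)
  \<comment> \<open>The exceptional set of the reflected density must be reflected back. Its image
    is known to be null only for the completed measure, hence the detour through
    \<open>lebesgue\<close>.\<close>
  have "uminus ` N \<in> null_sets lebesgue"
    using N(1) negligible_iff_null_sets negligible_linear_singular_image
    by (metis negligible_differentiable_image_negligible[of N uminus] order_refl
      differentiable_on_minus[OF differentiable_on_ident] null_sets_completionI)
  hence "AE x in lebesgue. x \<notin> uminus ` N" by (rule AE_not_in)
  hence "AE x in lebesgue. ?P (\<lambda>u. k (- u)) (- x)"
  proof eventually_elim
    case (elim x)
    hence "- x \<notin> N" by force
    thus ?case using N(2) by blast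
  qed
  moreover have "AE x in lebesgue. ?P k x" using R by (rule AE_completion)
  ultimately have "AE x in lebesgue. (primitive k has_real_derivative k x) (at x)"
  proof eventually_elim
    case (elim x)
    show ?case unfolding DERIV_def LIM_def
    proof (intro allI impI)
      fix e :: real assume "e > 0"
      obtain d1 where d1: "d1 > 0" "\<And>h. 0 < h \<and> h < d1 \<Longrightarrow> \<bar>(primitive k (x + h) - primitive k x) / h - k x\<bar> < e"
        using elim(2) \<open>e > 0\<close> by blast
      obtain d2 where d2: "d2 > 0" "\<And>h. 0 < h \<and> h < d2 \<Longrightarrow>
         \<bar>(primitive (\<lambda>u. k (- u)) (- x + h) - primitive (\<lambda>u. k (- u)) (- x)) / h - k (- (- x))\<bar> < e"
        using elim(1) \<open>e > 0\<close> by meson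
      show "\<exists>s>0. \<forall>h. h \<noteq> 0 \<and> dist h 0 < s \<longrightarrow> dist ((primitive k (x + h) - primitive k x) / h) (k x) < e"
      proof (intro exI[of _ "min d1 d2"] conjI allI impI)
        fix h :: real assume h: "h \<noteq> 0 \<and> dist h 0 < min d1 d2"
        show "dist ((primitive k (x + h) - primitive k x) / h) (k x) < e"
        proof (cases "h > 0")
          case True thus ?thesis using d1(2)[of h] h by (auto simp: dist_real_def)
        next
          case False
          hence "0 < -h \<and> -h < d2" using h by (auto simp: dist_real_def)
          from d2(2)[OF this] show ?thesis
            by (simp add: primitive_reflect[OF k] dist_real_def minus_divide_right[symmetric] add.commute)
               (simp add: diff_divide_distrib)
        qed
      qed (use d1 d2 in auto)
    qed
  qed
  thus ?thesis by (simp add: AE_completion_iff)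
qed

section \<open>Energy bounds from difference quotients\<close>

lemma nn_integral_mono_increments:
  fixes \<Phi> :: "real \<Rightarrow> real"
  assumes "A \<le> B" "h > 0" and mono: "mono \<Phi>"
    and A: "\<And>s. s \<le> A \<Longrightarrow> \<Phi> s = \<Phi> A" and B: "\<And>s. B \<le> s \<Longrightarrow> \<Phi> s = \<Phi> B"
  shows "(\<integral>\<^sup>+s. ennreal (\<Phi> (s + h) - \<Phi> s) \<partial>lborel) = ennreal (h * (\<Phi> B - \<Phi> A))"
proof -
  have [measurable]: "\<Phi> \<in> borel_measurable borel" by (rule borel_measurable_mono[OF mono])
  define D where "D = \<Phi> B - \<Phi> A"
  have D: "D \<ge> 0" using monoD[OF mono \<open>A \<le> B\<close>] by (simp add: D_def)
  \<comment> \<open>In general \<Phi> is not integrable. Subtracting a jump of height D at B leaves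
    a bounded function supported in [A, B], whose translates have equal integrals; the shifted jump
    alone contributes \<open>h * D\<close>.\<close>
  define J where "J = (\<lambda>s. \<Phi> s - \<Phi> A - D * indicator {B<..} s)"
  have [measurable]: "J \<in> borel_measurable borel" unfolding J_def by measurable
  have "\<bar>J s\<bar> \<le> D * indicator {A..B} s" for s
  proof -
    have "\<Phi> A \<le> \<Phi> s" using monoD[OF mono, of A s] A[of s] by linarith
    moreover have "\<Phi> s \<le> \<Phi> B" using monoD[OF mono, of s B] B[of s] by linarith
    ultimately show ?thesis using A[of s] B[of s] by (auto simp: J_def D_def indicator_def)
  qed
  moreover have "integrable lborel (\<lambda>s. D * indicat_real {A..B} s)"
    by (intro integrable_mult_right integrable_real_indicator) (auto simp: emeasure_lborel_Icc_eq)
  ultimately have Ji: "integrable lborel J"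
    by (intro Bochner_Integration.integrable_bound[of lborel "\<lambda>s. D * indicator {A..B} s" J]) (auto simp: D)
  have Jh: "integrable lborel (\<lambda>s. J (s + h))" "(LINT s|lborel. J (s + h)) = (LINT s|lborel. J s)"
    using lborel_integrable_real_affine[OF Ji, of 1 h] lborel_integral_real_affine[of 1 J h]
    by (simp_all add: add.commute)
  have eq: "\<Phi> (s + h) - \<Phi> s = (J (s + h) - J s) + D * indicator {B-h<..B} s" for s
    using \<open>h > 0\<close> by (auto simp: J_def indicator_def)
  have i: "integrable lborel (\<lambda>s. (J (s + h) - J s) + D * indicator {B-h<..B} s)"
    by (intro Bochner_Integration.integrable_add Bochner_Integration.integrable_diff Jh Ji integrable_mult_right
        integrable_real_indicator) (use \<open>h > 0\<close> in \<open>auto simp: emeasure_lborel_Ioc\<close>)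
  have "(\<integral>\<^sup>+s. ennreal (\<Phi> (s + h) - \<Phi> s) \<partial>lborel) = ennreal (LINT s|lborel. \<Phi> (s + h) - \<Phi> s)"
    by (rule nn_integral_eq_integral) (use i mono \<open>h > 0\<close> in \<open>auto simp: eq[symmetric] intro!: AE_I2 monoD[OF mono]\<close>)
  also have "(LINT s|lborel. \<Phi> (s + h) - \<Phi> s) = h * D"
    unfolding eq using Ji Jh \<open>h > 0\<close>
    by (subst Bochner_Integration.integral_add) (auto simp: Bochner_Integration.integral_diff)
  finally show ?thesis by (simp add: D_def)
qed

lemma difference_quotient_sequence:
  assumes "(\<theta> has_real_derivative d) (at x)"
  shows "(\<lambda>n. (\<theta> (x + 1 / real (Suc n)) - \<theta> x) * real (Suc n)) \<longlonglongrightarrow> d"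
proof -
  have "filterlim (\<lambda>n. 1 / real (Suc n)) (at 0) sequentially"
    unfolding filterlim_at by (auto intro: LIMSEQ_inverse_real_of_nat simp: field_simps)
       (use LIMSEQ_inverse_real_of_nat in \<open>simp add: inverse_eq_divide\<close>)
  moreover have "((\<lambda>h. (\<theta> (x + h) - \<theta> x) / h) \<longlongrightarrow> d) (at 0)"
    using assms by (simp add: DERIV_def)
  ultimately have "(\<lambda>n. (\<theta> (x + 1 / real (Suc n)) - \<theta> x) / (1 / real (Suc n))) \<longlonglongrightarrow> d"
    by (rule filterlim_compose[rotated])
  thus ?thesis by simp
qed

text \<open>Fatou's lemma for the difference quotients with step \<open>1 / Suc n\<close>, whose
  integrals do not depend on n. A singular part of G would only make the inequality strict.\<close>

lemma nn_integral_derivative_mono_le: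
  fixes G :: "real \<Rightarrow> real"
  assumes "A \<le> B" and mono: "mono G"
    and A: "\<And>s. s \<le> A \<Longrightarrow> G s = G A" and B: "\<And>s. B \<le> s \<Longrightarrow> G s = G B"
    and g: "AE s in lborel. (G has_real_derivative g s) (at s)"
  shows "(\<integral>\<^sup>+s. ennreal (g s) \<partial>lborel) \<le> ennreal (G B - G A)"
proof -
  have [measurable]: "G \<in> borel_measurable borel" by (rule borel_measurable_mono[OF mono])
  let ?q = "\<lambda>n s. ennreal ((G (s + 1 / real (Suc n)) - G s) * real (Suc n))"
  have "AE s in lborel. ennreal (g s) = liminf (\<lambda>n. ?q n s)"
    using g
  proof eventually_elim
    case (elim s)
    have "(\<lambda>n. ?q n s) \<longlonglongrightarrow> ennreal (g s)"
      by (rule tendsto_ennrealI) (rule difference_quotient_sequence[OF elim])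
    from lim_imp_Liminf[OF sequentially_bot this] show ?case by simp
  qed
  hence "(\<integral>\<^sup>+s. ennreal (g s) \<partial>lborel) = (\<integral>\<^sup>+s. liminf (\<lambda>n. ?q n s) \<partial>lborel)"
    by (rule nn_integral_cong_AE)
  also have "\<dots> \<le> liminf (\<lambda>n. \<integral>\<^sup>+s. ?q n s \<partial>lborel)"
    by (rule nn_integral_liminf) measurable
  also have "(\<lambda>n. \<integral>\<^sup>+s. ?q n s \<partial>lborel) = (\<lambda>n. ennreal (G B - G A))"
  proof
    fix n
    have "(\<integral>\<^sup>+s. ?q n s \<partial>lborel) = (\<integral>\<^sup>+s. ennreal (real (Suc n)) * ennreal (G (s + 1 / real (Suc n)) - G s) \<partial>lborel)"
      by (intro nn_integral_cong) (simp add: ennreal_mult'[symmetric] mult.commute del: of_nat_Suc)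
    also have "\<dots> = ennreal (real (Suc n)) * (\<integral>\<^sup>+s. ennreal (G (s + 1 / real (Suc n)) - G s) \<partial>lborel)"
      by (rule nn_integral_cmult) measurable
    also have "\<dots> = ennreal (real (Suc n)) * ennreal (1 / real (Suc n) * (G B - G A))"
      by (subst nn_integral_mono_increments[OF \<open>A \<le> B\<close> _ mono A B]) auto
    also have "\<dots> = ennreal (G B - G A)"
      by (subst ennreal_mult'[symmetric]) auto
    finally show "(\<integral>\<^sup>+s. ?q n s \<partial>lborel) = ennreal (G B - G A)" .
  qed
  also have "liminf (\<lambda>n::nat. ennreal (G B - G A)) = ennreal (G B - G A)"
    by (simp add: Liminf_const)
  finally show ?thesis .
qed

text \<open>Fatou's lemma again. For a fixed step, difference quotients follow pointwise convergence
  of \<theta>, which derivatives do not; a bound uniform in the step is therefore the form in which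
  energy bounds reach limit curves.\<close>

lemma nn_integral_derivative_square_le:
  fixes \<theta> :: "real \<Rightarrow> real"
  assumes d: "AE s in lborel. (\<theta> has_real_derivative k s) (at s)"
    and [measurable]: "\<theta> \<in> borel_measurable borel"
    and le: "\<And>n. (\<integral>\<^sup>+s. ennreal (((\<theta> (s + 1 / real (Suc n)) - \<theta> s) * real (Suc n))\<^sup>2) \<partial>lborel) \<le> E"
  shows "(\<integral>\<^sup>+s. ennreal ((k s)\<^sup>2) \<partial>lborel) \<le> E"
proof -
  let ?q = "\<lambda>n s. ennreal (((\<theta> (s + 1 / real (Suc n)) - \<theta> s) * real (Suc n))\<^sup>2)"
  have "AE s in lborel. ennreal ((k s)\<^sup>2) = liminf (\<lambda>n. ?q n s)"
    using d
  proof eventually_elim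
    case (elim s)
    have "(\<lambda>n. ?q n s) \<longlonglongrightarrow> ennreal ((k s)\<^sup>2)"
      by (intro tendsto_ennrealI tendsto_power) (rule difference_quotient_sequence[OF elim])
    from lim_imp_Liminf[OF sequentially_bot this] show ?case by simp
  qed
  hence "(\<integral>\<^sup>+s. ennreal ((k s)\<^sup>2) \<partial>lborel) = (\<integral>\<^sup>+s. liminf (\<lambda>n. ?q n s) \<partial>lborel)"
    by (rule nn_integral_cong_AE)
  also have "\<dots> \<le> liminf (\<lambda>n. \<integral>\<^sup>+s. ?q n s \<partial>lborel)"
    by (rule nn_integral_liminf) measurable
  also have "\<dots> \<le> E"
    using Liminf_mono[of "\<lambda>n. \<integral>\<^sup>+s. ?q n s \<partial>lborel" "\<lambda>_. E" sequentially] le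
    by (simp add: Liminf_const)
  finally show ?thesis .
qed

text \<open>After division by h^2 the increment inequality leaves the factor 1/h, which the integral
  of the shifted difference of \<Phi> cancels.\<close>

lemma nn_integral_difference_quotient_square_le:
  fixes \<theta> \<Phi> :: "real \<Rightarrow> real"
  assumes "A \<le> B" "h > 0" and mono: "mono \<Phi>"
    and A: "\<And>s. s \<le> A \<Longrightarrow> \<Phi> s = \<Phi> A" and B: "\<And>s. B \<le> s \<Longrightarrow> \<Phi> s = \<Phi> B"
    and le: "\<And>s t. s \<le> t \<Longrightarrow> (\<theta> t - \<theta> s)\<^sup>2 \<le> (t - s) * (\<Phi> t - \<Phi> s)"
  shows "(\<integral>\<^sup>+s. ennreal (((\<theta> (s + h) - \<theta> s) / h)\<^sup>2) \<partial>lborel) \<le> ennreal (\<Phi> B - \<Phi> A)"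
proof -
  have [measurable]: "\<Phi> \<in> borel_measurable borel" by (rule borel_measurable_mono[OF mono])
  have "(\<integral>\<^sup>+s. ennreal (((\<theta> (s + h) - \<theta> s) / h)\<^sup>2) \<partial>lborel)
      \<le> (\<integral>\<^sup>+s. ennreal (1/h) * ennreal (\<Phi> (s + h) - \<Phi> s) \<partial>lborel)"
  proof (rule nn_integral_mono)
    fix s
    have "((\<theta> (s + h) - \<theta> s) / h)\<^sup>2 = (\<theta> (s + h) - \<theta> s)\<^sup>2 / h\<^sup>2" by (simp add: power_divide)
    also have "\<dots> \<le> h * (\<Phi> (s + h) - \<Phi> s) / h\<^sup>2"
      using le[of s "s+h"] \<open>h > 0\<close> by (intro divide_right_mono) auto
    also have "\<dots> = 1/h * (\<Phi> (s + h) - \<Phi> s)" using \<open>h > 0\<close> by (simp add: power2_eq_square)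
    finally show "ennreal (((\<theta> (s + h) - \<theta> s) / h)\<^sup>2) \<le> ennreal (1/h) * ennreal (\<Phi> (s + h) - \<Phi> s)"
      using \<open>h > 0\<close> by (subst ennreal_mult'[symmetric]) (auto intro: ennreal_leI)
  qed
  also have "\<dots> = ennreal (1/h) * (\<integral>\<^sup>+s. ennreal (\<Phi> (s + h) - \<Phi> s) \<partial>lborel)"
    by (rule nn_integral_cmult) measurable
  also have "\<dots> = ennreal (1/h) * ennreal (h * (\<Phi> B - \<Phi> A))"
    by (subst nn_integral_mono_increments[OF \<open>A \<le> B\<close> \<open>h > 0\<close> mono A B]) auto
  also have "\<dots> = ennreal (\<Phi> B - \<Phi> A)"
    using \<open>h > 0\<close> by (subst ennreal_mult'[symmetric]) auto
  finally show ?thesis .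
qed

text \<open>Radon-Nikodym for the Stieltjes measure of f on [A, B]. Absolute continuity of f makes
  this measure small on finite unions of short intervals, then on open sets of small Lebesgue
  measure by continuity from below, and hence zero on null sets by outer regularity.\<close>

lemma primitive_density_exists:
  fixes f :: "real \<Rightarrow> real"
  assumes "A \<le> B" and mono: "mono f" and cont: "continuous_on UNIV f"
    and A: "\<And>s. s \<le> A \<Longrightarrow> f s = f A" and B: "\<And>s. B \<le> s \<Longrightarrow> f s = f B"
    and ac: "absolutely_continuous_on_interval A B f"
  obtains k where "integrable lborel k" "\<And>u. 0 \<le> k u" "\<And>u. u \<notin> {A<..<B} \<Longrightarrow> k u = 0"
    "\<And>s. f s = f A + primitive k s"
proof -
  have rc: "continuous (at_right a) f" for a
    using cont by (auto intro: continuous_within_subset simp: continuous_on_eq_continuous_within)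
  have m: "x \<le> y \<Longrightarrow> f x \<le> f y" for x y using mono by (rule monoD)
  define M where "M = interval_measure f"
  have M_sets[simp, measurable_cong]: "sets M = sets borel" and [simp]: "space M = UNIV" by (simp_all add: M_def)
  have Icc: "emeasure M {a..b} = ennreal (f b - f a)" if "a \<le> b" for a b
    unfolding M_def by (rule emeasure_interval_measure_Icc[OF that m cont])
  define I where "I = {A..B}"
  have [measurable]: "I \<in> sets borel" by (simp add: I_def)
  \<comment> \<open>The boxes in F may overlap, so their union, cut to [A, B], is first divided into
    non-overlapping intervals, for which absolute continuity is stated.\<close>
  have small: "\<exists>\<delta>>0. \<forall>F. finite F \<longrightarrow> (\<forall>K\<in>F. \<exists>a b. K = cbox a b) \<longrightarrow> emeasure lborel (\<Union>F) < ennreal \<delta> \<longrightarrow>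
      emeasure M (\<Union>F \<inter> I) \<le> ennreal \<epsilon>" if "\<epsilon> > 0" for \<epsilon>
  proof -
    obtain \<delta> where "\<delta> > 0" and \<delta>: "\<And>D. D division_of \<Union>D \<Longrightarrow> \<Union>D \<subseteq> {A..B} \<Longrightarrow>
        (\<Sum>K\<in>D. Sup K - Inf K) < \<delta> \<Longrightarrow> (\<Sum>K\<in>D. norm (f (Sup K) - f (Inf K))) < \<epsilon>"
      using ac \<open>\<epsilon> > 0\<close> unfolding absolutely_continuous_on_interval_def by meson
    show ?thesis
    proof (intro exI[of _ \<delta>] conjI allI impI \<open>\<delta> > 0\<close>)
      fix F :: "real set set"
      assume F: "finite F" "\<forall>K\<in>F. \<exists>a b. K = cbox a b" "emeasure lborel (\<Union>F) < ennreal \<delta>"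
      have Fm: "\<Union>F \<in> sets borel"  
      proof (intro sets.finite_Union subsetI)
        fix K assume "K \<in> F"
        then obtain a b where "K = cbox a b" using F(2) by blast
        thus "K \<in> sets borel" by simp
      qed (use F in blast)
      define F' where "F' = (\<lambda>K. K \<inter> I) ` F"
      have UF': "\<Union>F' = \<Union>F \<inter> I" by (auto simp: F'_def)
      have F'b: "\<exists>a b. K = cbox a b" if KF: "K \<in> F'" for K
      proof -
        obtain K0 where "K0 \<in> F" "K = K0 \<inter> I" using KF by (auto simp: F'_def)
        moreover obtain a b where "K0 = cbox a b" using F(2) \<open>K0 \<in> F\<close> by blast
        ultimately show ?thesis by (intro exI[of _ "max a A"] exI[of _ "min b B"]) (auto simp: I_def)
      qed
      obtain p where p: "p division_of \<Union>F'"
        using elementary_unions_intervals[of F'] F(1) F'b by (auto simp: F'_def)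
      have Up: "\<Union>p = \<Union>F'" using p by (rule division_ofD(6))
      have p1: "p division_of \<Union>p" "\<Union>p \<subseteq> {A..B}" using p Up UF' by (auto simp: I_def)
      have Kcase: "\<exists>l u. K = {l..u} \<and> l \<le> u" if "K \<in> p" for K
        using division_interval_cases[OF p1 that] by metis
      have [measurable]: "K \<in> sets borel" if "K \<in> p" for K using Kcase[OF that] by auto
      have fin: "finite p" using p by (rule division_ofD(1))
      have "(\<Sum>K\<in>p. Sup K - Inf K) = (\<Sum>K\<in>p. measure lborel K)"
        using Kcase by (intro sum.cong) fastforce+
      also have "\<dots> = measure lborel (\<Union>p)"
            proof -
        have "\<Union>p \<in> sets borel" using fin by (intro sets.finite_Union) auto
        thus ?thesis using content_division[OF p1(1)] by (simp add: measure_completion)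
      qed
      also have "ennreal (measure lborel (\<Union>p)) = emeasure lborel (\<Union>p)"
      proof (rule emeasure_eq_ennreal_measure[symmetric])
        have "emeasure lborel (\<Union>p) \<le> emeasure lborel (\<Union>F)"
          unfolding Up UF' using Fm by (intro emeasure_mono) auto
        thus "emeasure lborel (\<Union>p) \<noteq> top" using F(3) by (auto simp: top_unique)
      qed
      also have "\<dots> \<le> emeasure lborel (\<Union>F)"
        unfolding Up UF' using Fm by (intro emeasure_mono) auto
      finally have "ennreal (\<Sum>K\<in>p. Sup K - Inf K) < ennreal \<delta>" using F(3) by auto
      hence "(\<Sum>K\<in>p. Sup K - Inf K) < \<delta>" by (metis ennreal_leI leD leI)
      from \<delta>[OF p1 this] have lt: "(\<Sum>K\<in>p. norm (f (Sup K) - f (Inf K))) < \<epsilon>" .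
      have "emeasure M (\<Union>F \<inter> I) = emeasure M (\<Union>K\<in>p. K)" using Up UF' by simp
      also have "\<dots> \<le> (\<Sum>K\<in>p. emeasure M K)"
        by (rule emeasure_subadditive_finite) (use fin in auto)
      also have "\<dots> = (\<Sum>K\<in>p. ennreal (norm (f (Sup K) - f (Inf K))))"
      proof (rule sum.cong)
        fix K assume "K \<in> p"
        then obtain l u where "K = {l..u}" "l \<le> u" using Kcase by blast
        thus "emeasure M K = ennreal (norm (f (Sup K) - f (Inf K)))"
          using Icc[of l u] m[of l u] by simp
      qed simp
      also have "\<dots> = ennreal (\<Sum>K\<in>p. norm (f (Sup K) - f (Inf K)))"
        by (rule sum_ennreal) simp
      also have "\<dots> \<le> ennreal \<epsilon>" using lt by (intro ennreal_leI) simp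
      finally show "emeasure M (\<Union>F \<inter> I) \<le> ennreal \<epsilon>" .
    qed
  qed
  have null: "emeasure M (N \<inter> I) = 0" if N: "N \<in> null_sets lborel" for N
  proof (rule antisym)
    show "emeasure M (N \<inter> I) \<le> 0"
    proof (rule ennreal_le_epsilon)
      fix \<epsilon> :: real assume "\<epsilon> > 0"
      then obtain \<delta> where "\<delta> > 0" and \<delta>: "\<And>F. finite F \<Longrightarrow> (\<forall>K\<in>F. \<exists>a b. K = cbox a b) \<Longrightarrow>
           emeasure lborel (\<Union>F) < ennreal \<delta> \<Longrightarrow> emeasure M (\<Union>F \<inter> I) \<le> ennreal \<epsilon>"
        using small by metis
      have Ns: "N \<in> sets borel" using N by auto
      obtain U where U: "open U" "N \<subseteq> U" "emeasure lborel (U - N) < ennreal \<delta>"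
        using outer_regular_lborel[OF Ns \<open>\<delta> > 0\<close>] by metis
      have "emeasure lborel U \<le> emeasure lborel (U - N) + emeasure lborel N"
        using U Ns by (subst emeasure_Diff_null_set[OF N]) auto
      hence Ul: "emeasure lborel U < ennreal \<delta>" using U N by auto
      obtain \<D> where \<D>: "countable \<D>" "\<D> \<subseteq> Pow U" "\<And>X. X \<in> \<D> \<Longrightarrow> \<exists>a b. X = cbox a b" "\<Union>\<D> = U"
        using open_countable_Union_open_cbox[OF U(1)] by blast
      \<comment> \<open>The empty box \<open>cbox 1 0\<close> keeps the family nonempty, so that it
        can be enumerated even when U is empty.\<close>
      define X where "X = from_nat_into (insert (cbox 1 0) \<D>)"
      have rX: "range X = insert (cbox 1 0) \<D>" unfolding X_def using \<D>(1) by (intro range_from_nat_into) auto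
      have UX: "(\<Union>n. X n) = U" using rX \<D>(4) by auto
      have Xb: "\<exists>a b. X n = cbox a b" for n using \<D>(3) rX by (metis insert_iff rangeI)
      have Xm[measurable]: "X n \<in> sets borel" for n using Xb[of n] by auto
      have le: "emeasure M ((\<Union>i\<le>n. X i) \<inter> I) \<le> ennreal \<epsilon>" for n
      proof -
        have "emeasure lborel (\<Union>(X ` {..n})) \<le> emeasure lborel U"
          using UX U(1) by (intro emeasure_mono) auto
        hence "emeasure lborel (\<Union>(X ` {..n})) < ennreal \<delta>" using Ul by simp
        thus ?thesis using Xb by (intro \<delta>) auto
      qed
      have "emeasure M (\<Union>n. (\<Union>i\<le>n. X i) \<inter> I) = (SUP n. emeasure M ((\<Union>i\<le>n. X i) \<inter> I))"
        by (rule SUP_emeasure_incseq[symmetric]) (auto simp: incseq_def, force)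
      also have "\<dots> \<le> ennreal \<epsilon>" using le by (intro SUP_least)
      also have "(\<Union>n. (\<Union>i\<le>n. X i) \<inter> I) = U \<inter> I" using UX by auto
      finally have "emeasure M (U \<inter> I) \<le> ennreal \<epsilon>" .
      moreover have "emeasure M (N \<inter> I) \<le> emeasure M (U \<inter> I)"
        using U by (intro emeasure_mono) auto
      ultimately show "emeasure M (N \<inter> I) \<le> 0 + ennreal \<epsilon>" by simp
    qed
  qed simp
  define M' where "M' = density M (indicator I)"
  have M'e: "emeasure M' S = emeasure M (S \<inter> I)" if "S \<in> sets borel" for S
  proof -
    have "emeasure M' S = (\<integral>\<^sup>+x. indicator I x * indicator S x \<partial>M)"
      unfolding M'_def using that by (subst emeasure_density) auto
    also have "\<dots> = (\<integral>\<^sup>+x. indicator (S \<inter> I) x \<partial>M)"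
      by (intro nn_integral_cong) (auto simp: indicator_def)
    finally show ?thesis using that by simp
  qed
  have "absolutely_continuous lborel M'"
    unfolding absolutely_continuous_def
  proof
    fix N :: "real set" assume N: "N \<in> null_sets lborel"
    hence "N \<in> sets borel" by auto
    thus "N \<in> null_sets M'" using null[OF N] M'e by (auto simp: null_sets_def M'_def)
  qed
  then obtain g where g[measurable]: "g \<in> borel_measurable borel" and gM: "density lborel g = M'"
    using sigma_finite_measure.Radon_Nikodym[OF sigma_finite_lborel, of M'] by (auto simp: M'_def)
  have gS: "(\<integral>\<^sup>+x. g x * indicator S x \<partial>lborel) = emeasure M (S \<inter> I)" if "S \<in> sets borel" for S
    using M'e[OF that] gM that emeasure_density[of g lborel S] by simp
  have gtot: "(\<integral>\<^sup>+x. g x \<partial>lborel) = ennreal (f B - f A)"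
    using gS[of UNIV] Icc[OF \<open>A \<le> B\<close>] by (simp add: I_def)
  have gfin: "AE x in lborel. g x \<noteq> \<infinity>"
    by (rule nn_integral_PInf_AE) (use gtot in auto)
  have gout: "AE x in lborel. x \<notin> I \<longrightarrow> g x = 0"
  proof -
    have "(\<integral>\<^sup>+x. g x * indicator (-I) x \<partial>lborel) = 0" using gS[of "-I"] by simp
    hence "AE x in lborel. g x * indicator (-I) x = 0" by (subst (asm) nn_integral_0_iff_AE) auto
    thus ?thesis by eventually_elim (auto simp: indicator_def split: if_splits)
  qed
  \<comment> \<open>Infinite values and the two end points form a null set, so g may be made real
    valued and cut to the open interval.\<close>
  define k where "k = (\<lambda>x. enn2real (g x) * indicator {A<..<B} x)"
  have [measurable]: "k \<in> borel_measurable borel" unfolding k_def by measurable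
  have kg: "AE x in lborel. ennreal (k x) = g x"
    using gfin gout AE_lborel_singleton[of A] AE_lborel_singleton[of B]
  proof eventually_elim
    case (elim x)
    thus ?case by (auto simp: k_def I_def indicator_def less_top)
  qed
  have k0: "0 \<le> k x" for x by (simp add: k_def)
  have ki: "integrable lborel k"
  proof (rule integrableI_nonneg)
    have "(\<integral>\<^sup>+x. ennreal (k x) \<partial>lborel) = (\<integral>\<^sup>+x. g x \<partial>lborel)" using kg by (rule nn_integral_cong_AE)
    thus "(\<integral>\<^sup>+x. ennreal (k x) \<partial>lborel) < \<infinity>" using gtot by simp
  qed (use k0 in auto)
  have prim: "f s = f A + primitive k s" for s
  proof -
    have "ennreal (primitive k s) = (\<integral>\<^sup>+x. ennreal (indicator {..s} x *\<^sub>R k x) \<partial>lborel)"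
      unfolding primitive_def set_lebesgue_integral_def
      using ki k0 by (intro nn_integral_eq_integral[symmetric] integrable_mult_indicator) auto
    also have "\<dots> = (\<integral>\<^sup>+x. g x * indicator {..s} x \<partial>lborel)"
      by (rule nn_integral_cong_AE) (use kg in \<open>eventually_elim, auto simp: indicator_def\<close>)
    also have "\<dots> = emeasure M ({..s} \<inter> I)" by (rule gS) simp
    also have "\<dots> = ennreal (f s - f A)"
    proof (cases "A \<le> s")
      case True
      have "{..s} \<inter> I = {A..min s B}" by (auto simp: I_def)
      moreover have "f (min s B) = f s" using B[of s] by (auto simp: min_def)
      ultimately show ?thesis using Icc[of A "min s B"] True \<open>A \<le> B\<close> by simp
    next
      case False
      hence "{..s} \<inter> I = {}" by (auto simp: I_def)
      thus ?thesis using A[of s] False by simp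
    qed
    finally have e: "ennreal (primitive k s) = ennreal (f s - f A)" .
    have "0 \<le> f s - f A" using m[of A s] A[of s] by (cases "A \<le> s") auto
    moreover have "0 \<le> primitive k s" unfolding primitive_def set_lebesgue_integral_def
      using k0 by (intro integral_nonneg_AE) auto
    ultimately show ?thesis using e by simp
  qed
  show ?thesis by (rule that[OF ki k0 _ prim]) (auto simp: k_def indicator_def)
qed

text \<open>Comparing nearby points is enough, because no interval of a division is longer than the
  total length. The local form matters for tangent angles, which are controlled by the unit tangent
  only while they are close to each other.\<close>

lemma absolutely_continuous_dominated:
  fixes g :: "real \<Rightarrow> 'v::real_normed_vector" and g' :: "real \<Rightarrow> 'w::real_normed_vector"
  assumes ac: "absolutely_continuous_on_interval a b g" and sub: "a \<le> a'" "b' \<le> b" and "C > 0" "\<eta> > 0"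
    and le: "\<And>s t. a' \<le> s \<Longrightarrow> s \<le> t \<Longrightarrow> t \<le> b' \<Longrightarrow> t - s < \<eta> \<Longrightarrow> norm (g' t - g' s) \<le> C * norm (g t - g s)"
  shows "absolutely_continuous_on_interval a' b' g'"
  unfolding absolutely_continuous_on_interval_def
proof (intro allI impI)
  fix \<epsilon> :: real assume "\<epsilon> > 0"
  hence "\<epsilon> / C > 0" using \<open>C > 0\<close> by simp
  then obtain \<delta> where "\<delta> > 0" and \<delta>: "\<And>D. D division_of \<Union>D \<Longrightarrow> \<Union>D \<subseteq> {a..b} \<Longrightarrow>
      (\<Sum>K\<in>D. Sup K - Inf K) < \<delta> \<Longrightarrow> (\<Sum>K\<in>D. norm (g (Sup K) - g (Inf K))) < \<epsilon> / C"
    using ac[unfolded absolutely_continuous_on_interval_def, rule_format, of "\<epsilon> / C"] by blast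
  show "\<exists>\<delta>>0. \<forall>D. D division_of \<Union> D \<longrightarrow> \<Union> D \<subseteq> {a'..b'} \<longrightarrow> (\<Sum>K\<in>D. Sup K - Inf K) < \<delta> \<longrightarrow>
     (\<Sum>K\<in>D. norm (g' (Sup K) - g' (Inf K))) < \<epsilon>"
  proof (intro exI[of _ "min \<delta> \<eta>"] conjI allI impI)
    fix D :: "real set set"
    assume D: "D division_of \<Union> D" "\<Union> D \<subseteq> {a'..b'}" and lt: "(\<Sum>K\<in>D. Sup K - Inf K) < min \<delta> \<eta>"
    have K: "0 \<le> Sup K - Inf K" "a' \<le> Inf K" "Sup K \<le> b'" if KD: "K \<in> D" for K
    proof -
      obtain l u where "K = {l..u}" "l \<le> u" "a' \<le> l" "u \<le> b'" by (rule division_interval_cases[OF D KD])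
      thus "0 \<le> Sup K - Inf K" "a' \<le> Inf K" "Sup K \<le> b'" by auto
    qed
    have fin: "finite D" using D(1) by (rule division_ofD(1))
    have "(\<Sum>K\<in>D. norm (g' (Sup K) - g' (Inf K))) \<le> (\<Sum>K\<in>D. C * norm (g (Sup K) - g (Inf K)))"
    proof (rule sum_mono)
      fix K assume KD: "K \<in> D"
      have "Sup K - Inf K \<le> (\<Sum>K\<in>D. Sup K - Inf K)"
        by (rule member_le_sum[OF KD]) (use K fin in auto)
      thus "norm (g' (Sup K) - g' (Inf K)) \<le> C * norm (g (Sup K) - g (Inf K))"
        using K[OF KD] lt by (intro le) auto
    qed
    also have "\<dots> = C * (\<Sum>K\<in>D. norm (g (Sup K) - g (Inf K)))" by (simp add: sum_distrib_left)
    also have "\<dots> < C * (\<epsilon> / C)"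
      using \<open>C > 0\<close> lt D sub by (intro mult_strict_left_mono \<delta>) auto
    finally show "(\<Sum>K\<in>D. norm (g' (Sup K) - g' (Inf K))) < \<epsilon>" using \<open>C > 0\<close> by simp
  qed (use \<open>\<delta> > 0\<close> \<open>\<eta> > 0\<close> in auto)
qed

lemma square_le_if_all_scalings:
  fixes x A B :: real
  assumes "\<And>r. r > 0 \<Longrightarrow> 2 * x \<le> r * A + B / r" "0 \<le> A" "0 \<le> B" "0 \<le> x"
  shows "x\<^sup>2 \<le> A * B"
proof -
  have le: "2 * x \<le> 2 * sqrt ((A + e) * (B + e))" if "e > 0" for e
  proof -
    \<comment> \<open>The optimal scaling \<open>sqrt (B / A)\<close>, with both numbers raised by e
      so that it is defined and positive when one of them vanishes.\<close>
    define r where "r = sqrt ((B + e) / (A + e))"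
    have pos: "A + e > 0" "B + e > 0" using assms that by auto
    hence "r > 0" by (simp add: r_def)
    have "2 * x \<le> r * A + B / r" using assms(1)[OF \<open>r > 0\<close>] .
    also have "\<dots> \<le> r * (A + e) + (B + e) / r"
      using \<open>r > 0\<close> that by (intro add_mono mult_left_mono divide_right_mono) auto
    also have "\<dots> = 2 * sqrt ((A + e) * (B + e))"
    proof -
      define a b where "a = sqrt (A + e)" and "b = sqrt (B + e)"
      have "A + e = a * a" "B + e = b * b" "a > 0" "b > 0" "r = b / a" "sqrt ((A + e) * (B + e)) = a * b"
        using pos by (simp_all add: a_def b_def r_def real_sqrt_divide real_sqrt_mult)
      thus ?thesis by simp
    qed
    finally show ?thesis .
  qed
  have sq: "x\<^sup>2 \<le> (A + e) * (B + e)" if "e > 0" for e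
  proof -
    have "2 * x \<le> 2 * sqrt ((A + e) * (B + e))" using le[OF that] .
    hence "x \<le> sqrt ((A + e) * (B + e))" by simp
    hence "x\<^sup>2 \<le> (sqrt ((A + e) * (B + e)))\<^sup>2" using assms by (intro power_mono)
    thus ?thesis using that assms by simp
  qed
  show ?thesis
  proof (rule tendsto_lowerbound)
    show "((\<lambda>e. (A + e) * (B + e)) \<longlongrightarrow> A * B) (at_right 0)" by (auto intro!: tendsto_eq_intros)
    show "eventually (\<lambda>e. x\<^sup>2 \<le> (A + e) * (B + e)) (at_right 0)"
      using sq by (auto simp: eventually_at_right_field intro: exI[of _ 1])
  qed simp
qed

text \<open>Integrate 2 |k| \<le> r w + k^2 / (r w) and optimize over r > 0. Where w vanishes so
  does k, and the quotient is 0 / 0 = 0, so these points contribute nothing on either side.\<close>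

lemma set_integral_weighted_Cauchy_Schwarz:
  fixes k w :: "real \<Rightarrow> real"
  assumes k: "integrable lborel k" and w: "integrable lborel w" and q: "integrable lborel (\<lambda>u. (k u)\<^sup>2 / w u)"
    and w0: "\<And>u. 0 \<le> w u" "\<And>u. w u = 0 \<Longrightarrow> k u = 0" and A: "A \<in> sets borel"
  shows "(LINT u:A|lborel. \<bar>k u\<bar>)\<^sup>2 \<le> (LINT u:A|lborel. w u) * (LINT u:A|lborel. (k u)\<^sup>2 / w u)"
proof (rule square_le_if_all_scalings)
  note int = set_integrable_of_integrable[OF integrable_abs[OF k] A]
    set_integrable_of_integrable[OF w A] set_integrable_of_integrable[OF q A]
  fix r :: real assume "r > 0"
  have pt: "2 * \<bar>k u\<bar> \<le> r * w u + inverse r * ((k u)\<^sup>2 / w u)" for u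
  proof (cases "w u = 0")
    case False
    hence "w u > 0" using w0(1)[of u] by simp
    have "0 \<le> (r * w u - \<bar>k u\<bar>)\<^sup>2" by simp
    hence "2 * \<bar>k u\<bar> * (r * w u) \<le> (r * w u)\<^sup>2 + (k u)\<^sup>2" by (simp add: power2_diff algebra_simps)
    hence "2 * \<bar>k u\<bar> \<le> ((r * w u)\<^sup>2 + (k u)\<^sup>2) / (r * w u)"
      using \<open>r > 0\<close> \<open>w u > 0\<close> by (simp add: pos_le_divide_eq)
    also have "\<dots> = r * w u + inverse r * ((k u)\<^sup>2 / w u)"
      using \<open>r > 0\<close> \<open>w u > 0\<close> by (simp add: field_simps power2_eq_square)
    finally show ?thesis .
  qed (use w0(2) in simp)
  have "(LINT u:A|lborel. 2 * \<bar>k u\<bar>) \<le> (LINT u:A|lborel. r * w u + inverse r * ((k u)\<^sup>2 / w u))"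
    using pt int by (intro set_integral_mono set_integral_add set_integrable_mult_right) auto
  also have "\<dots> = r * (LINT u:A|lborel. w u) + (LINT u:A|lborel. (k u)\<^sup>2 / w u) / r"
    using int by (subst set_integral_add) (auto simp: divide_inverse)
  finally show "2 * (LINT u:A|lborel. \<bar>k u\<bar>) \<le> r * (LINT u:A|lborel. w u) + (LINT u:A|lborel. (k u)\<^sup>2 / w u) / r"
    using int by simp
qed (use w0 in \<open>auto simp: set_lebesgue_integral_def intro!: integral_nonneg_AE\<close>)

lemma integral_complex_combination:
  fixes f g :: "real \<Rightarrow> real" and z :: complex
  assumes "integrable lborel f" "integrable lborel g"
  shows "integrable lborel (\<lambda>u. complex_of_real (f u) + complex_of_real (g u) * z)"
    "(LINT u|lborel. complex_of_real (f u) + complex_of_real (g u) * z)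
       = complex_of_real (LINT u|lborel. f u) + complex_of_real (LINT u|lborel. g u) * z"
proof -
  have i: "integrable lborel (\<lambda>u. complex_of_real (f u))" "integrable lborel (\<lambda>u. complex_of_real (g u) * z)"
    by (intro integrable_mult_left integrable_of_real assms)+
  show "integrable lborel (\<lambda>u. complex_of_real (f u) + complex_of_real (g u) * z)"
    by (intro Bochner_Integration.integrable_add i)
  show "(LINT u|lborel. complex_of_real (f u) + complex_of_real (g u) * z)
       = complex_of_real (LINT u|lborel. f u) + complex_of_real (LINT u|lborel. g u) * z"
    by (simp only: Bochner_Integration.integral_add[OF i] Bochner_Integration.integral_mult_left_zero integral_complex_of_real)
qed

lemma primitive_total:
  assumes "\<And>u. u \<notin> {0<..<L} \<Longrightarrow> k u = 0"
  shows "primitive k L = (LINT u|lborel. k u)"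
  unfolding primitive_def set_lebesgue_integral_def
  by (rule Bochner_Integration.integral_cong) (use assms in \<open>auto simp: indicator_def\<close>)

section \<open>Curves that bend in one direction and then in the other\<close>

text \<open>
  The angle \<open>\<theta>\<close> is extended constantly beyond \<open>[0,L]\<close>, and its density \<open>k\<close> is normalized to vanish outside
  the open interval. The angle is extremal at \<open>c\<close>, a maximum if \<open>\<sigma> = 1\<close> and a minimum if \<open>\<sigma> = -1\<close>.
\<close>

definition bend :: "real \<Rightarrow> real \<Rightarrow> real \<Rightarrow> (real \<Rightarrow> real) \<Rightarrow> (real \<Rightarrow> real) \<Rightarrow> bool" where
  "bend \<sigma> L c \<theta> k \<longleftrightarrow> (\<sigma> = 1 \<or> \<sigma> = -1) \<and> 0 \<le> c \<and> c \<le> L \<and> integrable lborel k \<and>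
     (\<forall>u. u \<notin> {0<..<L} \<longrightarrow> k u = 0) \<and> (\<forall>u\<le>c. 0 \<le> \<sigma> * k u) \<and> (\<forall>u>c. \<sigma> * k u \<le> 0) \<and>
     (\<forall>s. \<theta> s = \<theta> 0 + primitive k s) \<and> \<bar>\<theta> c - \<theta> 0\<bar> \<le> pi \<and> \<bar>\<theta> L - \<theta> c\<bar> \<le> pi"

definition chord :: "real \<Rightarrow> (real \<Rightarrow> real) \<Rightarrow> complex" where
  "chord L \<theta> = (LINT s:{0..L}|lborel. cis (\<theta> s))"

lemma bend_facts:
  assumes "bend \<sigma> L c \<theta> k"
  shows "\<sigma> = 1 \<or> \<sigma> = -1" "0 \<le> c" "c \<le> L" "0 \<le> L" "integrable lborel k" "k \<in> borel_measurable borel"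
    "\<And>u. u \<notin> {0<..<L} \<Longrightarrow> k u = 0" "\<And>u. u \<le> c \<Longrightarrow> 0 \<le> \<sigma> * k u" "\<And>u. c < u \<Longrightarrow> \<sigma> * k u \<le> 0"
    "\<And>s. \<theta> s = \<theta> 0 + primitive k s" "\<bar>\<theta> c - \<theta> 0\<bar> \<le> pi" "\<bar>\<theta> L - \<theta> c\<bar> \<le> pi"
proof -
  note * = assms[unfolded bend_def]
  show "\<sigma> = 1 \<or> \<sigma> = -1" "0 \<le> c" "c \<le> L" "integrable lborel k" "\<bar>\<theta> c - \<theta> 0\<bar> \<le> pi" "\<bar>\<theta> L - \<theta> c\<bar> \<le> pi"
    "\<And>u. u \<notin> {0<..<L} \<Longrightarrow> k u = 0" "\<And>u. u \<le> c \<Longrightarrow> 0 \<le> \<sigma> * k u" "\<And>u. c < u \<Longrightarrow> \<sigma> * k u \<le> 0"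
    "\<And>s. \<theta> s = \<theta> 0 + primitive k s"
    using * by blast+
  show "0 \<le> L" using \<open>0 \<le> c\<close> \<open>c \<le> L\<close> by simp
  show "k \<in> borel_measurable borel" using borel_measurable_integrable[OF \<open>integrable lborel k\<close>] by simp
qed

lemma bend_increment_le:
  assumes "bend \<sigma> L c \<theta> k" "s \<le> t"
  shows "\<bar>\<theta> t - \<theta> s\<bar> \<le> (LINT u:{s<..t}|lborel. \<bar>k u\<bar>)"
proof -
  note f = bend_facts[OF assms(1)]
  have "\<theta> t - \<theta> s = (LINT u:{s<..t}|lborel. k u)"
    using f(10)[of s] f(10)[of t] primitive_diff[OF f(5) assms(2)] by linarith
  thus ?thesis
    unfolding set_lebesgue_integral_def
    using integral_norm_bound[of lborel "\<lambda>u. indicator {s<..t} u *\<^sub>R k u"] by (simp add: abs_mult)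
qed

lemma bend_continuous:
  assumes "bend \<sigma> L c \<theta> k"
  shows "continuous_on A \<theta>" "\<theta> \<in> borel_measurable borel"
proof -
  have "continuous_on UNIV (\<lambda>s. \<theta> 0 + primitive k s)"
    by (intro continuous_intros continuous_primitive bend_facts(5)[OF assms])
  hence c: "continuous_on UNIV \<theta>"
    by (rule continuous_on_eq) (rule bend_facts(10)[OF assms, symmetric])
  show "continuous_on A \<theta>" using c continuous_on_subset by blast
  show "\<theta> \<in> borel_measurable borel" using c by (rule borel_measurable_continuous_onI)
qed

lemma bend_const:
  assumes "bend \<sigma> L c \<theta> k"
  shows "s \<le> 0 \<Longrightarrow> \<theta> s = \<theta> 0" "L \<le> s \<Longrightarrow> \<theta> s = \<theta> L"
proof -
  note f = bend_facts[OF assms]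
  show "\<theta> s = \<theta> 0" if "s \<le> 0"
    using primitive_const[OF f(5) that] f(7) f(10)[of s] f(10)[of 0] by auto
  show "\<theta> s = \<theta> L" if "L \<le> s"
    using primitive_const[OF f(5) that] f(7) f(10)[of s] f(10)[of L] by auto
qed

lemma bend_AE_derivative:
  assumes "bend \<sigma> L c \<theta> k"
  shows "AE s in lborel. (\<theta> has_real_derivative k s) (at s)"
proof -
  have e: "\<theta> = (\<lambda>s. \<theta> 0 + primitive k s)" by (rule ext) (rule bend_facts(10)[OF assms])
  show ?thesis
    using AE_primitive_derivative[OF bend_facts(5)[OF assms]]
    by eventually_elim (subst e, auto intro!: derivative_eq_intros)
qed

lemma bend_mono:
  assumes "bend \<sigma> L c \<theta> k" "s \<le> t"
  shows "t \<le> c \<Longrightarrow> \<sigma> * \<theta> s \<le> \<sigma> * \<theta> t" "c \<le> s \<Longrightarrow> \<sigma> * \<theta> t \<le> \<sigma> * \<theta> s"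
proof -
  note f = bend_facts[OF assms(1)]
  have e: "\<sigma> * \<theta> t = \<sigma> * \<theta> 0 + primitive (\<lambda>u. \<sigma> * k u) t" for t
    using arg_cong[OF f(10)[of t], of "\<lambda>x. \<sigma> * x"] by (simp add: primitive_cmult distrib_left)
  show "\<sigma> * \<theta> s \<le> \<sigma> * \<theta> t" if "t \<le> c"
    using primitive_mono[of "\<lambda>u. \<sigma> * k u" s t] f(5,8) that assms(2)
    unfolding e[of s] e[of t] by simp
  show "\<sigma> * \<theta> t \<le> \<sigma> * \<theta> s" if "c \<le> s"
  proof -
    have "primitive (\<lambda>u. - \<sigma> * k u) s \<le> primitive (\<lambda>u. - \<sigma> * k u) t"
      using f(5,9) that assms(2) by (intro primitive_mono) (auto simp: mult_minus_left)
    thus ?thesis unfolding e[of s] e[of t] primitive_cmult by simp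
  qed
qed

lemma bend_exists:
  assumes \<sigma>: "\<sigma> = 1 \<or> \<sigma> = (-1::real)" and c: "0 \<le> c" "c \<le> L" and cont: "continuous_on UNIV \<theta>"
    and l: "\<And>s. s \<le> 0 \<Longrightarrow> \<theta> s = \<theta> 0" and r: "\<And>s. L \<le> s \<Longrightarrow> \<theta> s = \<theta> L"
    and up: "\<And>s t. 0 \<le> s \<Longrightarrow> s \<le> t \<Longrightarrow> t \<le> c \<Longrightarrow> \<sigma> * \<theta> s \<le> \<sigma> * \<theta> t"
    and dn: "\<And>s t. c \<le> s \<Longrightarrow> s \<le> t \<Longrightarrow> t \<le> L \<Longrightarrow> \<sigma> * \<theta> t \<le> \<sigma> * \<theta> s"
    and ac: "absolutely_continuous_on_interval 0 L \<theta>"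
    and pi: "\<bar>\<theta> c - \<theta> 0\<bar> \<le> pi" "\<bar>\<theta> L - \<theta> c\<bar> \<le> pi"
  obtains k where "bend \<sigma> L c \<theta> k"
proof -
  have \<sigma>\<sigma>: "\<sigma> * \<sigma> = 1" "\<bar>\<sigma>\<bar> = 1" using \<sigma> by auto
  \<comment> \<open>The part of the angle before c and the part after c, each frozen outside its
    range and signed so as to increase. Each has a nonnegative density, and the angle is recovered
    from the two by subtracting the value at c that they share.\<close>
  define f1 where "f1 = (\<lambda>s. \<sigma> * \<theta> (max 0 (min s c)))"
  define f2 where "f2 = (\<lambda>s. - \<sigma> * \<theta> (min L (max s c)))"
  have m1: "mono f1" unfolding f1_def by (intro monoI up) (use c in auto)
  have m2: "mono f2" unfolding f2_def by (intro monoI) (use c dn in auto)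
  have c1: "continuous_on UNIV f1" unfolding f1_def
    by (intro continuous_intros continuous_on_compose2[OF cont]) auto
  have c2: "continuous_on UNIV f2" unfolding f2_def
    by (intro continuous_intros continuous_on_compose2[OF cont]) auto
  have a1: "absolutely_continuous_on_interval 0 c f1"
    by (rule absolutely_continuous_dominated[OF ac, where C=1 and \<eta>=1])
       (use c \<sigma>\<sigma> in \<open>auto simp: f1_def right_diff_distrib[symmetric] abs_mult\<close>)
  have a2: "absolutely_continuous_on_interval c L f2"
    by (rule absolutely_continuous_dominated[OF ac, where C=1 and \<eta>=1])
       (use c \<sigma>\<sigma> in \<open>auto simp: f2_def right_diff_distrib[symmetric] abs_mult abs_minus_commute\<close>)
  obtain k1 where k1: "integrable lborel k1" "\<And>u. 0 \<le> k1 u" "\<And>u. u \<notin> {0<..<c} \<Longrightarrow> k1 u = 0"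
    "\<And>s. f1 s = f1 0 + primitive k1 s"
    by (rule primitive_density_exists[OF c(1) m1 c1 _ _ a1]) (auto simp: f1_def c)
  obtain k2 where k2: "integrable lborel k2" "\<And>u. 0 \<le> k2 u" "\<And>u. u \<notin> {c<..<L} \<Longrightarrow> k2 u = 0"
    "\<And>s. f2 s = f2 c + primitive k2 s"
    by (rule primitive_density_exists[OF c(2) m2 c2 _ _ a2]) (auto simp: f2_def c)
  define k where "k = (\<lambda>u. \<sigma> * (k1 u - k2 u))"
  have prim: "primitive k s = \<sigma> * (primitive k1 s - primitive k2 s)" for s
    unfolding k_def primitive_cmult unfolding primitive_def
    by (subst set_integral_diff) (use k1(1) k2(1) in \<open>auto intro: set_integrable_of_integrable\<close>)
  have \<theta>s: "\<theta> s = \<theta> 0 + primitive k s" for s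
  proof -
    have "\<theta> s = \<theta> (max 0 (min s c)) + \<theta> (min L (max s c)) - \<theta> c"
      using l[of s] r[of s] c by (cases "s \<le> c") (auto simp: max_def min_def)
    also have "\<dots> = \<sigma> * f1 s - \<sigma> * f2 s - \<theta> c"
      using \<sigma>\<sigma> by (simp add: f1_def f2_def mult.assoc[symmetric])
    also have "\<dots> = \<sigma> * f1 0 - \<sigma> * f2 c - \<theta> c + primitive k s"
      by (subst k1(4), subst k2(4)) (simp add: prim algebra_simps)
    also have "\<sigma> * f1 0 - \<sigma> * f2 c - \<theta> c = \<theta> 0"
      using \<sigma>\<sigma> c by (simp add: f1_def f2_def mult.assoc[symmetric])
    finally show ?thesis .
  qed
  have "bend \<sigma> L c \<theta> k"
    unfolding bend_def
  proof (intro conjI allI impI \<sigma> c pi \<theta>s)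
    show "integrable lborel k" unfolding k_def using k1(1) k2(1) by auto
    show "k u = 0" if "u \<notin> {0<..<L}" for u
      using that c k1(3)[of u] k2(3)[of u] by (auto simp: k_def)
    show "0 \<le> \<sigma> * k u" if "u \<le> c" for u
      using that k1(2)[of u] k2(3)[of u] \<sigma>\<sigma> by (auto simp: k_def mult.assoc[symmetric])
    show "\<sigma> * k u \<le> 0" if "u > c" for u
      using that k2(2)[of u] k1(3)[of u] \<sigma>\<sigma> by (auto simp: k_def mult.assoc[symmetric])
  qed
  thus ?thesis by (rule that)
qed

text \<open>The energy can be bounded from increments of the angle alone. This serves curves whose
  density is known only to exist, such as those obtained by reweighting.\<close>

lemma bend_energy_le:
  assumes b: "bend \<sigma> L c \<theta> k" and mono: "mono \<Phi>"
    and A: "\<And>s. s \<le> 0 \<Longrightarrow> \<Phi> s = \<Phi> 0" and B: "\<And>s. L \<le> s \<Longrightarrow> \<Phi> s = \<Phi> L"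
    and le: "\<And>s t. s \<le> t \<Longrightarrow> (\<theta> t - \<theta> s)\<^sup>2 \<le> (t - s) * (\<Phi> t - \<Phi> s)"
  shows "integrable lborel (\<lambda>u. (k u)\<^sup>2)" "(LINT u|lborel. (k u)\<^sup>2) \<le> \<Phi> L - \<Phi> 0"
proof -
  have [measurable]: "k \<in> borel_measurable borel" using bend_facts(6)[OF b] .
  have "(\<integral>\<^sup>+s. ennreal ((k s)\<^sup>2) \<partial>lborel) \<le> ennreal (\<Phi> L - \<Phi> 0)"
  proof (rule nn_integral_derivative_square_le[OF bend_AE_derivative[OF b] bend_continuous(2)[OF b]])
    fix n
    show "(\<integral>\<^sup>+s. ennreal (((\<theta> (s + 1 / real (Suc n)) - \<theta> s) * real (Suc n))\<^sup>2) \<partial>lborel) \<le> ennreal (\<Phi> L - \<Phi> 0)"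
      using nn_integral_difference_quotient_square_le[OF bend_facts(4)[OF b] _ mono A B le, of "1 / real (Suc n)"]
      by simp
  qed
  moreover have nonneg: "0 \<le> \<Phi> L - \<Phi> 0" using monoD[OF mono bend_facts(4)[OF b]] by simp
  ultimately show i: "integrable lborel (\<lambda>u. (k u)\<^sup>2)"
    by (intro integrableI_nonneg) (auto simp: less_top[symmetric] top_unique)
  have "ennreal (LINT u|lborel. (k u)\<^sup>2) \<le> ennreal (\<Phi> L - \<Phi> 0)"
    using \<open>_ \<le> ennreal (\<Phi> L - \<Phi> 0)\<close> nn_integral_eq_integral[OF i] by simp
  thus "(LINT u|lborel. (k u)\<^sup>2) \<le> \<Phi> L - \<Phi> 0" using nonneg by simp
qed

text \<open>Substitution by the new arclength, stated for measures because the primitive of w is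
  constant wherever w vanishes. Both measures are finite, so comparing them on right half lines
  suffices.\<close>

lemma distr_density_primitive:
  fixes w :: "real \<Rightarrow> real"
  assumes w: "integrable lborel w" "\<And>u. 0 \<le> w u" "\<And>u. u \<notin> {0<..<L} \<Longrightarrow> w u = 0" and "0 \<le> L"
  shows "distr (density lborel (\<lambda>u. ennreal (w u))) borel (primitive w) = density lborel (indicator {0..primitive w L})"
    (is "?M = ?N")
proof (rule measure_eqI_lessThan)
  define S where "S = primitive w"
  define T where "T = primitive w L"
  have Sc: "continuous_on UNIV S" unfolding S_def by (rule continuous_primitive[OF w(1)])
  have [measurable]: "S \<in> borel_measurable borel" using Sc by (rule borel_measurable_continuous_onI)
  have [measurable]: "w \<in> borel_measurable borel" using w(1) by simp
  have mono: "S s \<le> S t" if "s \<le> t" for s t unfolding S_def using w that by (intro primitive_mono) auto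
  have S0: "S s = 0" if "s \<le> 0" for s
    unfolding S_def by (rule primitive_eq_0) (use w(3) that in auto)
  have SL: "S s = T" if "L \<le> s" for s
    unfolding S_def T_def using primitive_const[OF w(1) that] w(3) by auto
  have T: "T = (LINT u|lborel. w u)" unfolding T_def using primitive_total w(3) by blast
  have T0: "0 \<le> T" using mono[of 0 L] S0[of 0] SL[of L] \<open>0 \<le> L\<close> by simp
  have Srange: "0 \<le> S s" "S s \<le> T" for s
    using mono[of 0 s] S0[of s] S0[of 0] mono[of s L] SL[of s] SL[of L] T0 by (cases "s \<le> 0"; cases "s \<ge> L"; force)+
  have Mx: "emeasure ?M {x<..} = (\<integral>\<^sup>+u. ennreal (indicator {u. x < S u} u * w u) \<partial>lborel)" for x
  proof -
    have m: "{u. x < S u} \<in> sets borel" by measurable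
    have "emeasure ?M {x<..} = emeasure (density lborel (\<lambda>u. ennreal (w u))) {u. x < S u}"
      by (subst emeasure_distr) (auto simp: S_def[symmetric] vimage_def)
    also have "\<dots> = (\<integral>\<^sup>+u. ennreal (w u) * indicator {u. x < S u} u \<partial>lborel)"
      using m by (subst emeasure_density) auto
    also have "\<dots> = (\<integral>\<^sup>+u. ennreal (indicator {u. x < S u} u * w u) \<partial>lborel)"
      by (intro nn_integral_cong) (auto simp: indicator_def)
    finally show ?thesis .
  qed
  show "sets ?M = sets borel" "sets ?N = sets borel" by simp_all
  show "emeasure ?M {x<..} = emeasure ?N {x<..}" for x
  proof -
    have N: "emeasure ?N {x<..} = emeasure lborel ({0..T} \<inter> {x<..})"
      by (subst emeasure_restricted) (auto simp: T_def)
    consider "x < 0" | "T \<le> x" | "0 \<le> x" "x < T" by linarith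
    thus ?thesis
    proof cases
      case 1
      hence "{0..T} \<inter> {x<..} = {0..T}" "{u. x < S u} = UNIV" using Srange by (auto intro: less_le_trans)
      thus ?thesis unfolding N Mx using T T0 w by (simp add: nn_integral_eq_integral)
    next
      case 2
      hence "{0..T} \<inter> {x<..} = {}" "{u. x < S u} = {}" using Srange by (auto simp: not_less intro: order_trans)
      thus ?thesis unfolding N Mx by simp
    next
      case 3
      \<comment> \<open>Its supremum s is the last time at which S is at most x; continuity gives S
        s = x, and the preimage of the half line is \<open>{s<..}\<close>.\<close>
      define Y where "Y = {s\<in>{0..L}. S s \<le> x}"
      have "closed Y" unfolding Y_def
        by (intro continuous_closed_preimage_constant continuous_on_closed_Collect_le closed_Collect_le continuous_intros)
           (auto intro: continuous_on_subset[OF Sc] continuous_on_const closed_atLeastAtMost)?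
      have "0 \<in> Y" using 3 S0[of 0] \<open>0 \<le> L\<close> by (simp add: Y_def)
      have bd: "bdd_above Y" by (auto simp: Y_def)
      define s where "s = Sup Y"
      have "s \<in> Y" unfolding s_def using \<open>0 \<in> Y\<close> bd \<open>closed Y\<close> by (intro closed_contains_Sup) auto
      have gt: "x < S u" if "s < u" for u
      proof (cases "u \<le> L")
        case True
        have "u \<notin> Y" using cSup_upper[OF _ bd, of u] that by (auto simp: s_def)
        thus ?thesis using True that \<open>s \<in> Y\<close> by (auto simp: Y_def)
      qed (use SL[of u] 3 in auto)
      have le: "S u \<le> x" if "u \<le> s" for u using mono[OF that] \<open>s \<in> Y\<close> by (auto simp: Y_def)
      have Sx: "S s = x"
      proof (rule antisym)
        show "S s \<le> x" using le by simp
        show "x \<le> S s"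
        proof (rule tendsto_lowerbound)
          have "isCont S s" using Sc by (simp add: continuous_on_eq_continuous_at)
          thus "(S \<longlongrightarrow> S s) (at_right s)" by (simp add: isCont_def filterlim_at_split)
          show "eventually (\<lambda>u. x \<le> S u) (at_right s)"
            unfolding eventually_at_right_field using gt by (intro exI[of _ "s+1"]) (auto intro: less_imp_le)
        qed simp
      qed
      have "{u. x < S u} = {s<..}" using gt le by (auto simp: not_le[symmetric])
      moreover have "{0..T} \<inter> {x<..} = {x<..T}" using 3 by auto
      moreover have "(\<integral>\<^sup>+u. ennreal (indicator {s<..} u * w u) \<partial>lborel) = ennreal (T - x)"
      proof -
        have "(\<integral>\<^sup>+u. ennreal (indicator {s<..} u * w u) \<partial>lborel) = (\<integral>\<^sup>+u. ennreal (indicator {s<..L} u *\<^sub>R w u) \<partial>lborel)"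
          by (intro nn_integral_cong) (use w(3) in \<open>auto simp: indicator_def\<close>)
        also have "\<dots> = ennreal (LINT u:{s<..L}|lborel. w u)"
          unfolding set_lebesgue_integral_def
          using w by (intro nn_integral_eq_integral integrable_mult_indicator) auto
        also have "(LINT u:{s<..L}|lborel. w u) = T - x"
          using primitive_diff[OF w(1), of s L] \<open>s \<in> Y\<close> Sx by (simp add: S_def T_def Y_def)
        finally show ?thesis .
      qed
      ultimately show ?thesis unfolding N Mx using 3 by simp
    qed
  qed
  show "emeasure ?M {x<..} < \<infinity>" for x
  proof -
    have "emeasure ?M {x<..} = emeasure lborel ({0..T} \<inter> {x<..})"
      using \<open>emeasure ?M {x<..} = emeasure ?N {x<..}\<close>
      by (simp add: emeasure_restricted T_def)
    also have "\<dots> \<le> emeasure lborel {0..T}" by (intro emeasure_mono) auto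
    also have "\<dots> < \<infinity>" by (simp add: emeasure_lborel_Icc_eq)
    finally show ?thesis .
  qed
qed

text \<open>
  The new curve runs through the same angles with arclength element \<open>w ds\<close>; straight parts, where
  \<open>k = 0\<close>, may be cut out altogether by \<open>w = 0\<close>, and the quotient \<open>k\<^sup>2 / w\<close> is then \<open>0\<close> as it should be.
\<close>

lemma bend_reweight:
  assumes b: "bend \<sigma> L c \<theta> k"
    and w: "integrable lborel w" "\<And>u. 0 \<le> w u" "\<And>u. u \<notin> {0<..<L} \<Longrightarrow> w u = 0" "\<And>u. w u = 0 \<Longrightarrow> k u = 0"
    and q: "integrable lborel (\<lambda>u. (k u)\<^sup>2 / w u)"
  obtains c' \<theta>' k' where "bend \<sigma> (LINT u|lborel. w u) c' \<theta>' k'" "\<theta>' 0 = \<theta> 0" "\<theta>' (LINT u|lborel. w u) = \<theta> L"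
    "chord (LINT u|lborel. w u) \<theta>' = (LINT u|lborel. w u *\<^sub>R cis (\<theta> u))"
    "integrable lborel (\<lambda>u. (k' u)\<^sup>2)" "(LINT u|lborel. (k' u)\<^sup>2) \<le> (LINT u|lborel. (k u)\<^sup>2 / w u)"
proof -
  note f = bend_facts[OF b]
  define S where "S = primitive w"
  define \<Phi> where "\<Phi> = primitive (\<lambda>u. (k u)\<^sup>2 / w u)"
  define T where "T = (LINT u|lborel. w u)"
  have Sc: "continuous_on A S" for A
    unfolding S_def using continuous_primitive[OF w(1)] continuous_on_subset by blast
  have [measurable]: "w \<in> borel_measurable borel" using w(1) by simp
  have [measurable]: "\<theta> \<in> borel_measurable borel" by (rule bend_continuous[OF b])
  have mono: "S s \<le> S t" if "s \<le> t" for s t unfolding S_def using w that by (intro primitive_mono) auto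
  have \<Phi>mono: "\<Phi> s \<le> \<Phi> t" if "s \<le> t" for s t unfolding \<Phi>_def using w q that by (intro primitive_mono) auto
  have S0: "S 0 = 0"
    unfolding S_def by (rule primitive_eq_0) (use w(3) in auto)
  have SL: "S L = T" unfolding S_def T_def using primitive_total w(3) by blast
  have \<Phi>0: "\<Phi> 0 = 0"
    unfolding \<Phi>_def by (rule primitive_eq_0) (use w(3) in auto)
  have \<Phi>L: "\<Phi> L = (LINT u|lborel. (k u)\<^sup>2 / w u)" unfolding \<Phi>_def
    by (rule primitive_total) (use w(3) in auto)
  have T0: "0 \<le> T" using mono[OF f(4)] S0 SL by simp
  have key: "(\<theta> t - \<theta> s)\<^sup>2 \<le> (S t - S s) * (\<Phi> t - \<Phi> s)" if "s \<le> t" for s t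
  proof -
    have "\<bar>\<theta> t - \<theta> s\<bar> \<le> (LINT u:{s<..t}|lborel. \<bar>k u\<bar>)" by (rule bend_increment_le[OF b that])
    hence "\<bar>\<theta> t - \<theta> s\<bar>\<^sup>2 \<le> (LINT u:{s<..t}|lborel. \<bar>k u\<bar>)\<^sup>2" by (intro power_mono) auto
    also have "\<dots> \<le> (LINT u:{s<..t}|lborel. w u) * (LINT u:{s<..t}|lborel. (k u)\<^sup>2 / w u)"
      by (rule set_integral_weighted_Cauchy_Schwarz[OF f(5) w(1) q w(2,4)]) auto
    also have "\<dots> = (S t - S s) * (\<Phi> t - \<Phi> s)"
      unfolding S_def \<Phi>_def using primitive_diff[OF w(1) that] primitive_diff[OF q that] by simp
    finally show ?thesis by simp
  qed
  define cl where "cl = (\<lambda>x. max 0 (min x T))"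
  \<comment> \<open>Only a right inverse of S is available, since S is constant where w vanishes.
    The choice depends on x through \<open>cl x\<close> alone, so r is constant beyond [0, T];
    \<theta> takes equal values wherever S does, so \<theta> (r x) does not depend on the
    choice.\<close>
  define r where "r = (\<lambda>x. SOME s. 0 \<le> s \<and> s \<le> L \<and> S s = cl x)"
  have r: "0 \<le> r x \<and> r x \<le> L \<and> S (r x) = cl x" for x
    unfolding r_def
  proof (rule someI_ex)
    show "\<exists>s. 0 \<le> s \<and> s \<le> L \<and> S s = cl x"
      using IVT'[of S 0 "cl x" L] S0 SL T0 f(4) Sc by (auto simp: cl_def)
  qed
  have rmono: "r x \<le> r y" if "x \<le> y" for x y
  proof (cases "cl x = cl y")
    case True
    have "r x = r y" unfolding r_def True ..
    thus ?thesis by simp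
  next
    case False
    hence "S (r x) < S (r y)" using r[of x] r[of y] that by (auto simp: cl_def)
    thus ?thesis using mono[of "r y" "r x"] by linarith
  qed
  define \<theta>' where "\<theta>' = (\<lambda>x. \<theta> (r x))"
  define \<Phi>' where "\<Phi>' = (\<lambda>x. \<Phi> (r x))"
  have S\<theta>: "\<theta> s = \<theta> t" if "S s = S t" for s t
  proof -
    have "(\<theta> t - \<theta> s)\<^sup>2 \<le> 0 \<or> (\<theta> s - \<theta> t)\<^sup>2 \<le> 0"
      using key[of s t] key[of t s] unfolding that by (cases "s \<le> t") auto
    thus ?thesis by auto
  qed
  have \<theta>'S: "\<theta>' (S s) = \<theta> s" if "0 \<le> s" "s \<le> L" for s
  proof -
    have "0 \<le> S s" "S s \<le> T" using mono[of 0 s] mono[of s L] S0 SL that by auto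
    hence "S (r (S s)) = S s" using r[of "S s"] by (simp add: cl_def)
    thus ?thesis unfolding \<theta>'_def by (rule S\<theta>)
  qed
  have \<Phi>'m: "mono \<Phi>'" unfolding \<Phi>'_def by (intro monoI \<Phi>mono rmono)
  have \<Phi>'b: "0 \<le> \<Phi>' x" "\<Phi>' x \<le> \<Phi> L" for x
    using \<Phi>mono[of 0 "r x"] \<Phi>mono[of "r x" L] r[of x] \<Phi>0 by (auto simp: \<Phi>'_def)
  have key': "(\<theta>' y - \<theta>' x)\<^sup>2 \<le> (y - x) * (\<Phi>' y - \<Phi>' x)" if "x \<le> y" for x y
  proof -
    have "(\<theta>' y - \<theta>' x)\<^sup>2 \<le> (cl y - cl x) * (\<Phi>' y - \<Phi>' x)"
      unfolding \<theta>'_def \<Phi>'_def using key[OF rmono[OF that]] r by simp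
    also have "\<dots> \<le> (y - x) * (\<Phi>' y - \<Phi>' x)"
      using that monoD[OF \<Phi>'m that] by (intro mult_right_mono) (auto simp: cl_def)
    finally show ?thesis .
  qed
  have cont: "continuous_on UNIV \<theta>'"
    unfolding continuous_on_iff
  proof (intro ballI allI impI)
    fix x e :: real assume "e > 0"
    show "\<exists>d>0. \<forall>x'\<in>UNIV. dist x' x < d \<longrightarrow> dist (\<theta>' x') (\<theta>' x) < e"
    proof (intro exI[of _ "e\<^sup>2 / (\<Phi> L + 1)"] conjI ballI impI)
      have pos: "0 < \<Phi> L + 1" using \<Phi>'b[of 0] by linarith
      show "0 < e\<^sup>2 / (\<Phi> L + 1)" using \<open>e > 0\<close> pos by simp
      fix y assume y: "dist y x < e\<^sup>2 / (\<Phi> L + 1)"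
      have "(\<theta>' y - \<theta>' x)\<^sup>2 \<le> \<bar>y - x\<bar> * \<bar>\<Phi>' y - \<Phi>' x\<bar>"
        using key'[of x y] key'[of y x] monoD[OF \<Phi>'m, of x y] monoD[OF \<Phi>'m, of y x]
        by (cases "x \<le> y") (auto simp: power2_commute)
      also have "\<dots> \<le> \<bar>y - x\<bar> * (\<Phi> L + 1)"
        using \<Phi>'b[of x] \<Phi>'b[of y] by (intro mult_left_mono) auto
      also have "\<dots> < e\<^sup>2" using y pos by (simp add: dist_real_def pos_less_divide_eq)
      finally show "dist (\<theta>' y) (\<theta>' x) < e"
        using \<open>e > 0\<close> by (simp add: dist_real_def) (metis abs_of_pos power2_abs power2_less_imp_less less_imp_le)
    qed
  qed
  have c0: "0 \<le> S c" "S c \<le> T" using mono[of 0 c] mono[of c L] S0 SL f(2,3) by auto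
  have e0: "\<theta>' 0 = \<theta> 0" using \<theta>'S[of 0] S0 f(4) by simp
  have eT: "\<theta>' T = \<theta> L" using \<theta>'S[of L] SL f(4) by simp
  have ec: "\<theta>' (S c) = \<theta> c" using \<theta>'S[of c] f(2,3) by simp
  have rl: "r x = r 0" if "x \<le> 0" for x
  proof -
    have "cl x = cl 0" using that T0 by (simp add: cl_def)
    thus ?thesis unfolding r_def by simp
  qed
  have rr: "r x = r T" if "T \<le> x" for x
  proof -
    have "cl x = cl T" using that T0 by (simp add: cl_def)
    thus ?thesis unfolding r_def by simp
  qed
  obtain k' where k': "bend \<sigma> T (S c) \<theta>' k'"
  proof (rule bend_exists[OF f(1) c0 cont])
    show "absolutely_continuous_on_interval 0 T \<theta>'"
      by (rule absolutely_continuous_if_energy_bound[where \<Phi>=\<Phi>'])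
         (use T0 key' \<Phi>'m in \<open>auto intro: mono_imp_mono_on\<close>)
    show "\<theta>' x = \<theta>' 0" if "x \<le> 0" for x using rl[OF that] by (simp add: \<theta>'_def)
    show "\<theta>' x = \<theta>' T" if "T \<le> x" for x using rr[OF that] by (simp add: \<theta>'_def)
    show "\<sigma> * \<theta>' x \<le> \<sigma> * \<theta>' y" if "0 \<le> x" "x \<le> y" "y \<le> S c" for x y
    proof -
      \<comment> \<open>If S is constant to the right of c, the chosen time may overshoot c although
        z \<le> S c; the angle there still equals its value at c, so the time may be clamped. The
        case beyond c below is symmetric.\<close>
      have *: "\<theta> (r z) = \<theta> (min (r z) c)" if "z \<le> S c" for z
      proof (cases "r z \<le> c")
        case False
        have "cl z \<le> S c" using that c0 by (auto simp: cl_def)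
        hence "S (r z) = S c" using False mono[of c "r z"] r[of z] by auto
        thus ?thesis using False S\<theta>[of "r z" c] by simp
      qed simp
      show ?thesis unfolding \<theta>'_def using that rmono[of x y]
        by (subst (1 2) *) (auto intro!: bend_mono(1)[OF b])
    qed
    show "\<sigma> * \<theta>' y \<le> \<sigma> * \<theta>' x" if "S c \<le> x" "x \<le> y" "y \<le> T" for x y
    proof -
      have *: "\<theta> (r z) = \<theta> (max (r z) c)" if "S c \<le> z" for z
      proof (cases "c \<le> r z")
        case False
        have "S c \<le> cl z" using that c0 by (auto simp: cl_def)
        hence "S (r z) = S c" using False mono[of "r z" c] r[of z] by auto
        thus ?thesis using False S\<theta>[of "r z" c] by simp
      qed simp
      show ?thesis unfolding \<theta>'_def using that rmono[of x y]
        by (subst (1 2) *) (auto intro!: bend_mono(2)[OF b])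
    qed
    show "\<bar>\<theta>' (S c) - \<theta>' 0\<bar> \<le> pi" "\<bar>\<theta>' T - \<theta>' (S c)\<bar> \<le> pi" using f(11,12) unfolding e0 eT ec .
  qed
  have \<Phi>'T: "\<Phi>' T - \<Phi>' 0 \<le> (LINT u|lborel. (k u)\<^sup>2 / w u)"
    using \<Phi>'b[of T] \<Phi>'b[of 0] \<Phi>L by simp
  have E: "integrable lborel (\<lambda>u. (k' u)\<^sup>2)" "(LINT u|lborel. (k' u)\<^sup>2) \<le> \<Phi>' T - \<Phi>' 0"
    by (rule bend_energy_le[OF k' \<Phi>'m _ _ key']; (unfold \<Phi>'_def, erule rl[THEN arg_cong] rr[THEN arg_cong])?; assumption?)+
  have ch: "chord T \<theta>' = (LINT u|lborel. w u *\<^sub>R cis (\<theta> u))"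
  proof -
    have [measurable]: "\<theta>' \<in> borel_measurable borel" using cont by (rule borel_measurable_continuous_onI)
    have [measurable]: "S \<in> borel_measurable borel" using Sc by (rule borel_measurable_continuous_onI)
    have "chord T \<theta>' = (LINT x|density lborel (\<lambda>x. ennreal (indicator {0..T} x)). cis (\<theta>' x))"
      unfolding chord_def set_lebesgue_integral_def
      by (subst integral_density) auto
    also have "density lborel (\<lambda>x. ennreal (indicator {0..T} x)) = distr (density lborel (\<lambda>u. ennreal (w u))) borel S"
      using distr_density_primitive[OF w(1-3) f(4)] by (simp add: S_def[symmetric] SL ennreal_indicator)
    also have "(LINT x|\<dots>. cis (\<theta>' x)) = (LINT u|density lborel (\<lambda>u. ennreal (w u)). cis (\<theta>' (S u)))"
      by (subst integral_distr) auto
    also have "\<dots> = (LINT u|lborel. w u *\<^sub>R cis (\<theta>' (S u)))"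
      by (subst integral_density) (use w in auto)
    also have "\<dots> = (LINT u|lborel. w u *\<^sub>R cis (\<theta> u))"
    proof (rule Bochner_Integration.integral_cong)
      fix u
      show "w u *\<^sub>R cis (\<theta>' (S u)) = w u *\<^sub>R cis (\<theta> u)"
        using w(3)[of u] \<theta>'S[of u] by (cases "u \<in> {0<..<L}") auto
    qed simp
    finally show ?thesis .
  qed
  show ?thesis
    by (rule that[of "S c" \<theta>' k']) (use k' e0 eT ch E \<Phi>'T in \<open>auto simp: T_def\<close>)
qed

section \<open>Compactness and lower semicontinuity\<close>

lemma bend_increment_square_le:
  assumes b: "bend \<sigma> L c \<theta> k" and k2: "integrable lborel (\<lambda>u. (k u)\<^sup>2)"
  defines "\<Phi> \<equiv> primitive (\<lambda>u. (k u)\<^sup>2)"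
  shows "mono \<Phi>" "\<And>s. s \<le> 0 \<Longrightarrow> \<Phi> s = 0" "\<And>s. L \<le> s \<Longrightarrow> \<Phi> s = (LINT u|lborel. (k u)\<^sup>2)"
    "\<And>s t. s \<le> t \<Longrightarrow> (\<theta> t - \<theta> s)\<^sup>2 \<le> (t - s) * (\<Phi> t - \<Phi> s)"
proof -
  note f = bend_facts[OF b]
  show m: "mono \<Phi>" unfolding \<Phi>_def by (intro monoI primitive_mono k2) auto
  show "\<Phi> s = 0" if "s \<le> 0" for s
    unfolding \<Phi>_def by (rule primitive_eq_0) (use f(7) that in auto)
  show "\<Phi> s = (LINT u|lborel. (k u)\<^sup>2)" if "L \<le> s" for s unfolding \<Phi>_def
    by (rule primitive_total) (use f(7) that in auto)
  show "(\<theta> t - \<theta> s)\<^sup>2 \<le> (t - s) * (\<Phi> t - \<Phi> s)" if "s \<le> t" for s t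
  proof -
    \<comment> \<open>The weight 1 would not be integrable over the line. Its restriction to the
      support of k gives the Hoelder estimate of exponent 1/2 that makes curves of bounded energy
      equicontinuous.\<close>
    let ?w = "indicat_real {0<..<L}"
    have w: "integrable lborel ?w" by (rule integrable_real_indicator) (use f(4) in auto)
    have eq: "(\<lambda>u. (k u)\<^sup>2 / ?w u) = (\<lambda>u. (k u)\<^sup>2)" using f(7) by (auto simp: indicator_def fun_eq_iff)
    have "\<bar>\<theta> t - \<theta> s\<bar> \<le> (LINT u:{s<..t}|lborel. \<bar>k u\<bar>)" by (rule bend_increment_le[OF b that])
    hence "\<bar>\<theta> t - \<theta> s\<bar>\<^sup>2 \<le> (LINT u:{s<..t}|lborel. \<bar>k u\<bar>)\<^sup>2" by (intro power_mono) auto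
    also have "\<dots> \<le> (LINT u:{s<..t}|lborel. ?w u) * (LINT u:{s<..t}|lborel. (k u)\<^sup>2 / ?w u)"
      by (rule set_integral_weighted_Cauchy_Schwarz[OF f(5) w])
         (use k2 eq f(7) in \<open>auto simp: indicator_def split: if_splits\<close>)
    also have "(LINT u:{s<..t}|lborel. (k u)\<^sup>2 / ?w u) = \<Phi> t - \<Phi> s"
      unfolding eq \<Phi>_def using primitive_diff[OF k2 that] by simp
    also have "(LINT u:{s<..t}|lborel. ?w u) * (\<Phi> t - \<Phi> s) \<le> (t - s) * (\<Phi> t - \<Phi> s)"
    proof (rule mult_right_mono)
      have "(LINT u:{s<..t}|lborel. ?w u) \<le> (LINT u:{s<..t}|lborel. 1)"
      proof (rule set_integral_mono)
        show "set_integrable lborel {s<..t} ?w" using w by (rule set_integrable_of_integrable) simp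
        show "set_integrable lborel {s<..t} (\<lambda>_. 1::real)"
          unfolding set_integrable_def using that by simp
      qed (simp add: indicator_def)
      thus "(LINT u:{s<..t}|lborel. ?w u) \<le> t - s" using that by (simp add: set_lebesgue_integral_def)
    qed (use monoD[OF m that] in simp)
    finally show ?thesis by simp
  qed
qed

lemma bend_shift:
  assumes "bend \<sigma> L c \<theta> k"
  shows "bend \<sigma> L c (\<lambda>s. \<theta> s + r) k"
proof -
  note f = bend_facts[OF assms]
  show ?thesis unfolding bend_def
  proof (intro conjI allI impI)
    show "\<theta> s + r = \<theta> 0 + r + primitive k s" for s using f(10)[of s] by simp
  qed (use f(1-9,11,12) in auto)
qed

lemma angle_reduce: "\<exists>n::int. \<bar>x + 2 * pi * of_int n\<bar> \<le> pi"
proof (intro exI)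
  let ?n = "- round (x / (2 * pi))"
  have "\<bar>of_int (round (x / (2 * pi))) - x / (2 * pi)\<bar> \<le> 1/2" by (rule of_int_round_abs_le)
  hence "\<bar>of_int (round (x / (2 * pi))) - x / (2 * pi)\<bar> * (2 * pi) \<le> 1/2 * (2 * pi)"
    by (rule mult_right_mono) simp
  also have "\<bar>of_int (round (x / (2 * pi))) - x / (2 * pi)\<bar> * (2 * pi)
      = \<bar>(of_int (round (x / (2 * pi))) - x / (2 * pi)) * (2 * pi)\<bar>" by (simp add: abs_mult)
  also have "(of_int (round (x / (2 * pi))) - x / (2 * pi)) * (2 * pi) = - (x + 2 * pi * of_int ?n)"
    by (simp add: field_simps)
  finally show "\<bar>x + 2 * pi * of_int ?n\<bar> \<le> pi" by simp
qed

lemma cis_add_2pi_int: "cis (x + 2 * pi * of_int n) = cis x"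
  by (simp add: cis_mult[symmetric] cis_multiple_2pi)

lemma chord_shift_2pi: "chord L (\<lambda>s. \<theta> s + 2 * pi * of_int n) = chord L \<theta>"
  unfolding chord_def cis_add_2pi_int ..

text \<open>Arzela-Ascoli applies to the angles, while \<sigma>, L and c range over compact sets.
  The densities need not converge pointwise, so the limit density is recovered from the limit angle.
  The numbers E n are upper bounds for the energies, and only these bounds are required to
  converge.\<close>

lemma bend_limit:
  fixes L c \<sigma> E :: "nat \<Rightarrow> real" and \<theta> k :: "nat \<Rightarrow> real \<Rightarrow> real"
  assumes b: "\<And>n. bend (\<sigma> n) (L n) (c n) (\<theta> n) (k n)"
    and k2: "\<And>n. integrable lborel (\<lambda>u. (k n u)\<^sup>2)" and kE: "\<And>n. (LINT u|lborel. (k n u)\<^sup>2) \<le> E n"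
    and E: "E \<longlonglongrightarrow> e" and LC: "\<And>n. L n \<le> C" and z: "\<And>n. chord (L n) (\<theta> n) = z"
    and d: "(\<lambda>n. cis (\<theta> n 0)) \<longlonglongrightarrow> d" and d': "(\<lambda>n. cis (\<theta> n (L n))) \<longlonglongrightarrow> d'"
  obtains \<sigma>' L' c' \<theta>' k' where "bend \<sigma>' L' c' \<theta>' k'" "integrable lborel (\<lambda>u. (k' u)\<^sup>2)"
    "(LINT u|lborel. (k' u)\<^sup>2) \<le> e" "chord L' \<theta>' = z" "cis (\<theta>' 0) = d" "cis (\<theta>' L') = d'"
proof -
  \<comment> \<open>Only end directions are prescribed, so the angles could drift off by multiples
    of 2 pi; normalizing them at 0 bounds the family.\<close>
  have "\<forall>n. \<exists>j::int. \<bar>\<theta> n 0 + 2 * pi * of_int j\<bar> \<le> pi" using angle_reduce by blast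
  then obtain j where j: "\<And>n. \<bar>\<theta> n 0 + 2 * pi * of_int (j n)\<bar> \<le> pi" by metis
  define \<psi> where "\<psi> = (\<lambda>n s. \<theta> n s + 2 * pi * of_int (j n))"
  have b\<psi>: "bend (\<sigma> n) (L n) (c n) (\<psi> n) (k n)" for n unfolding \<psi>_def by (rule bend_shift[OF b])
  have cis\<psi>: "cis (\<psi> n s) = cis (\<theta> n s)" for n s unfolding \<psi>_def by (rule cis_add_2pi_int)
  have ch\<psi>: "chord (L n) (\<psi> n) = z" for n unfolding \<psi>_def chord_shift_2pi by (rule z)
  obtain K where K: "\<And>n. E n \<le> K"
    using convergent_imp_Bseq[OF convergentI[OF E]] unfolding Bseq_def by (metis abs_le_D1 real_norm_def)
  have K0: "0 \<le> K"
  proof -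
    have "0 \<le> (LINT u|lborel. (k 0 u)\<^sup>2)" by simp
    thus ?thesis using kE[of 0] K[of 0] by linarith
  qed
  define \<Phi> where "\<Phi> n = primitive (\<lambda>u. (k n u)\<^sup>2)" for n
  note inc = bend_increment_square_le[OF b\<psi> k2, folded \<Phi>_def]
  have \<Phi>b: "0 \<le> \<Phi> n s" "\<Phi> n s \<le> E n" for n s
    using monoD[OF inc(1)[of n], of "min s 0" s] inc(2)[of "min s 0" n]
      monoD[OF inc(1)[of n], of s "max s (L n)"] inc(3)[of n "max s (L n)"] kE[of n] by auto
  have eq: "\<bar>\<psi> n t - \<psi> n s\<bar> \<le> sqrt (\<bar>t - s\<bar> * K)" for n s t
  proof (rule real_le_rsqrt)
    have "(\<psi> n t - \<psi> n s)\<^sup>2 \<le> \<bar>t - s\<bar> * \<bar>\<Phi> n t - \<Phi> n s\<bar>"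
      using inc(4)[of s t n] inc(4)[of t s n] monoD[OF inc(1)[of n], of s t] monoD[OF inc(1)[of n], of t s]
      by (cases "s \<le> t") (auto simp: power2_commute)
    also have "\<dots> \<le> \<bar>t - s\<bar> * K"
      using \<Phi>b[of n s] \<Phi>b[of n t] K[of n] by (intro mult_left_mono) auto
    finally show "\<bar>\<psi> n t - \<psi> n s\<bar>\<^sup>2 \<le> \<bar>t - s\<bar> * K" by simp
  qed
  have C0: "0 \<le> C" using LC[of 0] bend_facts(4)[OF b[of 0]] by linarith
  have M: "norm (\<psi> n s) \<le> pi + sqrt (C * K)" if "s \<in> {0..C}" for n s
  proof -
    have "sqrt (\<bar>s - 0\<bar> * K) \<le> sqrt (C * K)" using that K0 by (intro real_sqrt_le_mono mult_right_mono) auto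
    moreover have "\<bar>\<psi> n 0\<bar> \<le> pi" using j[of n] by (simp add: \<psi>_def)
    ultimately show ?thesis using eq[of n s 0] unfolding real_norm_def by linarith
  qed
  have equi: "\<exists>d>0. \<forall>n t. t \<in> {0..C} \<and> norm (s - t) < d \<longrightarrow> norm (\<psi> n s - \<psi> n t) < \<epsilon>" if "\<epsilon> > 0" for s \<epsilon>
  proof (intro exI[of _ "\<epsilon>\<^sup>2 / (K + 1)"] conjI allI impI)
    show "0 < \<epsilon>\<^sup>2 / (K + 1)" using that K0 by simp
    fix n t assume t: "t \<in> {0..C} \<and> norm (s - t) < \<epsilon>\<^sup>2 / (K + 1)"
    have "\<bar>\<psi> n s - \<psi> n t\<bar> \<le> sqrt (\<bar>s - t\<bar> * K)" by (rule eq)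
    also have "\<dots> \<le> sqrt (\<bar>s - t\<bar> * (K + 1))" by (intro real_sqrt_le_mono mult_left_mono) auto
    also have "\<dots> < sqrt (\<epsilon>\<^sup>2)"
      using t K0 by (intro real_sqrt_less_mono) (simp add: pos_less_divide_eq)
    finally show "norm (\<psi> n s - \<psi> n t) < \<epsilon>" using that by simp
  qed
  obtain g r1 where g: "continuous_on {0..C} g" "strict_mono (r1 :: nat \<Rightarrow> nat)"
    "\<And>\<epsilon>. 0 < \<epsilon> \<Longrightarrow> \<exists>N. \<forall>n x. n \<ge> N \<and> x \<in> {0..C} \<longrightarrow> norm (\<psi> (r1 n) x - g x) < \<epsilon>"
    by (rule Arzela_Ascoli[of "{0..C}" \<psi> "pi + sqrt (C * K)"]) (use M equi in auto)
  have cpt: "seq_compact ({-1,1::real} \<times> {0..C} \<times> {0..C})"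
    by (intro compact_imp_seq_compact compact_Times) auto
  have "\<forall>n. (\<sigma> (r1 n), L (r1 n), c (r1 n)) \<in> {-1,1} \<times> {0..C} \<times> {0..C}"
    using LC bend_facts(1-4)[OF b] order_trans[OF bend_facts(3)[OF b] LC] by auto
  then obtain lim r2 where lim: "lim \<in> {-1,1} \<times> {0..C} \<times> {0..C}" and r2: "strict_mono (r2::nat\<Rightarrow>nat)"
    and "((\<lambda>n. (\<sigma> (r1 n), L (r1 n), c (r1 n))) \<circ> r2) \<longlonglongrightarrow> lim"
    using cpt unfolding seq_compact_def by meson
  moreover obtain \<sigma>' L' c' where lim_eq: "lim = (\<sigma>', L', c')" using prod_cases3 by blast
  ultimately have t: "((\<lambda>n. (\<sigma> (r1 n), L (r1 n), c (r1 n))) \<circ> r2) \<longlonglongrightarrow> (\<sigma>', L', c')" by simp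
  define r where "r = (\<lambda>n. r1 (r2 n))"
  have r: "strict_mono r" using g(2) r2 by (simp add: r_def strict_mono_def)
  have \<sigma>': "\<sigma>' = 1 \<or> \<sigma>' = -1" and L': "0 \<le> L'" "L' \<le> C" using lim lim_eq by auto
  have \<sigma>lim: "(\<lambda>n. \<sigma> (r n)) \<longlonglongrightarrow> \<sigma>'" using tendsto_fst[OF t] by (simp add: o_def r_def)
  have Llim: "(\<lambda>n. L (r n)) \<longlonglongrightarrow> L'" using tendsto_fst[OF tendsto_snd[OF t]] by (simp add: o_def r_def)
  have clim: "(\<lambda>n. c (r n)) \<longlonglongrightarrow> c'" using tendsto_snd[OF tendsto_snd[OF t]] by (simp add: o_def r_def)
  have c': "0 \<le> c'" "c' \<le> L'"
    using bend_facts(2,3)[OF b] LIMSEQ_le_const[OF clim] LIMSEQ_le[OF clim Llim] by auto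
  define \<theta>' where "\<theta>' = (\<lambda>s. g (max 0 (min s C)))"
  have pw: "(\<lambda>n. \<psi> (r n) s) \<longlonglongrightarrow> \<theta>' s" for s
  proof -
    have "(\<lambda>n. \<psi> (r1 n) (max 0 (min s C))) \<longlonglongrightarrow> \<theta>' s"
      unfolding \<theta>'_def LIMSEQ_iff using g(3) C0 by (meson atLeastAtMost_iff max.bounded_iff max.cobounded1 min.cobounded2)
    hence "((\<lambda>n. \<psi> (r1 n) (max 0 (min s C))) \<circ> r2) \<longlonglongrightarrow> \<theta>' s" by (rule LIMSEQ_subseq_LIMSEQ[OF _ r2])
    moreover have "\<psi> n (max 0 (min s C)) = \<psi> n s" for n
      using bend_const[OF b\<psi>[of n], of s] bend_const(2)[OF b\<psi>[of n], of C] LC[of n] C0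
      by (cases "s \<le> 0"; cases "s \<le> C") auto
    ultimately show ?thesis by (simp add: o_def r_def)
  qed
  \<comment> \<open>The Hoelder bound is uniform in n, so the evaluation point may move with n. This
    is needed at the varying times L n and c n.\<close>
  have pws: "(\<lambda>n. \<psi> (r n) (s n)) \<longlonglongrightarrow> \<theta>' t" if "s \<longlonglongrightarrow> t" for s t
  proof -
    have "(\<lambda>n. sqrt (\<bar>s n - t\<bar> * K)) \<longlonglongrightarrow> sqrt (\<bar>t - t\<bar> * K)" by (intro tendsto_intros that)
    hence "(\<lambda>n. sqrt (\<bar>s n - t\<bar> * K)) \<longlonglongrightarrow> 0" by simp
    hence "(\<lambda>n. \<psi> (r n) (s n) - \<psi> (r n) t) \<longlonglongrightarrow> 0"
      by (rule Lim_null_comparison[rotated]) (auto intro!: always_eventually eq)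
    from tendsto_add[OF this pw[of t]] show ?thesis by simp
  qed
  have cont: "continuous_on UNIV \<theta>'" unfolding \<theta>'_def
    using C0 by (intro continuous_on_compose2[OF g(1)] continuous_intros) auto
  have [measurable]: "\<theta>' \<in> borel_measurable borel" using cont by (rule borel_measurable_continuous_onI)
  have Er: "(\<lambda>n. E (r n)) \<longlonglongrightarrow> e" using LIMSEQ_subseq_LIMSEQ[OF E r] by (simp add: o_def)
  have e0: "0 \<le> e"
  proof (rule LIMSEQ_le_const[OF E], intro exI allI impI)
    fix n show "0 \<le> E n" using \<Phi>b[of n 0] by linarith
  qed
  obtain k' where k': "bend \<sigma>' L' c' \<theta>' k'"
  proof (rule bend_exists[OF \<sigma>' c' cont])
    show "\<theta>' s = \<theta>' 0" if "s \<le> 0" for s using that C0 by (simp add: \<theta>'_def)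
    show "\<theta>' s = \<theta>' L'" if "L' \<le> s" for s
    proof (cases "L' = s")
      case False
      have "eventually (\<lambda>n. L (r n) < s) sequentially"
        using order_tendstoD(2)[OF Llim] False that by auto
      hence ev: "eventually (\<lambda>n. \<psi> (r n) (L (r n)) = \<psi> (r n) s) sequentially"
        by eventually_elim (rule bend_const(2)[OF b\<psi>, symmetric], simp)
      show ?thesis
        using LIMSEQ_unique[OF pw[of s] Lim_transform_eventually[OF pws[OF Llim] ev]] .
    qed simp
    show "\<sigma>' * \<theta>' s \<le> \<sigma>' * \<theta>' t" if "0 \<le> s" "s \<le> t" "t \<le> c'" for s t
    proof -
      \<comment> \<open>A point x \<le> c' need not lie before c (r n), so it is clamped first; the
        clamped points converge to x.\<close>
      have m: "(\<lambda>n. \<sigma> (r n) * \<psi> (r n) (min x (c (r n)))) \<longlonglongrightarrow> \<sigma>' * \<theta>' x" if "x \<le> c'" for x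
      proof -
        have "(\<lambda>n. min x (c (r n))) \<longlonglongrightarrow> min x c'" by (intro tendsto_intros clim)
        thus ?thesis using that by (intro tendsto_mult \<sigma>lim pws) simp
      qed
      show ?thesis
        by (rule LIMSEQ_le[OF m m]) (use that in \<open>auto intro!: bend_mono(1)[OF b\<psi>] exI[of _ 0]\<close>)
    qed
    show "\<sigma>' * \<theta>' t \<le> \<sigma>' * \<theta>' s" if "c' \<le> s" "s \<le> t" "t \<le> L'" for s t
    proof -
      have m: "(\<lambda>n. \<sigma> (r n) * \<psi> (r n) (max x (c (r n)))) \<longlonglongrightarrow> \<sigma>' * \<theta>' x" if "c' \<le> x" for x
      proof -
        have "(\<lambda>n. max x (c (r n))) \<longlonglongrightarrow> max x c'" by (intro tendsto_intros clim)
        thus ?thesis using that by (intro tendsto_mult \<sigma>lim pws) simp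
      qed
      show ?thesis
        by (rule LIMSEQ_le[OF m m]) (use that in \<open>auto intro!: bend_mono(2)[OF b\<psi>] exI[of _ 0]\<close>)
    qed
    show "absolutely_continuous_on_interval 0 L' \<theta>'"
    \<comment> \<open>For a fixed division both sides of the squared estimate converge, so no limit
      of the accumulated energies \<open>\<Phi> n\<close> is needed.\<close>
    proof (rule absolutely_continuous_if_sum_square_le[OF e0])
      fix D :: "real set set" assume D: "D division_of \<Union>D" "\<Union>D \<subseteq> {0..L'}"
      have "(\<lambda>n. (\<Sum>K\<in>D. norm (\<psi> (r n) (Sup K) - \<psi> (r n) (Inf K)))\<^sup>2) \<longlonglongrightarrow>
          (\<Sum>K\<in>D. norm (\<theta>' (Sup K) - \<theta>' (Inf K)))\<^sup>2"
        by (intro tendsto_intros pw)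
      moreover have "(\<lambda>n. (\<Sum>K\<in>D. Sup K - Inf K) * E (r n)) \<longlonglongrightarrow> (\<Sum>K\<in>D. Sup K - Inf K) * e"
        by (intro tendsto_intros Er)
      moreover have "(\<Sum>K\<in>D. norm (\<psi> n (Sup K) - \<psi> n (Inf K)))\<^sup>2 \<le> (\<Sum>K\<in>D. Sup K - Inf K) * E n" for n
      proof -
        have "(\<Sum>K\<in>D. norm (\<psi> n (Sup K) - \<psi> n (Inf K)))\<^sup>2 \<le> (\<Sum>K\<in>D. Sup K - Inf K) * (\<Phi> n L' - \<Phi> n 0)"
          by (rule sum_increments_square_le[OF L'(1) _ _ D])
             (use inc(1,4) in \<open>auto intro: mono_imp_mono_on\<close>)
        also have "\<dots> \<le> (\<Sum>K\<in>D. Sup K - Inf K) * E n"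
        proof (rule mult_left_mono)
          show "\<Phi> n L' - \<Phi> n 0 \<le> E n" using \<Phi>b[of n L'] \<Phi>b[of n 0] by linarith
          show "0 \<le> (\<Sum>K\<in>D. Sup K - Inf K)"
          proof (rule sum_nonneg)
            fix K assume KD: "K \<in> D"
            obtain l u where "K = {l..u}" "l \<le> u" "0 \<le> l" "u \<le> L'" by (rule division_interval_cases[OF D KD])
            thus "0 \<le> Sup K - Inf K" by simp
          qed
        qed
        finally show ?thesis .
      qed
      ultimately show "(\<Sum>K\<in>D. norm (\<theta>' (Sup K) - \<theta>' (Inf K)))\<^sup>2 \<le> (\<Sum>K\<in>D. Sup K - Inf K) * e"
        by (blast intro: LIMSEQ_le)
    qed
    show "\<bar>\<theta>' c' - \<theta>' 0\<bar> \<le> pi"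
    proof (rule LIMSEQ_le_const2)
      show "(\<lambda>n. \<bar>\<psi> (r n) (c (r n)) - \<psi> (r n) 0\<bar>) \<longlonglongrightarrow> \<bar>\<theta>' c' - \<theta>' 0\<bar>"
        by (intro tendsto_intros pws clim pw)
    qed (use bend_facts(11)[OF b\<psi>] in auto)
    show "\<bar>\<theta>' L' - \<theta>' c'\<bar> \<le> pi"
    proof (rule LIMSEQ_le_const2)
      show "(\<lambda>n. \<bar>\<psi> (r n) (L (r n)) - \<psi> (r n) (c (r n))\<bar>) \<longlonglongrightarrow> \<bar>\<theta>' L' - \<theta>' c'\<bar>"
        by (intro tendsto_intros pws clim Llim)
    qed (use bend_facts(12)[OF b\<psi>] in auto)
  qed
  have [measurable]: "k' \<in> borel_measurable borel" using bend_facts(6)[OF k'] .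
  have [measurable]: "\<psi> n \<in> borel_measurable borel" for n by (rule bend_continuous[OF b\<psi>])
  \<comment> \<open>Fatou's lemma is used twice: for a fixed step as the curves converge, then as
    the step tends to 0.\<close>
  have nn: "(\<integral>\<^sup>+s. ennreal ((k' s)\<^sup>2) \<partial>lborel) \<le> ennreal e"
  proof (rule nn_integral_derivative_square_le[OF bend_AE_derivative[OF k']])
    fix i
    let ?h = "1 / real (Suc i)"
    have "(\<integral>\<^sup>+s. ennreal (((\<theta>' (s + ?h) - \<theta>' s) * real (Suc i))\<^sup>2) \<partial>lborel)
        = (\<integral>\<^sup>+s. liminf (\<lambda>n. ennreal (((\<psi> (r n) (s + ?h) - \<psi> (r n) s) / ?h)\<^sup>2)) \<partial>lborel)"
    proof (rule nn_integral_cong)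
      fix s
      have "(\<lambda>n. ennreal (((\<psi> (r n) (s + ?h) - \<psi> (r n) s) / ?h)\<^sup>2)) \<longlonglongrightarrow> ennreal (((\<theta>' (s + ?h) - \<theta>' s) / ?h)\<^sup>2)"
        by (intro tendsto_ennrealI tendsto_intros pw) simp
      from lim_imp_Liminf[OF sequentially_bot this]
      show "ennreal (((\<theta>' (s + ?h) - \<theta>' s) * real (Suc i))\<^sup>2)
        = liminf (\<lambda>n. ennreal (((\<psi> (r n) (s + ?h) - \<psi> (r n) s) / ?h)\<^sup>2))" by simp
    qed
    also have "\<dots> \<le> liminf (\<lambda>n. \<integral>\<^sup>+s. ennreal (((\<psi> (r n) (s + ?h) - \<psi> (r n) s) / ?h)\<^sup>2) \<partial>lborel)"
      by (rule nn_integral_liminf) measurable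
    also have "\<dots> \<le> liminf (\<lambda>n. ennreal (E (r n)))"
    proof (rule Liminf_mono, rule always_eventually, rule allI)
      fix n
      let ?n = "r n"
      have "(\<integral>\<^sup>+s. ennreal (((\<psi> ?n (s + ?h) - \<psi> ?n s) / ?h)\<^sup>2) \<partial>lborel) \<le> ennreal (\<Phi> ?n (L ?n) - \<Phi> ?n 0)"
        by (rule nn_integral_difference_quotient_square_le[OF bend_facts(4)[OF b] _ inc(1) _ _ inc(4)])
           (use inc(2)[of _ ?n] inc(3)[of ?n] in auto)
      also have "\<dots> \<le> ennreal (E ?n)"
        using \<Phi>b[of ?n "L ?n"] \<Phi>b[of ?n 0] by (intro ennreal_leI) linarith
      finally show "(\<integral>\<^sup>+s. ennreal (((\<psi> ?n (s + ?h) - \<psi> ?n s) / ?h)\<^sup>2) \<partial>lborel) \<le> ennreal (E ?n)" .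
    qed
    also have "liminf (\<lambda>n. ennreal (E (r n))) = ennreal e"
      by (rule lim_imp_Liminf[OF sequentially_bot tendsto_ennrealI[OF Er]])
    finally show "(\<integral>\<^sup>+s. ennreal (((\<theta>' (s + ?h) - \<theta>' s) * real (Suc i))\<^sup>2) \<partial>lborel) \<le> ennreal e" .
  qed simp
  hence i: "integrable lborel (\<lambda>u. (k' u)\<^sup>2)"
    by (intro integrableI_nonneg) (auto simp: less_top[symmetric] top_unique)
  have "ennreal (LINT u|lborel. (k' u)\<^sup>2) \<le> ennreal e" using nn nn_integral_eq_integral[OF i] by simp
  hence ke: "(LINT u|lborel. (k' u)\<^sup>2) \<le> e" using e0 by simp
  \<comment> \<open>Dominated convergence; the indicators of [0, L n] converge at every point except
    possibly L'.\<close>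
  have "(\<lambda>n. chord (L (r n)) (\<psi> (r n))) \<longlonglongrightarrow> chord L' \<theta>'"
    unfolding chord_def set_lebesgue_integral_def
  proof (rule integral_dominated_convergence[where w="indicat_real {0..C}"])
    show "(\<lambda>s. indicat_real {0..L'} s *\<^sub>R cis (\<theta>' s)) \<in> borel_measurable lborel" by measurable
    show "(\<lambda>s. indicat_real {0..L (r n)} s *\<^sub>R cis (\<psi> (r n) s)) \<in> borel_measurable lborel" for n by measurable
    show "integrable lborel (indicat_real {0..C})" by (rule integrable_real_indicator) (use C0 in auto)
    show "AE s in lborel. (\<lambda>n. indicat_real {0..L (r n)} s *\<^sub>R cis (\<psi> (r n) s))
           \<longlonglongrightarrow> indicat_real {0..L'} s *\<^sub>R cis (\<theta>' s)"
      using AE_lborel_singleton[of L']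
    proof eventually_elim
      case (elim s)
      have "eventually (\<lambda>n. indicat_real {0..L (r n)} s = indicat_real {0..L'} s) sequentially"
      proof (cases "s < L'")
        case True
        show ?thesis using order_tendstoD(1)[OF Llim True] by eventually_elim (use True in \<open>auto simp: indicator_def\<close>)
      next
        case False
        hence "L' < s" using elim by simp
        show ?thesis using order_tendstoD(2)[OF Llim \<open>L' < s\<close>]
          by eventually_elim (use \<open>L' < s\<close> in \<open>auto simp: indicator_def\<close>)
      qed
      hence "(\<lambda>n. indicat_real {0..L (r n)} s) \<longlonglongrightarrow> indicat_real {0..L'} s" by (rule tendsto_eventually)
      thus ?case by (intro tendsto_scaleR tendsto_cis pw)
    qed
    show "AE s in lborel. norm (indicat_real {0..L (r n)} s *\<^sub>R cis (\<psi> (r n) s)) \<le> indicat_real {0..C} s" for n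
      using LC[of "r n"] by (auto simp: indicator_def)
  qed
  hence ch: "chord L' \<theta>' = z" unfolding ch\<psi> by (simp add: LIMSEQ_const_iff)
  have "(\<lambda>n. cis (\<psi> (r n) 0)) \<longlonglongrightarrow> cis (\<theta>' 0)" by (intro tendsto_cis pw)
  moreover have "(\<lambda>n. cis (\<psi> (r n) 0)) \<longlonglongrightarrow> d" unfolding cis\<psi> using LIMSEQ_subseq_LIMSEQ[OF d r] by (simp add: o_def)
  ultimately have d0: "cis (\<theta>' 0) = d" by (rule LIMSEQ_unique)
  have "(\<lambda>n. cis (\<psi> (r n) (L (r n)))) \<longlonglongrightarrow> cis (\<theta>' L')" by (intro tendsto_cis pws Llim)
  moreover have "(\<lambda>n. cis (\<psi> (r n) (L (r n)))) \<longlonglongrightarrow> d'"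
    unfolding cis\<psi> using LIMSEQ_subseq_LIMSEQ[OF d' r] by (simp add: o_def)
  ultimately have d1: "cis (\<theta>' L') = d'" by (rule LIMSEQ_unique)
  show ?thesis by (rule that[OF k' i ke ch d0 d1])
qed

section \<open>Shortening\<close>

lemma primitive_cong_AE:
  assumes "k \<in> borel_measurable borel" "k' \<in> borel_measurable borel" "AE u in lborel. k u = k' u"
  shows "primitive k s = primitive k' s"
  unfolding primitive_def set_lebesgue_integral_def
  by (rule integral_cong_AE) (use assms in \<open>auto elim!: eventually_mono\<close>)

lemma bend_range:
  assumes "bend \<sigma> L c \<theta> k"
  shows "\<sigma> * \<theta> s \<le> \<sigma> * \<theta> c" "min (\<sigma> * \<theta> 0) (\<sigma> * \<theta> L) \<le> \<sigma> * \<theta> s"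
proof -
  note f = bend_facts[OF assms]
  show "\<sigma> * \<theta> s \<le> \<sigma> * \<theta> c"
    using bend_mono(1)[OF assms, of s c] bend_mono(2)[OF assms, of c s] by (cases "s \<le> c") auto
  show "min (\<sigma> * \<theta> 0) (\<sigma> * \<theta> L) \<le> \<sigma> * \<theta> s"
  proof (cases "s \<le> c")
    case True
    have "\<sigma> * \<theta> 0 \<le> \<sigma> * \<theta> s"
      using bend_mono(1)[OF assms, of 0 s] bend_const(1)[OF assms, of s] True by (cases "s \<le> 0") auto
    thus ?thesis by simp
  next
    case False
    have "\<sigma> * \<theta> L \<le> \<sigma> * \<theta> s"
      using bend_mono(2)[OF assms, of s L] bend_const(2)[OF assms, of s] False by (cases "s \<le> L") auto
    thus ?thesis by simp
  qed
qed

text \<open>Where the angle touches a global bound its derivative, if it exists, is 0, so k vanishes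
  there almost everywhere and may be redefined to vanish everywhere there. Quotients such as |k| /
  sqrt (sin \<phi>) then read 0 / 0 = 0 where the sine vanishes.\<close>

lemma bend_density_vanishes_at_extremes:
  assumes b: "bend \<sigma> L c \<theta> k" and lo: "\<And>s. lo \<le> \<theta> s" and hi: "\<And>s. \<theta> s \<le> hi"
  obtains k' where "bend \<sigma> L c \<theta> k'" "AE s in lborel. k' s = k s" "\<And>s. \<theta> s = lo \<or> \<theta> s = hi \<Longrightarrow> k' s = 0"
proof -
  note f = bend_facts[OF b]
  have [measurable]: "\<theta> \<in> borel_measurable borel" by (rule bend_continuous[OF b])
  have [measurable]: "k \<in> borel_measurable borel" by (rule f(6))
  define k' where "k' = (\<lambda>s. if \<theta> s = lo \<or> \<theta> s = hi then 0 else k s)"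
  have [measurable]: "k' \<in> borel_measurable borel" unfolding k'_def by measurable
  have ae: "AE s in lborel. k' s = k s"
    using bend_AE_derivative[OF b]
  proof eventually_elim
    case (elim s)
    have "k s = 0" if "\<theta> s = lo"
      by (rule DERIV_local_min[OF elim zero_less_one]) (use lo that in auto)
    moreover have "k s = 0" if "\<theta> s = hi"
      by (rule DERIV_local_max[OF elim zero_less_one]) (use hi that in auto)
    ultimately show ?case by (auto simp: k'_def)
  qed
  have "bend \<sigma> L c \<theta> k'" unfolding bend_def
  proof (intro conjI allI impI f(1-3,11,12))
    show "integrable lborel k'"
      by (rule Bochner_Integration.integrable_bound[OF f(5)]) (auto simp: k'_def)
    show "\<theta> s = \<theta> 0 + primitive k' s" for s
      using f(10)[of s] primitive_cong_AE[OF _ _ ae] by simp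
  qed (use f(7-9) in \<open>auto simp: k'_def\<close>)
  thus ?thesis using ae by (rule that) (auto simp: k'_def)
qed

text \<open>On a monotone stretch the integrand is, up to sign, the derivative of 2 sqrt (\<psi> +
  \<epsilon>), whose total change is bounded by the turning alone, whatever the length. The
  \<epsilon> keeps the root differentiable where \<psi> vanishes.\<close>

lemma nn_integral_div_sqrt_le:
  fixes \<theta> :: "real \<Rightarrow> real"
  assumes d: "AE s in lborel. (\<theta> has_real_derivative k s) (at s)" and "a \<le> b" and "\<epsilon> > 0"
    and \<tau>: "\<tau> = 1 \<or> \<tau> = (-1::real)" and \<rho>: "\<rho> = 1 \<or> \<rho> = (-1::real)"
    and \<psi>: "\<And>s. \<psi> s = \<tau> * (\<theta> s - m)" "\<And>s. 0 \<le> \<psi> s" "\<And>s. \<psi> s \<le> pi"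
    and mono: "\<And>s t. a \<le> s \<Longrightarrow> s \<le> t \<Longrightarrow> t \<le> b \<Longrightarrow> \<rho> * \<psi> s \<le> \<rho> * \<psi> t"
    and sgn: "\<And>s. a < s \<Longrightarrow> s < b \<Longrightarrow> 0 \<le> \<rho> * \<tau> * k s"
  shows "(\<integral>\<^sup>+s. ennreal (indicator {a<..<b} s * (\<bar>k s\<bar> / sqrt (\<psi> s + \<epsilon>))) \<partial>lborel) \<le> ennreal (2 * sqrt (pi + \<epsilon>))"
proof -
  define cl where "cl = (\<lambda>s. max a (min s b))"
  define G where "G = (\<lambda>s. \<rho> * (2 * sqrt (\<psi> (cl s) + \<epsilon>)))"
  have pos: "0 < \<psi> s + \<epsilon>" for s using \<psi>(2)[of s] \<open>\<epsilon> > 0\<close> by simp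
  have G: "mono G"
  proof
    fix s t :: real assume "s \<le> t"
    hence "\<rho> * \<psi> (cl s) \<le> \<rho> * \<psi> (cl t)" using \<open>a \<le> b\<close> by (intro mono) (auto simp: cl_def)
    thus "G s \<le> G t" using \<rho> by (auto simp: G_def)
  qed
  have "(\<integral>\<^sup>+s. ennreal (indicator {a<..<b} s * (\<bar>k s\<bar> / sqrt (\<psi> s + \<epsilon>))) \<partial>lborel) \<le> ennreal (G b - G a)"
  proof (rule nn_integral_derivative_mono_le[OF \<open>a \<le> b\<close> G])
    show "G s = G a" if "s \<le> a" for s using that \<open>a \<le> b\<close> by (simp add: G_def cl_def)
    show "G s = G b" if "b \<le> s" for s using that \<open>a \<le> b\<close> by (simp add: G_def cl_def)
    show "AE s in lborel. (G has_real_derivative indicator {a<..<b} s * (\<bar>k s\<bar> / sqrt (\<psi> s + \<epsilon>))) (at s)"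
      using d AE_lborel_singleton[of a] AE_lborel_singleton[of b]
    proof eventually_elim
      case (elim s)
      consider "s < a" | "b < s" | "a < s" "s < b" using elim by linarith
      thus ?case
      proof cases
        case 1
        have "(G has_real_derivative 0) (at s)"
        proof (rule DERIV_cong_ev[THEN iffD1, OF refl _ refl])
          show "((\<lambda>_. G a) has_real_derivative 0) (at s)" by simp
          have "eventually (\<lambda>x. x \<in> {..<a}) (nhds s)" using 1 by (intro eventually_nhds_in_open) auto
          thus "eventually (\<lambda>x. G a = G x) (nhds s)"
            by eventually_elim (use \<open>a \<le> b\<close> in \<open>simp add: G_def cl_def\<close>)
        qed
        thus ?thesis using 1 by simp
      next
        case 2
        have "(G has_real_derivative 0) (at s)"
        proof (rule DERIV_cong_ev[THEN iffD1, OF refl _ refl])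
          show "((\<lambda>_. G b) has_real_derivative 0) (at s)" by simp
          have "eventually (\<lambda>x. x \<in> {b<..}) (nhds s)" using 2 by (intro eventually_nhds_in_open) auto
          thus "eventually (\<lambda>x. G b = G x) (nhds s)"
            by eventually_elim (use \<open>a \<le> b\<close> in \<open>simp add: G_def cl_def\<close>)
        qed
        thus ?thesis using 2 by simp
      next
        case 3
        have "\<psi> = (\<lambda>s. \<tau> * (\<theta> s - m))" using \<psi>(1) by blast
        hence "(\<psi> has_real_derivative \<tau> * k s) (at s)"
          using elim(1) by (auto intro!: derivative_eq_intros)
        hence "((\<lambda>s. \<rho> * (2 * sqrt (\<psi> s + \<epsilon>))) has_real_derivative \<rho> * \<tau> * k s / sqrt (\<psi> s + \<epsilon>)) (at s)"
          using pos[of s] by (auto intro!: derivative_eq_intros simp: field_simps)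
        also have "\<rho> * \<tau> * k s = \<bar>k s\<bar>" using sgn[OF 3] \<rho> \<tau> by auto
        finally have "(G has_real_derivative \<bar>k s\<bar> / sqrt (\<psi> s + \<epsilon>)) (at s)"
        proof (rule DERIV_cong_ev[THEN iffD1, OF refl _ refl, rotated])
          have "eventually (\<lambda>x. x \<in> {a<..<b}) (nhds s)" using 3 by (intro eventually_nhds_in_open) auto
          thus "eventually (\<lambda>x. \<rho> * (2 * sqrt (\<psi> x + \<epsilon>)) = G x) (nhds s)"
            by eventually_elim (simp add: G_def cl_def)
        qed
        thus ?thesis using 3 by simp
      qed
    qed
  qed
  also have "G b - G a \<le> 2 * sqrt (pi + \<epsilon>)"
  proof -
    have "sqrt (\<psi> (cl s) + \<epsilon>) \<le> sqrt (pi + \<epsilon>)" "0 \<le> sqrt (\<psi> (cl s) + \<epsilon>)" for s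
      using \<psi>(3)[of "cl s"] pos[of "cl s"] by auto
    from this[of a] this[of b] have "\<bar>2 * sqrt (\<psi> (cl b) + \<epsilon>) - 2 * sqrt (\<psi> (cl a) + \<epsilon>)\<bar> \<le> 2 * sqrt (pi + \<epsilon>)"
      by linarith
    moreover have "\<bar>\<rho>\<bar> = 1" using \<rho> by auto
    ultimately have "\<bar>G b - G a\<bar> \<le> 2 * sqrt (pi + \<epsilon>)"
      unfolding G_def right_diff_distrib[symmetric] abs_mult[of \<rho>] by simp
    thus ?thesis by simp
  qed
  finally show ?thesis by (simp add: ennreal_leI)
qed

text \<open>The two monotone stretches give twice the bound of one, and Fatou's lemma removes
  \<epsilon>. The sign \<tau> allows the angle to be measured from either end of its range.\<close>

lemma nn_integral_div_sqrt_angle_le: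
  assumes b: "bend \<sigma> L c \<theta> k" and \<tau>: "\<tau> = 1 \<or> \<tau> = (-1::real)"
    and \<psi>: "\<And>s. \<psi> s = \<tau> * (\<theta> s - m)" "\<And>s. 0 \<le> \<psi> s" "\<And>s. \<psi> s \<le> pi"
    and k0: "\<And>s. \<psi> s = 0 \<Longrightarrow> k s = 0"
  shows "(\<integral>\<^sup>+s. ennreal (\<bar>k s\<bar> / sqrt (\<psi> s)) \<partial>lborel) \<le> ennreal (4 * sqrt pi)"
proof -
  note f = bend_facts[OF b]
  have [measurable]: "\<theta> \<in> borel_measurable borel" by (rule bend_continuous[OF b])
  have [measurable]: "k \<in> borel_measurable borel" by (rule f(6))
  have [measurable]: "\<psi> \<in> borel_measurable borel" unfolding \<psi>(1)[abs_def] by measurable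
  have st: "\<sigma> * \<tau> = 1 \<or> \<sigma> * \<tau> = -1" "- \<sigma> * \<tau> = 1 \<or> - \<sigma> * \<tau> = -1" "\<sigma> * \<tau> * \<tau> = \<sigma>"
    using f(1) \<tau> by auto
  have ee: "\<sigma> * \<tau> * \<psi> s = \<sigma> * \<theta> s - \<sigma> * m" for s
    unfolding \<psi>(1) using \<tau> by (auto simp: algebra_simps)
  have le: "(\<integral>\<^sup>+s. ennreal (\<bar>k s\<bar> / sqrt (\<psi> s + \<epsilon>)) \<partial>lborel) \<le> ennreal (4 * sqrt (pi + \<epsilon>))" if "\<epsilon> > 0" for \<epsilon>
  proof -
    have "(\<integral>\<^sup>+s. ennreal (\<bar>k s\<bar> / sqrt (\<psi> s + \<epsilon>)) \<partial>lborel)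
       \<le> (\<integral>\<^sup>+s. ennreal (indicator {0<..<c} s * (\<bar>k s\<bar> / sqrt (\<psi> s + \<epsilon>)))
            + ennreal (indicator {c<..<L} s * (\<bar>k s\<bar> / sqrt (\<psi> s + \<epsilon>))) \<partial>lborel)"
    proof (rule nn_integral_mono_AE)
      show "AE s in lborel. ennreal (\<bar>k s\<bar> / sqrt (\<psi> s + \<epsilon>)) \<le> ennreal (indicator {0<..<c} s * (\<bar>k s\<bar> / sqrt (\<psi> s + \<epsilon>)))
            + ennreal (indicator {c<..<L} s * (\<bar>k s\<bar> / sqrt (\<psi> s + \<epsilon>)))"
        using AE_lborel_singleton[of c]
      proof eventually_elim
        case (elim s)
        show ?case using elim f(7)[of s] by (cases "s \<in> {0<..<L}"; cases "s < c") (auto simp: indicator_def)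
      qed
    qed
    also have "\<dots> = (\<integral>\<^sup>+s. ennreal (indicator {0<..<c} s * (\<bar>k s\<bar> / sqrt (\<psi> s + \<epsilon>))) \<partial>lborel)
            + (\<integral>\<^sup>+s. ennreal (indicator {c<..<L} s * (\<bar>k s\<bar> / sqrt (\<psi> s + \<epsilon>))) \<partial>lborel)"
      by (rule nn_integral_add) measurable
    also have "\<dots> \<le> ennreal (2 * sqrt (pi + \<epsilon>)) + ennreal (2 * sqrt (pi + \<epsilon>))"
    proof (rule add_mono)
      show "(\<integral>\<^sup>+s. ennreal (indicator {0<..<c} s * (\<bar>k s\<bar> / sqrt (\<psi> s + \<epsilon>))) \<partial>lborel) \<le> ennreal (2 * sqrt (pi + \<epsilon>))"
      proof (rule nn_integral_div_sqrt_le[OF bend_AE_derivative[OF b] f(2) that \<tau> st(1) \<psi>])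
        show "\<sigma> * \<tau> * \<psi> s \<le> \<sigma> * \<tau> * \<psi> t" if "0 \<le> s" "s \<le> t" "t \<le> c" for s t
          unfolding ee using bend_mono(1)[OF b that(2,3)] by simp
        show "0 \<le> \<sigma> * \<tau> * \<tau> * k s" if "0 < s" "s < c" for s unfolding st(3) using f(8)[of s] that by simp
      qed
      show "(\<integral>\<^sup>+s. ennreal (indicator {c<..<L} s * (\<bar>k s\<bar> / sqrt (\<psi> s + \<epsilon>))) \<partial>lborel) \<le> ennreal (2 * sqrt (pi + \<epsilon>))"
      proof (rule nn_integral_div_sqrt_le[OF bend_AE_derivative[OF b] f(3) that \<tau> st(2) \<psi>])
        show "- \<sigma> * \<tau> * \<psi> s \<le> - \<sigma> * \<tau> * \<psi> t" if "c \<le> s" "s \<le> t" "t \<le> L" for s t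
          using ee[of s] ee[of t] bend_mono(2)[OF b that(2,1)] by simp
        show "0 \<le> - \<sigma> * \<tau> * \<tau> * k s" if "c < s" "s < L" for s using f(9)[of s] that \<tau> by auto
      qed
    qed
    also have "\<dots> = ennreal (4 * sqrt (pi + \<epsilon>))" using \<open>\<epsilon> > 0\<close> by (subst ennreal_plus[symmetric]) auto
    finally show ?thesis .
  qed
  let ?e = "\<lambda>n. 1 / real (Suc n)"
  have e0: "?e \<longlonglongrightarrow> 0" using LIMSEQ_inverse_real_of_nat by (simp add: inverse_eq_divide)
  have "(\<integral>\<^sup>+s. ennreal (\<bar>k s\<bar> / sqrt (\<psi> s)) \<partial>lborel) = (\<integral>\<^sup>+s. liminf (\<lambda>n. ennreal (\<bar>k s\<bar> / sqrt (\<psi> s + ?e n))) \<partial>lborel)"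
  proof (rule nn_integral_cong)
    fix s
    have "(\<lambda>n. \<bar>k s\<bar> / sqrt (\<psi> s + ?e n)) \<longlonglongrightarrow> \<bar>k s\<bar> / sqrt (\<psi> s)"
    proof (cases "\<psi> s = 0")
      case True thus ?thesis using k0 by simp
    next
      case False
      have "(\<lambda>n. \<bar>k s\<bar> / sqrt (\<psi> s + ?e n)) \<longlonglongrightarrow> \<bar>k s\<bar> / sqrt (\<psi> s + 0)"
        by (intro tendsto_intros e0) (use False in auto)
      thus ?thesis by simp
    qed
    from lim_imp_Liminf[OF sequentially_bot tendsto_ennrealI[OF this]]
    show "ennreal (\<bar>k s\<bar> / sqrt (\<psi> s)) = liminf (\<lambda>n. ennreal (\<bar>k s\<bar> / sqrt (\<psi> s + ?e n)))" by simp
  qed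
  also have "\<dots> \<le> liminf (\<lambda>n. \<integral>\<^sup>+s. ennreal (\<bar>k s\<bar> / sqrt (\<psi> s + ?e n)) \<partial>lborel)"
    by (rule nn_integral_liminf) measurable
  also have "\<dots> \<le> liminf (\<lambda>n. ennreal (4 * sqrt (pi + ?e n)))"
    by (intro Liminf_mono always_eventually allI le) simp
  also have "\<dots> = ennreal (4 * sqrt pi)"
  proof (rule lim_imp_Liminf[OF sequentially_bot tendsto_ennrealI])
    have "(\<lambda>n. 4 * sqrt (pi + ?e n)) \<longlonglongrightarrow> 4 * sqrt (pi + 0)" by (intro tendsto_intros e0)
    thus "(\<lambda>n. 4 * sqrt (pi + ?e n)) \<longlonglongrightarrow> 4 * sqrt pi" by simp
  qed
  finally show ?thesis .
qed

text \<open>Concavity puts the sine above its chord of slope 2/\<pi>; the slope 1/2 is a cruder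
  value that keeps later constants simple.\<close>

lemma half_le_sin:
  assumes "0 \<le> x" "x \<le> pi / 2"
  shows "x / 2 \<le> sin x"
proof -
  have "convex_on {0..pi} (\<lambda>x. - sin x)"
    by (rule f''_ge0_imp_convex[where f' = "\<lambda>x. - cos x" and f'' = sin])
       (auto intro!: derivative_eq_intros sin_ge_zero)
  hence "concave_on {0..pi} sin" by (simp add: concave_on_def)
  hence "(1 - 2 / pi * x) * sin 0 + (2 / pi * x) * sin (pi / 2)
     \<le> sin ((1 - 2 / pi * x) *\<^sub>R 0 + (2 / pi * x) *\<^sub>R (pi / 2))"
    using assms by (intro concave_onD) (auto simp: field_simps)
  hence "2 / pi * x \<le> sin x" by simp
  moreover have "1 / 2 * x \<le> 2 / pi * x"
    using assms pi_less_4 by (intro mult_right_mono) (auto simp: field_simps)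
  ultimately show ?thesis by linarith
qed

text \<open>
  Among all weights with prescribed \<open>\<integral> w sin \<psi>\<close>, the energy \<open>\<integral> k\<^sup>2 / w\<close> is smallest for \<open>w\<close>
  proportional to \<open>\<bar>k\<bar> / \<surd>(sin \<psi>)\<close> (the rectangular elastica), and this weight has bounded total mass.
\<close>

lemma elastica_weight:
  fixes k \<psi> :: "real \<Rightarrow> real"
  assumes S[measurable]: "S \<in> sets borel" "S \<subseteq> {0<..<L}" and k: "integrable lborel k" "integrable lborel (\<lambda>u. (k u)\<^sup>2)"
    and \<psi>m[measurable]: "\<psi> \<in> borel_measurable borel" and \<psi>: "\<And>u. u \<in> S \<Longrightarrow> 0 \<le> \<psi> u \<and> \<psi> u \<le> pi / 2"
    and \<psi>0: "\<And>u. 0 \<le> \<psi> u" and k0: "\<And>u. \<psi> u = 0 \<Longrightarrow> k u = 0"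
    and C: "(\<integral>\<^sup>+s. ennreal (\<bar>k s\<bar> / sqrt (\<psi> s)) \<partial>lborel) \<le> ennreal C" "0 \<le> C"
    and J: "0 < J0" "J0 \<le> (LINT u:S|lborel. \<bar>k u\<bar> * sqrt (sin (\<psi> u)))"
  obtains w where "integrable lborel w" "\<And>u. 0 \<le> w u" "\<And>u. u \<notin> S \<Longrightarrow> w u = 0"
    "\<And>u. u \<in> S \<Longrightarrow> w u = 0 \<Longrightarrow> k u = 0"
    "(LINT u:S|lborel. w u * sin (\<psi> u)) = (LINT u:S|lborel. sin (\<psi> u))"
    "(LINT u|lborel. w u) \<le> C * sqrt 2 / J0 * (LINT u:S|lborel. sin (\<psi> u))"
    "integrable lborel (\<lambda>u. (k u)\<^sup>2 / w u)"
    "(LINT u|lborel. (k u)\<^sup>2 / w u) \<le> (LINT u:S|lborel. (k u)\<^sup>2)"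
proof -
  have [measurable]: "k \<in> borel_measurable borel" using k(1) by simp
  have sin_lb: "\<psi> u / 2 \<le> sin (\<psi> u)" if "u \<in> S" for u
    using \<psi>[OF that] by (intro half_le_sin) auto
  have sin0: "0 \<le> sin (\<psi> u)" if "u \<in> S" for u using sin_lb[OF that] \<psi>[OF that] by linarith
  have sinpos: "0 < sin (\<psi> u)" if "u \<in> S" "k u \<noteq> 0" for u
    using sin_lb[OF that(1)] \<psi>[OF that(1)] k0[of u] that by fastforce
  define Y where "Y = (LINT u:S|lborel. sin (\<psi> u))"
  define j where "j = (\<lambda>u. indicator S u * (\<bar>k u\<bar> * sqrt (sin (\<psi> u))))"
  define JJ where "JJ = (LINT u|lborel. j u)"
  have jm[measurable]: "j \<in> borel_measurable borel" unfolding j_def by measurable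
  have ji: "integrable lborel j"
    by (rule Bochner_Integration.integrable_bound[OF k(1)])
       (use sin0 in \<open>auto simp: j_def indicator_def abs_mult intro!: mult_left_le\<close>)
  have J1: "J0 \<le> JJ" using J(2) by (simp add: JJ_def j_def set_lebesgue_integral_def)
  have JJ: "0 < JJ" using J1 J(1) by simp
  define y where "y = (\<lambda>u. indicator S u * sin (\<psi> u))"
  have yi: "integrable lborel y"
  proof (rule Bochner_Integration.integrable_bound)
    show "integrable lborel (indicat_real {0<..<L})" by (intro integrable_real_indicator) (cases "0 \<le> L"; simp)+
    show "y \<in> borel_measurable lborel" unfolding y_def by measurable
    show "AE u in lborel. norm (y u) \<le> norm (indicat_real {0<..<L} u)"
      using S(2) by (intro AE_I2) (auto simp: y_def indicator_def)
  qed
  have Yy: "Y = (LINT u|lborel. y u)" by (simp add: Y_def y_def set_lebesgue_integral_def)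
  have jy: "(j u)\<^sup>2 / y u = indicator S u * (k u)\<^sup>2" for u
    using sinpos[of u] sin0[of u] by (cases "k u = 0") (auto simp: j_def y_def indicator_def power_mult_distrib)
  have kS: "integrable lborel (\<lambda>u. indicator S u * (k u)\<^sup>2)"
    using integrable_mult_indicator[OF _ k(2), of S] by simp
  \<comment> \<open>The new weight will have energy JJ^2 / Y, so this inequality is the comparison
    with the old energy. Since JJ > 0, it also forces Y > 0.\<close>
  have CS: "JJ\<^sup>2 \<le> Y * (LINT u:S|lborel. (k u)\<^sup>2)"
  proof -
    have "(LINT u:UNIV|lborel. \<bar>j u\<bar>)\<^sup>2 \<le> (LINT u:UNIV|lborel. y u) * (LINT u:UNIV|lborel. (j u)\<^sup>2 / y u)"
    proof (rule set_integral_weighted_Cauchy_Schwarz[OF ji yi])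
      show "integrable lborel (\<lambda>u. (j u)\<^sup>2 / y u)" unfolding jy by (rule kS)
      show "0 \<le> y u" for u using sin0 by (auto simp: y_def indicator_def)
      show "j u = 0" if "y u = 0" for u using that by (auto simp: j_def y_def)
    qed simp
    moreover have "\<bar>j u\<bar> = j u" for u using sin0[of u] by (auto simp: j_def indicator_def)
    ultimately show ?thesis unfolding jy by (simp add: set_lebesgue_integral_def JJ_def Yy)
  qed
  have "0 < Y"
  proof (rule ccontr)
    assume "\<not> 0 < Y"
    moreover have "0 \<le> (LINT u:S|lborel. (k u)\<^sup>2)" by (simp add: set_lebesgue_integral_def)
    ultimately have "Y * (LINT u:S|lborel. (k u)\<^sup>2) \<le> 0" by (simp add: mult_nonpos_nonneg)
    thus False using CS JJ by (metis not_le order_trans zero_less_power)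
  qed
  \<comment> \<open>The factor Y / JJ normalizes the integral of \<open>w * sin \<psi>\<close> to
    Y.\<close>
  define w where "w = (\<lambda>u. indicator S u * (Y / JJ * (\<bar>k u\<bar> / sqrt (sin (\<psi> u)))))"
  have [measurable]: "w \<in> borel_measurable borel" unfolding w_def by measurable
  have w0: "0 \<le> w u" for u using sin0[of u] \<open>0 < Y\<close> JJ by (auto simp: w_def indicator_def)
  have wS: "u \<in> S \<Longrightarrow> w u = 0 \<Longrightarrow> k u = 0" for u using sinpos[of u] \<open>0 < Y\<close> JJ by (cases "k u = 0") (auto simp: w_def)
  \<comment> \<open>By sin \<psi> \<ge> \<psi> / 2 the sine may be replaced by its argument at the
    price of sqrt 2; what results has integral at most a multiple of C.\<close>
  have w_le: "w u \<le> Y / JJ * sqrt 2 * (\<bar>k u\<bar> / sqrt (\<psi> u))" for u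
  proof (cases "u \<in> S \<and> k u \<noteq> 0")
    case True
    hence p: "0 < \<psi> u" using \<psi>[of u] k0[of u] by force
    have "sqrt (\<psi> u) / sqrt 2 \<le> sqrt (sin (\<psi> u))"
      using sin_lb[of u] True by (simp add: real_sqrt_divide[symmetric])
    hence "1 / sqrt (sin (\<psi> u)) \<le> 1 / (sqrt (\<psi> u) / sqrt 2)"
      using p sinpos[of u] True by (intro divide_left_mono) (auto intro!: mult_pos_pos divide_pos_pos)
    hence "\<bar>k u\<bar> * (1 / sqrt (sin (\<psi> u))) \<le> \<bar>k u\<bar> * (1 / (sqrt (\<psi> u) / sqrt 2))" by (rule mult_left_mono) simp
    hence "\<bar>k u\<bar> / sqrt (sin (\<psi> u)) \<le> sqrt 2 * (\<bar>k u\<bar> / sqrt (\<psi> u))" by (simp add: mult.commute)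
    hence "Y / JJ * (\<bar>k u\<bar> / sqrt (sin (\<psi> u))) \<le> Y / JJ * (sqrt 2 * (\<bar>k u\<bar> / sqrt (\<psi> u)))"
      using \<open>0 < Y\<close> JJ by (intro mult_left_mono) auto
    thus ?thesis using True by (simp add: w_def mult.assoc)
  next
    case False
    have "0 \<le> Y / JJ * sqrt 2 * (\<bar>k u\<bar> / sqrt (\<psi> u))"
      using \<psi>0[of u] \<open>0 < Y\<close> JJ by (intro mult_nonneg_nonneg divide_nonneg_nonneg) auto
    moreover have "w u = 0" using False by (auto simp: w_def)
    ultimately show ?thesis by simp
  qed
  have nnw: "(\<integral>\<^sup>+u. ennreal (w u) \<partial>lborel) \<le> ennreal (Y / JJ * sqrt 2 * C)"
  proof -
    have "(\<integral>\<^sup>+u. ennreal (w u) \<partial>lborel) \<le> (\<integral>\<^sup>+u. ennreal (Y / JJ * sqrt 2) * ennreal (\<bar>k u\<bar> / sqrt (\<psi> u)) \<partial>lborel)"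
    proof (rule nn_integral_mono)
      fix u
      have "ennreal (w u) \<le> ennreal (Y / JJ * sqrt 2 * (\<bar>k u\<bar> / sqrt (\<psi> u)))" by (rule ennreal_leI[OF w_le])
      also have "\<dots> = ennreal (Y / JJ * sqrt 2) * ennreal (\<bar>k u\<bar> / sqrt (\<psi> u))"
        using \<open>0 < Y\<close> JJ by (intro ennreal_mult') auto
      finally show "ennreal (w u) \<le> ennreal (Y / JJ * sqrt 2) * ennreal (\<bar>k u\<bar> / sqrt (\<psi> u))" .
    qed
    also have "\<dots> = ennreal (Y / JJ * sqrt 2) * (\<integral>\<^sup>+u. ennreal (\<bar>k u\<bar> / sqrt (\<psi> u)) \<partial>lborel)"
      by (rule nn_integral_cmult) measurable
    also have "\<dots> \<le> ennreal (Y / JJ * sqrt 2) * ennreal C" by (rule mult_left_mono[OF C(1)]) simp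
    also have "\<dots> = ennreal (Y / JJ * sqrt 2 * C)" using \<open>0 < Y\<close> JJ by (intro ennreal_mult'[symmetric]) auto
    finally show ?thesis .
  qed
  have wi: "integrable lborel w"
    by (rule integrableI_nonneg) (use nnw w0 in \<open>auto simp: less_top[symmetric] top_unique\<close>)
  have "ennreal (LINT u|lborel. w u) \<le> ennreal (Y / JJ * sqrt 2 * C)"
    using nnw nn_integral_eq_integral[OF wi] w0 by simp
  hence "(LINT u|lborel. w u) \<le> Y / JJ * sqrt 2 * C" using \<open>0 < Y\<close> JJ C(2) by simp
  also have "\<dots> = C * sqrt 2 * Y * (1 / JJ)" by simp
  also have "\<dots> \<le> C * sqrt 2 * Y * (1 / J0)"
    using \<open>0 < Y\<close> J1 J(1) C(2) by (intro mult_left_mono divide_left_mono) auto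
  finally have wb: "(LINT u|lborel. w u) \<le> C * sqrt 2 / J0 * Y" by simp
  have ws: "indicator S u * (w u * sin (\<psi> u)) = Y / JJ * j u" for u
  proof (cases "u \<in> S")
    case True
    have "\<bar>k u\<bar> / sqrt (sin (\<psi> u)) * sin (\<psi> u) = \<bar>k u\<bar> * (sin (\<psi> u) / sqrt (sin (\<psi> u)))"
      by (simp only: times_divide_eq_left times_divide_eq_right)
    also have "\<dots> = \<bar>k u\<bar> * sqrt (sin (\<psi> u))" using real_div_sqrt[OF sin0[OF True]] by simp
    finally have "Y / JJ * (\<bar>k u\<bar> / sqrt (sin (\<psi> u)) * sin (\<psi> u)) = Y / JJ * (\<bar>k u\<bar> * sqrt (sin (\<psi> u)))" by simp
    thus ?thesis using True by (simp only: w_def j_def indicator_simps mult_1 mult.assoc)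
  qed (simp add: j_def)
  have wsi: "(LINT u:S|lborel. w u * sin (\<psi> u)) = Y"
    unfolding set_lebesgue_integral_def real_scaleR_def ws using ji JJ by (simp add: JJ_def[symmetric])
  have kw: "(k u)\<^sup>2 / w u = JJ / Y * j u" for u
  proof (cases "u \<in> S \<and> k u \<noteq> 0")
    case True
    have g: "a * a / (Y / JJ * (a / q)) = JJ / Y * (a * q)" if "a > 0" "q > 0" for a q
      using that \<open>0 < Y\<close> JJ by (simp add: field_simps)
    have "(k u)\<^sup>2 = \<bar>k u\<bar> * \<bar>k u\<bar>" by (simp add: power2_eq_square)
    thus ?thesis using True sinpos[of u] g[of "\<bar>k u\<bar>" "sqrt (sin (\<psi> u))"]
      by (simp only: w_def j_def indicator_simps mult_1 real_sqrt_gt_0_iff zero_less_abs_iff not_False_eq_True simp_thms)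
  qed (auto simp: w_def j_def)
  have ki: "integrable lborel (\<lambda>u. (k u)\<^sup>2 / w u)" unfolding kw using ji by simp
  have "(LINT u|lborel. (k u)\<^sup>2 / w u) = JJ\<^sup>2 / Y" unfolding kw using ji by (simp add: JJ_def power2_eq_square)
  also have "\<dots> \<le> (LINT u:S|lborel. (k u)\<^sup>2)" using CS \<open>0 < Y\<close> by (simp add: pos_divide_le_eq mult.commute)
  finally have ke: "(LINT u|lborel. (k u)\<^sup>2 / w u) \<le> (LINT u:S|lborel. (k u)\<^sup>2)" .
  show ?thesis
    by (rule that[OF wi w0 _ wS _ _ ki ke]) (use wsi wb in \<open>auto simp: w_def Y_def\<close>)
qed

text \<open>Convexity of the reciprocal between the weights 1 and w, scaled by x. In the case w = 0
  = x both sides vanish under the convention 0 / 0 = 0.\<close>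

lemma convex_reciprocal:
  fixes t w x :: real
  assumes "0 \<le> t" "t \<le> 1" "0 \<le> w" "w = 0 \<Longrightarrow> x = 0" "0 \<le> x"
  shows "x / ((1 - t) + t * w) \<le> (1 - t) * x + t * (x / w)"
proof (cases "w = 0")
  case False
  hence w: "0 < w" using assms by simp
  hence d: "0 < (1 - t) + t * w"
    using assms by (cases "t = 1") (auto intro: add_pos_nonneg)
  have "((1 - t) + t / w) * ((1 - t) + t * w) - 1 = (1 - t) * t * ((w - 1)\<^sup>2 / w)"
    using w by (simp add: field_simps power2_eq_square)
  moreover have "0 \<le> (1 - t) * t * ((w - 1)\<^sup>2 / w)" using w assms by simp
  ultimately have "1 \<le> ((1 - t) + t / w) * ((1 - t) + t * w)" by linarith
  hence "1 / ((1 - t) + t * w) \<le> (1 - t) + t / w" using d by (simp add: pos_divide_le_eq)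
  hence "x * (1 / ((1 - t) + t * w)) \<le> x * ((1 - t) + t / w)" using assms by (intro mult_left_mono) auto
  thus ?thesis by (simp add: algebra_simps)
qed (use assms in auto)

lemma one_le_abs_cos_add_sin: "0 \<le> sin x \<Longrightarrow> 1 \<le> \<bar>cos x\<bar> + sin (x::real)"
proof -
  assume s: "0 \<le> sin x"
  have "(\<bar>cos x\<bar> + sin x)\<^sup>2 = 1 + 2 * \<bar>cos x\<bar> * sin x"
    using sin_cos_squared_add2[of x] unfolding power2_sum by simp
  moreover have "0 \<le> 2 * \<bar>cos x\<bar> * sin x" using s by simp
  ultimately have "1\<^sup>2 \<le> (\<bar>cos x\<bar> + sin x)\<^sup>2" by simp
  moreover have "0 \<le> \<bar>cos x\<bar> + sin x" using s by simp
  ultimately show ?thesis by (rule power2_le_imp_le)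
qed

text \<open>For either elastica weight the component of its chord along the reference direction is
  at most C1 |z|, where C1 = 64 sqrt 2 / sqrt pi. The balanced weights then have length at most (2
  C1 + 2) |z|; the 6 is what the other case of \<open>bend_shorten\<close> requires.\<close>

definition length_const :: real where "length_const = 128 * sqrt 2 / sqrt pi + 6"

text \<open>The two cases depend on whether the angle \<phi>, measured from the end direction
  farther from the extremum, reaches 3\<pi>/4. If not, the chord already bounds the length. If so,
  the curve sweeps a fixed range of angles on each side of \<pi>/2, and this bounds the normalizing
  integrals of both elastica weights from below.\<close>

lemma bend_shorten:
  assumes b0: "bend \<sigma> L c \<theta> k0" and k02: "integrable lborel (\<lambda>u. (k0 u)\<^sup>2)"
  obtains L' c' \<theta>' k' where "bend \<sigma> L' c' \<theta>' k'" "\<theta>' 0 = \<theta> 0" "\<theta>' L' = \<theta> L" "chord L' \<theta>' = chord L \<theta>"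
    "integrable lborel (\<lambda>u. (k' u)\<^sup>2)" "(LINT u|lborel. (k' u)\<^sup>2) \<le> (LINT u|lborel. (k0 u)\<^sup>2)"
    "L' \<le> length_const * norm (chord L \<theta>)"
proof -
  note f0 = bend_facts[OF b0]
  \<comment> \<open>The end angle farther from the extremum; measured from it, all angles lie in
    [0, pi].\<close>
  define m where "m = (if \<sigma> * \<theta> 0 \<le> \<sigma> * \<theta> L then \<theta> 0 else \<theta> L)"
  define \<phi> where "\<phi> = (\<lambda>s. \<sigma> * (\<theta> s - m))"
  define z where "z = chord L \<theta>"
  have \<sigma>\<sigma>: "\<sigma> * (\<sigma> * x) = x" for x using f0(1) by auto
  have \<theta>\<phi>: "\<theta> s = m + \<sigma> * \<phi> s" for s by (simp add: \<phi>_def \<sigma>\<sigma>)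
  have \<sigma>m: "\<sigma> * m = min (\<sigma> * \<theta> 0) (\<sigma> * \<theta> L)" by (simp add: m_def min_def)
  have \<phi>0: "0 \<le> \<phi> s" for s using bend_range(2)[OF b0, of s] by (simp add: \<phi>_def right_diff_distrib \<sigma>m)
  have \<phi>c: "\<phi> s \<le> \<phi> c" for s using bend_range(1)[OF b0, of s] by (simp add: \<phi>_def right_diff_distrib)
  have "\<phi> c \<le> \<bar>\<theta> c - m\<bar>" using f0(1) by (auto simp: \<phi>_def)
  also have "\<dots> \<le> pi" using f0(11,12) by (auto simp: m_def abs_minus_commute)
  finally have \<phi>pi: "\<phi> s \<le> pi" for s using \<phi>c[of s] by linarith
  obtain k where b: "bend \<sigma> L c \<theta> k" and kae: "AE s in lborel. k s = k0 s"
    and kext: "\<And>s. \<phi> s = 0 \<or> \<phi> s = pi \<Longrightarrow> k s = 0"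
  proof -
    define lo where "lo = (if \<sigma> = 1 then m else m - pi)"
    define hi where "hi = (if \<sigma> = 1 then m + pi else m)"
    have 1: "lo \<le> \<theta> s" "\<theta> s \<le> hi" for s
      using f0(1) \<phi>0[of s] \<phi>pi[of s] by (auto simp: lo_def hi_def \<theta>\<phi>[of s])
    have 2: "\<theta> s = lo \<or> \<theta> s = hi" if "\<phi> s = 0 \<or> \<phi> s = pi" for s
      using f0(1) that by (auto simp: lo_def hi_def \<theta>\<phi>[of s])
    obtain k where "bend \<sigma> L c \<theta> k" "AE s in lborel. k s = k0 s" "\<And>s. \<theta> s = lo \<or> \<theta> s = hi \<Longrightarrow> k s = 0"
      by (rule bend_density_vanishes_at_extremes[OF b0 1]) blast
    thus ?thesis using 2 by (intro that[of k]) blast+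
  qed
  note f = bend_facts[OF b]
  have [measurable]: "k \<in> borel_measurable borel" "k0 \<in> borel_measurable borel" by (rule f(6) f0(6))+
  have [measurable]: "\<theta> \<in> borel_measurable borel" by (rule bend_continuous[OF b])
  have \<phi>m[measurable]: "\<phi> \<in> borel_measurable borel" unfolding \<phi>_def by measurable
  have \<phi>cont: "continuous_on A \<phi>" for A unfolding \<phi>_def by (intro continuous_intros bend_continuous[OF b])
  have k2: "integrable lborel (\<lambda>u. (k u)\<^sup>2)"
    by (rule integrable_cong_AE_imp[OF k02]) (use kae in \<open>auto elim!: eventually_mono\<close>)
  have k2e: "(LINT u|lborel. (k u)\<^sup>2) = (LINT u|lborel. (k0 u)\<^sup>2)"
    by (rule integral_cong_AE) (use kae in \<open>auto elim!: eventually_mono\<close>)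
  have sin0: "0 \<le> sin (\<phi> s)" for s by (intro sin_ge_zero \<phi>0 \<phi>pi)
  have bi: "integrable lborel (\<lambda>u. w u * g (\<phi> u))"
    if "integrable lborel w" "\<And>x. \<bar>g x\<bar> \<le> 1" "g \<in> borel_measurable borel" for w g :: "real \<Rightarrow> real"
  proof (rule Bochner_Integration.integrable_bound[OF that(1)])
    show "(\<lambda>u. w u * g (\<phi> u)) \<in> borel_measurable lborel" using that by measurable
    show "AE u in lborel. norm (w u * g (\<phi> u)) \<le> norm (w u)"
      using that(2) by (auto simp: abs_mult intro!: mult_left_le)
  qed
  note bic = bi[where g=cos, OF _ abs_cos_le_one borel_measurable_continuous_onI[OF continuous_on_cos[OF continuous_on_id]]]
  note bis = bi[where g=sin, OF _ abs_sin_le_one borel_measurable_continuous_onI[OF continuous_on_sin[OF continuous_on_id]]]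
  \<comment> \<open>\<open>V w\<close> is the chord after reweighting by w; \<open>Xw w\<close> and
    \<open>Yw w\<close> are its components along the direction m and orthogonal to it.\<close>
  define V where "V = (\<lambda>w::real\<Rightarrow>real. LINT u|lborel. w u *\<^sub>R cis (\<theta> u))"
  define Xw where "Xw = (\<lambda>w::real\<Rightarrow>real. LINT u|lborel. w u * cos (\<phi> u))"
  define Yw where "Yw = (\<lambda>w::real\<Rightarrow>real. LINT u|lborel. w u * sin (\<phi> u))"
  have Vw: "V w = cis m * Complex (Xw w) (\<sigma> * Yw w)" if w: "integrable lborel w" for w
  proof -
    have e: "w u *\<^sub>R cis (\<theta> u) = cis m * (complex_of_real (w u * cos (\<phi> u)) + complex_of_real (w u * sin (\<phi> u)) * (\<i> * of_real \<sigma>))" for u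
    proof -
      have "cis (\<sigma> * \<phi> u) = Complex (cos (\<phi> u)) (\<sigma> * sin (\<phi> u))" using f(1) by (auto simp: complex_eq_iff)
      thus ?thesis by (simp add: \<theta>\<phi>[of u] cis_mult[symmetric] complex_eq_iff algebra_simps)
    qed
    have "V w = cis m * (complex_of_real (Xw w) + complex_of_real (Yw w) * (\<i> * of_real \<sigma>))"
      unfolding V_def e Xw_def Yw_def Bochner_Integration.integral_mult_right_zero
        integral_complex_combination(2)[OF bic[OF w] bis[OF w]] ..
    also have "complex_of_real (Xw w) + complex_of_real (Yw w) * (\<i> * of_real \<sigma>) = Complex (Xw w) (\<sigma> * Yw w)"
      by (simp add: complex_eq_iff)
    finally show ?thesis .
  qed
  define one where "one = indicat_real {0<..<L}"
  have onei: "integrable lborel one" unfolding one_def by (rule integrable_real_indicator) (use f(4) in auto)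
  have zV: "z = V one"
    unfolding z_def V_def one_def chord_def set_lebesgue_integral_def
  proof (rule integral_cong_AE)
    show "(\<lambda>s. indicat_real {0..L} s *\<^sub>R cis (\<theta> s)) \<in> borel_measurable lborel"
      "(\<lambda>s. indicat_real {0<..<L} s *\<^sub>R cis (\<theta> s)) \<in> borel_measurable lborel" by measurable
    show "AE s in lborel. indicat_real {0..L} s *\<^sub>R cis (\<theta> s) = indicat_real {0<..<L} s *\<^sub>R cis (\<theta> s)"
      using AE_lborel_singleton[of 0] AE_lborel_singleton[of L] by eventually_elim (auto simp: indicator_def)
  qed
  define X Y where "X = Xw one" and "Y = Yw one"
  have "norm z = norm (Complex X (\<sigma> * Y))" unfolding zV Vw[OF onei] by (simp add: norm_mult X_def Y_def)
  hence XYz: "\<bar>X\<bar> \<le> norm z" "\<bar>Y\<bar> \<le> norm z"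
    using abs_Re_le_cmod[of "Complex X (\<sigma> * Y)"] abs_Im_le_cmod[of "Complex X (\<sigma> * Y)"] f(1) by (auto simp: abs_mult)
  have C1pos: "0 \<le> 64 * sqrt 2 / sqrt pi" by simp
  show ?thesis
  proof (cases "\<phi> c < 3 * pi / 4")
    case True
    \<comment> \<open>The factor 2 lets the sine outweigh the negative cosine up to 3\<pi>/4, where
      the sum is still sqrt 2 / 2. Integration bounds L / 2 by X + 2 Y, hence L by 6 |z|.\<close>
    have lb: "1/2 \<le> cos (\<phi> u) + 2 * sin (\<phi> u)" for u
    proof (cases "\<phi> u \<le> pi / 2")
      case True
      have "0 \<le> cos (\<phi> u)" using \<phi>0[of u] True by (intro cos_ge_zero) auto
      thus ?thesis using one_le_abs_cos_add_sin[OF sin0[of u]] sin0[of u] by auto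
    next
      case False
      define y where "y = \<phi> u - pi / 2"
      have y: "0 \<le> y" "y \<le> pi / 4" using False \<phi>c[of u] True by (auto simp: y_def)
      have "cos (pi / 4) \<le> cos y" using y by (intro cos_monotone_0_pi_le) auto
      moreover have "sin y \<le> sin (pi / 4)" using y by (intro sin_monotone_2pi_le) auto
      moreover have "cos (\<phi> u) = - sin y" "sin (\<phi> u) = cos y" by (simp_all add: y_def sin_diff cos_diff)
      moreover have "1 \<le> sqrt 2" by simp
      ultimately show ?thesis unfolding cos_45 sin_45 by linarith
    qed
    have "(LINT u|lborel. one u * (1/2)) \<le> (LINT u|lborel. one u * cos (\<phi> u) + 2 * (one u * sin (\<phi> u)))"
    proof (rule integral_mono)
      show "one u * (1/2) \<le> one u * cos (\<phi> u) + 2 * (one u * sin (\<phi> u))" for u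
        using mult_left_mono[OF lb[of u], of "one u"] by (simp add: one_def algebra_simps)
    qed (use onei bic[OF onei] bis[OF onei] in auto)
    also have "\<dots> = X + 2 * Y" using bic[OF onei] bis[OF onei] by (simp add: X_def Y_def Xw_def Yw_def)
    also have "(LINT u|lborel. one u * (1/2)) = L / 2" using f(4) by (simp add: one_def)
    finally have "L \<le> 6 * norm z" using XYz by linarith
    also have "\<dots> \<le> length_const * norm z" using C1pos by (intro mult_right_mono) (auto simp: length_const_def)
    finally show ?thesis
      by (intro that[OF b0 refl refl refl k02]) (auto simp: z_def)
  next
    case False
    \<comment> \<open>The curve runs forwards on \<open>A\<close> and backwards on \<open>B\<close>. On both sets move linearly from the weight \<open>1\<close> to
      the elastica weight, at such speeds that the two contributions to \<open>X\<close> change by the same amount,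
      until one of the elastica weights is reached; the other contribution is then bounded as well.\<close>
    define A where "A = {u\<in>{0<..<L}. \<phi> u < pi / 2}"
    define B where "B = {u\<in>{0<..<L}. pi / 2 \<le> \<phi> u}"
    have Am[measurable]: "A \<in> sets borel" unfolding A_def by measurable
    have Bm[measurable]: "B \<in> sets borel" unfolding B_def by measurable
    \<comment> \<open>The monotone part between the end with \<phi> = 0 and the extremum runs
      through all angles up to 3\<pi>/4; which part this is depends on which end is farther from the
      extremum.\<close>
    have passage: "\<exists>I\<in>sets borel. I \<subseteq> {0<..<L} \<and> (\<forall>u\<in>I. p \<le> \<phi> u \<and> \<phi> u \<le> q) \<and> q - p \<le> (LINT u:I|lborel. \<bar>k u\<bar>)"
      if pq: "0 \<le> p" "p < q" "q \<le> 3 * pi / 4" for p q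
    proof -
      have "\<exists>s1 s2. s1 \<le> s2 \<and> \<bar>\<phi> s2 - \<phi> s1\<bar> = q - p \<and> (\<forall>u. s1 \<le> u \<and> u \<le> s2 \<longrightarrow> p \<le> \<phi> u \<and> \<phi> u \<le> q)"
      proof (cases "\<sigma> * \<theta> 0 \<le> \<sigma> * \<theta> L")
        case True
        hence "\<phi> 0 = 0" by (simp add: \<phi>_def m_def)
        obtain s1 where s1: "0 \<le> s1" "s1 \<le> c" "\<phi> s1 = p"
          using IVT'[of \<phi> 0 p c] \<open>\<phi> 0 = 0\<close> False pq f(2) \<phi>cont by auto
        obtain s2 where s2: "s1 \<le> s2" "s2 \<le> c" "\<phi> s2 = q"
          using IVT'[of \<phi> s1 q c] s1 False pq \<phi>cont by auto
        have mono: "\<phi> s \<le> \<phi> t" if "s \<le> t" "t \<le> c" for s t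
          using bend_mono(1)[OF b that] by (simp add: \<phi>_def right_diff_distrib)
        show ?thesis
        proof (rule exI[of _ s1], rule exI[of _ s2], intro conjI allI impI)
          show "p \<le> \<phi> u" "\<phi> u \<le> q" if "s1 \<le> u \<and> u \<le> s2" for u
            using mono[of s1 u] mono[of u s2] that s1 s2 by auto
        qed (use s1 s2 pq in auto)
      next
        case False': False
        hence "\<phi> L = 0" by (simp add: \<phi>_def m_def)
        obtain s1 where s1: "c \<le> s1" "s1 \<le> L" "\<phi> s1 = q"
          using IVT2'[of \<phi> L q c] \<open>\<phi> L = 0\<close> False pq f(3) \<phi>cont by auto
        obtain s2 where s2: "s1 \<le> s2" "s2 \<le> L" "\<phi> s2 = p"
          using IVT2'[of \<phi> L p s1] s1 \<open>\<phi> L = 0\<close> False pq \<phi>cont by auto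
        have mono: "\<phi> t \<le> \<phi> s" if "s \<le> t" "c \<le> s" for s t
          using bend_mono(2)[OF b that] by (simp add: \<phi>_def right_diff_distrib)
        show ?thesis
        proof (rule exI[of _ s1], rule exI[of _ s2], intro conjI allI impI)
          show "p \<le> \<phi> u" "\<phi> u \<le> q" if "s1 \<le> u \<and> u \<le> s2" for u
            using mono[of s1 u] mono[of u s2] that s1 s2 by auto
        qed (use s1 s2 pq in auto)
      qed
      then obtain s1 s2 where s: "s1 \<le> s2" "\<bar>\<phi> s2 - \<phi> s1\<bar> = q - p" "\<And>u. s1 \<le> u \<Longrightarrow> u \<le> s2 \<Longrightarrow> p \<le> \<phi> u \<and> \<phi> u \<le> q"
        by blast
      show ?thesis
      proof (intro bexI[of _ "{s1<..s2} \<inter> {0<..<L}"] conjI ballI)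
        have "\<bar>\<theta> s2 - \<theta> s1\<bar> \<le> (LINT u:{s1<..s2}|lborel. \<bar>k u\<bar>)" by (rule bend_increment_le[OF b s(1)])
        also have "\<dots> = (LINT u:{s1<..s2} \<inter> {0<..<L}|lborel. \<bar>k u\<bar>)"
          unfolding set_lebesgue_integral_def
          by (rule Bochner_Integration.integral_cong) (use f(7) in \<open>auto simp: indicator_def\<close>)
        also have "\<bar>\<theta> s2 - \<theta> s1\<bar> = q - p"
          using s(2) f(1) by (auto simp: \<phi>_def right_diff_distrib[symmetric])
        finally show "q - p \<le> (LINT u:{s1<..s2} \<inter> {0<..<L}|lborel. \<bar>k u\<bar>)" .
      qed (use s(3) in auto)
    qed
    \<comment> \<open>A window of angles of width pi / 8 in which \<psi> \<ge> pi / 4, hence sqrt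
      (sin \<psi>) \<ge> 1/2. The same argument serves both halves, with \<psi> = \<phi> and with
      \<psi> = pi - \<phi>.\<close>
    have J: "pi / 16 \<le> (LINT u:S|lborel. \<bar>k u\<bar> * sqrt (sin (\<psi> u)))"
      if S: "S \<in> sets borel" and \<psi>[measurable]: "\<psi> \<in> borel_measurable borel" and sn: "\<And>u. 0 \<le> sin (\<psi> u)"
        and pq: "0 \<le> p" "q - p = pi / 8" "q \<le> 3 * pi / 4"
        and sub: "\<And>u. u \<in> {0<..<L} \<Longrightarrow> p \<le> \<phi> u \<Longrightarrow> \<phi> u \<le> q \<Longrightarrow> u \<in> S \<and> pi / 4 \<le> \<psi> u \<and> \<psi> u \<le> 3 * pi / 8"
      for S \<psi> p q
    proof -
      have "p < q" using pq(2) pi_gt_zero by linarith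
      then obtain I where I: "I \<in> sets borel" "I \<subseteq> {0<..<L}" "\<And>u. u \<in> I \<Longrightarrow> p \<le> \<phi> u \<and> \<phi> u \<le> q" "q - p \<le> (LINT u:I|lborel. \<bar>k u\<bar>)"
        using passage[OF pq(1) _ pq(3)] by blast
      have [measurable]: "S \<in> sets borel" by (rule S)
      have le: "1/2 \<le> sqrt (sin (\<psi> u))" if "u \<in> I" for u
      proof -
        have "pi / 4 \<le> \<psi> u" "\<psi> u \<le> 3 * pi / 8" using sub[of u] I(2) I(3)[OF that] that by auto
        hence "sin (pi / 4) \<le> sin (\<psi> u)" by (intro sin_monotone_2pi_le) auto
        moreover have "1 \<le> sqrt 2" by simp
        ultimately have "(1/2)\<^sup>2 \<le> sin (\<psi> u)" unfolding sin_45 power2_eq_square by linarith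
        thus ?thesis by (rule real_le_rsqrt)
      qed
      have i1: "integrable lborel (\<lambda>u. \<bar>k u\<bar> * sqrt (sin (\<psi> u)))"
        by (rule Bochner_Integration.integrable_bound[OF f(5)]) (use sn in \<open>auto simp: abs_mult intro!: mult_left_le\<close>)
      have "pi / 16 \<le> 1/2 * (LINT u:I|lborel. \<bar>k u\<bar>)" using I(4) pq(2) by simp
      also have "\<dots> = (LINT u|lborel. indicator I u * (1/2 * \<bar>k u\<bar>))"
        by (simp add: set_lebesgue_integral_def mult.left_commute)
      also have "\<dots> \<le> (LINT u|lborel. indicator S u * (\<bar>k u\<bar> * sqrt (sin (\<psi> u))))"
      proof (rule integral_mono)
        show "integrable lborel (\<lambda>u. indicat_real I u * (1/2 * \<bar>k u\<bar>))"
          using integrable_mult_indicator[of I lborel "\<lambda>u. 1/2 * \<bar>k u\<bar>"] f(5) I(1) by simp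
        show "integrable lborel (\<lambda>u. indicat_real S u * (\<bar>k u\<bar> * sqrt (sin (\<psi> u))))"
          using integrable_mult_indicator[of S lborel "\<lambda>u. \<bar>k u\<bar> * sqrt (sin (\<psi> u))"] i1 by simp
        fix u
        show "indicat_real I u * (1/2 * \<bar>k u\<bar>) \<le> indicat_real S u * (\<bar>k u\<bar> * sqrt (sin (\<psi> u)))"
        proof (cases "u \<in> I")
          case True
          hence "u \<in> S" using sub[of u] I(2) I(3)[OF True] by auto
          thus ?thesis using True mult_right_mono[OF le[OF True], of "\<bar>k u\<bar>"] by (simp add: mult.commute)
        qed (use sn in \<open>auto simp: indicator_def\<close>)
      qed
      finally show ?thesis by (simp add: set_lebesgue_integral_def)
    qed
    have C0: "0 \<le> 4 * sqrt pi" by simp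
    have J0: "0 < pi / 16" by simp
    \<comment> \<open>The bound \<open>4 * sqrt pi\<close> is the total mass from the two monotone
      stretches, \<open>sqrt 2\<close> comes from comparing sine and angle, and
      \<open>pi / 16\<close> is the lower bound J.\<close>
    have const: "4 * sqrt pi * sqrt 2 / (pi / 16) = 64 * sqrt 2 / sqrt pi"
    proof -
      have "pi = sqrt pi * sqrt pi" by simp
      thus ?thesis by (simp add: field_simps)
    qed
    obtain wA where wA: "integrable lborel wA" "\<And>u. 0 \<le> wA u" "\<And>u. u \<notin> A \<Longrightarrow> wA u = 0" "\<And>u. u \<in> A \<Longrightarrow> wA u = 0 \<Longrightarrow> k u = 0"
      "(LINT u:A|lborel. wA u * sin (\<phi> u)) = (LINT u:A|lborel. sin (\<phi> u))"
      "(LINT u|lborel. wA u) \<le> 64 * sqrt 2 / sqrt pi * (LINT u:A|lborel. sin (\<phi> u))"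
      "integrable lborel (\<lambda>u. (k u)\<^sup>2 / wA u)"
      "(LINT u|lborel. (k u)\<^sup>2 / wA u) \<le> (LINT u:A|lborel. (k u)\<^sup>2)"
    proof (rule elastica_weight[OF Am _ f(5) k2 \<phi>m _ \<phi>0 _ _ C0 J0, unfolded const])
      show "A \<subseteq> {0<..<L}" by (auto simp: A_def)
      show "0 \<le> \<phi> u \<and> \<phi> u \<le> pi / 2" if "u \<in> A" for u using that \<phi>0[of u] by (auto simp: A_def)
      show "k u = 0" if "\<phi> u = 0" for u using kext that by blast
      show "(\<integral>\<^sup>+s. ennreal (\<bar>k s\<bar> / sqrt (\<phi> s)) \<partial>lborel) \<le> ennreal (4 * sqrt pi)"
        by (rule nn_integral_div_sqrt_angle_le[OF b f(1)]) (use \<phi>0 \<phi>pi kext in \<open>auto simp: \<phi>_def\<close>)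
      show "pi / 16 \<le> (LINT u:A|lborel. \<bar>k u\<bar> * sqrt (sin (\<phi> u)))"
      proof (rule J[OF Am \<phi>m sin0, where p="pi/4" and q="3*pi/8"])
        fix u assume u: "u \<in> {0<..<L}" "pi / 4 \<le> \<phi> u" "\<phi> u \<le> 3 * pi / 8"
        hence "\<phi> u < pi / 2" using pi_gt_zero by linarith
        thus "u \<in> A \<and> pi / 4 \<le> \<phi> u \<and> \<phi> u \<le> 3 * pi / 8" using u by (simp add: A_def)
      qed auto
    qed (rule that)
    \<comment> \<open>Measured from the opposite direction, the backward half becomes a forward one:
      the angle is \<open>pi - \<phi>\<close>, with the sign \<tau> = - \<sigma>.\<close>
    obtain wB where wB: "integrable lborel wB" "\<And>u. 0 \<le> wB u" "\<And>u. u \<notin> B \<Longrightarrow> wB u = 0" "\<And>u. u \<in> B \<Longrightarrow> wB u = 0 \<Longrightarrow> k u = 0"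
      "(LINT u:B|lborel. wB u * sin (pi - \<phi> u)) = (LINT u:B|lborel. sin (pi - \<phi> u))"
      "(LINT u|lborel. wB u) \<le> 64 * sqrt 2 / sqrt pi * (LINT u:B|lborel. sin (pi - \<phi> u))"
      "integrable lborel (\<lambda>u. (k u)\<^sup>2 / wB u)"
      "(LINT u|lborel. (k u)\<^sup>2 / wB u) \<le> (LINT u:B|lborel. (k u)\<^sup>2)"
    proof (rule elastica_weight[OF Bm _ f(5) k2 _ _ _ _ _ C0 J0, where \<psi>="\<lambda>u. pi - \<phi> u", unfolded const])
      show "B \<subseteq> {0<..<L}" by (auto simp: B_def)
      show "(\<lambda>u. pi - \<phi> u) \<in> borel_measurable borel" by measurable
      show "0 \<le> pi - \<phi> u \<and> pi - \<phi> u \<le> pi / 2" if "u \<in> B" for u using that \<phi>pi[of u] by (auto simp: B_def)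
      show "0 \<le> pi - \<phi> u" for u using \<phi>pi[of u] by simp
      show "k u = 0" if "pi - \<phi> u = 0" for u using kext[of u] that by simp
      show "(\<integral>\<^sup>+s. ennreal (\<bar>k s\<bar> / sqrt (pi - \<phi> s)) \<partial>lborel) \<le> ennreal (4 * sqrt pi)"
      proof (rule nn_integral_div_sqrt_angle_le[OF b, where \<tau>="- \<sigma>" and m="m + \<sigma> * pi"])
        show "- \<sigma> = 1 \<or> - \<sigma> = -1" using f(1) by auto
        show "pi - \<phi> s = - \<sigma> * (\<theta> s - (m + \<sigma> * pi))" for s
          using \<sigma>\<sigma>[of pi] by (simp add: \<phi>_def algebra_simps)
        show "k s = 0" if "pi - \<phi> s = 0" for s using kext[of s] that by simp
      qed (use \<phi>0 \<phi>pi in auto)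
      show "pi / 16 \<le> (LINT u:B|lborel. \<bar>k u\<bar> * sqrt (sin (pi - \<phi> u)))"
      proof (rule J[OF Bm, where p="5*pi/8" and q="3*pi/4"])
        fix u assume u: "u \<in> {0<..<L}" "5 * pi / 8 \<le> \<phi> u" "\<phi> u \<le> 3 * pi / 4"
        hence "pi / 2 \<le> \<phi> u" "pi / 4 \<le> pi - \<phi> u" "pi - \<phi> u \<le> 3 * pi / 8" using pi_gt_zero by linarith+
        thus "u \<in> B \<and> pi / 4 \<le> pi - \<phi> u \<and> pi - \<phi> u \<le> 3 * pi / 8" using u by (simp add: B_def)
      qed (use sin0 in auto)
    qed (rule that)
    define iA where "iA = indicat_real A"
    define iB where "iB = indicat_real B"
    have iAi: "integrable lborel iA" and iBi: "integrable lborel iB"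
    proof -
      have "integrable lborel (\<lambda>u. indicator A u *\<^sub>R one u)" "integrable lborel (\<lambda>u. indicator B u *\<^sub>R one u)"
        by (rule integrable_mult_indicator; use onei in simp)+
      moreover have "(\<lambda>u. indicator A u *\<^sub>R one u) = iA" "(\<lambda>u. indicator B u *\<^sub>R one u) = iB"
        by (auto simp: iA_def iB_def one_def A_def B_def indicator_def)
      ultimately show "integrable lborel iA" "integrable lborel iB" by auto
    qed
    have AB: "iA u + iB u = one u" for u by (auto simp: iA_def iB_def one_def A_def B_def indicator_def)
    \<comment> \<open>On each half the elastica weight keeps the orthogonal component, so mixing it
      with the weight 1 in any proportion does too. Only X has to be balanced between the
      halves.\<close>
    have YA: "Yw wA = Yw iA"
    proof -
      have "Yw wA = (LINT u:A|lborel. wA u * sin (\<phi> u))" unfolding Yw_def set_lebesgue_integral_def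
        by (rule Bochner_Integration.integral_cong) (use wA(3) in \<open>auto simp: indicator_def\<close>)
      thus ?thesis using wA(5) by (simp add: Yw_def iA_def set_lebesgue_integral_def)
    qed
    have YB: "Yw wB = Yw iB"
    proof -
      have "Yw wB = (LINT u:B|lborel. wB u * sin (pi - \<phi> u))" unfolding Yw_def set_lebesgue_integral_def
        by (rule Bochner_Integration.integral_cong) (use wB(3) in \<open>auto simp: indicator_def\<close>)
      thus ?thesis using wB(5) by (simp add: Yw_def iB_def set_lebesgue_integral_def)
    qed
    have Yn: "0 \<le> Yw iA" "0 \<le> Yw iB" unfolding Yw_def iA_def iB_def using sin0 by auto
    have Xadd: "Xw (\<lambda>u. r1 * w1 u + r2 * w2 u + r3 * w3 u + r4 * w4 u) = r1 * Xw w1 + r2 * Xw w2 + r3 * Xw w3 + r4 * Xw w4"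
      and Yadd: "Yw (\<lambda>u. r1 * w1 u + r2 * w2 u + r3 * w3 u + r4 * w4 u) = r1 * Yw w1 + r2 * Yw w2 + r3 * Yw w3 + r4 * Yw w4"
      if w: "integrable lborel w1" "integrable lborel w2" "integrable lborel w3" "integrable lborel w4" for r1 r2 r3 r4 w1 w2 w3 w4
      unfolding Xw_def Yw_def distrib_right mult.assoc
      using bic[OF w(1)] bic[OF w(2)] bic[OF w(3)] bic[OF w(4)] bis[OF w(1)] bis[OF w(2)] bis[OF w(3)] bis[OF w(4)]
      by (simp_all)
    have one4: "one = (\<lambda>u. 1 * iA u + 0 * iA u + 1 * iB u + 0 * iB u)" using AB by auto
    have Xs: "X = Xw iA + Xw iB" and Ys: "Y = Yw iA + Yw iB"
      unfolding X_def Y_def by (subst one4, subst Xadd Yadd, (rule iAi iBi)+, simp)+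
    have Xw_abs: "\<bar>Xw v\<bar> \<le> (LINT u|lborel. v u)" if v: "integrable lborel v" "\<And>u. 0 \<le> v u" for v
    proof -
      have "\<bar>Xw v\<bar> \<le> (LINT u|lborel. \<bar>v u * cos (\<phi> u)\<bar>)"
        unfolding Xw_def using integral_norm_bound[of lborel "\<lambda>u. v u * cos (\<phi> u)"] by simp
      also have "\<dots> \<le> (LINT u|lborel. v u)"
      proof (rule integral_mono[OF integrable_abs[OF bic[OF v(1)]] v(1)])
        fix u show "\<bar>v u * cos (\<phi> u)\<bar> \<le> v u" using v(2)[of u] by (simp add: abs_mult mult_left_le)
      qed
      finally show ?thesis .
    qed
    have XwA: "\<bar>Xw wA\<bar> \<le> 64 * sqrt 2 / sqrt pi * norm z"
    proof -
      have "\<bar>Xw wA\<bar> \<le> (LINT u|lborel. wA u)" by (rule Xw_abs[OF wA(1,2)])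
      also have "\<dots> \<le> 64 * sqrt 2 / sqrt pi * Yw iA" using wA(6) by (simp add: Yw_def iA_def set_lebesgue_integral_def)
      also have "\<dots> \<le> 64 * sqrt 2 / sqrt pi * norm z"
        using Yn Ys XYz by (intro mult_left_mono) auto
      finally show ?thesis .
    qed
    have XwB: "\<bar>Xw wB\<bar> \<le> 64 * sqrt 2 / sqrt pi * norm z"
    proof -
      have "\<bar>Xw wB\<bar> \<le> (LINT u|lborel. wB u)" by (rule Xw_abs[OF wB(1,2)])
      also have "\<dots> \<le> 64 * sqrt 2 / sqrt pi * Yw iB" using wB(6) by (simp add: Yw_def iB_def set_lebesgue_integral_def)
      also have "\<dots> \<le> 64 * sqrt 2 / sqrt pi * norm z"
        using Yn Ys XYz by (intro mult_left_mono) auto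
      finally show ?thesis .
    qed
    \<comment> \<open>Forward and backward contributions to X. The second is negated, so that X is
      their difference and the integral of w |cos \<phi>| is their sum.\<close>
    define XA where "XA t = (1 - t) * Xw iA + t * Xw wA" for t
    define XB where "XB u = - ((1 - u) * Xw iB + u * Xw wB)" for u
    have "\<exists>t u. 0 \<le> t \<and> t \<le> 1 \<and> 0 \<le> u \<and> u \<le> 1 \<and> XA t - XB u = X \<and> (XA t \<le> Xw wA \<or> XB u \<le> - Xw wB)"
    proof -
      define a where "a = Xw iA - Xw wA"
      define b where "b = - Xw iB + Xw wB"
      have eA: "XA t = Xw iA - t * a" "XA t = Xw wA + (1 - t) * a" for t by (simp_all add: XA_def a_def algebra_simps)
      have eB: "XB t = - Xw iB - t * b" "XB t = - Xw wB + (1 - t) * b" for t by (simp_all add: XB_def b_def algebra_simps)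
      consider "a \<le> 0 \<or> b \<le> 0" | "0 < a" "a \<le> b" | "0 < b" "b < a" by linarith
      thus ?thesis
      proof cases
        \<comment> \<open>If one contribution does not exceed its elastica value to begin with, the
          weight 1 can be kept on both halves.\<close>
        case 1
        show ?thesis by (rule exI[of _ 0], rule exI[of _ 0]) (use 1 in \<open>auto simp: XA_def XB_def Xs a_def b_def\<close>)
      next
        case 2
        show ?thesis
          by (rule exI[of _ 1], rule exI[of _ "a / b"]) (use 2 in \<open>simp add: eA(1) eB(1) Xs\<close>, simp add: a_def)
      next
        case 3
        show ?thesis
          by (rule exI[of _ "b / a"], rule exI[of _ 1]) (use 3 in \<open>simp add: eA(1) eB(1) Xs\<close>, simp add: b_def)
      qed
    qed
    then obtain t u where tu: "0 \<le> t" "t \<le> 1" "0 \<le> u" "u \<le> 1" and Xtu: "XA t - XB u = X" and small: "XA t \<le> Xw wA \<or> XB u \<le> - Xw wB"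
      by blast
    define w where "w = (\<lambda>s. (1 - t) * iA s + t * wA s + (1 - u) * iB s + u * wB s)"
    have wi: "integrable lborel w" unfolding w_def using iAi iBi wA(1) wB(1) by auto
    have w0: "0 \<le> w s" for s unfolding w_def using tu wA(2)[of s] wB(2)[of s] by (simp add: iA_def iB_def)
    have wcase: "s \<in> A \<and> w s = (1 - t) + t * wA s \<or> s \<in> B \<and> w s = (1 - u) + u * wB s \<or> s \<notin> {0<..<L} \<and> w s = 0" for s
    proof -
      have "A \<inter> B = {}" "A \<union> B = {0<..<L}" by (auto simp: A_def B_def)
      hence "s \<in> A \<and> s \<notin> B \<or> s \<in> B \<and> s \<notin> A \<or> s \<notin> A \<and> s \<notin> B \<and> s \<notin> {0<..<L}" by blast
      thus ?thesis using wA(3)[of s] wB(3)[of s] by (auto simp: w_def iA_def iB_def)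
    qed
    have wout: "w s = 0" if "s \<notin> {0<..<L}" for s using wcase[of s] that by (auto simp: A_def B_def)
    have wk: "k s = 0" if "w s = 0" for s
    proof -
      have aux: "v = 0" if "(1 - r) + r * v = 0" "0 \<le> r" "r \<le> 1" "0 \<le> v" for r v :: real
      proof -
        have "0 \<le> r * v" using that by simp
        hence "r = 1" using that by linarith
        thus ?thesis using that by simp
      qed
      show ?thesis using wcase[of s] that aux[of t "wA s"] aux[of u "wB s"] tu wA(2,4)[of s] wB(2,4)[of s] f(7)[of s] by auto
    qed
    have qle: "(k s)\<^sup>2 / w s \<le> (1 - t) * (iA s * (k s)\<^sup>2) + t * ((k s)\<^sup>2 / wA s) + (1 - u) * (iB s * (k s)\<^sup>2) + u * ((k s)\<^sup>2 / wB s)" for s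
    proof -
      have nn: "0 \<le> (1 - t) * (iA s * (k s)\<^sup>2)" "0 \<le> t * ((k s)\<^sup>2 / wA s)" "0 \<le> (1 - u) * (iB s * (k s)\<^sup>2)" "0 \<le> u * ((k s)\<^sup>2 / wB s)"
        using tu wA(2)[of s] wB(2)[of s] by (auto simp: iA_def iB_def)
      from wcase[of s] show ?thesis
      proof (elim disjE conjE)
        assume "s \<in> A" "w s = (1 - t) + t * wA s"
        thus ?thesis using convex_reciprocal[of t "wA s" "(k s)\<^sup>2"] tu wA(2,4)[of s] nn by (simp add: iA_def)
      next
        assume "s \<in> B" "w s = (1 - u) + u * wB s"
        thus ?thesis using convex_reciprocal[of u "wB s" "(k s)\<^sup>2"] tu wB(2,4)[of s] nn by (simp add: iB_def)
      next
        assume "w s = 0" thus ?thesis using nn by simp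
      qed
    qed
    have iAk: "integrable lborel (\<lambda>s. iA s * (k s)\<^sup>2)" and iBk: "integrable lborel (\<lambda>s. iB s * (k s)\<^sup>2)"
      unfolding iA_def iB_def using integrable_mult_indicator[OF _ k2, of A] integrable_mult_indicator[OF _ k2, of B] by auto
    note Qi = iAk iBk wA(7) wB(7)
    have qi: "integrable lborel (\<lambda>s. (k s)\<^sup>2 / w s)"
    proof (rule Bochner_Integration.integrable_bound)
      show "integrable lborel (\<lambda>s. (1 - t) * (iA s * (k s)\<^sup>2) + t * ((k s)\<^sup>2 / wA s) + (1 - u) * (iB s * (k s)\<^sup>2) + u * ((k s)\<^sup>2 / wB s))"
        by (intro Bochner_Integration.integrable_add integrable_mult_right Qi)
      show "(\<lambda>s. (k s)\<^sup>2 / w s) \<in> borel_measurable lborel" using borel_measurable_integrable[OF wi] by simp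
      show "AE s in lborel. norm ((k s)\<^sup>2 / w s) \<le> norm ((1 - t) * (iA s * (k s)\<^sup>2) + t * ((k s)\<^sup>2 / wA s) + (1 - u) * (iB s * (k s)\<^sup>2) + u * ((k s)\<^sup>2 / wB s))"
      proof (rule AE_I2)
        fix s
        have "0 \<le> (k s)\<^sup>2 / w s" using w0[of s] by simp
        thus "norm ((k s)\<^sup>2 / w s) \<le> norm ((1 - t) * (iA s * (k s)\<^sup>2) + t * ((k s)\<^sup>2 / wA s) + (1 - u) * (iB s * (k s)\<^sup>2) + u * ((k s)\<^sup>2 / wB s))"
          using qle[of s] unfolding real_norm_def by linarith
      qed
    qed
    have energy: "(LINT s|lborel. (k s)\<^sup>2 / w s) \<le> (LINT s|lborel. (k0 s)\<^sup>2)"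
    proof -
      have "(LINT s|lborel. (k s)\<^sup>2 / w s) \<le> (LINT s|lborel. (1 - t) * (iA s * (k s)\<^sup>2) + t * ((k s)\<^sup>2 / wA s) + (1 - u) * (iB s * (k s)\<^sup>2) + u * ((k s)\<^sup>2 / wB s))"
        by (intro integral_mono qi qle Bochner_Integration.integrable_add integrable_mult_right Qi)
      also have "\<dots> = (1 - t) * (LINT s|lborel. iA s * (k s)\<^sup>2) + t * (LINT s|lborel. (k s)\<^sup>2 / wA s)
           + (1 - u) * (LINT s|lborel. iB s * (k s)\<^sup>2) + u * (LINT s|lborel. (k s)\<^sup>2 / wB s)"
        using Qi by (simp del: times_divide_eq_right)
      also have "\<dots> \<le> (1 - t) * (LINT s|lborel. iA s * (k s)\<^sup>2) + t * (LINT s|lborel. iA s * (k s)\<^sup>2)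
           + (1 - u) * (LINT s|lborel. iB s * (k s)\<^sup>2) + u * (LINT s|lborel. iB s * (k s)\<^sup>2)"
        using tu wA(8) wB(8) by (intro add_mono mult_left_mono order_refl) (auto simp: iA_def iB_def set_lebesgue_integral_def)
      also have "\<dots> = (LINT s|lborel. iA s * (k s)\<^sup>2) + (LINT s|lborel. iB s * (k s)\<^sup>2)" by (simp add: algebra_simps)
      also have "\<dots> = (LINT s|lborel. iA s * (k s)\<^sup>2 + iB s * (k s)\<^sup>2)" using Qi by simp
      also have "\<dots> = (LINT s|lborel. (k s)\<^sup>2)"
        by (rule Bochner_Integration.integral_cong) (use AB f(7) in \<open>auto simp: distrib_right[symmetric] one_def indicator_def\<close>)
      finally show ?thesis by (simp add: k2e)
    qed
    have Xww: "Xw w = X" "Yw w = Y"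
    proof -
      have "Xw w = XA t - XB u" unfolding w_def by (subst Xadd[OF iAi wA(1) iBi wB(1)]) (simp add: XA_def XB_def)
      thus "Xw w = X" using Xtu by simp
      show "Yw w = Y" unfolding w_def by (subst Yadd[OF iAi wA(1) iBi wB(1)]) (simp add: YA YB Ys algebra_simps)
    qed
    have Vz: "V w = z" unfolding zV Vw[OF wi] Vw[OF onei] Xww by (simp add: X_def Y_def)
    have len: "(LINT s|lborel. w s) \<le> length_const * norm z"
    proof -
      \<comment> \<open>The cosine is nonnegative on A and nonpositive on B, so integrating this
        gives XA t + XB u. With 1 \<le> |cos \<phi>| + sin \<phi>, the length is then at most XA t +
        XB u + Y.\<close>
      have c: "\<bar>cos (\<phi> s)\<bar> * w s = (1 - t) * (iA s * cos (\<phi> s)) + t * (wA s * cos (\<phi> s)) - (1 - u) * (iB s * cos (\<phi> s)) - u * (wB s * cos (\<phi> s))" for s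
      proof -
        from wcase[of s] show ?thesis
        proof (elim disjE conjE)
          assume s: "s \<in> A" "w s = (1 - t) + t * wA s"
          have "0 \<le> cos (\<phi> s)" using s(1) \<phi>0[of s] by (intro cos_ge_zero) (auto simp: A_def)
          moreover have "s \<notin> B" using s by (auto simp: A_def B_def)
          ultimately show ?thesis using s(1) wB(3)[of s] unfolding s(2) by (simp add: iA_def iB_def algebra_simps)
        next
          assume s: "s \<in> B" "w s = (1 - u) + u * wB s"
          have "cos (\<phi> s) \<le> 0" using s(1) \<phi>pi[of s] cos_ge_zero[of "\<phi> s - pi"] by (auto simp: B_def)
          moreover have "s \<notin> A" using s by (auto simp: A_def B_def)
          ultimately show ?thesis using s(1) wA(3)[of s] unfolding s(2) by (simp add: iA_def iB_def algebra_simps)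
        next
          assume s: "w s = 0" "s \<notin> {0<..<L}"
          hence "s \<notin> A" "s \<notin> B" by (auto simp: A_def B_def)
          thus ?thesis using s wA(3)[of s] wB(3)[of s] by (simp add: iA_def iB_def)
        qed
      qed
      note ints = bic[OF iAi] bic[OF iBi] bic[OF wA(1)] bic[OF wB(1)] bis[OF wi]
      have "(LINT s|lborel. w s) \<le> (LINT s|lborel. ((1 - t) * (iA s * cos (\<phi> s)) + t * (wA s * cos (\<phi> s)) - (1 - u) * (iB s * cos (\<phi> s)) - u * (wB s * cos (\<phi> s))) + w s * sin (\<phi> s))"
      proof (rule integral_mono[OF wi])
        show "integrable lborel (\<lambda>s. ((1 - t) * (iA s * cos (\<phi> s)) + t * (wA s * cos (\<phi> s)) - (1 - u) * (iB s * cos (\<phi> s)) - u * (wB s * cos (\<phi> s))) + w s * sin (\<phi> s))"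
          using ints by auto
        show "w s \<le> ((1 - t) * (iA s * cos (\<phi> s)) + t * (wA s * cos (\<phi> s)) - (1 - u) * (iB s * cos (\<phi> s)) - u * (wB s * cos (\<phi> s))) + w s * sin (\<phi> s)" for s
          using mult_right_mono[OF one_le_abs_cos_add_sin[OF sin0[of s]] w0[of s]] unfolding c[symmetric] by (simp add: algebra_simps)
      qed
      also have "\<dots> = XA t + XB u + Y"
        using ints Xww(2) by (simp add: XA_def XB_def Xw_def Yw_def)
      also have "\<dots> \<le> length_const * norm z"
        using small Xtu XwA XwB XYz by (auto simp: length_const_def distrib_right)
      finally show ?thesis .
    qed
    obtain c' \<theta>' k' where "bend \<sigma> (LINT u|lborel. w u) c' \<theta>' k'" "\<theta>' 0 = \<theta> 0" "\<theta>' (LINT u|lborel. w u) = \<theta> L"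
      "chord (LINT u|lborel. w u) \<theta>' = V w"
      "integrable lborel (\<lambda>u. (k' u)\<^sup>2)" "(LINT u|lborel. (k' u)\<^sup>2) \<le> (LINT u|lborel. (k u)\<^sup>2 / w u)"
      unfolding V_def by (rule bend_reweight[OF b wi w0 wout wk qi])
    thus ?thesis using Vz len energy by (intro that) (auto simp: z_def)
  qed
qed

section \<open>Regularity of minimizers\<close>

text \<open>Competitors have the same end angles, not merely the same end directions. Reweighting
  keeps the values of the angle, so the comparisons that follow stay in this smaller class.\<close>

definition least_energy :: "real \<Rightarrow> (real \<Rightarrow> real) \<Rightarrow> real \<Rightarrow> bool" where
  "least_energy L \<theta> e \<longleftrightarrow> (\<forall>\<sigma>' L' c' \<theta>' k'. bend \<sigma>' L' c' \<theta>' k' \<longrightarrow> integrable lborel (\<lambda>u. (k' u)\<^sup>2) \<longrightarrow>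
     chord L' \<theta>' = chord L \<theta> \<longrightarrow> \<theta>' 0 = \<theta> 0 \<longrightarrow> \<theta>' L' = \<theta> L \<longrightarrow> e \<le> (LINT u|lborel. (k' u)\<^sup>2))"

lemma chord_open_interval:
  assumes "\<theta> \<in> borel_measurable borel"
  shows "chord L \<theta> = (LINT u|lborel. indicat_real {0<..<L} u *\<^sub>R cis (\<theta> u))"
  unfolding chord_def set_lebesgue_integral_def
proof (rule integral_cong_AE)
  note assms[measurable]
  show "(\<lambda>s. indicat_real {0..L} s *\<^sub>R cis (\<theta> s)) \<in> borel_measurable lborel"
    "(\<lambda>s. indicat_real {0<..<L} s *\<^sub>R cis (\<theta> s)) \<in> borel_measurable lborel" by measurable
  show "AE s in lborel. indicat_real {0..L} s *\<^sub>R cis (\<theta> s) = indicat_real {0<..<L} s *\<^sub>R cis (\<theta> s)"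
    using AE_lborel_singleton[of 0] AE_lborel_singleton[of L] by eventually_elim (auto simp: indicator_def)
qed

lemma integrable_scaleR_cis:
  assumes "integrable lborel w" and [measurable]: "\<theta> \<in> borel_measurable borel"
  shows "integrable lborel (\<lambda>u. w u *\<^sub>R cis (\<theta> u))"
proof (rule Bochner_Integration.integrable_bound[OF assms(1)])
  have [measurable]: "w \<in> borel_measurable borel" using assms(1) by simp
  show "(\<lambda>u. w u *\<^sub>R cis (\<theta> u)) \<in> borel_measurable lborel" by measurable
qed simp

lemma integrable_bounded_on_interval:
  fixes g :: "real \<Rightarrow> real"
  assumes "g \<in> borel_measurable borel" "\<And>u. u \<notin> {0<..<L} \<Longrightarrow> g u = 0" "\<And>u. \<bar>g u\<bar> \<le> M" "0 \<le> L"
  shows "integrable lborel g"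
proof (rule Bochner_Integration.integrable_bound)
  show "integrable lborel (\<lambda>u. M * indicat_real {0<..<L} u)"
    by (intro integrable_mult_right integrable_real_indicator) (use assms(4) in auto)
  have "0 \<le> M" using assms(3)[of 0] by linarith
  hence "norm (g u) \<le> norm (M * indicat_real {0<..<L} u)" for u
    using assms(2)[of u] assms(3)[of u] by (auto simp: indicator_def)
  thus "AE u in lborel. norm (g u) \<le> norm (M * indicat_real {0<..<L} u)" by simp
qed (use assms in auto)

text \<open>Reweight by 1 + e h. The chord does not change, and 1 / (1 + x) \<le> 1 - x + 2 x^2 for
  |x| \<le> 1/2 expands the energy to second order in e. As e may have either sign, the first-order
  term must vanish.\<close>

lemma first_variation:
  assumes b: "bend \<sigma> L c \<theta> k" and k2: "integrable lborel (\<lambda>u. (k u)\<^sup>2)"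
    and least: "least_energy L \<theta> (LINT u|lborel. (k u)\<^sup>2)"
    and h[measurable]: "h \<in> borel_measurable borel" "\<And>u. u \<notin> {0<..<L} \<Longrightarrow> h u = 0" "\<And>u. \<bar>h u\<bar> \<le> M"
    and h0: "(LINT u|lborel. h u *\<^sub>R cis (\<theta> u)) = 0"
  shows "(LINT u|lborel. (k u)\<^sup>2 * h u) = 0"
proof -
  note f = bend_facts[OF b]
  have [measurable]: "k \<in> borel_measurable borel" by (rule f(6))
  have [measurable]: "\<theta> \<in> borel_measurable borel" by (rule bend_continuous[OF b])
  have M0: "0 \<le> M" using h(3)[of 0] by linarith
  have hi: "integrable lborel h" by (rule integrable_bounded_on_interval[OF h f(4)])
  have khi: "integrable lborel (\<lambda>u. (k u)\<^sup>2 * h u)"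
  proof (rule Bochner_Integration.integrable_bound)
    show "integrable lborel (\<lambda>u. M * (k u)\<^sup>2)" using k2 by simp
    show "AE u in lborel. norm ((k u)\<^sup>2 * h u) \<le> norm (M * (k u)\<^sup>2)"
      using h(3) M0 by (intro AE_I2) (simp add: abs_mult mult.commute mult_right_mono)
  qed simp
  define K where "K = (LINT u|lborel. (k u)\<^sup>2)"
  define H where "H = (LINT u|lborel. (k u)\<^sup>2 * h u)"
  have ineq: "0 \<le> - e * H + 2 * e\<^sup>2 * (M\<^sup>2 * K)" if e: "\<bar>e\<bar> * M \<le> 1/2" for e
  proof -
    define w where "w = (\<lambda>u. indicat_real {0<..<L} u + e * h u)"
    have wi: "integrable lborel w" unfolding w_def
      by (intro Bochner_Integration.integrable_add integrable_mult_right hi integrable_real_indicator) (use f(4) in auto)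
    have eh: "\<bar>e * h u\<bar> \<le> 1/2" for u
      using mult_left_mono[OF h(3)[of u], of "\<bar>e\<bar>"] e by (simp add: abs_mult)
    have win: "1/2 \<le> w u" if "u \<in> {0<..<L}" for u using eh[of u] that by (simp add: w_def abs_le_iff)
    have wout: "w u = 0" if "u \<notin> {0<..<L}" for u using h(2)[OF that] that by (simp add: w_def)
    have w0: "0 \<le> w u" for u using win[of u] wout[of u] by (cases "u \<in> {0<..<L}") auto
    have wk: "k u = 0" if "w u = 0" for u using win[of u] f(7)[of u] that by (cases "u \<in> {0<..<L}") auto
    have qle: "(k u)\<^sup>2 / w u \<le> (k u)\<^sup>2 - e * ((k u)\<^sup>2 * h u) + 2 * e\<^sup>2 * M\<^sup>2 * (k u)\<^sup>2" for u
    proof (cases "u \<in> {0<..<L}")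
      case True
      define x where "x = e * h u"
      have x: "\<bar>x\<bar> \<le> 1/2" "w u = 1 + x" using eh[of u] True by (simp_all add: x_def w_def)
      have "(1 - x + 2 * x\<^sup>2) * (1 + x) = 1 + x\<^sup>2 * (1 + 2 * x)" by (simp add: algebra_simps power2_eq_square)
      also have "\<dots> \<ge> 1" using x(1) by simp
      finally have "1 / (1 + x) \<le> 1 - x + 2 * x\<^sup>2" using x(1) by (simp add: pos_divide_le_eq)
      also have "x\<^sup>2 \<le> e\<^sup>2 * M\<^sup>2"
        using h(3)[of u] M0 by (simp add: x_def power_mult_distrib mult_left_mono abs_le_square_iff[symmetric])
      finally have "(k u)\<^sup>2 * (1 / (1 + x)) \<le> (k u)\<^sup>2 * (1 - x + 2 * (e\<^sup>2 * M\<^sup>2))" by (intro mult_left_mono) auto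
      thus ?thesis unfolding x(2) by (simp add: x_def algebra_simps)
    qed (use f(7) in simp)
    have ri: "integrable lborel (\<lambda>u. (k u)\<^sup>2 - e * ((k u)\<^sup>2 * h u) + 2 * e\<^sup>2 * M\<^sup>2 * (k u)\<^sup>2)"
      by (intro Bochner_Integration.integrable_add Bochner_Integration.integrable_diff integrable_mult_right k2 khi)
    have qi: "integrable lborel (\<lambda>u. (k u)\<^sup>2 / w u)"
    proof (rule Bochner_Integration.integrable_bound[OF ri])
      show "(\<lambda>u. (k u)\<^sup>2 / w u) \<in> borel_measurable lborel" using borel_measurable_integrable[OF wi] by simp
      show "AE u in lborel. norm ((k u)\<^sup>2 / w u) \<le> norm ((k u)\<^sup>2 - e * ((k u)\<^sup>2 * h u) + 2 * e\<^sup>2 * M\<^sup>2 * (k u)\<^sup>2)"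
      proof (rule AE_I2)
        fix u
        have "0 \<le> (k u)\<^sup>2 / w u" using w0[of u] by simp
        thus "norm ((k u)\<^sup>2 / w u) \<le> norm ((k u)\<^sup>2 - e * ((k u)\<^sup>2 * h u) + 2 * e\<^sup>2 * M\<^sup>2 * (k u)\<^sup>2)"
          using qle[of u] unfolding real_norm_def by linarith
      qed
    qed
    obtain c' \<theta>' k' where n: "bend \<sigma> (LINT u|lborel. w u) c' \<theta>' k'" "\<theta>' 0 = \<theta> 0" "\<theta>' (LINT u|lborel. w u) = \<theta> L"
      "chord (LINT u|lborel. w u) \<theta>' = (LINT u|lborel. w u *\<^sub>R cis (\<theta> u))"
      "integrable lborel (\<lambda>u. (k' u)\<^sup>2)" "(LINT u|lborel. (k' u)\<^sup>2) \<le> (LINT u|lborel. (k u)\<^sup>2 / w u)"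
      by (rule bend_reweight[OF b wi w0 wout wk qi])
    have "(LINT u|lborel. w u *\<^sub>R cis (\<theta> u)) = (LINT u|lborel. indicat_real {0<..<L} u *\<^sub>R cis (\<theta> u) + e *\<^sub>R (h u *\<^sub>R cis (\<theta> u)))"
      by (simp add: w_def scaleR_add_left)
    also have "\<dots> = chord L \<theta>"
    proof -
      have "integrable lborel (\<lambda>u. indicat_real {0<..<L} u *\<^sub>R cis (\<theta> u))"
        by (rule integrable_scaleR_cis) (use f(4) in \<open>auto intro!: integrable_real_indicator\<close>)
      moreover have "integrable lborel (\<lambda>u. e *\<^sub>R (h u *\<^sub>R cis (\<theta> u)))"
        by (intro integrable_scaleR_right integrable_scaleR_cis hi) simp
      ultimately have "(LINT u|lborel. indicat_real {0<..<L} u *\<^sub>R cis (\<theta> u) + e *\<^sub>R (h u *\<^sub>R cis (\<theta> u)))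
        = (LINT u|lborel. indicat_real {0<..<L} u *\<^sub>R cis (\<theta> u)) + (LINT u|lborel. e *\<^sub>R (h u *\<^sub>R cis (\<theta> u)))"
        by (rule Bochner_Integration.integral_add)
      also have "(LINT u|lborel. e *\<^sub>R (h u *\<^sub>R cis (\<theta> u))) = 0"
        unfolding integral_scaleR_right h0 by simp
      finally show ?thesis by (simp add: chord_open_interval)
    qed
    finally have "chord (LINT u|lborel. w u) \<theta>' = chord L \<theta>" using n(4) by simp
    hence "K \<le> (LINT u|lborel. (k' u)\<^sup>2)"
      using least[unfolded least_energy_def, rule_format, OF n(1,5) _ n(2,3)] unfolding K_def by blast
    also have "\<dots> \<le> (LINT u|lborel. (k u)\<^sup>2 / w u)" by (rule n(6))
    also have "\<dots> \<le> (LINT u|lborel. (k u)\<^sup>2 - e * ((k u)\<^sup>2 * h u) + 2 * e\<^sup>2 * M\<^sup>2 * (k u)\<^sup>2)"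
      by (rule integral_mono[OF qi ri qle])
    also have "\<dots> = K - e * H + 2 * e\<^sup>2 * M\<^sup>2 * K" using k2 khi by (simp add: K_def H_def)
    finally show ?thesis by (simp add: mult.assoc)
  qed
  have "H = 0"
  proof (rule ccontr)
    assume "H \<noteq> 0"
    \<comment> \<open>Taking N > M^2 K makes the first-order gain e H exceed the second-order loss 2
      e^2 M^2 K for e = H / (2 N), while N \<ge> M |H| keeps |e| M \<le> 1/2.\<close>
    define N where "N = M\<^sup>2 * K + M * \<bar>H\<bar> + 1"
    have K0: "0 \<le> K" unfolding K_def by simp
    have N: "0 < N" "M\<^sup>2 * K < N" "M * \<bar>H\<bar> \<le> N" using K0 M0 by (auto simp: N_def add_nonneg_pos)
    define e where "e = H / (2 * N)"
    have "\<bar>e\<bar> * M \<le> 1/2" using N by (simp add: e_def abs_mult pos_divide_le_eq mult.commute)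
    from ineq[OF this] have "e * H \<le> 2 * e\<^sup>2 * (M\<^sup>2 * K)" by simp
    also have "\<dots> < 2 * e\<^sup>2 * N" using N \<open>H \<noteq> 0\<close> by (intro mult_strict_left_mono) (auto simp: e_def)
    also have "\<dots> = e * H" using N(1) by (simp add: e_def power2_eq_square)
    finally show False by simp
  qed
  thus ?thesis by (simp add: H_def)
qed

section \<open>The squared curvature of a minimizer\<close>

lemma continuous_le_on_interval_if_AE:
  fixes g h :: "real \<Rightarrow> real"
  assumes "continuous_on UNIV g" "continuous_on UNIV h" "AE u in lborel. u \<in> {a<..<b} \<longrightarrow> g u \<le> h u" "a < b" "s \<in> {a..b}"
  shows "g s \<le> h s"
proof -
  have "closed {u. g u \<le> h u}" by (rule closed_Collect_le[OF assms(1,2)])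
  hence "u \<in> {u. g u \<le> h u}" if "u \<in> {a<..<b}" for u
    by (rule mem_closed_if_AE_lebesgue_open[OF open_greaterThanLessThan _ _ that])
       (use AE_completion[OF assms(3)] in \<open>auto elim: eventually_mono\<close>)
  hence "{a<..<b} \<subseteq> {u. g u \<le> h u}" by blast
  hence "closure {a<..<b} \<subseteq> {u. g u \<le> h u}" using \<open>closed _\<close> by (rule closure_minimal)
  thus ?thesis using assms(4,5) by (auto simp: closure_greaterThanLessThan)
qed

text \<open>If \<theta> moved away from \<theta> 0, the distance would by continuity take some value
  strictly between 0 and pi, where the sine is positive.\<close>

lemma constant_if_sin_differences_vanish:
  fixes \<theta> :: "real \<Rightarrow> real"
  assumes cont: "continuous_on {0..L} \<theta>" and sin: "\<And>s. s \<in> {0..L} \<Longrightarrow> sin (\<theta> s - \<theta> 0) = 0" and "s \<in> {0..L}"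
  shows "\<theta> s = \<theta> 0"
proof (rule ccontr)
  assume ne: "\<theta> s \<noteq> \<theta> 0"
  define d where "d = min 1 (\<bar>\<theta> s - \<theta> 0\<bar>)"
  have d: "0 < d" "d < pi" "d \<le> \<bar>\<theta> s - \<theta> 0\<bar>" using ne pi_gt3 by (auto simp: d_def min_def)
  have c: "continuous_on {0..s} (\<lambda>t. \<bar>\<theta> t - \<theta> 0\<bar>)"
    by (intro continuous_intros continuous_on_subset[OF cont]) (use assms(3) in auto)
  obtain t where t: "0 \<le> t" "t \<le> s" "\<bar>\<theta> t - \<theta> 0\<bar> = d"
    using IVT'[of "\<lambda>t. \<bar>\<theta> t - \<theta> 0\<bar>" 0 d s] c d assms(3) by auto
  have "sin \<bar>\<theta> t - \<theta> 0\<bar> = 0" using sin[of t] sin_minus[of "\<theta> t - \<theta> 0"] t assms(3) by (auto simp: abs_if)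
  moreover have "0 < sin d" using d by (intro sin_gt_zero) auto
  ultimately show False using t by simp
qed

text \<open>A Lagrange multiplier rule: k^2 annihilates every bounded h orthogonal to cos \<theta>
  and sin \<theta> on (0, L), hence lies in their span. These two functions are linearly independent
  because \<theta> is not constant. As k^2 is known only to be integrable, the remainder is tested
  against its sign instead of being projected in the space of square integrable functions.\<close>

lemma curvature_square_of_minimizer:
  assumes b: "bend \<sigma> L c \<theta> k" and k2: "integrable lborel (\<lambda>u. (k u)\<^sup>2)"
    and least: "least_energy L \<theta> (LINT u|lborel. (k u)\<^sup>2)" and "0 < L"
    and nc: "\<exists>s\<in>{0..L}. \<theta> s \<noteq> \<theta> 0"
  obtains \<alpha> \<beta> :: real where "AE u in lborel. u \<in> {0<..<L} \<longrightarrow> (k u)\<^sup>2 = \<alpha> * cos (\<theta> u) + \<beta> * sin (\<theta> u)"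
proof -
  note f = bend_facts[OF b]
  have [measurable]: "k \<in> borel_measurable borel" by (rule f(6))
  have tm[measurable]: "\<theta> \<in> borel_measurable borel" by (rule bend_continuous[OF b])
  have tc: "continuous_on A \<theta>" for A by (rule bend_continuous[OF b])
  define I where "I = indicat_real {0<..<L}"
  have I[measurable]: "I \<in> borel_measurable borel" unfolding I_def by measurable
  have Iout: "I u = 0" if "u \<notin> {0<..<L}" for u using that by (simp add: I_def)
  have bdd: "integrable lborel (\<lambda>u. I u * g u)" if [measurable]: "g \<in> borel_measurable borel" and "\<And>u. \<bar>g u\<bar> \<le> M" for g M
  proof (rule integrable_bounded_on_interval[OF _ _ _ f(4)])
    show "(\<lambda>u. I u * g u) \<in> borel_measurable borel" by measurable
    show "I u * g u = 0" if "u \<notin> {0<..<L}" for u using Iout[OF that] by simp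
    have "0 \<le> M" using that(2)[of 0] by linarith
    thus "\<bar>I u * g u\<bar> \<le> M" for u using that(2)[of u] by (auto simp: I_def indicator_def)
  qed
  have cs_le: "\<bar>cos x * cos y\<bar> \<le> 1" "\<bar>cos x * sin y\<bar> \<le> 1" "\<bar>sin x * sin y\<bar> \<le> 1" for x y :: real
    unfolding abs_mult by (auto intro!: mult_le_one)
  have bcc: "integrable lborel (\<lambda>u. I u * (cos (\<theta> u) * cos (\<theta> u)))"
    and bcs: "integrable lborel (\<lambda>u. I u * (cos (\<theta> u) * sin (\<theta> u)))"
    and bss: "integrable lborel (\<lambda>u. I u * (sin (\<theta> u) * sin (\<theta> u)))"
    by (rule bdd[where M=1]; (rule cs_le | measurable))+
  define p r x where "p = (LINT u|lborel. I u * (cos (\<theta> u) * cos (\<theta> u)))"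
    and "r = (LINT u|lborel. I u * (sin (\<theta> u) * sin (\<theta> u)))"
    and "x = (LINT u|lborel. I u * (cos (\<theta> u) * sin (\<theta> u)))"
  \<comment> \<open>The quadratic form of the Gram matrix is the integral of (\<gamma> cos \<theta>
    + \<delta> sin \<theta>)^2. If it vanishes, this combination is 0 at every time, which leaves
    only one angle modulo pi and makes \<theta> constant.\<close>
  have degenerate: False if nz: "(\<gamma>, \<delta>) \<noteq> (0, 0)" and zero: "\<gamma>\<^sup>2 * p + 2 * \<gamma> * \<delta> * x + \<delta>\<^sup>2 * r = 0" for \<gamma> \<delta>
  proof -
    define g where "g = (\<lambda>u. \<gamma> * cos (\<theta> u) + \<delta> * sin (\<theta> u))"
    have gI: "I u * (g u)\<^sup>2 = \<gamma>\<^sup>2 * (I u * (cos (\<theta> u) * cos (\<theta> u))) + 2 * \<gamma> * \<delta> * (I u * (cos (\<theta> u) * sin (\<theta> u)))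
       + \<delta>\<^sup>2 * (I u * (sin (\<theta> u) * sin (\<theta> u)))" for u
      by (simp add: g_def power2_eq_square algebra_simps)
    have i: "integrable lborel (\<lambda>u. I u * (g u)\<^sup>2)"
      unfolding gI by (intro Bochner_Integration.integrable_add integrable_mult_right bcc bcs bss)
    have "(LINT u|lborel. I u * (g u)\<^sup>2) = 0"
      unfolding gI using bcc bcs bss zero by (simp add: p_def x_def r_def)
    hence "AE u in lborel. I u * (g u)\<^sup>2 = 0"
      by (subst (asm) integral_nonneg_eq_0_iff_AE[OF i]) (auto simp: I_def)
    hence ae: "AE u in lborel. u \<in> {0<..<L} \<longrightarrow> (g u)\<^sup>2 \<le> 0" by eventually_elim (auto simp: I_def)
    have "continuous_on UNIV (\<lambda>u. (g u)\<^sup>2)" unfolding g_def by (intro continuous_intros tc)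
    hence "(g s)\<^sup>2 \<le> 0" if "s \<in> {0..L}" for s
      using continuous_le_on_interval_if_AE[OF _ continuous_on_const ae \<open>0 < L\<close> that] by blast
    hence g0: "\<gamma> * cos (\<theta> s) + \<delta> * sin (\<theta> s) = 0" if "s \<in> {0..L}" for s using that by (auto simp: g_def)
    have "sin (\<theta> s - \<theta> 0) = 0" if s: "s \<in> {0..L}" for s
    proof -
      have e: "\<gamma> * cos (\<theta> s) + \<delta> * sin (\<theta> s) = 0" "\<gamma> * cos (\<theta> 0) + \<delta> * sin (\<theta> 0) = 0"
        using g0[OF s] g0[of 0] \<open>0 < L\<close> by auto
      have "\<gamma> * sin (\<theta> s - \<theta> 0) = sin (\<theta> s) * (\<gamma> * cos (\<theta> 0) + \<delta> * sin (\<theta> 0)) - sin (\<theta> 0) * (\<gamma> * cos (\<theta> s) + \<delta> * sin (\<theta> s))"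
        by (simp add: sin_diff algebra_simps)
      moreover have "\<delta> * sin (\<theta> s - \<theta> 0) = cos (\<theta> 0) * (\<gamma> * cos (\<theta> s) + \<delta> * sin (\<theta> s)) - cos (\<theta> s) * (\<gamma> * cos (\<theta> 0) + \<delta> * sin (\<theta> 0))"
        by (simp add: sin_diff algebra_simps)
      ultimately show ?thesis using nz e by auto
    qed
    thus False using nc constant_if_sin_differences_vanish[OF tc] by blast
  qed
  \<comment> \<open>The Gram determinant of \<open>cos \<theta>\<close> and \<open>sin \<theta>\<close>\<close>
  define D where "D = p * r - x\<^sup>2"
  have D: "D \<noteq> 0"
  proof
    assume D0: "D = 0"
    show False
    proof (cases "r = 0")
      case True
      thus False using degenerate[of 0 1] by simp
    next
      case False
      have "r\<^sup>2 * p + 2 * r * (- x) * x + (- x)\<^sup>2 * r = r * D" by (simp add: D_def power2_eq_square algebra_simps)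
      thus False using degenerate[of r "- x"] D0 False by simp
    qed
  qed
  have kc: "integrable lborel (\<lambda>u. (k u)\<^sup>2 * g u)" if [measurable]: "g \<in> borel_measurable borel" and "\<And>u. \<bar>g u\<bar> \<le> 1" for g
    by (rule Bochner_Integration.integrable_bound[OF k2]) (use that(2) in \<open>auto simp: abs_mult intro!: mult_left_le\<close>)
  have kcos: "integrable lborel (\<lambda>u. (k u)\<^sup>2 * cos (\<theta> u))" and ksin: "integrable lborel (\<lambda>u. (k u)\<^sup>2 * sin (\<theta> u))"
    by (rule kc; simp)+
  define K1 K2 where "K1 = (LINT u|lborel. (k u)\<^sup>2 * cos (\<theta> u))" and "K2 = (LINT u|lborel. (k u)\<^sup>2 * sin (\<theta> u))"
  \<comment> \<open>Cramer's rule for the coefficients that make k^2 - \<alpha> cos \<theta> -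
    \<beta> sin \<theta> orthogonal to both functions on (0, L).\<close>
  define \<alpha> \<beta> where "\<alpha> = (r * K1 - x * K2) / D" and "\<beta> = (p * K2 - x * K1) / D"
  define F where "F = (\<lambda>u. I u * ((k u)\<^sup>2 - (\<alpha> * cos (\<theta> u) + \<beta> * sin (\<theta> u))))"
  \<comment> \<open>Integrating F against its own sign gives the integral of |F|, and the sign is
    bounded even where k is not.\<close>
  define h where "h = (\<lambda>u. I u * sgn (F u))"
  have Fm[measurable]: "F \<in> borel_measurable borel" unfolding F_def by measurable
  have hm[measurable]: "h \<in> borel_measurable borel" unfolding h_def by measurable
  have h1: "\<bar>h u\<bar> \<le> 1" for u by (auto simp: h_def I_def indicator_def sgn_if)
  have bh1: "integrable lborel (\<lambda>u. I u * (h u * cos (\<theta> u)))" and bh2: "integrable lborel (\<lambda>u. I u * (h u * sin (\<theta> u)))"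
    by (rule bdd[where M=1]; use h1 in \<open>simp add: abs_mult mult_le_one\<close>)+
  have Ih: "I u * h u = h u" "I u * (k u)\<^sup>2 = (k u)\<^sup>2" for u using f(7)[of u] by (auto simp: h_def I_def indicator_def)
  define v1 v2 where "v1 = (LINT u|lborel. h u * cos (\<theta> u))" and "v2 = (LINT u|lborel. h u * sin (\<theta> u))"
  have bh1': "integrable lborel (\<lambda>u. h u * cos (\<theta> u))" and bh2': "integrable lborel (\<lambda>u. h u * sin (\<theta> u))"
    using bh1 bh2 by (simp_all add: Ih(1) mult.assoc[symmetric])
  \<comment> \<open>The same linear system for h: subtracting these multiples makes h' admissible in
    the first variation.\<close>
  define \<mu> \<nu> where "\<mu> = (r * v1 - x * v2) / D" and "\<nu> = (p * v2 - x * v1) / D"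
  define h' where "h' = (\<lambda>u. h u - \<mu> * (I u * cos (\<theta> u)) - \<nu> * (I u * sin (\<theta> u)))"
  have "(LINT u|lborel. (k u)\<^sup>2 * h' u) = 0"
  proof (rule first_variation[OF b k2 least])
    show "h' \<in> borel_measurable borel" unfolding h'_def by measurable
    show "h' u = 0" if "u \<notin> {0<..<L}" for u using Iout[OF that] by (simp add: h'_def h_def)
    show "\<bar>h' u\<bar> \<le> 1 + \<bar>\<mu>\<bar> + \<bar>\<nu>\<bar>" for u
    proof -
      have "\<bar>\<mu> * (I u * cos (\<theta> u))\<bar> \<le> \<bar>\<mu>\<bar>" "\<bar>\<nu> * (I u * sin (\<theta> u))\<bar> \<le> \<bar>\<nu>\<bar>"
        unfolding abs_mult by (auto simp: I_def indicator_def intro!: mult_left_le)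
      thus ?thesis using h1[of u] unfolding h'_def by linarith
    qed
    have e1: "h' u * cos (\<theta> u) = h u * cos (\<theta> u) - \<mu> * (I u * (cos (\<theta> u) * cos (\<theta> u))) - \<nu> * (I u * (cos (\<theta> u) * sin (\<theta> u)))"
      and e2: "h' u * sin (\<theta> u) = h u * sin (\<theta> u) - \<mu> * (I u * (cos (\<theta> u) * sin (\<theta> u))) - \<nu> * (I u * (sin (\<theta> u) * sin (\<theta> u)))" for u
      by (simp_all add: h'_def algebra_simps)
    have i1: "integrable lborel (\<lambda>u. h' u * cos (\<theta> u))" "integrable lborel (\<lambda>u. h' u * sin (\<theta> u))"
      unfolding e1 e2 by (intro Bochner_Integration.integrable_diff integrable_mult_right bh1' bh2' bcc bcs bss)+
    have "(LINT u|lborel. h' u * cos (\<theta> u)) = v1 - \<mu> * p - \<nu> * x"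
      unfolding e1 using bh1' bcc bcs by (simp add: v1_def p_def x_def)
    also have "\<mu> * p + \<nu> * x = v1 * D / D"
      by (simp add: \<mu>_def \<nu>_def D_def add_divide_distrib[symmetric] power2_eq_square algebra_simps)
    hence "v1 - \<mu> * p - \<nu> * x = 0" using D by simp
    finally have c0: "(LINT u|lborel. h' u * cos (\<theta> u)) = 0" .
    have "(LINT u|lborel. h' u * sin (\<theta> u)) = v2 - \<mu> * x - \<nu> * r"
      unfolding e2 using bh2' bss bcs by (simp add: v2_def r_def x_def)
    also have "\<mu> * x + \<nu> * r = v2 * D / D"
      by (simp add: \<mu>_def \<nu>_def D_def add_divide_distrib[symmetric] power2_eq_square algebra_simps)
    hence "v2 - \<mu> * x - \<nu> * r = 0" using D by simp
    finally have s0: "(LINT u|lborel. h' u * sin (\<theta> u)) = 0" .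
    have e: "h' u *\<^sub>R cis (\<theta> u) = complex_of_real (h' u * cos (\<theta> u)) + complex_of_real (h' u * sin (\<theta> u)) * \<i>" for u
      by (simp add: complex_eq_iff)
    show "(LINT u|lborel. h' u *\<^sub>R cis (\<theta> u)) = 0" unfolding e integral_complex_combination(2)[OF i1] c0 s0 by simp
  qed
  moreover have "(k u)\<^sup>2 * h' u = (k u)\<^sup>2 * h u - \<mu> * ((k u)\<^sup>2 * cos (\<theta> u)) - \<nu> * ((k u)\<^sup>2 * sin (\<theta> u))" for u
  proof -
    have "(k u)\<^sup>2 * h' u = (k u)\<^sup>2 * h u - \<mu> * ((I u * (k u)\<^sup>2) * cos (\<theta> u)) - \<nu> * ((I u * (k u)\<^sup>2) * sin (\<theta> u))"
      by (simp add: h'_def algebra_simps)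
    thus ?thesis unfolding Ih .
  qed
  moreover have kh: "integrable lborel (\<lambda>u. (k u)\<^sup>2 * h u)" by (rule kc[OF hm h1])
  ultimately have "(LINT u|lborel. (k u)\<^sup>2 * h u) = \<mu> * K1 + \<nu> * K2"
    using kcos ksin by (simp add: K1_def K2_def)
  \<comment> \<open>Symmetry of the inverse Gram matrix moves it from h to k^2. The result says that
    the integral of F h is 0, that is, F = 0 almost everywhere.\<close>
  also have "\<dots> = \<alpha> * v1 + \<beta> * v2"
    by (simp add: \<mu>_def \<nu>_def \<alpha>_def \<beta>_def add_divide_distrib[symmetric] algebra_simps)
  finally have eq: "(LINT u|lborel. (k u)\<^sup>2 * h u) = \<alpha> * v1 + \<beta> * v2" .
  have Fh: "\<bar>F u\<bar> = (k u)\<^sup>2 * h u - \<alpha> * (h u * cos (\<theta> u)) - \<beta> * (h u * sin (\<theta> u))" for u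
  proof -
    have "\<bar>F u\<bar> = F u * sgn (F u)" by (simp add: abs_sgn)
    also have "\<dots> = ((k u)\<^sup>2 - (\<alpha> * cos (\<theta> u) + \<beta> * sin (\<theta> u))) * h u" by (simp add: F_def h_def)
    finally show ?thesis by (simp add: algebra_simps)
  qed
  have Fi: "integrable lborel (\<lambda>u. \<bar>F u\<bar>)" unfolding Fh
    by (intro Bochner_Integration.integrable_diff integrable_mult_right bh1' bh2' kh)
  have "(LINT u|lborel. \<bar>F u\<bar>) = 0"
    unfolding Fh using kh bh1' bh2' eq by (simp add: v1_def v2_def)
  hence "AE u in lborel. \<bar>F u\<bar> = 0" by (subst (asm) integral_nonneg_eq_0_iff_AE[OF Fi]) auto
  hence "AE u in lborel. u \<in> {0<..<L} \<longrightarrow> (k u)\<^sup>2 = \<alpha> * cos (\<theta> u) + \<beta> * sin (\<theta> u)"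
    by eventually_elim (auto simp: F_def I_def)
  thus ?thesis by (rule that)
qed

text \<open>The cut is made at two times of equal angle around the extremum, so the integral of the
  density between them is 0 and deleting it leaves the angle unchanged elsewhere.\<close>

lemma bend_truncate:
  assumes b: "bend \<sigma> L c \<theta> k" and s: "0 \<le> s1" "s1 \<le> c" "c \<le> s2" "s2 \<le> L" and eq: "\<theta> s1 = \<theta> s2"
  shows "bend \<sigma> L c (\<lambda>s. if s \<in> {s1..s2} then \<theta> s1 else \<theta> s) (\<lambda>u. if u \<in> {s1<..<s2} then 0 else k u)"
    (is "bend \<sigma> L c ?\<theta> ?k")
proof -
  note f = bend_facts[OF b]
  have [measurable]: "k \<in> borel_measurable borel" by (rule f(6))
  have ki: "integrable lborel ?k"
    by (rule Bochner_Integration.integrable_bound[OF f(5)]) auto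
  have zero: "primitive ?k 0 = primitive k 0"
    unfolding primitive_def set_lebesgue_integral_def
    by (rule Bochner_Integration.integral_cong) (use f(7) s in \<open>auto simp: indicator_def\<close>)
  have low: "primitive ?k s = primitive k s" if "s \<le> s1" for s
    unfolding primitive_def set_lebesgue_integral_def
    by (rule Bochner_Integration.integral_cong) (use that in \<open>auto simp: indicator_def\<close>)
  have mid: "primitive ?k s = primitive k s1" if "s1 \<le> s" "s \<le> s2" for s
    using primitive_const[OF ki that(1)] that(2) low[of s1] by auto
  have high: "primitive ?k s = primitive k s" if "s2 \<le> s" for s
  proof -
    have "primitive ?k s - primitive ?k s2 = (LINT u:{s2<..s}|lborel. ?k u)" by (rule primitive_diff[OF ki that])
    also have "\<dots> = (LINT u:{s2<..s}|lborel. k u)" unfolding set_lebesgue_integral_def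
      by (rule Bochner_Integration.integral_cong) (auto simp: indicator_def)
    also have "\<dots> = primitive k s - primitive k s2" by (rule primitive_diff[OF f(5) that, symmetric])
    finally show ?thesis using mid[of s2] s f(10)[of s1] f(10)[of s2] eq by linarith
  qed
  have p: "\<theta> s1 = \<theta> 0 + primitive k s1" "\<theta> s2 = \<theta> 0 + primitive k s2" by (rule f(10))+
  have \<theta>0: "?\<theta> 0 = \<theta> 0" using s by auto
  have \<theta>L: "?\<theta> L = \<theta> L" using s eq by auto
  have \<theta>c: "?\<theta> c = \<theta> s1" using s by auto
  have \<sigma>m: "\<sigma> * \<theta> 0 \<le> \<sigma> * \<theta> s1" "\<sigma> * \<theta> s1 \<le> \<sigma> * \<theta> c" "\<sigma> * \<theta> L \<le> \<sigma> * \<theta> s2"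
    using bend_mono(1)[OF b s(1,2)] bend_mono(1)[OF b s(2)] bend_mono(2)[OF b s(4,3)] by auto
  show ?thesis unfolding bend_def
  proof (intro conjI allI impI f(1-3) ki)
    show "?\<theta> s = ?\<theta> 0 + primitive ?k s" for s
    proof -
      consider "s < s1" | "s1 \<le> s" "s \<le> s2" | "s2 < s" by linarith
      thus ?thesis
      proof cases
        case 1 thus ?thesis unfolding \<theta>0 using low[of s] f(10)[of s] by auto
      next
        case 2 thus ?thesis unfolding \<theta>0 using mid[OF 2] p by auto
      next
        case 3 thus ?thesis unfolding \<theta>0 using high[of s] f(10)[of s] by auto
      qed
    qed
    show "\<bar>?\<theta> c - ?\<theta> 0\<bar> \<le> pi" unfolding \<theta>0 \<theta>c using \<sigma>m f(1,11) by auto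
    show "\<bar>?\<theta> L - ?\<theta> c\<bar> \<le> pi" unfolding \<theta>L \<theta>c using \<sigma>m eq f(1,12) by auto
  qed (use f(7-9) in auto)
qed

text \<open>If q c > 0, deleting the bending of the tip saves at least q0 times its width s2 - s1.
  Orthogonally to the direction at the cut, the tip contributes at most \<delta> times this width to
  the chord; shrinking an arc away from the tip compensates for this at a cost of order \<delta>
  times the width, which is less once \<delta> is small.\<close>

lemma no_corner_at_peak:
  assumes b: "bend \<sigma> L c \<theta> k" and k2: "integrable lborel (\<lambda>u. (k u)\<^sup>2)"
    and least: "least_energy L \<theta> (LINT u|lborel. (k u)\<^sup>2)" and c: "0 < c" "c < L"
    and q: "continuous_on UNIV q" "AE u in lborel. u \<in> {0<..<L} \<longrightarrow> (k u)\<^sup>2 = q u"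
  shows "q c \<le> 0"
proof (rule ccontr)
  assume "\<not> q c \<le> 0"
  define q0 where "q0 = q c / 2"
  have q0: "0 < q0" "q0 < q c" using \<open>\<not> q c \<le> 0\<close> by (auto simp: q0_def)
  note f = bend_facts[OF b]
  have [measurable]: "k \<in> borel_measurable borel" by (rule f(6))
  have tm[measurable]: "\<theta> \<in> borel_measurable borel" by (rule bend_continuous[OF b])
  have tc: "continuous_on A \<theta>" for A by (rule bend_continuous[OF b])
  have \<sigma>\<sigma>: "\<sigma> * (\<sigma> * x) = x" for x using f(1) by auto
  define d where "d = (\<lambda>s. \<sigma> * (\<theta> c - \<theta> s))"
  have dcont: "continuous_on A d" for A unfolding d_def by (intro continuous_intros tc)
  have d0: "0 \<le> d s" "d c = 0" for s using bend_range(1)[OF b, of s] by (simp_all add: d_def right_diff_distrib)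
  have mono1: "d t \<le> d s" if "s \<le> t" "t \<le> c" for s t using bend_mono(1)[OF b that] by (simp add: d_def right_diff_distrib)
  have mono2: "d s \<le> d t" if "s \<le> t" "c \<le> s" for s t using bend_mono(2)[OF b that] by (simp add: d_def right_diff_distrib)
  obtain r where r: "0 < r" "r < c" "r < L - c" "\<And>s. \<bar>s - c\<bar> \<le> r \<Longrightarrow> q0 \<le> q s \<and> d s \<le> 1"
  proof -
    have "isCont q c" "isCont d c" using q(1) dcont[of UNIV] by (auto simp: continuous_on_eq_continuous_at)
    hence lim: "(q \<longlongrightarrow> q c) (nhds c)" "(d \<longlongrightarrow> d c) (nhds c)"
      unfolding isCont_def tendsto_at_iff_tendsto_nhds by auto
    have "eventually (\<lambda>s. q0 < q s) (nhds c)" by (rule order_tendstoD(1)[OF lim(1) q0(2)])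
    moreover have "eventually (\<lambda>s. d s < 1) (nhds c)" by (rule order_tendstoD(2)[OF lim(2)]) (simp add: d0)
    ultimately have "eventually (\<lambda>s. q0 < q s \<and> d s < 1) (nhds c)" by eventually_elim auto
    then obtain \<rho> where \<rho>: "0 < \<rho>" "\<And>s. \<bar>s - c\<bar> < \<rho> \<Longrightarrow> q0 < q s \<and> d s < 1"
      unfolding eventually_nhds_metric dist_real_def by blast
    define r where "r = min (\<rho> / 2) (min (c / 2) ((L - c) / 2))"
    have r: "r \<le> \<rho>/2" "r \<le> c/2" "r \<le> (L-c)/2" "0 < r"
      using \<rho>(1) c unfolding r_def by (simp_all only: min_le_iff_disj min_less_iff_conj) auto
    have "q0 \<le> q s \<and> d s \<le> 1" if "\<bar>s - c\<bar> \<le> r" for s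
    proof -
      have "\<bar>s - c\<bar> < \<rho>" using that \<open>r \<le> \<rho>/2\<close> \<rho>(1) by linarith
      from \<rho>(2)[OF this] show ?thesis by auto
    qed
    moreover have "c / 2 < c" "(L - c) / 2 < L - c" using c by simp_all
    moreover from this r have "r < c" "r < L - c" by (blast intro: le_less_trans)+
    ultimately show ?thesis using \<open>0 < r\<close> by (intro that[of r]) auto
  qed
  \<comment> \<open>An arc to the left of the tip, at a positive distance from c, where the angle
    differs from that at the cut by a fixed amount. The distance is needed so that shrinking this
    arc has an effect orthogonal to the cut that does not fade with \<delta>.\<close>
  define j where "j = c - r / 2"
  define J where "J = {c - r<..<j}"
  have j: "c - r < j" "j < c" "0 < c - r" using r by (auto simp: j_def)
  have [measurable]: "J \<in> sets borel" by (simp add: J_def)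
  have qae: "AE u in lborel. \<bar>u - c\<bar> < r \<longrightarrow> q0 \<le> (k u)\<^sup>2"
    using q(2)
  proof eventually_elim
    case (elim u)
    show ?case using elim r(2,3) r(4)[of u] by (auto simp: abs_less_iff)
  qed
  \<comment> \<open>If d vanished at a second point near c, monotonicity would make the angle
    constant in between, so k = 0 there, against k^2 \<ge> q0 almost everywhere.\<close>
  have dpos: "0 < d s" if s: "c - r < s" "s < c \<or> c < s" "s < c + r" for s
  proof (rule ccontr)
    assume "\<not> 0 < d s"
    hence ds: "d s = 0" using d0(1)[of s] by simp
    define a1 a2 where "a1 = min s c" and "a2 = max s c"
    have "AE u in lborel. u \<in> {a1<..<a2} \<longrightarrow> False"
      using bend_AE_derivative[OF b] qae
    proof eventually_elim
      case (elim u)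
      show ?case
      proof
        assume u: "u \<in> {a1<..<a2}"
        have const: "d v = 0" if "v \<in> {a1<..<a2}" for v
          using mono1[of s v] mono2[of v s] ds d0(1)[of v] that by (auto simp: a1_def a2_def min_def max_def split: if_splits)
        have "(\<theta> has_real_derivative 0) (at u)"
        proof (rule DERIV_cong_ev[THEN iffD1, OF refl _ refl])
          show "((\<lambda>_. \<theta> c) has_real_derivative 0) (at u)" by simp
          have "eventually (\<lambda>v. v \<in> {a1<..<a2}) (nhds u)" using u by (intro eventually_nhds_in_open) auto
          thus "eventually (\<lambda>v. \<theta> c = \<theta> v) (nhds u)"
          proof eventually_elim
            case (elim v) thus ?case using const[of v] f(1) by (auto simp: d_def)
          qed
        qed
        hence "k u = 0" using elim(1) by (rule DERIV_unique[symmetric])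
        moreover have "\<bar>u - c\<bar> < r" using u s by (auto simp: a1_def a2_def)
        ultimately show False using elim(2) q0 by simp
      qed
    qed
    hence "AE u in lborel. u \<notin> {a1<..<a2}" by eventually_elim auto
    hence "emeasure lborel {a1<..<a2} = 0" 
      using AE_iff_null_sets[of "{a1<..<a2}" lborel] by auto
    moreover have "a1 < a2" using s(2) by (auto simp: a1_def a2_def)
    ultimately show False by simp
  qed
  define M1 where "M1 = d j"
  define M2 where "M2 = d (c + r / 2)"
  have M: "0 < M1" "0 < M2" "M1 \<le> 1" unfolding M1_def M2_def using r j by (auto intro!: dpos simp: j_def)
  \<comment> \<open>The length r / 2 of J times the least sine over J when \<delta> \<le> M1 / 2: a
    lower bound for \<open>sJ\<close> that does not depend on \<delta>.\<close>
  define D0 where "D0 = r / 2 * sin (M1 / 2)"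
  have D0: "0 < D0" unfolding D0_def using r(1) M pi_gt3 by (intro mult_pos_pos sin_gt_zero) auto
  define K where "K = (LINT u|lborel. (k u)\<^sup>2)"
  have K0: "0 \<le> K" unfolding K_def by simp
  \<comment> \<open>The first two bounds make the height \<delta> attained on both sides of c and
    separate the angles over J from the cut, the third gives a \<le> 1/2, and the last makes the
    cost smaller than the gain.\<close>
  define \<delta> where "\<delta> = min (min (M1 / 2) M2) (min (D0 / (2 * L)) (q0 * D0 / (4 * K + 1)))"
  have \<delta>: "0 < \<delta>" "\<delta> \<le> M1 / 2" "\<delta> \<le> M2" "\<delta> \<le> D0 / (2 * L)" "\<delta> \<le> q0 * D0 / (4 * K + 1)"
    using M D0 q0 K0 c unfolding \<delta>_def by (simp_all only: min_le_iff_disj min_less_iff_conj) auto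
  obtain s1 where s1: "j \<le> s1" "s1 \<le> c" "d s1 = \<delta>"
    using IVT2'[of d c \<delta> j] dcont d0(2) \<delta> M j by (auto simp: M1_def)
  obtain s2 where s2: "c \<le> s2" "s2 \<le> c + r / 2" "d s2 = \<delta>"
    using IVT'[of d c \<delta> "c + r / 2"] dcont d0(2) \<delta> M r by (auto simp: M2_def)
  have ne: "s1 < c" "c < s2" using s1 s2 d0(2) \<delta>(1) by (auto simp: less_le)
  define I where "I = {s1<..<s2}"
  have [measurable]: "I \<in> sets borel" by (simp add: I_def)
  define p where "p = \<theta> s1"
  have ts: "\<theta> s1 = \<theta> s2" using s1(3) s2(3) f(1) by (auto simp: d_def)
  have sp: "\<sigma> * (\<theta> s - p) = \<delta> - d s" for s using s1(3) by (simp add: d_def p_def right_diff_distrib) 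
  have near: "\<bar>u - c\<bar> < r" "u \<in> {0<..<L}" if "u \<in> I \<or> u \<in> J" for u
    using that s1 s2 r j by (auto simp: I_def J_def j_def abs_less_iff)
  have IJ: "u \<notin> J" if "u \<in> I" for u using that s1 by (auto simp: I_def J_def)
  have dI: "0 \<le> d u" "d u \<le> \<delta>" if "u \<in> I" for u
    using d0(1)[of u] mono1[of s1 u] mono2[of u s2] s1 s2 that by (cases "u \<le> c"; auto simp: I_def)+
  have dJ: "M1 \<le> d u" "d u \<le> 1" if "u \<in> J" for u
    using mono1[of u j] r(4)[of u] near(1)[of u] that j by (auto simp: J_def M1_def)
  let ?\<theta> = "\<lambda>s. if s \<in> {s1..s2} then \<theta> s1 else \<theta> s"
  let ?k = "\<lambda>u. if u \<in> {s1<..<s2} then 0 else k u"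
  have bt: "bend \<sigma> L c ?\<theta> ?k"
    by (rule bend_truncate[OF assms(1)]) (use s1 s2 j r c ts in auto)
  have i_ind: "integrable lborel (\<lambda>u. indicat_real S u * g u)" if SIJ: "S = I \<or> S = J" and "g \<in> borel_measurable borel" "\<And>u. \<bar>g u\<bar> \<le> 1" for S g
  proof (rule integrable_bounded_on_interval[OF _ _ _ f(4), where M=1])
    have [measurable]: "S \<in> sets borel" "g \<in> borel_measurable borel" using that(1,2) by auto
    show "(\<lambda>u. indicat_real S u * g u) \<in> borel_measurable borel" by measurable
    show "indicat_real S u * g u = 0" if "u \<notin> {0<..<L}" for u using near(2)[of u] that SIJ by (auto simp: indicator_def)
    show "\<bar>indicat_real S u * g u\<bar> \<le> 1" for u using that(3)[of u] by (auto simp: indicator_def)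
  qed
  define sI cI sJ cJ where "sI = (LINT u|lborel. indicat_real I u * sin (\<sigma> * (\<theta> u - p)))"
    and "cI = (LINT u|lborel. indicat_real I u * cos (\<sigma> * (\<theta> u - p)))"
    and "sJ = (LINT u|lborel. indicat_real J u * sin (- (\<sigma> * (\<theta> u - p))))"
    and "cJ = (LINT u|lborel. indicat_real J u * cos (\<sigma> * (\<theta> u - p)))"
  have Ilen: "(LINT u|lborel. indicat_real I u * 1) = s2 - s1" "(LINT u|lborel. indicat_real J u * 1) = r / 2"
    using ne r by (simp_all add: I_def J_def j_def)
  have iI: "integrable lborel (\<lambda>u. indicat_real I u * 1)" "integrable lborel (\<lambda>u. indicat_real J u * 1)"
    by (rule i_ind; simp)+
  have iSI: "integrable lborel (\<lambda>u. indicat_real I u * sin (\<sigma> * (\<theta> u - p)))"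
    "integrable lborel (\<lambda>u. indicat_real I u * cos (\<sigma> * (\<theta> u - p)))"
    "integrable lborel (\<lambda>u. indicat_real J u * sin (- (\<sigma> * (\<theta> u - p))))"
    "integrable lborel (\<lambda>u. indicat_real J u * cos (\<sigma> * (\<theta> u - p)))"
    by (rule i_ind; (simp; fail | measurable))+
  have \<delta>1: "\<delta> \<le> 1/2" using \<delta> M by linarith
  have sI: "0 \<le> sI" "sI \<le> \<delta> * (s2 - s1)"
  proof -
    have *: "0 \<le> sin (\<sigma> * (\<theta> u - p)) \<and> sin (\<sigma> * (\<theta> u - p)) \<le> \<delta>" if "u \<in> I" for u
    proof -
      have "0 \<le> \<delta> - d u" "\<delta> - d u \<le> \<delta>" using dI[OF that] by auto
      thus ?thesis unfolding sp using \<delta>1 pi_gt3 sin_x_le_x[of "\<delta> - d u"] by (auto intro!: sin_ge_zero)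
    qed
    show "0 \<le> sI" unfolding sI_def using * by (intro integral_nonneg_AE) (auto simp: indicator_def)
    have "sI \<le> (LINT u|lborel. \<delta> * (indicat_real I u * 1))" unfolding sI_def
      by (intro integral_mono iSI integrable_mult_right iI) (use * in \<open>auto simp: indicator_def\<close>)
    thus "sI \<le> \<delta> * (s2 - s1)" using iI Ilen by simp
  qed
  have cosnn: "0 \<le> cos (\<sigma> * (\<theta> u - p))" if "u \<in> I \<or> u \<in> J" for u
    unfolding sp using dI[of u] dJ[of u] \<delta>1 M pi_gt3 d0(1)[of u] \<delta>(1) that by (intro cos_ge_zero) auto
  have cI: "0 \<le> cI" and cJ: "0 \<le> cJ"
    unfolding cI_def cJ_def using cosnn by (intro integral_nonneg_AE; auto simp: indicator_def)+
  have sJ: "D0 \<le> sJ"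
  proof -
    have *: "sin (M1 / 2) \<le> sin (- (\<sigma> * (\<theta> u - p)))" if "u \<in> J" for u
      unfolding sp using dJ[OF that] \<delta> M pi_gt3 by (intro sin_monotone_2pi_le) auto
    have "D0 = (LINT u|lborel. sin (M1 / 2) * (indicat_real J u * 1))" using iI Ilen by (simp add: D0_def)
    also have "\<dots> \<le> sJ" unfolding sJ_def
      by (intro integral_mono iSI integrable_mult_right iI) (use * in \<open>auto simp: indicator_def\<close>)
    finally show ?thesis .
  qed
  have sJ0: "0 < sJ" using sJ D0 by linarith
  \<comment> \<open>The tip \<open>I\<close> is replaced by a segment of direction \<open>p\<close>. Its chord then lacks \<open>sI\<close> orthogonally to \<open>p\<close>, which
    is made up for by shrinking the arc over \<open>J\<close> by the factor \<open>1 - a\<close>; the length \<open>\<rho> (s2 - s1)\<close> of the segment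
    accounts for the direction of \<open>p\<close>.\<close>
  define a where "a = sI / sJ"
  define \<rho> where "\<rho> = (cI + a * cJ) / (s2 - s1)"
  have a: "0 \<le> a" "a \<le> \<delta> * (s2 - s1) / D0"
    unfolding a_def using sI sJ0 sJ D0 \<delta> ne by (auto intro!: frac_le mult_nonneg_nonneg)
  have a2: "a \<le> 1/2"
  proof -
    have "\<delta> * (s2 - s1) / D0 \<le> D0 / (2 * L) * L / D0"
      using \<delta> D0 s1 s2 j r ne c by (intro divide_right_mono mult_mono) auto
    also have "\<dots> = 1/2" using D0 c by (simp add: field_simps)
    finally show ?thesis using a(2) by linarith
  qed
  have \<rho>0: "0 \<le> \<rho>" unfolding \<rho>_def using a cI cJ ne by (intro divide_nonneg_nonneg add_nonneg_nonneg mult_nonneg_nonneg) auto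
  define w where "w = (\<lambda>u. indicat_real {0<..<L} u + (\<rho> - 1) * (indicat_real I u * 1) + (- a) * (indicat_real J u * 1))"
  have Li: "integrable lborel (indicat_real {0<..<L})" by (rule integrable_real_indicator) (use f(4) in auto)
  have wi: "integrable lborel w" unfolding w_def
    by (intro Bochner_Integration.integrable_add integrable_mult_right iI Li)
  have wI: "w u = \<rho>" if "u \<in> I" for u using near(2)[of u] that IJ[OF that] by (simp add: w_def)
  have wJ: "w u = 1 - a" if "u \<in> J" for u using near(2)[of u] that IJ[of u] by (cases "u \<in> I") (simp_all add: w_def)
  have wL: "w u = 1" if "u \<in> {0<..<L}" "u \<notin> I" "u \<notin> J" for u using that by (simp add: w_def)
  have wout: "w u = 0" if "u \<notin> {0<..<L}" for u using that near(2)[of u] by (auto simp: w_def indicator_def)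
  have w0: "0 \<le> w u" for u
    using wI[of u] wJ[of u] wL[of u] wout[of u] \<rho>0 a2 by (cases "u \<in> {0<..<L}"; cases "u \<in> I"; cases "u \<in> J") auto
  have wk: "?k u = 0" if "w u = 0" for u
    using that wI[of u] wJ[of u] wL[of u] f(7)[of u] a2 by (cases "u \<in> {0<..<L}"; cases "u \<in> I"; cases "u \<in> J") (auto simp: I_def)
  have qle: "(?k u)\<^sup>2 / w u \<le> (k u)\<^sup>2 - indicator I u * (k u)\<^sup>2 + 2 * a * (k u)\<^sup>2" for u
  proof -
    have "1 / (1 - a) \<le> 1 + 2 * a" using a a2 by (simp add: pos_divide_le_eq) (simp add: algebra_simps mult_left_le)
    hence 1: "(k u)\<^sup>2 * (1 / (1 - a)) \<le> (k u)\<^sup>2 * (1 + 2 * a)" by (rule mult_left_mono) simp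
    have 2: "0 \<le> 2 * a * (k u)\<^sup>2" using a by simp
    consider "u \<in> I" | "u \<in> J" "u \<notin> I" | "u \<in> {0<..<L}" "u \<notin> I" "u \<notin> J" | "u \<notin> {0<..<L}" "u \<notin> I" by blast
    thus ?thesis
    proof cases
      case 1 thus ?thesis using 2 by (simp add: I_def)
    next
      case 2
      have e: "?k u = k u" using 2 by (auto simp: I_def)
      show ?thesis unfolding e wJ[OF 2(1)] using 1 2(2) by (simp add: algebra_simps)
    next
      case 3 thus ?thesis using 2 wL[of u] by (simp add: I_def)
    next
      case 4 thus ?thesis using wout[of u] f(7)[of u] 2 by (simp add: I_def)
    qed
  qed
  have Ik: "integrable lborel (\<lambda>u. indicator I u * (k u)\<^sup>2)"
    using integrable_mult_indicator[OF _ k2, of I] by simp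
  have ri: "integrable lborel (\<lambda>u. (k u)\<^sup>2 - indicator I u * (k u)\<^sup>2 + 2 * a * (k u)\<^sup>2)"
    by (intro Bochner_Integration.integrable_add Bochner_Integration.integrable_diff integrable_mult_right k2 Ik)
  have qi: "integrable lborel (\<lambda>u. (?k u)\<^sup>2 / w u)"
  proof (rule Bochner_Integration.integrable_bound[OF ri])
    show "(\<lambda>u. (?k u)\<^sup>2 / w u) \<in> borel_measurable lborel" using borel_measurable_integrable[OF wi] by measurable
    show "AE u in lborel. norm ((?k u)\<^sup>2 / w u) \<le> norm ((k u)\<^sup>2 - indicator I u * (k u)\<^sup>2 + 2 * a * (k u)\<^sup>2)"
    proof (rule AE_I2)
      fix u
      have "0 \<le> (?k u)\<^sup>2 / w u" using w0[of u] by simp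
      thus "norm ((?k u)\<^sup>2 / w u) \<le> norm ((k u)\<^sup>2 - indicator I u * (k u)\<^sup>2 + 2 * a * (k u)\<^sup>2)"
        using qle[of u] unfolding real_norm_def by linarith
    qed
  qed
  obtain c' \<theta>' k' where n: "bend \<sigma> (LINT u|lborel. w u) c' \<theta>' k'" "\<theta>' 0 = ?\<theta> 0" "\<theta>' (LINT u|lborel. w u) = ?\<theta> L"
    "chord (LINT u|lborel. w u) \<theta>' = (LINT u|lborel. w u *\<^sub>R cis (?\<theta> u))"
    "integrable lborel (\<lambda>u. (k' u)\<^sup>2)" "(LINT u|lborel. (k' u)\<^sup>2) \<le> (LINT u|lborel. (?k u)\<^sup>2 / w u)"
    by (rule bend_reweight[OF bt wi w0 wout wk qi])
  have ends: "?\<theta> 0 = \<theta> 0" "?\<theta> L = \<theta> L" using s1 s2 j r by auto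
  have ch: "(LINT u|lborel. w u *\<^sub>R cis (?\<theta> u)) = chord L \<theta>"
  proof -
    have cisrot: "cis (\<theta> u) = cis p * (complex_of_real (cos (\<sigma> * (\<theta> u - p))) + complex_of_real (sin (\<sigma> * (\<theta> u - p))) * (\<i> * of_real \<sigma>))" for u
    proof -
      have "cis (\<theta> u - p) = Complex (cos (\<sigma> * (\<theta> u - p))) (\<sigma> * sin (\<sigma> * (\<theta> u - p)))"
        using f(1) by (auto simp: complex_eq_iff) (metis cos_minus minus_diff_eq, metis sin_minus minus_diff_eq minus_minus)?
      hence "cis p * cis (\<theta> u - p) = cis p * (complex_of_real (cos (\<sigma> * (\<theta> u - p))) + complex_of_real (sin (\<sigma> * (\<theta> u - p))) * (\<i> * of_real \<sigma>))"
        by (simp add: complex_eq_iff)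
      thus ?thesis by (simp add: cis_mult)
    qed
    have pt: "w u *\<^sub>R cis (?\<theta> u) = indicat_real {0<..<L} u *\<^sub>R cis (\<theta> u)
       + cis p * (complex_of_real (\<rho> * (indicat_real I u * 1) - indicat_real I u * cos (\<sigma> * (\<theta> u - p)) - a * (indicat_real J u * cos (\<sigma> * (\<theta> u - p))))
         + complex_of_real (a * (indicat_real J u * sin (- (\<sigma> * (\<theta> u - p)))) - indicat_real I u * sin (\<sigma> * (\<theta> u - p))) * (\<i> * of_real \<sigma>))" for u
    proof -
      define C S Q where "C = cos (\<sigma> * (\<theta> u - p))" and "S = sin (\<sigma> * (\<theta> u - p))" and "Q = \<i> * complex_of_real \<sigma>"
      have rot: "cis (\<theta> u) = cis p * (of_real C + of_real S * Q)" unfolding C_def S_def Q_def by (rule cisrot)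
      consider "u \<in> I" | "u \<in> J" "u \<notin> I" | "u \<in> {0<..<L}" "u \<notin> I" "u \<notin> J" | "u \<notin> {0<..<L}" "u \<notin> I" "u \<notin> J" using near(2) by blast
      hence "w u *\<^sub>R cis (?\<theta> u) = indicat_real {0<..<L} u *\<^sub>R cis (\<theta> u)
        + cis p * (complex_of_real (\<rho> * (indicat_real I u * 1) - indicat_real I u * C - a * (indicat_real J u * C))
          + complex_of_real (a * (indicat_real J u * (- S)) - indicat_real I u * S) * Q)"
      proof cases
        case 1
        have e: "?\<theta> u = p" using 1 by (simp add: p_def I_def)
        show ?thesis unfolding e rot wI[OF 1] using IJ[OF 1] near(2)[of u] 1
          by (simp add: scaleR_conv_of_real algebra_simps)
      next
        case 2
        have e: "?\<theta> u = \<theta> u" using 2 s1(1) by (auto simp: J_def)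
        show ?thesis unfolding e rot wJ[OF 2(1)] using near(2)[of u] 2
          by (simp add: scaleR_conv_of_real algebra_simps)
      next
        case 3
        have e: "?\<theta> u = \<theta> u" using 3 ts by (auto simp: I_def)
        show ?thesis unfolding e wL[OF 3] using 3 by simp
      next
        case 4
        show ?thesis unfolding wout[OF 4(1)] using 4 by simp
      qed
      thus ?thesis unfolding C_def S_def Q_def sin_minus .
    qed
    define g1 where "g1 = (\<lambda>u. \<rho> * (indicat_real I u * 1) - indicat_real I u * cos (\<sigma> * (\<theta> u - p)) - a * (indicat_real J u * cos (\<sigma> * (\<theta> u - p))))"
    define g2 where "g2 = (\<lambda>u. a * (indicat_real J u * sin (- (\<sigma> * (\<theta> u - p)))) - indicat_real I u * sin (\<sigma> * (\<theta> u - p)))"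
    have g1: "integrable lborel g1" "(LINT u|lborel. g1 u) = 0"
    proof -
      show "integrable lborel g1" unfolding g1_def
        by (intro Bochner_Integration.integrable_diff integrable_mult_right iI iSI)
      have "(LINT u|lborel. g1 u) = \<rho> * (s2 - s1) - cI - a * cJ"
        unfolding g1_def using iI iSI Ilen by (simp add: cI_def cJ_def)
      thus "(LINT u|lborel. g1 u) = 0" using ne by (simp add: \<rho>_def)
    qed
    have g2: "integrable lborel g2" "(LINT u|lborel. g2 u) = 0"
    proof -
      show "integrable lborel g2" unfolding g2_def
        by (intro Bochner_Integration.integrable_diff integrable_mult_right iI iSI)
      have "(LINT u|lborel. g2 u) = a * sJ - sI"
        unfolding g2_def sJ_def sI_def
        by (subst Bochner_Integration.integral_diff) (intro integrable_mult_right iSI refl | simp only: Bochner_Integration.integral_mult_right_zero)+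
      thus "(LINT u|lborel. g2 u) = 0" using sJ0 by (simp add: a_def)
    qed
    note g12 = integral_complex_combination[OF g1(1) g2(1), of "\<i> * of_real \<sigma>"]
    have z: "(LINT u|lborel. cis p * (complex_of_real (g1 u) + complex_of_real (g2 u) * (\<i> * of_real \<sigma>))) = 0"
      unfolding Bochner_Integration.integral_mult_right_zero g12(2) g1 g2 by simp
    have "(LINT u|lborel. w u *\<^sub>R cis (?\<theta> u)) = (LINT u|lborel. indicat_real {0<..<L} u *\<^sub>R cis (\<theta> u)
       + cis p * (complex_of_real (g1 u) + complex_of_real (g2 u) * (\<i> * of_real \<sigma>)))"
      unfolding pt g1_def g2_def ..
    also have "\<dots> = (LINT u|lborel. indicat_real {0<..<L} u *\<^sub>R cis (\<theta> u))
       + (LINT u|lborel. cis p * (complex_of_real (g1 u) + complex_of_real (g2 u) * (\<i> * of_real \<sigma>)))"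
      by (rule Bochner_Integration.integral_add[OF integrable_scaleR_cis[OF Li tm]])
         (intro integrable_mult_right g12(1))
    finally show ?thesis unfolding z chord_open_interval[OF tm] by simp
  qed
  have "K \<le> (LINT u|lborel. (k' u)\<^sup>2)"
    using least[unfolded least_energy_def, rule_format, OF n(1,5) _ _ _] n(2-4) ch ends unfolding K_def by simp
  also have "\<dots> \<le> (LINT u|lborel. (?k u)\<^sup>2 / w u)" by (rule n(6))
  also have "\<dots> \<le> (LINT u|lborel. (k u)\<^sup>2 - indicator I u * (k u)\<^sup>2 + 2 * a * (k u)\<^sup>2)"
    by (rule integral_mono[OF qi ri qle])
  also have "\<dots> = K - (LINT u|lborel. indicator I u * (k u)\<^sup>2) + 2 * a * K" using k2 Ik by (simp add: K_def)
  finally have "(LINT u|lborel. indicator I u * (k u)\<^sup>2) \<le> 2 * a * K" by simp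
  moreover have "q0 * (s2 - s1) \<le> (LINT u|lborel. indicator I u * (k u)\<^sup>2)"
  proof -
    have "q0 * (s2 - s1) = (LINT u|lborel. q0 * (indicat_real I u * 1))" using iI Ilen by simp
    also have "\<dots> \<le> (LINT u|lborel. indicator I u * (k u)\<^sup>2)"
    proof (rule integral_mono_AE[OF integrable_mult_right[OF iI(1)] Ik])
      show "AE u in lborel. q0 * (indicat_real I u * 1) \<le> indicator I u * (k u)\<^sup>2"
        using qae by eventually_elim (use near(1) in \<open>auto simp: indicator_def\<close>)
    qed
    finally show ?thesis .
  qed
  moreover have "2 * a * K \<le> 2 * (\<delta> * (s2 - s1) / D0) * K"
    using a K0 by (intro mult_right_mono mult_left_mono) auto
  moreover have "2 * (\<delta> * (s2 - s1) / D0) * K < q0 * (s2 - s1)"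
  proof -
    have "\<delta> * (4 * K + 1) \<le> q0 * D0" using \<delta>(5) K0 by (simp add: pos_le_divide_eq)
    moreover have "\<delta> * (2 * K) < \<delta> * (4 * K + 1)" using \<delta>(1) K0 by (intro mult_strict_left_mono) auto
    ultimately have "\<delta> * (2 * K) < q0 * D0" by linarith
    hence "\<delta> * (2 * K) * (s2 - s1) < q0 * D0 * (s2 - s1)" using ne by (intro mult_strict_right_mono) auto
    thus ?thesis using D0 by (simp add: field_simps)
  qed
  ultimately show False by linarith
qed

text \<open>Almost everywhere |k| is the root of a continuous function, and the sign of k changes at
  most at c. If c is an interior point the root vanishes there, so attaching the sign keeps it
  continuous; otherwise only one sign occurs.\<close>

lemma least_energy_imp_C1:
  assumes b: "bend \<sigma> L c \<theta> k" and k2: "integrable lborel (\<lambda>u. (k u)\<^sup>2)"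
    and least: "least_energy L \<theta> (LINT u|lborel. (k u)\<^sup>2)" and "0 < L"
  obtains \<kappa> where "continuous_on {0..L} \<kappa>"
    "\<And>s. s \<in> {0..L} \<Longrightarrow> (\<theta> has_real_derivative \<kappa> s) (at s within {0..L})"
proof (cases "\<exists>s\<in>{0..L}. \<theta> s \<noteq> \<theta> 0")
  case False
  have "((\<lambda>_. \<theta> 0) has_real_derivative 0) (at s within {0..L})" for s by simp
  hence "(\<theta> has_real_derivative 0) (at s within {0..L})" if "s \<in> {0..L}" for s
    by (rule has_field_derivative_transform_within[OF _ zero_less_one that]) (use False in metis)
  thus ?thesis by (intro that[of "\<lambda>_. 0"]) auto
next
  case True
  note f = bend_facts[OF b]
  have [measurable]: "k \<in> borel_measurable borel" by (rule f(6))
  have tc: "continuous_on A \<theta>" for A by (rule bend_continuous[OF b])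
  obtain \<alpha> \<beta> where ae: "AE u in lborel. u \<in> {0<..<L} \<longrightarrow> (k u)\<^sup>2 = \<alpha> * cos (\<theta> u) + \<beta> * sin (\<theta> u)"
    by (rule curvature_square_of_minimizer[OF b k2 least \<open>0 < L\<close> True])
  define q where "q = (\<lambda>u. \<alpha> * cos (\<theta> u) + \<beta> * sin (\<theta> u))"
  have qc: "continuous_on A q" for A unfolding q_def by (intro continuous_intros tc)
  have qae: "AE u in lborel. u \<in> {0<..<L} \<longrightarrow> (k u)\<^sup>2 = q u" using ae by (simp add: q_def)
  have q0: "0 \<le> q s" if "s \<in> {0..L}" for s
  proof (rule continuous_le_on_interval_if_AE[OF continuous_on_const qc _ \<open>0 < L\<close> that])
    show "AE u in lborel. u \<in> {0<..<L} \<longrightarrow> 0 \<le> q u"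
      using qae by eventually_elim (metis zero_le_power2)
  qed
  \<comment> \<open>The condition 0 < c excludes the case c = 0, in which the first branch would
    consist of the single point 0 and could break continuity there.\<close>
  define \<kappa> where "\<kappa> = (\<lambda>s. if s \<le> c \<and> 0 < c then \<sigma> * sqrt (q s) else - \<sigma> * sqrt (q s))"
  have cont: "continuous_on {0..L} \<kappa>"
  proof -
    consider "c = 0" | "c = L" | "0 < c" "c < L" using f(2,3) by linarith
    thus ?thesis
    proof cases
      case 1
      have "continuous_on {0..L} (\<lambda>s. - \<sigma> * sqrt (q s))" by (intro continuous_intros qc)
      thus ?thesis using 1 by (simp add: \<kappa>_def)
    next
      case 2
      have "continuous_on {0..L} (\<lambda>s. \<sigma> * sqrt (q s))" by (intro continuous_intros qc)
      thus ?thesis by (rule continuous_on_eq) (use 2 \<open>0 < L\<close> in \<open>auto simp: \<kappa>_def\<close>)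
    next
      case 3
      have "q c = 0"
        using no_corner_at_peak[OF b k2 least 3 qc qae] q0[of c] 3 by simp
      have "continuous_on ({0..c} \<union> {c..L}) (\<lambda>s. if s \<le> c then \<sigma> * sqrt (q s) else - \<sigma> * sqrt (q s))"
        by (rule continuous_on_cases) (use \<open>q c = 0\<close> in \<open>auto intro!: continuous_intros qc\<close>)
      moreover have "{0..c} \<union> {c..L} = {0..L}" using 3 by auto
      ultimately show ?thesis using 3 by (simp add: \<kappa>_def)
    qed
  qed
  have k\<kappa>: "AE u in lborel. u \<in> {0<..<L} \<longrightarrow> k u = \<kappa> u"
    using qae AE_lborel_singleton[of c]
  proof eventually_elim
    case (elim u)
    show ?case
    proof
      assume u: "u \<in> {0<..<L}"
      hence "\<bar>k u\<bar> = sqrt (q u)" using elim(1) real_sqrt_abs[of "k u"] by simp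
      moreover have "k u = \<sigma> * \<bar>k u\<bar>" if "u \<le> c" using f(8)[OF that] f(1) by (auto simp: abs_if)
      moreover have "k u = - \<sigma> * \<bar>k u\<bar>" if "c < u" using f(9)[OF that] f(1) by (auto simp: abs_if)
      ultimately show "k u = \<kappa> u" using u by (auto simp: \<kappa>_def not_le)
    qed
  qed
  \<comment> \<open>Since k and \<kappa> agree almost everywhere, \<theta> is a primitive of the
    continuous \<kappa> and hence differentiable at every point, the ends included.\<close>
  have \<theta>int: "\<theta> s = \<theta> 0 + integral {0..s} \<kappa>" if s: "s \<in> {0..L}" for s
  proof -
    have "\<theta> s - \<theta> 0 = integral {0..s} k"
      using f(10)[of s] f(10)[of 0] primitive_diff_integral[OF f(5), of 0 s] s by auto
    also have "\<dots> = integral {0..s} \<kappa>"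
    proof -
      have "AE u in lebesgue. u \<in> {0<..<L} \<longrightarrow> k u = \<kappa> u" using k\<kappa> by (rule AE_completion)
      then obtain N where N: "N \<in> null_sets lebesgue" "\<And>u. u \<notin> N \<Longrightarrow> u \<in> {0<..<L} \<longrightarrow> k u = \<kappa> u"
        by (auto elim!: AE_E3)
      show ?thesis
        by (rule integral_spike[of "N \<union> {0, L}"]) (use N s in \<open>auto simp: negligible_iff_null_sets[symmetric]\<close>)
    qed
    finally show ?thesis by simp
  qed
  have "(\<theta> has_real_derivative \<kappa> s) (at s within {0..L})" if s: "s \<in> {0..L}" for s
  proof -
    have "((\<lambda>s. \<theta> 0 + integral {0..s} \<kappa>) has_real_derivative \<kappa> s) (at s within {0..L})"
      using integral_has_real_derivative[OF cont s] by (auto intro!: derivative_eq_intros)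
    thus ?thesis
      by (rule has_field_derivative_transform_within[OF _ zero_less_one s]) (rule \<theta>int[symmetric])
  qed
  with cont show ?thesis by (rule that)
qed

section \<open>Existence of curves with prescribed end directions\<close>

lemma integral_pos_if_pos_on_open:
  fixes g :: "real \<Rightarrow> real"
  assumes g: "integrable lborel g" "\<And>u. 0 \<le> g u" and U: "open U" "U \<noteq> {}" "\<And>u. u \<in> U \<Longrightarrow> 0 < g u"
  shows "0 < (LINT u|lborel. g u)"
proof (rule ccontr)
  assume "\<not> 0 < (LINT u|lborel. g u)"
  moreover have "0 \<le> (LINT u|lborel. g u)" using g by simp
  ultimately have "(LINT u|lborel. g u) = 0" by linarith
  hence "AE u in lborel. g u = 0"
    using integral_nonneg_eq_0_iff_AE[OF g(1)] g(2) by simp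
  hence "AE u in lborel. u \<notin> U" by eventually_elim (use U(3) in fastforce)
  hence "U \<in> null_sets lborel" using AE_iff_null_sets[of U lborel] U(1) by auto
  hence "negligible U" by (simp add: negligible_iff_null_sets null_sets_completionI)
  thus False using open_not_negligible[OF U(1,2)] by simp
qed

text \<open>Provides at least one competitor of finite energy for every admissible pair of end
  directions. Unless both directions are that of z, a profile of the angle relative to z is chosen
  first; weights then correct the chord without touching the end directions.\<close>

lemma bend_between_exists:
  fixes z d d' :: complex
  assumes z: "z \<noteq> 0" and d: "norm d = 1" "0 \<le> Re (d * cnj z)" and d': "norm d' = 1" "0 \<le> Re (d' * cnj z)"
  obtains \<sigma> L c \<theta> k where "bend \<sigma> L c \<theta> k" "integrable lborel (\<lambda>u. (k u)\<^sup>2)" "chord L \<theta> = z"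
    "cis (\<theta> 0) = d" "cis (\<theta> L) = d'"
proof -
  define \<gamma> where "\<gamma> = Arg z"
  define \<alpha> where "\<alpha> = Arg (d / cis \<gamma>)"
  define \<beta> where "\<beta> = Arg (d' / cis \<gamma>)"
  have z\<gamma>: "z = of_real (norm z) * cis \<gamma>" unfolding \<gamma>_def using cis_Arg[OF z] by (simp add: sgn_div_norm scaleR_conv_of_real divide_inverse mult.commute z)
  have ang: "cis (\<gamma> + Arg (e / cis \<gamma>)) = e \<and> \<bar>Arg (e / cis \<gamma>)\<bar> \<le> pi / 2" if "norm e = 1" "0 \<le> Re (e * cnj z)" for e
  proof -
    have ne: "e / cis \<gamma> \<noteq> 0" using that(1) by auto
    have n1: "norm (e / cis \<gamma>) = 1" using that(1) by (simp add: norm_divide)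
    have "cis (Arg (e / cis \<gamma>)) = e / cis \<gamma>" using cis_Arg[OF ne] n1 by (simp add: sgn_div_norm)
    hence "cis (\<gamma> + Arg (e / cis \<gamma>)) = e" by (simp add: cis_mult[symmetric])
    moreover have "e * cnj z = of_real (norm z) * (e / cis \<gamma>)"
    proof -
      have "cnj z = of_real (norm z) * cis (- \<gamma>)" using arg_cong[OF z\<gamma>, of cnj] by (simp only: complex_cnj_mult complex_cnj_complex_of_real cis_cnj)
      thus ?thesis by (simp only: divide_inverse cis_inverse mult.left_commute)
    qed
    have re: "Re (of_real r * y) = r * Re y" for r y by simp
    have "0 \<le> norm z * Re (e / cis \<gamma>)" using that(2) unfolding \<open>e * cnj z = _\<close> re .
    hence "0 \<le> Re (e / cis \<gamma>)" using z by (simp only: zero_le_mult_iff zero_less_norm_iff) auto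
    hence "\<bar>Arg (e / cis \<gamma>)\<bar> \<le> pi / 2" using Arg_Re_nonneg[of "e / cis \<gamma>"] by blast
    ultimately show ?thesis by blast
  qed
  have \<alpha>: "cis (\<gamma> + \<alpha>) = d" "\<bar>\<alpha>\<bar> \<le> pi / 2" using ang[OF d] by (auto simp: \<alpha>_def)
  have \<beta>: "cis (\<gamma> + \<beta>) = d'" "\<bar>\<beta>\<bar> \<le> pi / 2" using ang[OF d'] by (auto simp: \<beta>_def)
  show ?thesis
  proof (cases "\<alpha> = 0 \<and> \<beta> = 0")
    case True
    have b: "bend 1 (norm z) 0 (\<lambda>_. \<gamma>) (\<lambda>_. 0)"
      by (auto simp: bend_def primitive_def set_lebesgue_integral_def)
    show ?thesis
    proof (rule that[OF b])
      have "chord (norm z) (\<lambda>_. \<gamma>) = norm z *\<^sub>R cis \<gamma>" by (simp add: chord_def set_lebesgue_integral_def)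
      thus "chord (norm z) (\<lambda>_. \<gamma>) = z" by (simp only: scaleR_conv_of_real z\<gamma>[symmetric])
    qed (use True \<alpha> \<beta> in auto)
  next
    case False
    \<comment> \<open>A reflection, if necessary, makes at least one end angle positive. The profile
      can then supply the negative angles by dipping down.\<close>
    obtain \<tau> :: real where \<tau>: "\<tau> = 1 \<or> \<tau> = -1" and mx: "0 < max (\<tau> * \<alpha>) (\<tau> * \<beta>)"
    proof (cases "0 < max \<alpha> \<beta>")
      case True thus ?thesis by (intro that[of 1]) auto
    next
      case F: False
      hence "0 < max (- \<alpha>) (- \<beta>)" using False by (auto simp: max_def split: if_splits)
      thus ?thesis by (intro that[of "-1"]) auto
    qed
    have \<tau>\<tau>: "\<tau> * (\<tau> * x) = x" for x using \<tau> by auto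
    define a where "a = \<tau> * \<alpha>"
    define b where "b = \<tau> * \<beta>"
    have ab: "\<bar>a\<bar> \<le> pi / 2" "\<bar>b\<bar> \<le> pi / 2" "0 < max a b" using \<alpha> \<beta> \<tau> mx by (auto simp: a_def b_def)
    \<comment> \<open>The bottom of the profile: negative even if both end angles are not, and still
      at least - pi / 2 because 1 < pi / 2. With unit slope the descent from a takes time a - p and
      the ascent to b takes b - p, each at most pi.\<close>
    define p where "p = min (-1) (min a b)"
    have p: "p \<le> -1" "p \<le> a" "p \<le> b" "- pi / 2 \<le> p" using ab pi_gt3 unfolding p_def by (auto simp: abs_le_iff min_def)
    define c where "c = a - p"
    define L where "L = c + (b - p)"
    have c: "0 \<le> c" "c \<le> L" using p by (auto simp: c_def L_def)
    have L: "0 < L" using ab p by (auto simp: L_def c_def max_def split: if_splits)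
    define cl where "cl = (\<lambda>s. max 0 (min s L))"
    \<comment> \<open>A profile of slope \<open>-1\<close> and then \<open>1\<close>. It takes both signs, so the direction \<open>\<gamma>\<close> of \<open>z\<close> is interior to the
      cone spanned by the directions of the curve, and the curve can be reweighted to have the chord \<open>z\<close>.\<close>
    define \<psi> where "\<psi> = (\<lambda>s. p + \<bar>cl s - c\<bar>)"
    define \<theta> where "\<theta> = (\<lambda>s. \<gamma> + \<tau> * \<psi> s)"
    have \<psi>v: "\<psi> 0 = a" "\<psi> c = p" "\<psi> L = b" using c L p by (auto simp: \<psi>_def cl_def c_def L_def)
    have \<psi>c: "continuous_on A \<psi>" for A unfolding \<psi>_def cl_def by (intro continuous_intros)
    have \<theta>c: "continuous_on A \<theta>" for A unfolding \<theta>_def by (intro continuous_intros \<psi>c)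
    have clm: "mono cl" by (auto simp: cl_def mono_def)
    have \<theta>cl: "\<theta> s = \<gamma> + \<tau> * (p + \<bar>cl s - c\<bar>)" for s by (simp add: \<theta>_def \<psi>_def)
    have key: "(\<theta> t - \<theta> s)\<^sup>2 \<le> (t - s) * (cl t - cl s)" if "s \<le> t" for s t
    proof -
      have "\<theta> t - \<theta> s = \<tau> * (\<bar>cl t - c\<bar> - \<bar>cl s - c\<bar>)" by (simp add: \<theta>cl algebra_simps)
      hence "\<bar>\<theta> t - \<theta> s\<bar> = \<bar>\<bar>cl t - c\<bar> - \<bar>cl s - c\<bar>\<bar>" using \<tau> by auto
      also have "\<dots> \<le> cl t - cl s" using monoD[OF clm that] by linarith
      finally have "\<bar>\<theta> t - \<theta> s\<bar>\<^sup>2 \<le> (cl t - cl s)\<^sup>2" by (intro power_mono) auto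
      also have "\<dots> \<le> (t - s) * (cl t - cl s)"
        unfolding power2_eq_square using monoD[OF clm that] that by (intro mult_right_mono) (auto simp: cl_def)
      finally show ?thesis by simp
    qed
    obtain k where bk: "bend (- \<tau>) L c \<theta> k"
    proof (rule bend_exists[of "- \<tau>" c L \<theta>])
      show "- \<tau> = 1 \<or> - \<tau> = -1" using \<tau> by auto
      show "\<theta> s = \<theta> 0" if "s \<le> 0" for s using that L by (simp add: \<theta>cl cl_def)
      show "\<theta> s = \<theta> L" if "L \<le> s" for s using that L by (simp add: \<theta>cl cl_def)
      have tt: "- \<tau> * \<theta> s = - \<tau> * \<gamma> - p - \<bar>cl s - c\<bar>" for s unfolding \<theta>cl using \<tau>\<tau>[of "p + \<bar>cl s - c\<bar>"] by (simp add: algebra_simps)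
      show "- \<tau> * \<theta> s \<le> - \<tau> * \<theta> t" if "0 \<le> s" "s \<le> t" "t \<le> c" for s t
        unfolding tt using that c by (auto simp: cl_def)
      show "- \<tau> * \<theta> t \<le> - \<tau> * \<theta> s" if "c \<le> s" "s \<le> t" "t \<le> L" for s t
        unfolding tt using that c by (auto simp: cl_def)
      show "absolutely_continuous_on_interval 0 L \<theta>"
        by (rule absolutely_continuous_if_energy_bound[where \<Phi>=cl])
           (use L key clm in \<open>auto intro: mono_imp_mono_on\<close>)
      have "\<theta> c - \<theta> 0 = \<tau> * (p - a)" "\<theta> L - \<theta> c = \<tau> * (b - p)" by (simp_all add: \<theta>_def \<psi>v algebra_simps)
      thus "\<bar>\<theta> c - \<theta> 0\<bar> \<le> pi" "\<bar>\<theta> L - \<theta> c\<bar> \<le> pi" using \<tau> p ab by auto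
    qed (use c \<theta>c in auto)
    have k2: "integrable lborel (\<lambda>u. (k u)\<^sup>2)"
      by (rule bend_energy_le[OF bk clm _ _ key]) (use L in \<open>auto simp: cl_def\<close>)
    note f = bend_facts[OF bk]
    have [measurable]: "k \<in> borel_measurable borel" by (rule f(6))
    have [measurable]: "\<psi> \<in> borel_measurable borel" using \<psi>c by (rule borel_measurable_continuous_onI)
    have \<psi>bd: "- pi / 2 \<le> \<psi> s" "\<psi> s \<le> pi / 2" for s
    proof -
      show "- pi / 2 \<le> \<psi> s" using p by (simp add: \<psi>_def)
      have "\<bar>cl s - c\<bar> \<le> max c (L - c)" using c L by (auto simp: cl_def)
      hence "\<psi> s \<le> max a b" by (auto simp: \<psi>_def c_def L_def)
      thus "\<psi> s \<le> pi / 2" using ab by auto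
    qed
    have cos0: "0 \<le> cos (\<psi> s)" for s using \<psi>bd[of s] by (intro cos_ge_zero) auto
    define U where "U = {u\<in>{0<..<L}. 0 < \<psi> u}"
    define V where "V = {u\<in>{0<..<L}. \<psi> u < 0}"
    define Z where "Z = {u\<in>{0<..<L}. \<psi> u = 0}"
    have oU: "open U" and oV: "open V"
    proof -
      have "open ({0<..<L} \<inter> {u. 0 < \<psi> u})" "open ({0<..<L} \<inter> {u. \<psi> u < 0})"
        by (intro open_Int open_greaterThanLessThan open_Collect_less continuous_on_const \<psi>c)+
      thus "open U" "open V" by (simp_all add: U_def V_def Int_def)
    qed
    have [measurable]: "U \<in> sets borel" "V \<in> sets borel" "Z \<in> sets borel" unfolding U_def V_def Z_def by measurable
    obtain u1 where u1: "u1 \<in> U"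
    proof (cases "0 < a")
      case True
      have "a / 2 \<in> U" using True p c by (auto simp: U_def \<psi>_def cl_def c_def L_def)
      thus ?thesis by (rule that)
    next
      case False
      hence "0 < b" using ab by (auto simp: max_def split: if_splits)
      have "L - b / 2 \<in> U" using \<open>0 < b\<close> p c by (auto simp: U_def \<psi>_def cl_def c_def L_def)
      thus ?thesis by (rule that)
    qed
    obtain u2 where u2: "u2 \<in> V"
    proof (cases "c < L")
      case True
      define e where "e = min (1/2) ((L - c) / 2)"
      have e: "0 < e" "e \<le> 1/2" "e < L - c" using True by (auto simp: e_def min_def)
      have "c + e \<in> V" using e p c by (auto simp: V_def \<psi>_def cl_def)
      thus ?thesis by (rule that)
    next
      case False
      hence cL: "c = L" using c by simp
      define e where "e = min (1/2) (c / 2)"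
      have e: "0 < e" "e \<le> 1/2" "e < c" using cL L by (auto simp: e_def min_def)
      have "c - e \<in> V" using e p cL by (auto simp: V_def \<psi>_def cl_def)
      thus ?thesis by (rule that)
    qed
    obtain u0 where u0: "u0 \<in> {0<..<L}" "\<psi> u0 = 0"
    proof (cases "u1 \<le> u2")
      case True
      obtain u where "u1 \<le> u" "u \<le> u2" "\<psi> u = 0"
        using IVT2'[of \<psi> u2 0 u1] True u1 u2 \<psi>c by (auto simp: U_def V_def)
      thus ?thesis using u1 u2 by (intro that[of u]) (auto simp: U_def V_def)
    next
      case False
      obtain u where "u2 \<le> u" "u \<le> u1" "\<psi> u = 0"
        using IVT'[of \<psi> u2 0 u1] False u1 u2 \<psi>c by (auto simp: U_def V_def)
      thus ?thesis using u1 u2 by (intro that[of u]) (auto simp: U_def V_def)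
    qed
    have ib: "integrable lborel (\<lambda>u. indicat_real S u * g (\<psi> u))"
      if S: "S \<in> sets borel" "S \<subseteq> {0<..<L}" and g: "g \<in> borel_measurable borel" "\<And>x. \<bar>g x\<bar> \<le> 1" for S and g :: "real \<Rightarrow> real"
    proof (rule integrable_bounded_on_interval[OF _ _ _ less_imp_le[OF L], where M=1])
      have [measurable]: "S \<in> sets borel" "g \<in> borel_measurable borel" by (rule S g)+
      show "(\<lambda>u. indicat_real S u * g (\<psi> u)) \<in> borel_measurable borel" by measurable
    qed (use S g in \<open>auto simp: indicator_def\<close>)
    have sub: "U \<subseteq> {0<..<L}" "V \<subseteq> {0<..<L}" "Z \<subseteq> {0<..<L}" by (auto simp: U_def V_def Z_def)
    have int: "integrable lborel (\<lambda>u. indicat_real U u * sin (\<psi> u))" "integrable lborel (\<lambda>u. indicat_real V u * sin (\<psi> u))"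
      "integrable lborel (\<lambda>u. indicat_real Z u * sin (\<psi> u))"
      "integrable lborel (\<lambda>u. indicat_real U u * cos (\<psi> u))" "integrable lborel (\<lambda>u. indicat_real V u * cos (\<psi> u))"
      "integrable lborel (\<lambda>u. indicat_real Z u * cos (\<psi> u))"
      by (rule ib; use sub in simp)+
    define A where "A = (LINT u|lborel. indicat_real U u * sin (\<psi> u))"
    define B where "B = - (LINT u|lborel. indicat_real V u * sin (\<psi> u))"
    have "0 < A" unfolding A_def
    proof (rule integral_pos_if_pos_on_open[OF int(1) _ oU])
      have pos: "0 < sin (\<psi> u)" if "u \<in> U" for u
        using that \<psi>bd[of u] pi_gt3 by (intro sin_gt_zero) (auto simp: U_def)
      show "0 \<le> indicat_real U u * sin (\<psi> u)" for u using pos[of u] by (auto simp: indicator_def)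
      show "0 < indicat_real U u * sin (\<psi> u)" if "u \<in> U" for u using pos[of u] that by simp
    qed (use u1 in auto)
    have "0 < B"
    proof -
      have "0 < (LINT u|lborel. - (indicat_real V u * sin (\<psi> u)))"
      proof (rule integral_pos_if_pos_on_open[OF Bochner_Integration.integrable_minus[OF int(2)] _ oV])
        have pos: "sin (\<psi> u) < 0" if "u \<in> V" for u
          using sin_gt_zero[of "- \<psi> u"] that \<psi>bd[of u] pi_gt3 by (auto simp: V_def)
        show "0 \<le> - (indicat_real V u * sin (\<psi> u))" for u using pos[of u] by (auto simp: indicator_def)
        show "0 < - (indicat_real V u * sin (\<psi> u))" if "u \<in> V" for u using pos[of u] that by simp
      qed (use u2 in auto)
      thus ?thesis by (simp add: B_def)
    qed
    \<comment> \<open>The weights B and A are exchanged between the sets of positive and negative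
      angle, so the orthogonal components B A and - A B cancel. Any positive weight serves on Z,
      where the sine is 0.\<close>
    define w0 where "w0 = (\<lambda>u. B * indicat_real U u + A * indicat_real V u + indicat_real Z u)"
    have w0c: "w0 u * cos (\<psi> u) = B * (indicat_real U u * cos (\<psi> u)) + A * (indicat_real V u * cos (\<psi> u)) + indicat_real Z u * cos (\<psi> u)"
      and w0s: "w0 u * sin (\<psi> u) = B * (indicat_real U u * sin (\<psi> u)) + A * (indicat_real V u * sin (\<psi> u))" for u
      by (auto simp: w0_def algebra_simps Z_def indicator_def)
    have i0: "integrable lborel (\<lambda>u. w0 u * cos (\<psi> u))" "integrable lborel (\<lambda>u. w0 u * sin (\<psi> u))"
      unfolding w0c w0s by (intro Bochner_Integration.integrable_add integrable_mult_right int)+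
    have s0: "(LINT u|lborel. w0 u * sin (\<psi> u)) = 0"
      unfolding w0s using int by (simp add: A_def[symmetric]) (simp add: B_def)
    define X where "X = (LINT u|lborel. w0 u * cos (\<psi> u))"
    have w0pos: "min B (min A 1) \<le> w0 u" if "u \<in> {0<..<L}" for u
    proof -
      have "u \<in> U \<or> u \<in> V \<or> u \<in> Z" using that by (auto simp: U_def V_def Z_def)
      moreover have "u \<in> U \<Longrightarrow> w0 u = B" "u \<in> V \<Longrightarrow> w0 u = A" "u \<in> Z \<Longrightarrow> w0 u = 1"
        by (auto simp: w0_def U_def V_def Z_def indicator_def)
      ultimately show ?thesis by auto
    qed
    have mpos: "0 < min B (min A 1)" using \<open>0 < A\<close> \<open>0 < B\<close> by simp
    have w0nn: "0 \<le> w0 u" for u using \<open>0 < A\<close> \<open>0 < B\<close> by (auto simp: w0_def)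
    have w0out: "w0 u = 0" if "u \<notin> {0<..<L}" for u using that sub by (auto simp: w0_def indicator_def)
    have "0 < X" unfolding X_def
    proof (rule integral_pos_if_pos_on_open[OF i0(1), of "{0<..<L} \<inter> {u. \<bar>\<psi> u\<bar> < 1}"])
      show "0 \<le> w0 u * cos (\<psi> u)" for u using w0nn cos0 by simp
      show "open ({0<..<L} \<inter> {u. \<bar>\<psi> u\<bar> < 1})"
        by (intro open_Int open_greaterThanLessThan open_Collect_less continuous_intros \<psi>c)
      show "{0<..<L} \<inter> {u. \<bar>\<psi> u\<bar> < 1} \<noteq> {}" using u0 by auto
      show "0 < w0 u * cos (\<psi> u)" if "u \<in> {0<..<L} \<inter> {u. \<bar>\<psi> u\<bar> < 1}" for u
        using that w0pos[of u] mpos pi_gt3 by (intro mult_pos_pos cos_gt_zero_pi) auto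
    qed
    \<comment> \<open>The weighted chord already points in the direction \<gamma>; a scaling adjusts
      its length.\<close>
    define \<kappa> where "\<kappa> = norm z / X"
    have \<kappa>: "0 < \<kappa>" using \<open>0 < X\<close> z by (simp add: \<kappa>_def)
    define w where "w = (\<lambda>u. \<kappa> * w0 u)"
    have w0i: "integrable lborel w0" unfolding w0_def
      using ib[of U "\<lambda>_. 1"] ib[of V "\<lambda>_. 1"] ib[of Z "\<lambda>_. 1"] sub
      by (intro Bochner_Integration.integrable_add integrable_mult_right) simp_all
    have wi: "integrable lborel w" unfolding w_def using w0i by simp
    have wn: "0 \<le> w u" for u using w0nn[of u] \<kappa> by (simp add: w_def)
    have wout: "w u = 0" if "u \<notin> {0<..<L}" for u using w0out[OF that] by (simp add: w_def)
    have wk: "k u = 0" if "w u = 0" for u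
      using that w0pos[of u] mpos \<kappa> f(7)[of u] by (cases "u \<in> {0<..<L}") (auto simp: w_def)
    have qi: "integrable lborel (\<lambda>u. (k u)\<^sup>2 / w u)"
    proof (rule Bochner_Integration.integrable_bound)
      show "integrable lborel (\<lambda>u. (k u)\<^sup>2 / (\<kappa> * min B (min A 1)))" using k2 by simp
      show "(\<lambda>u. (k u)\<^sup>2 / w u) \<in> borel_measurable lborel" using borel_measurable_integrable[OF wi] by measurable
      show "AE u in lborel. norm ((k u)\<^sup>2 / w u) \<le> norm ((k u)\<^sup>2 / (\<kappa> * min B (min A 1)))"
      proof (rule AE_I2)
        fix u
        have pos: "0 < \<kappa> * min B (min A 1)" using \<kappa> mpos by simp
        have "(k u)\<^sup>2 / w u \<le> (k u)\<^sup>2 / (\<kappa> * min B (min A 1))"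
        proof (cases "u \<in> {0<..<L}")
          case True
          have "\<kappa> * min B (min A 1) \<le> w u" unfolding w_def using w0pos[OF True] \<kappa> by (intro mult_left_mono) auto
          thus ?thesis using pos by (intro divide_left_mono) (auto intro: mult_pos_pos)
        qed (use wout pos in simp)
        moreover have "0 \<le> (k u)\<^sup>2 / w u" using wn[of u] by simp
        ultimately show "norm ((k u)\<^sup>2 / w u) \<le> norm ((k u)\<^sup>2 / (\<kappa> * min B (min A 1)))"
          unfolding real_norm_def by linarith
      qed
    qed
    obtain c' \<theta>' k' where n: "bend (- \<tau>) (LINT u|lborel. w u) c' \<theta>' k'" "\<theta>' 0 = \<theta> 0" "\<theta>' (LINT u|lborel. w u) = \<theta> L"
      "chord (LINT u|lborel. w u) \<theta>' = (LINT u|lborel. w u *\<^sub>R cis (\<theta> u))"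
      "integrable lborel (\<lambda>u. (k' u)\<^sup>2)" "(LINT u|lborel. (k' u)\<^sup>2) \<le> (LINT u|lborel. (k u)\<^sup>2 / w u)"
      by (rule bend_reweight[OF bk wi wn wout wk qi])
    have e: "w u *\<^sub>R cis (\<theta> u) = cis \<gamma> * (complex_of_real (\<kappa> * (w0 u * cos (\<psi> u))) + complex_of_real (\<kappa> * (w0 u * sin (\<psi> u))) * (\<i> * of_real \<tau>))" for u
    proof -
      have "cis (\<tau> * \<psi> u) = complex_of_real (cos (\<psi> u)) + complex_of_real (sin (\<psi> u)) * (\<i> * of_real \<tau>)"
        using \<tau> by (auto simp: complex_eq_iff)
      hence "cis (\<theta> u) = cis \<gamma> * (complex_of_real (cos (\<psi> u)) + complex_of_real (sin (\<psi> u)) * (\<i> * of_real \<tau>))"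
        by (simp add: \<theta>_def cis_mult[symmetric])
      thus ?thesis by (simp add: w_def scaleR_conv_of_real algebra_simps)
    qed
    have "\<kappa> * X = norm z" using \<open>0 < X\<close> by (simp add: \<kappa>_def)
    moreover have "(LINT u|lborel. complex_of_real (\<kappa> * (w0 u * cos (\<psi> u))) + complex_of_real (\<kappa> * (w0 u * sin (\<psi> u))) * (\<i> * of_real \<tau>))
      = complex_of_real (\<kappa> * X)"
      unfolding integral_complex_combination(2)[OF integrable_mult_right[OF i0(1)] integrable_mult_right[OF i0(2)]]
        Bochner_Integration.integral_mult_right_zero s0 X_def by simp
    ultimately have ch: "chord (LINT u|lborel. w u) \<theta>' = z"
      unfolding n(4) e Bochner_Integration.integral_mult_right_zero using z\<gamma> by (simp only: mult.commute)
    show ?thesis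
    proof (rule that[OF n(1,5) ch])
      show "cis (\<theta>' 0) = d" unfolding n(2) \<theta>_def \<psi>v a_def \<tau>\<tau> by (rule \<alpha>(1))
      show "cis (\<theta>' (LINT u|lborel. w u)) = d'" unfolding n(3) \<theta>_def \<psi>v b_def \<tau>\<tau> by (rule \<beta>(1))
    qed
  qed
qed

section \<open>Arclength parametrization\<close>

lemma absolutely_continuous_imp_continuous_on:
  fixes g :: "real \<Rightarrow> 'v::real_normed_vector"
  assumes "absolutely_continuous_on_interval a b g"
  shows "continuous_on {a..b} g"
  unfolding continuous_on_iff
proof (intro ballI allI impI)
  fix x \<epsilon> :: real assume x: "x \<in> {a..b}" and "\<epsilon> > 0"
  then obtain \<delta> where "\<delta> > 0" and \<delta>: "\<And>D. D division_of \<Union>D \<Longrightarrow> \<Union>D \<subseteq> {a..b} \<Longrightarrow>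
      (\<Sum>K\<in>D. Sup K - Inf K) < \<delta> \<Longrightarrow> (\<Sum>K\<in>D. norm (g (Sup K) - g (Inf K))) < \<epsilon>"
    using assms[unfolded absolutely_continuous_on_interval_def, rule_format, of \<epsilon>] by blast
  have *: "norm (g t - g s) < \<epsilon>" if "a \<le> s" "s \<le> t" "t \<le> b" "t - s < \<delta>" for s t
  proof -
    have "{{s..t}} division_of \<Union>{{s..t}}" using division_of_self[of s t] that by simp
    from \<delta>[OF this] that show ?thesis by simp
  qed
  show "\<exists>d>0. \<forall>x'\<in>{a..b}. dist x' x < d \<longrightarrow> dist (g x') (g x) < \<epsilon>"
  proof (intro exI[of _ \<delta>] conjI ballI impI \<open>\<delta> > 0\<close>)
    fix y assume "y \<in> {a..b}" "dist y x < \<delta>"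
    thus "dist (g y) (g x) < \<epsilon>"
      using *[of x y] *[of y x] x by (cases "x \<le> y") (auto simp: dist_norm norm_minus_commute)
  qed
qed

text \<open>A strictly increasing map carries a division into a division, and the Lipschitz bound
  controls the total length. Strictness keeps distinct intervals distinct, so that the sum can be
  reindexed.\<close>

lemma absolutely_continuous_compose:
  fixes g :: "real \<Rightarrow> 'v::real_normed_vector"
  assumes ac: "absolutely_continuous_on_interval a b g" and "C > 0"
    and range: "\<And>s. s \<in> {a'..b'} \<Longrightarrow> \<phi> s \<in> {a..b}"
    and strict: "\<And>s t. a' \<le> s \<Longrightarrow> s < t \<Longrightarrow> t \<le> b' \<Longrightarrow> \<phi> s < \<phi> t"
    and lip: "\<And>s t. a' \<le> s \<Longrightarrow> s \<le> t \<Longrightarrow> t \<le> b' \<Longrightarrow> \<phi> t - \<phi> s \<le> C * (t - s)"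
  shows "absolutely_continuous_on_interval a' b' (\<lambda>s. g (\<phi> s))"
  unfolding absolutely_continuous_on_interval_def
proof (intro allI impI)
  fix \<epsilon> :: real assume "\<epsilon> > 0"
  then obtain \<delta> where "\<delta> > 0" and \<delta>: "\<And>D. D division_of \<Union>D \<Longrightarrow> \<Union>D \<subseteq> {a..b} \<Longrightarrow>
      (\<Sum>K\<in>D. Sup K - Inf K) < \<delta> \<Longrightarrow> (\<Sum>K\<in>D. norm (g (Sup K) - g (Inf K))) < \<epsilon>"
    using ac[unfolded absolutely_continuous_on_interval_def, rule_format, of \<epsilon>] by blast
  have mono: "\<phi> s \<le> \<phi> t" if "a' \<le> s" "s \<le> t" "t \<le> b'" for s t
    using strict[of s t] that by (cases "s = t") auto
  show "\<exists>\<delta>>0. \<forall>D. D division_of \<Union> D \<longrightarrow> \<Union> D \<subseteq> {a'..b'} \<longrightarrow> (\<Sum>K\<in>D. Sup K - Inf K) < \<delta> \<longrightarrow>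
     (\<Sum>K\<in>D. norm (g (\<phi> (Sup K)) - g (\<phi> (Inf K)))) < \<epsilon>"
  proof (intro exI[of _ "\<delta> / C"] conjI allI impI)
    show "0 < \<delta> / C" using \<open>\<delta> > 0\<close> \<open>C > 0\<close> by simp
    fix D :: "real set set"
    assume D: "D division_of \<Union> D" "\<Union> D \<subseteq> {a'..b'}" and lt: "(\<Sum>K\<in>D. Sup K - Inf K) < \<delta> / C"
    have K: "K = {Inf K..Sup K}" "a' \<le> Inf K" "Inf K \<le> Sup K" "Sup K \<le> b'" if KD: "K \<in> D" for K
    proof -
      obtain l u where "K = {l..u}" "l \<le> u" "a' \<le> l" "u \<le> b'" by (rule division_interval_cases[OF D KD])
      thus "K = {Inf K..Sup K}" "a' \<le> Inf K" "Inf K \<le> Sup K" "Sup K \<le> b'" by auto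
    qed
    define h where "h = (\<lambda>K. {\<phi> (Inf K)..\<phi> (Sup K)})"
    have hm: "\<phi> (Inf K) \<le> \<phi> (Sup K)" if "K \<in> D" for K using K[OF that] by (intro mono)
    have hs: "Inf (h K) = \<phi> (Inf K)" "Sup (h K) = \<phi> (Sup K)" if "K \<in> D" for K using hm[OF that] by (simp_all add: h_def)
    have phi_inj: "s = t" if "\<phi> s = \<phi> t" "s \<in> {a'..b'}" "t \<in> {a'..b'}" for s t
      using strict[of s t] strict[of t s] that by (cases s t rule: linorder_cases) auto
    have inj: "inj_on h D"
    proof (rule inj_onI)
      fix K K' assume KK: "K \<in> D" "K' \<in> D" "h K = h K'"
      have "\<phi> (Inf K) = \<phi> (Inf K')" "\<phi> (Sup K) = \<phi> (Sup K')" using hs[OF KK(1)] hs[OF KK(2)] KK(3) by auto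
      hence "Inf K = Inf K'" "Sup K = Sup K'" using K[OF KK(1)] K[OF KK(2)] by (auto intro!: phi_inj)
      thus "K = K'" using K(1)[OF KK(1)] K(1)[OF KK(2)] by simp
    qed
    have hD: "h ` D division_of \<Union>(h ` D)"
      unfolding division_of_def
    proof (intro conjI ballI impI)
      show "finite (h ` D)" using division_ofD(1)[OF D(1)] by simp
      fix X assume X: "X \<in> h ` D"
      then obtain K where K': "K \<in> D" "X = h K" by blast
      show "X \<subseteq> \<Union>(h ` D)" using X by blast
      show "X \<noteq> {}" using hm[OF K'(1)] K' by (simp add: h_def)
      show "\<exists>a b. X = cbox a b" using K' by (auto simp: h_def)
      fix Y assume Y: "Y \<in> h ` D" and "X \<noteq> Y"
      then obtain K2 where K2: "K2 \<in> D" "Y = h K2" "K \<noteq> K2" using K' by blast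
      have "interior K \<inter> interior K2 = {}" using division_ofD(5)[OF D(1) K'(1) K2(1,3)] .
      hence "{Inf K<..<Sup K} \<inter> {Inf K2<..<Sup K2} = {}"
        using K(1)[OF K'(1)] K(1)[OF K2(1)] interior_atLeastAtMost_real by metis
      hence "min (Sup K) (Sup K2) \<le> max (Inf K) (Inf K2)" by (simp add: Int_greaterThanLessThan)
      \<comment> \<open>The last two alternatives are degenerate intervals, which a division may
        contain.\<close>
      hence "Sup K \<le> Inf K2 \<or> Sup K2 \<le> Inf K \<or> Sup K \<le> Inf K \<or> Sup K2 \<le> Inf K2" by linarith
      hence "\<phi> (Sup K) \<le> \<phi> (Inf K2) \<or> \<phi> (Sup K2) \<le> \<phi> (Inf K) \<or> \<phi> (Sup K) \<le> \<phi> (Inf K) \<or> \<phi> (Sup K2) \<le> \<phi> (Inf K2)"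
        using mono K[OF K'(1)] K[OF K2(1)] by (meson order_trans)
      thus "interior X \<inter> interior Y = {}" using K' K2 by (auto simp: h_def)
    qed simp
    have "(\<Sum>X\<in>h ` D. norm (g (Sup X) - g (Inf X))) < \<epsilon>"
    proof (rule \<delta>[OF hD])
      show "\<Union>(h ` D) \<subseteq> {a..b}"
      proof
        fix x assume "x \<in> \<Union>(h ` D)"
        then obtain K0 where K0: "K0 \<in> D" "x \<in> h K0" by blast
        have "\<phi> (Inf K0) \<in> {a..b}" "\<phi> (Sup K0) \<in> {a..b}" 
          using range[of "Inf K0"] range[of "Sup K0"] K(2-4)[OF K0(1)] by auto
        thus "x \<in> {a..b}" using K0(2) by (auto simp: h_def)
      qed
      have "(\<Sum>X\<in>h ` D. Sup X - Inf X) = (\<Sum>K\<in>D. \<phi> (Sup K) - \<phi> (Inf K))"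
        by (simp add: sum.reindex[OF inj] hs)
      also have "\<dots> \<le> (\<Sum>K\<in>D. C * (Sup K - Inf K))" using K by (intro sum_mono lip) auto
      also have "\<dots> = C * (\<Sum>K\<in>D. Sup K - Inf K)" by (simp add: sum_distrib_left)
      also have "\<dots> < C * (\<delta> / C)" using lt \<open>C > 0\<close> by (intro mult_strict_left_mono)
      finally show "(\<Sum>X\<in>h ` D. Sup X - Inf X) < \<delta>" using \<open>C > 0\<close> by simp
    qed
    thus "(\<Sum>K\<in>D. norm (g (\<phi> (Sup K)) - g (\<phi> (Inf K)))) < \<epsilon>"
      by (simp add: sum.reindex[OF inj] hs)
  qed
qed

lemma curve_facts:
  assumes "curve a b f"
  shows "a < b" "absolutely_continuous_on_interval a b (velocity a b f)" "continuous_on {a..b} (velocity a b f)"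
    "\<And>t. t \<in> {a..b} \<Longrightarrow> (f has_vector_derivative velocity a b f t) (at t within {a..b})"
    "\<And>t. t \<in> {a..b} \<Longrightarrow> velocity a b f t \<noteq> 0"
proof -
  note * = assms[unfolded curve_def]
  show "a < b" "absolutely_continuous_on_interval a b (velocity a b f)"
    "\<And>t. t \<in> {a..b} \<Longrightarrow> velocity a b f t \<noteq> 0" using * by auto
  thus "continuous_on {a..b} (velocity a b f)" by (auto intro: absolutely_continuous_imp_continuous_on)
  show "(f has_vector_derivative velocity a b f t) (at t within {a..b})" if "t \<in> {a..b}" for t
    using * that unfolding velocity_def differentiable_on_def by (auto simp: vector_derivative_works[symmetric])
qed

lemma velocity_eqI:
  assumes "a < b" "t \<in> {a..b}" "(f has_vector_derivative v) (at t within {a..b})"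
  shows "velocity a b f t = v"
  using vector_derivative_within_cbox[of a b t f v] assms by (simp add: velocity_def)

lemma velocity_restrict:
  assumes "curve a b f" "a \<le> s" "s < t" "t \<le> b" "u \<in> {s..t}"
  shows "velocity s t f u = velocity a b f u"
proof (rule velocity_eqI[OF assms(3,5)])
  have "(f has_vector_derivative velocity a b f u) (at u within {a..b})"
    using curve_facts(4)[OF assms(1), of u] assms by auto
  thus "(f has_vector_derivative velocity a b f u) (at u within {s..t})"
    by (rule has_vector_derivative_within_subset) (use assms in auto)
qed

lemma curve_restrict:
  assumes c: "curve a b f" and st: "a \<le> s" "s < t" "t \<le> b"
  shows "curve s t f"
  unfolding curve_def
proof (intro conjI ballI st(2))
  note v = velocity_restrict[OF c st]
  show "f differentiable_on {s..t}"
    using c st unfolding curve_def by (auto intro: differentiable_on_subset)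
  show "absolutely_continuous_on_interval s t (velocity s t f)"
    by (rule absolutely_continuous_dominated[OF curve_facts(2)[OF c] st(1,3), where C=1 and \<eta>=1]) (auto simp: v)
  show "velocity s t f u \<noteq> 0" if "u \<in> {s..t}" for u
    using curve_facts(5)[OF c, of u] v[OF that] that st by auto
qed

text \<open>The last fact holds because the speed is continuous and has no zero on a compact
  interval. It makes the inverse of the arclength Lipschitz, so that absolute continuity survives
  the change to arclength.\<close>

lemma arclength_upto_facts:
  assumes c: "curve a b f"
  defines "S \<equiv> arclength_upto a b f"
  shows "S a = 0"
    "\<And>t. t \<in> {a..b} \<Longrightarrow> (S has_real_derivative norm (velocity a b f t)) (at t within {a..b})"
    "continuous_on {a..b} S"
    "\<And>s t. a \<le> s \<Longrightarrow> s \<le> t \<Longrightarrow> t \<le> b \<Longrightarrow> S t - S s = integral {s..t} (\<lambda>u. norm (velocity a b f u))"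
    "\<exists>m>0. (\<forall>t\<in>{a..b}. m \<le> norm (velocity a b f t)) \<and> (\<forall>s t. a \<le> s \<longrightarrow> s \<le> t \<longrightarrow> t \<le> b \<longrightarrow> m * (t - s) \<le> S t - S s)"
proof -
  note f = curve_facts[OF c]
  have nc: "continuous_on {a..b} (\<lambda>u. norm (velocity a b f u))" by (intro continuous_intros f(3))
  show "S a = 0" by (simp add: S_def arclength_upto_def)
  show der: "(S has_real_derivative norm (velocity a b f t)) (at t within {a..b})" if "t \<in> {a..b}" for t
    using integral_has_real_derivative[OF nc that] by (simp add: S_def arclength_upto_def[abs_def])
  show "continuous_on {a..b} S" by (rule DERIV_continuous_on[OF der])
  show inc: "S t - S s = integral {s..t} (\<lambda>u. norm (velocity a b f u))" if "a \<le> s" "s \<le> t" "t \<le> b" for s t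
    using Henstock_Kurzweil_Integration.integral_combine[of a s t "\<lambda>u. norm (velocity a b f u)"] that
      integrable_continuous_real[OF continuous_on_subset[OF nc, of "{a..t}"]]
    by (simp add: S_def arclength_upto_def)
  obtain t0 where t0: "t0 \<in> {a..b}" "\<And>t. t \<in> {a..b} \<Longrightarrow> norm (velocity a b f t0) \<le> norm (velocity a b f t)"
    using continuous_attains_inf[OF compact_Icc _ nc] f(1) by auto
  define m where "m = norm (velocity a b f t0)"
  have "0 < m" using f(5)[OF t0(1)] by (simp add: m_def)
  moreover have "m * (t - s) \<le> S t - S s" if "a \<le> s" "s \<le> t" "t \<le> b" for s t
  proof -
    have "integral {s..t} (\<lambda>_. m) \<le> integral {s..t} (\<lambda>u. norm (velocity a b f u))"
      using that t0(2) integrable_continuous_real[OF continuous_on_subset[OF nc, of "{s..t}"]]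
      by (intro integral_le) (auto simp: m_def)
    thus ?thesis using inc[OF that] that by (simp add: mult.commute)
  qed
  ultimately show "\<exists>m>0. (\<forall>t\<in>{a..b}. m \<le> norm (velocity a b f t)) \<and> (\<forall>s t. a \<le> s \<longrightarrow> s \<le> t \<longrightarrow> t \<le> b \<longrightarrow> m * (t - s) \<le> S t - S s)"
    using t0(2) by (intro exI[of _ m]) (auto simp: m_def)
qed

lemma arclength_upto_strict_mono:
  assumes "curve a b f" "a \<le> s" "s < t" "t \<le> b"
  shows "arclength_upto a b f s < arclength_upto a b f t"
proof -
  obtain m where "m > 0" "m * (t - s) \<le> arclength_upto a b f t - arclength_upto a b f s"
    using arclength_upto_facts(5)[OF assms(1)] assms(2-4) by (meson less_imp_le)
  moreover have "0 < m * (t - s)" using \<open>m > 0\<close> assms by simp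
  ultimately show ?thesis by linarith
qed

lemma arclength_pos: "curve a b f \<Longrightarrow> 0 < arclength a b f"
  using arclength_upto_strict_mono[of a b f a b] arclength_upto_facts(1)[of a b f] curve_facts(1)[of a b f]
  by (simp add: arclength_def)

lemma time_at_arclength_facts:
  assumes c: "curve a b f"
  shows "\<And>t. t \<in> {a..b} \<Longrightarrow> time_at_arclength a b f (arclength_upto a b f t) = t"
    "\<And>s. s \<in> {0..arclength a b f} \<Longrightarrow> time_at_arclength a b f s \<in> {a..b} \<and> arclength_upto a b f (time_at_arclength a b f s) = s"
    "\<And>t. t \<in> {a..b} \<Longrightarrow> arclength_upto a b f t \<in> {0..arclength a b f}"
proof -
  have inj: "inj_on (arclength_upto a b f) {a..b}"
    by (rule linorder_inj_onI') (use arclength_upto_strict_mono[OF c] in \<open>fastforce\<close>)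
  show tS: "time_at_arclength a b f (arclength_upto a b f t) = t" if "t \<in> {a..b}" for t
    unfolding time_at_arclength_def by (rule the_inv_into_f_f[OF inj that])
  show "time_at_arclength a b f s \<in> {a..b} \<and> arclength_upto a b f (time_at_arclength a b f s) = s"
    if "s \<in> {0..arclength a b f}" for s
  proof -
    have "\<exists>t\<ge>a. t \<le> b \<and> arclength_upto a b f t = s"
      using arclength_upto_facts(1,3)[OF c] that curve_facts(1)[OF c]
      by (intro IVT') (auto simp: arclength_def)
    then obtain t where "t \<in> {a..b}" "arclength_upto a b f t = s" by auto
    thus ?thesis using tS by auto
  qed
  show "arclength_upto a b f t \<in> {0..arclength a b f}" if "t \<in> {a..b}" for t
    using arclength_upto_strict_mono[OF c, of a t] arclength_upto_strict_mono[OF c, of t b] that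
      arclength_upto_facts(1)[OF c] by (cases "t = a"; cases "t = b") (auto simp: arclength_def)
qed

lemma unit_tangent_ends:
  assumes "curve a b f"
  shows "unit_tangent a b f 0 = sgn (velocity a b f a)" "unit_tangent a b f (arclength a b f) = sgn (velocity a b f b)"
  using time_at_arclength_facts(1)[OF assms, of a] time_at_arclength_facts(1)[OF assms, of b]
    arclength_upto_facts(1)[OF assms] curve_facts(1)[OF assms]
  by (auto simp: unit_tangent_def arclength_def)

lemma arclength_restrict:
  assumes c: "curve a b f" and st: "a \<le> s" "s < t" "t \<le> b"
  shows "\<And>u. u \<in> {s..t} \<Longrightarrow> arclength_upto s t f u = arclength_upto a b f u - arclength_upto a b f s"
    "arclength s t f = arclength_upto a b f t - arclength_upto a b f s"
    "\<And>x. x \<in> {0..arclength s t f} \<Longrightarrow> unit_tangent s t f x = unit_tangent a b f (arclength_upto a b f s + x)"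
proof -
  note c' = curve_restrict[OF c st]
  show S: "arclength_upto s t f u = arclength_upto a b f u - arclength_upto a b f s" if u: "u \<in> {s..t}" for u
  proof -
    have "integral {s..u} (\<lambda>x. norm (velocity s t f x)) = integral {s..u} (\<lambda>x. norm (velocity a b f x))"
      by (rule integral_cong) (use u velocity_restrict[OF c st] in auto)
    thus ?thesis using arclength_upto_facts(4)[OF c, of s u] u st by (simp add: arclength_upto_def)
  qed
  show L: "arclength s t f = arclength_upto a b f t - arclength_upto a b f s"
    using S[of t] st by (simp add: arclength_def)
  show "unit_tangent s t f x = unit_tangent a b f (arclength_upto a b f s + x)" if x: "x \<in> {0..arclength s t f}" for x
  proof -
    define u where "u = time_at_arclength s t f x"
    have u: "u \<in> {s..t}" "arclength_upto s t f u = x" using time_at_arclength_facts(2)[OF c' x] by (auto simp: u_def)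
    have "arclength_upto a b f s + x = arclength_upto a b f u" using S[OF u(1)] u(2) by simp
    hence "time_at_arclength a b f (arclength_upto a b f s + x) = u"
      using time_at_arclength_facts(1)[OF c, of u] u(1) st by simp
    thus ?thesis using velocity_restrict[OF c st u(1)] by (simp add: unit_tangent_def u_def)
  qed
qed

text \<open>Second of the two comparisons that carry absolute continuity from the velocity through
  the unit tangent to the angle. Periodicity of \<open>cis\<close> confines it to nearby
  angles.\<close>

lemma angle_dist_le_cis_dist:
  assumes "\<bar>x - y\<bar> \<le> 1"
  shows "\<bar>x - y\<bar> \<le> 2 * norm (cis x - cis y)"
proof -
  have "\<bar>x - y\<bar> / 2 \<le> sin \<bar>x - y\<bar>" using assms pi_gt3 by (intro half_le_sin) auto
  also have "\<dots> = \<bar>sin (x - y)\<bar>"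
  proof -
    have "0 \<le> sin \<bar>x - y\<bar>" using assms pi_gt3 by (intro sin_ge_zero) auto
    moreover have "sin \<bar>u\<bar> = \<bar>sin u\<bar>" if "0 \<le> sin \<bar>u\<bar>" for u :: real
      using that by (cases "0 \<le> u") auto
    ultimately show ?thesis by blast
  qed
  also have "sin (x - y) = Im ((cis x - cis y) * cnj (cis y))" by (simp add: sin_diff algebra_simps)
  also have "\<bar>Im ((cis x - cis y) * cnj (cis y))\<bar> \<le> norm ((cis x - cis y) * cnj (cis y))" by (rule abs_Im_le_cmod)
  also have "\<dots> = norm (cis x - cis y)" by (simp add: norm_mult)
  finally show ?thesis by simp
qed

text \<open>Normalization is Lipschitz away from the origin: the factor 2 accounts for the change of
  the vector and for that of its length.\<close>

lemma norm_sgn_diff_le: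
  fixes v w :: complex
  assumes "0 < m" "m \<le> norm v" "m \<le> norm w"
  shows "norm (sgn v - sgn w) \<le> 2 / m * norm (v - w)"
proof -
  have nz: "norm v \<noteq> 0" "norm w \<noteq> 0" using assms by auto
  have "norm v *\<^sub>R (sgn v - sgn w) = (v - w) + (norm w - norm v) *\<^sub>R sgn w"
    using nz by (simp add: sgn_div_norm algebra_simps)
  hence "norm v * norm (sgn v - sgn w) = norm ((v - w) + (norm w - norm v) *\<^sub>R sgn w)"
    by (metis norm_scaleR abs_norm_cancel)
  also have "\<dots> \<le> norm (v - w) + \<bar>norm w - norm v\<bar> * norm (sgn w)"
    by (metis norm_triangle_ineq norm_scaleR)
  also have "\<dots> \<le> 2 * norm (v - w)"
    using norm_triangle_ineq3[of w v] nz by (simp add: norm_sgn norm_minus_commute)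
  finally have "norm v * norm (sgn v - sgn w) \<le> 2 * norm (v - w)" .
  moreover have "m * norm (sgn v - sgn w) \<le> norm v * norm (sgn v - sgn w)" using assms by (intro mult_right_mono) auto
  ultimately have "m * norm (sgn v - sgn w) \<le> 2 * norm (v - w)" by linarith
  thus ?thesis using assms(1) by (simp add: field_simps)
qed

text \<open>Passage from the definition of an s-curve to its angle as a function of arclength. The
  given angle is only continuous; its absolute continuity comes from that of the velocity, and then
  the density exists.\<close>

lemma s_curve_bend:
  assumes sc: "s_curve a b f"
  obtains \<sigma> c \<theta> k where "bend \<sigma> (arclength a b f) c \<theta> k"
    "\<And>s. s \<in> {0..arclength a b f} \<Longrightarrow> unit_tangent a b f s = cis (\<theta> s)" "chord (arclength a b f) \<theta> = f b - f a"
proof -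
  have cv: "curve a b f" using sc by (simp add: s_curve_def)
  note f = curve_facts[OF cv]
  obtain \<phi> c0 where ta: "tangent_angle a b f \<phi>" and c0: "c0 \<in> {a..b}"
    and mon: "mono_on {a..c0} \<phi> \<and> antimono_on {c0..b} \<phi> \<or> antimono_on {a..c0} \<phi> \<and> mono_on {c0..b} \<phi>"
    and turn: "\<bar>\<phi> c0 - \<phi> a\<bar> \<le> pi" "\<bar>\<phi> b - \<phi> c0\<bar> \<le> pi"
    using sc unfolding s_curve_def by blast
  have \<phi>c: "continuous_on {a..b} \<phi>" and \<phi>v: "\<And>t. t \<in> {a..b} \<Longrightarrow> velocity a b f t = of_real (norm (velocity a b f t)) * cis (\<phi> t)"
    using ta by (auto simp: tangent_angle_def)
  have sgnv: "sgn (velocity a b f t) = cis (\<phi> t)" if "t \<in> {a..b}" for t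
  proof -
    have nz: "norm (velocity a b f t) \<noteq> 0" using f(5)[OF that] by simp
    have "sgn (velocity a b f t) = velocity a b f t / of_real (norm (velocity a b f t))" by (rule sgn_eq)
    also have "\<dots> = (of_real (norm (velocity a b f t)) * cis (\<phi> t)) / of_real (norm (velocity a b f t))"
      using \<phi>v[OF that] by presburger
    also have "\<dots> = cis (\<phi> t)" using nz by simp
    finally show ?thesis .
  qed
  define S where "S = arclength_upto a b f"
  define \<tau> where "\<tau> = time_at_arclength a b f"
  define L where "L = arclength a b f"
  have L0: "0 < L" unfolding L_def by (rule arclength_pos[OF cv])
  obtain m where m: "m > 0" "\<And>t. t \<in> {a..b} \<Longrightarrow> m \<le> norm (velocity a b f t)"
    "\<And>s t. a \<le> s \<Longrightarrow> s \<le> t \<Longrightarrow> t \<le> b \<Longrightarrow> m * (t - s) \<le> S t - S s"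
    using arclength_upto_facts(5)[OF cv] unfolding S_def by blast
  note t1 = time_at_arclength_facts(1)[OF cv, folded S_def \<tau>_def]
  note t2 = time_at_arclength_facts(2)[OF cv, folded S_def \<tau>_def L_def]
  note t3 = time_at_arclength_facts(3)[OF cv, folded S_def L_def]
  note Sstrict = arclength_upto_strict_mono[OF cv, folded S_def]
  have S0: "S a = 0" "S b = L" using arclength_upto_facts(1)[OF cv] by (simp_all add: S_def L_def arclength_def)
  have \<tau>strict: "\<tau> s < \<tau> t" if "0 \<le> s" "s < t" "t \<le> L" for s t
  proof (rule ccontr)
    assume "\<not> \<tau> s < \<tau> t"
    hence "S (\<tau> t) \<le> S (\<tau> s)" using Sstrict[of "\<tau> t" "\<tau> s"] t2[of s] t2[of t] that by (cases "\<tau> t = \<tau> s") auto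
    thus False using t2[of s] t2[of t] that by auto
  qed
  have \<tau>lip: "\<tau> t - \<tau> s \<le> 1 / m * (t - s)" if "0 \<le> s" "s \<le> t" "t \<le> L" for s t
  proof -
    have "\<tau> s \<le> \<tau> t" using \<tau>strict[of s t] that by (cases "s = t") auto
    hence "m * (\<tau> t - \<tau> s) \<le> t - s" using m(3)[of "\<tau> s" "\<tau> t"] t2[of s] t2[of t] that by auto
    thus ?thesis using m(1) by (simp add: field_simps)
  qed
  have ac\<phi>: "absolutely_continuous_on_interval a b \<phi>"
  proof -
    have "uniformly_continuous_on {a..b} \<phi>" by (rule compact_uniformly_continuous[OF \<phi>c compact_Icc])
    \<comment> \<open>Uniform continuity of the angle brings nearby times into the range where the
      angle is controlled by the unit tangent.\<close>
    then obtain \<eta> where \<eta>: "\<eta> > 0" "\<And>s t. s \<in> {a..b} \<Longrightarrow> t \<in> {a..b} \<Longrightarrow> dist t s < \<eta> \<Longrightarrow> dist (\<phi> t) (\<phi> s) < 1"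
      unfolding uniformly_continuous_on_def by (meson zero_less_one)
    show ?thesis
    proof (rule absolutely_continuous_dominated[OF f(2) order_refl order_refl _ \<eta>(1), where C="4/m"])
      show "0 < 4 / m" using m by simp
      fix s t assume st: "a \<le> s" "s \<le> t" "t \<le> b" "t - s < \<eta>"
      hence in_ab: "s \<in> {a..b}" "t \<in> {a..b}" by auto
      have "\<bar>\<phi> t - \<phi> s\<bar> \<le> 2 * norm (cis (\<phi> t) - cis (\<phi> s))"
        using \<eta>(2)[OF in_ab] st by (intro angle_dist_le_cis_dist) (simp add: dist_real_def)
      also have "\<dots> = 2 * norm (sgn (velocity a b f t) - sgn (velocity a b f s))" using sgnv in_ab by simp
      also have "\<dots> \<le> 2 * (2 / m * norm (velocity a b f t - velocity a b f s))"
        using m(1) m(2)[OF in_ab(1)] m(2)[OF in_ab(2)] by (intro mult_left_mono norm_sgn_diff_le) auto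
      finally show "norm (\<phi> t - \<phi> s) \<le> 4 / m * norm (velocity a b f t - velocity a b f s)" by simp
    qed
  qed
  define \<theta> where "\<theta> = (\<lambda>s. \<phi> (\<tau> (max 0 (min s L))))"
  have \<theta>in: "\<theta> s = \<phi> (\<tau> s)" if "s \<in> {0..L}" for s using that by (simp add: \<theta>_def)
  have ac\<theta>: "absolutely_continuous_on_interval 0 L \<theta>"
  proof -
    have "absolutely_continuous_on_interval 0 L (\<lambda>s. \<phi> (\<tau> s))"
      by (rule absolutely_continuous_compose[OF ac\<phi>, where C="1/m"]) (use m t2 \<tau>strict \<tau>lip in auto)
    thus ?thesis
      by (rule absolutely_continuous_dominated[where C=1 and \<eta>=1]) (auto simp: \<theta>in)
  qed
  have \<theta>cont: "continuous_on UNIV \<theta>"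
  proof -
    have c: "continuous_on {0..L} \<theta>" by (rule absolutely_continuous_imp_continuous_on[OF ac\<theta>])
    have "continuous_on UNIV (\<lambda>s. \<theta> (max 0 (min s L)))"
      by (intro continuous_on_compose2[OF c] continuous_intros) (use L0 in auto)
    thus ?thesis by (rule continuous_on_eq) (use L0 in \<open>auto simp: \<theta>_def\<close>)
  qed
  define c where "c = S c0"
  have c: "0 \<le> c" "c \<le> L" using t3[OF c0] by (auto simp: c_def)
  have \<tau>c: "\<tau> c = c0" unfolding c_def by (rule t1[OF c0])
  have \<tau>0: "\<tau> 0 = a" "\<tau> L = b" using t1[of a] t1[of b] S0 f(1) by auto
  have \<tau>mono: "\<tau> s \<le> \<tau> t" if "0 \<le> s" "s \<le> t" "t \<le> L" for s t using \<tau>strict[of s t] that by (cases "s = t") auto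
  define \<sigma> :: real where "\<sigma> = (if mono_on {a..c0} \<phi> \<and> antimono_on {c0..b} \<phi> then 1 else -1)"
  have up: "\<sigma> * \<phi> s \<le> \<sigma> * \<phi> t" if "a \<le> s" "s \<le> t" "t \<le> c0" for s t
    using mon that by (auto simp: \<sigma>_def monotone_on_def)
  have dn: "\<sigma> * \<phi> t \<le> \<sigma> * \<phi> s" if "c0 \<le> s" "s \<le> t" "t \<le> b" for s t
    using mon that by (auto simp: \<sigma>_def monotone_on_def)
  obtain k where k: "bend \<sigma> L c \<theta> k"
  proof (rule bend_exists[OF _ c \<theta>cont])
    show "\<sigma> = 1 \<or> \<sigma> = -1" by (simp add: \<sigma>_def)
    show "\<theta> s = \<theta> 0" if "s \<le> 0" for s using that L0 by (simp add: \<theta>_def)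
    show "\<theta> s = \<theta> L" if "L \<le> s" for s using that L0 by (simp add: \<theta>_def)
    show "\<sigma> * \<theta> s \<le> \<sigma> * \<theta> t" if "0 \<le> s" "s \<le> t" "t \<le> c" for s t
      using that c \<tau>mono[of s t] \<tau>mono[of t c] t2[of s] by (simp add: \<theta>in \<tau>c up)
    show "\<sigma> * \<theta> t \<le> \<sigma> * \<theta> s" if "c \<le> s" "s \<le> t" "t \<le> L" for s t
      using that c \<tau>mono[of s t] \<tau>mono[of c s] t2[of t] by (simp add: \<theta>in \<tau>c dn)
    show "absolutely_continuous_on_interval 0 L \<theta>" by (rule ac\<theta>)
    show "\<bar>\<theta> c - \<theta> 0\<bar> \<le> pi" "\<bar>\<theta> L - \<theta> c\<bar> \<le> pi" using turn c L0 by (simp_all add: \<theta>in \<tau>c \<tau>0)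
  qed
  have ut: "unit_tangent a b f s = cis (\<theta> s)" if "s \<in> {0..L}" for s
    using sgnv[of "\<tau> s"] t2[OF that] by (simp add: unit_tangent_def \<theta>in[OF that] \<tau>_def[symmetric])
  \<comment> \<open>The curve and the integral of \<open>cis \<theta>\<close> up to the current
    arclength have the same velocity, so they differ by a constant.\<close>
  have "chord L \<theta> = f b - f a"
  proof -
    have cisc: "continuous_on {0..L} (\<lambda>s. cis (\<theta> s))" by (intro continuous_on_cis continuous_on_subset[OF \<theta>cont]) auto
    define G where "G = (\<lambda>x. integral {0..x} (\<lambda>s. cis (\<theta> s)))"
    have "((\<lambda>t. f t - G (S t)) has_derivative (\<lambda>h. 0)) (at t within {a..b})" if t: "t \<in> {a..b}" for t
    proof -
      have "(G has_vector_derivative cis (\<theta> (S t))) (at (S t) within {0..L})"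
        unfolding G_def by (rule integral_has_vector_derivative[OF cisc t3[OF t]])
      hence "(G has_vector_derivative cis (\<theta> (S t))) (at (S t) within S ` {a..b})"
        by (rule has_vector_derivative_within_subset) (use t3 in auto)
      moreover have "(S has_vector_derivative norm (velocity a b f t)) (at t within {a..b})"
        using arclength_upto_facts(2)[OF cv t] by (simp add: S_def has_real_derivative_iff_has_vector_derivative)
      ultimately have "((G \<circ> S) has_vector_derivative norm (velocity a b f t) *\<^sub>R cis (\<theta> (S t))) (at t within {a..b})"
        by (rule vector_diff_chain_within[rotated])
      also have "norm (velocity a b f t) *\<^sub>R cis (\<theta> (S t)) = velocity a b f t"
        using \<phi>v[OF t] \<theta>in[OF t3[OF t]] t1[OF t] by (simp add: scaleR_conv_of_real)
      finally have "((\<lambda>t. f t - (G \<circ> S) t) has_vector_derivative velocity a b f t - velocity a b f t) (at t within {a..b})"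
        by (intro has_vector_derivative_diff f(4)[OF t])
      thus ?thesis by (simp add: has_vector_derivative_def)
    qed
    from has_derivative_zero_constant[OF convex_real_interval(5) this]
    obtain C where C: "\<And>t. t \<in> {a..b} \<Longrightarrow> f t - G (S t) = C" by auto
    have "f b - G L = f a - G 0" using C[of a] C[of b] f(1) S0 by auto
    hence "f b - f a = G L" by (simp add: G_def algebra_simps)
    also have "\<dots> = chord L \<theta>" unfolding G_def chord_def
    proof (rule set_borel_integral_eq_integral(2)[symmetric])
      show "set_integrable lborel {0..L} (\<lambda>s. cis (\<theta> s))"
        by (rule borel_integrable_atLeastAtMost'[OF cisc])
    qed
    finally show ?thesis ..
  qed
  with k ut show ?thesis unfolding L_def by (rule that)
qed

section \<open>Curvature and energy of a curve composed of pieces\<close>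

lemma cis_vector_derivative_within:
  assumes L: "0 < L" and s: "s \<in> {0..L}" and u: "\<And>s. s \<in> {0..L} \<Longrightarrow> T s = cis (\<theta> s)"
    and d: "(\<theta> has_real_derivative \<kappa>) (at s within {0..L})"
  shows "(T has_vector_derivative \<kappa> *\<^sub>R (\<i> * cis (\<theta> s))) (at s within {0..L})"
proof -
  have "((\<lambda>s. cis (\<theta> s)) has_derivative (\<lambda>x. (\<kappa> * x) *\<^sub>R (\<i> * cis (\<theta> s)))) (at s within {0..L})"
    using has_derivative_cis[OF d[unfolded has_field_derivative_def]] .
  hence "((\<lambda>s. cis (\<theta> s)) has_vector_derivative \<kappa> *\<^sub>R (\<i> * cis (\<theta> s))) (at s within {0..L})"
    by (simp add: has_vector_derivative_def mult.commute)
  thus ?thesis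
    by (rule has_vector_derivative_transform_within[OF _ zero_less_one s]) (simp add: u)
qed

lemma signed_curvature_eqI:
  assumes "T = unit_tangent a b f" "L = arclength a b f" "0 < L" "s \<in> {0..L}" "T s = cis \<phi>"
    and d: "(T has_vector_derivative \<kappa> *\<^sub>R (\<i> * cis \<phi>)) (at s within {0..L})"
  shows "signed_curvature a b f s = \<kappa>"
proof -
  have "vector_derivative T (at s within {0..L}) = \<kappa> *\<^sub>R (\<i> * cis \<phi>)"
    using vector_derivative_within_cbox[of 0 L s T] assms by simp
  hence "signed_curvature a b f s = Im (cnj (cis \<phi>) * (\<kappa> *\<^sub>R (\<i> * cis \<phi>)))"
    using assms by (simp add: signed_curvature_def)
  also have "cnj (cis \<phi>) * (\<kappa> *\<^sub>R (\<i> * cis \<phi>)) = \<kappa> *\<^sub>R \<i>"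
    by (simp add: cis_cnj cis_mult mult.left_commute scaleR_conv_of_real)
  finally show ?thesis by simp
qed

lemma AE_lborel_shift:
  assumes "AE x in lborel. P (x::real)"
  shows "AE x in lborel. P (x - r)"
proof -
  obtain N where N: "N \<in> null_sets lborel" "\<And>x. x \<notin> N \<Longrightarrow> P x" using assms by (auto elim!: AE_E3)
  have [measurable]: "N \<in> sets borel" using N(1) by auto
  have "AE x in lborel. x \<notin> N" by (rule AE_not_in[OF N(1)])
  hence "AE x in lborel. (- r + 1 * x) \<notin> N" by (intro AE_borel_affine) auto
  thus ?thesis by eventually_elim (use N(2) in \<open>auto simp: algebra_simps\<close>)
qed

lemma steps_mono:
  fixes S :: "nat \<Rightarrow> real"
  assumes "\<And>j. 1 \<le> j \<Longrightarrow> j < m \<Longrightarrow> S j \<le> S (Suc j)" "1 \<le> i" "i \<le> j" "j \<le> m"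
  shows "S i \<le> S j"
  using assms(3,4)
proof (induction j rule: dec_induct)
  case (step n)
  thus ?case using assms(1)[of n] assms(2) by auto
qed simp

lemma steps_cover:
  fixes S :: "nat \<Rightarrow> real"
  assumes "S 1 \<le> s" "s < S m" "1 \<le> m"
  shows "\<exists>j\<in>{1..<m}. S j \<le> s \<and> s < S (Suc j)"
  using assms(3,2)
proof (induction m rule: dec_induct)
  case base thus ?case using assms(1) by simp
next
  case (step n)
  show ?case
  proof (cases "s < S n")
    case True thus ?thesis using step.IH by force
  next
    case False thus ?thesis using step by (intro bexI[of _ n]) auto
  qed
qed

text \<open>Each density vanishes outside its own open interval, so after shifting, at most one is
  nonzero at any s, and the squared curvature is their sum except on a null set that contains the
  nodes. The integrals are extended real valued, so infinite energy is covered.\<close>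

lemma bending_energy_pieces:
  fixes S L :: "nat \<Rightarrow> real"
  assumes cv: "curve a b F" and m: "1 \<le> m" and S: "S 1 = 0" "S m = arclength a b F"
    and bd: "\<And>j. j \<in> {1..<m} \<Longrightarrow> bend (\<sigma> j) (L j) (c j) (\<theta> j) (k j)"
    and SL: "\<And>j. j \<in> {1..<m} \<Longrightarrow> S (Suc j) = S j + L j"
    and ut: "\<And>j s. j \<in> {1..<m} \<Longrightarrow> s \<in> {0..L j} \<Longrightarrow> unit_tangent a b F (S j + s) = cis (\<theta> j s)"
  shows "bending_energy a b F = (\<Sum>j\<in>{1..<m}. \<integral>\<^sup>+s. ennreal ((k j s)\<^sup>2) \<partial>lborel) / 4"
proof -
  define A where "A = arclength a b F"
  have A0: "0 < A" unfolding A_def by (rule arclength_pos[OF cv])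
  have km[measurable]: "k j \<in> borel_measurable borel" if "j \<in> {1..<m}" for j by (rule bend_facts(6)[OF bd[OF that]])
  have mono: "S i \<le> S j" if "1 \<le> i" "i \<le> j" "j \<le> m" for i j
    by (rule steps_mono[where m=m]) (use that SL bend_facts(4)[OF bd] in auto)
  have k0: "k j (s - S j) = 0" if "j \<in> {1..<m}" "s \<notin> {S j<..<S (Suc j)}" for j s
    using bend_facts(7)[OF bd[OF that(1)], of "s - S j"] that SL[OF that(1)] by auto
  have "AE s in lborel. \<forall>j\<in>{1..<m}. (\<theta> j has_real_derivative k j (s - S j)) (at (s - S j))"
    using AE_lborel_shift[OF bend_AE_derivative[OF bd]] by (intro AE_finite_allI) auto
  moreover have "AE s in lborel. \<forall>j\<in>{1..m}. s \<noteq> S j"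
    by (intro AE_finite_allI AE_lborel_singleton) auto
  ultimately have "AE s in lborel. ennreal ((signed_curvature a b F s)\<^sup>2) * indicator {0..A} s
      = (\<Sum>j\<in>{1..<m}. ennreal ((k j (s - S j))\<^sup>2))"
  proof eventually_elim
    case (elim s)
    show ?case
    proof (cases "s \<in> {0..A}")
      case False
      have "k j (s - S j) = 0" if j: "j \<in> {1..<m}" for j
        using k0[OF j, of s] mono[of 1 j] mono[of "Suc j" m] j False S by (auto simp: A_def)
      thus ?thesis using False by simp
    next
      case True
      have "s \<noteq> S m" using elim(2) m by auto
      hence "s < S m" using True S by (auto simp: A_def)
      then obtain j where j: "j \<in> {1..<m}" "S j \<le> s" "s < S (Suc j)"
        using steps_cover[of S s m] True S(1) m by auto
      have js: "S j < s" using elim(2) j by (auto simp: less_le)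
      have zero: "k i (s - S i) = 0" if "i \<in> {1..<m} - {j}" for i
      proof -
        have "Suc i \<le> j \<or> Suc j \<le> i" "i \<in> {1..<m}" using that by auto
        hence "S (Suc i) \<le> S j \<or> S (Suc j) \<le> S i" using mono[of "Suc i" j] mono[of "Suc j" i] j by auto
        thus ?thesis using k0[OF \<open>i \<in> {1..<m}\<close>, of s] j js by auto
      qed
      have sub: "{S j<..<S (Suc j)} \<subseteq> {0..A}" using mono[of 1 j] mono[of "Suc j" m] j S by (auto simp: A_def)
      have "((\<lambda>x. \<theta> j (x - S j)) has_real_derivative k j (s - S j)) (at s)"
        using DERIV_shift[of "\<theta> j" "k j (s - S j)" s "- S j"] elim(1) j by simp
      hence d: "((\<lambda>x. cis (\<theta> j (x - S j))) has_vector_derivative k j (s - S j) *\<^sub>R (\<i> * cis (\<theta> j (s - S j)))) (at s)"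
        using has_derivative_cis[of "\<lambda>x. \<theta> j (x - S j)" "(*) (k j (s - S j))" s UNIV]
        by (simp add: has_field_derivative_def has_vector_derivative_def mult.commute)
      have eq: "cis (\<theta> j (x - S j)) = unit_tangent a b F x" if "x \<in> {S j<..<S (Suc j)}" for x
        using ut[OF j(1), of "x - S j"] SL[OF j(1)] that by auto
      have "(unit_tangent a b F has_vector_derivative k j (s - S j) *\<^sub>R (\<i> * cis (\<theta> j (s - S j)))) (at s)"
        by (rule has_vector_derivative_transform_within_open[OF d, of "{S j<..<S (Suc j)}"]) (use js j eq in auto)
      from has_vector_derivative_at_within[OF this] have "signed_curvature a b F s = k j (s - S j)"
        by (rule signed_curvature_eqI[OF refl refl, rotated 3])
           (use A0 True eq[of s] js j in \<open>auto simp: A_def\<close>)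
      moreover have "(\<Sum>i\<in>{1..<m}. ennreal ((k i (s - S i))\<^sup>2)) = ennreal ((k j (s - S j))\<^sup>2)"
        using zero by (subst sum.remove[OF _ j(1)]) auto
      ultimately show ?thesis using True by simp
    qed
  qed
  hence ae: "AE s in lebesgue. ennreal ((signed_curvature a b F s)\<^sup>2) * indicator {0..A} s
      = (\<Sum>j\<in>{1..<m}. ennreal ((k j (s - S j))\<^sup>2))" by (rule AE_completion)
  have "(\<integral>\<^sup>+ s\<in>{0..A}. ennreal ((signed_curvature a b F s)\<^sup>2) \<partial>lebesgue)
     = (\<integral>\<^sup>+s. (\<Sum>j\<in>{1..<m}. ennreal ((k j (s - S j))\<^sup>2)) \<partial>lebesgue)"
    by (rule nn_integral_cong_AE[OF ae])
  also have "\<dots> = (\<integral>\<^sup>+s. (\<Sum>j\<in>{1..<m}. ennreal ((k j (s - S j))\<^sup>2)) \<partial>lborel)"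
    by (rule nn_integral_completion)
  also have "\<dots> = (\<Sum>j\<in>{1..<m}. \<integral>\<^sup>+s. ennreal ((k j (s - S j))\<^sup>2) \<partial>lborel)"
    by (rule nn_integral_sum) measurable
  also have "\<dots> = (\<Sum>j\<in>{1..<m}. \<integral>\<^sup>+s. ennreal ((k j s)\<^sup>2) \<partial>lborel)"
  proof (rule sum.cong[OF refl])
    fix j assume "j \<in> {1..<m}"
    note [measurable] = km[OF this]
    show "(\<integral>\<^sup>+s. ennreal ((k j (s - S j))\<^sup>2) \<partial>lborel) = (\<integral>\<^sup>+s. ennreal ((k j s)\<^sup>2) \<partial>lborel)"
      using nn_integral_real_affine[of "\<lambda>s. ennreal ((k j s)\<^sup>2)" 1 "- S j"] by simp
  qed
  finally show ?thesis by (simp add: bending_energy_def A_def)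
qed

text \<open>The chord angle condition becomes an inequality between continuous functions of the
  direction; in this form it passes to limits, which \<open>Arg\<close> would obstruct on the
  negative axis.\<close>

lemma abs_Arg_div_le_iff:
  assumes "z \<noteq> 0"
  shows "\<bar>Arg (w / z)\<bar> \<le> pi / 2 \<longleftrightarrow> 0 \<le> Re (w * cnj z)"
proof -
  have "Re (w / z) = Re (w * cnj z) / (norm z)\<^sup>2"
    by (subst complex_div_cnj) (simp only: Re_divide_of_real of_real_power[symmetric])
  thus ?thesis using assms by (simp only: Arg_Re_nonneg zero_le_divide_iff) auto
qed

lemma norm_cis_diff_le: "norm (cis x - cis y) \<le> \<bar>x - y\<bar>"
proof -
  have "(norm (cis x - cis y))\<^sup>2 = (cos x - cos y)\<^sup>2 + (sin x - sin y)\<^sup>2" by (simp add: cmod_power2)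
  also have "\<dots> = 2 - 2 * cos (x - y)"
    using sin_cos_squared_add[of x] sin_cos_squared_add[of y] by (simp add: power2_diff cos_diff algebra_simps)
  also have "\<dots> = (2 * sin ((x - y) / 2))\<^sup>2"
  proof -
    have "2 * ((x - y) / 2) = x - y" by simp
    from cos_double_sin[of "(x - y) / 2", unfolded this] show ?thesis by (simp add: power_mult_distrib)
  qed
  also have "\<dots> = (2 * \<bar>sin ((x - y) / 2)\<bar>)\<^sup>2" by (simp add: power_mult_distrib)
  also have "\<dots> \<le> (2 * \<bar>(x - y) / 2\<bar>)\<^sup>2"
    by (intro power_mono mult_left_mono abs_sin_x_le_abs_x) auto
  also have "\<dots> = \<bar>x - y\<bar>\<^sup>2" by (simp add: power_mult_distrib power_divide)
  finally show ?thesis by (rule power2_le_imp_le) simp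
qed

text \<open>Gluing: integrating the unit tangent along the concatenated angles yields a curve
  parametrized by arclength, whose nodes are right because each piece has the prescribed
  chord.\<close>

lemma bend_chain_curve:
  fixes P :: "nat \<Rightarrow> complex" and L :: "nat \<Rightarrow> real"
  assumes m: "2 \<le> m" and ne: "\<And>j. j \<in> {1..<m} \<Longrightarrow> P j \<noteq> P (Suc j)"
    and bd: "\<And>j. j \<in> {1..<m} \<Longrightarrow> bend (\<sigma> j) (L j) (c j) (\<theta> j) (k j)"
    and k2: "\<And>j. j \<in> {1..<m} \<Longrightarrow> integrable lborel (\<lambda>u. (k j u)\<^sup>2)"
    and ch: "\<And>j. j \<in> {1..<m} \<Longrightarrow> chord (L j) (\<theta> j) = P (Suc j) - P j"
    and match: "\<And>j. j \<in> {1..<m} \<Longrightarrow> Suc j \<in> {1..<m} \<Longrightarrow> cis (\<theta> j (L j)) = cis (\<theta> (Suc j) 0)"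
    and re: "\<And>j. j \<in> {1..<m} \<Longrightarrow> 0 \<le> Re (cis (\<theta> j 0) * cnj (P (Suc j) - P j))"
      "\<And>j. j \<in> {1..<m} \<Longrightarrow> 0 \<le> Re (cis (\<theta> j (L j)) * cnj (P (Suc j) - P j))"
  obtains b F t where "admissible_times (pi / 2) P m 0 b F t"
    "bending_energy 0 b F = (\<Sum>j\<in>{1..<m}. \<integral>\<^sup>+s. ennreal ((k j s)\<^sup>2) \<partial>lborel) / 4"
proof -
  define S where "S = (\<lambda>j. \<Sum>i\<in>{1..<j}. L i)"
  have S1: "S 1 = 0" by (simp add: S_def)
  have SL: "S (Suc j) = S j + L j" if "j \<in> {1..<m}" for j using that by (simp add: S_def)
  \<comment> \<open>A piece of length 0 would have chord 0, while consecutive points are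
    distinct.\<close>
  have L0: "0 < L j" if j: "j \<in> {1..<m}" for j
  proof (rule ccontr)
    assume "\<not> 0 < L j"
    hence "L j = 0" using bend_facts(4)[OF bd[OF j]] by simp
    hence "chord (L j) (\<theta> j) = (LINT s|lborel. indicat_real {0} s *\<^sub>R cis (\<theta> j s))"
      by (simp add: chord_def set_lebesgue_integral_def)
    also have "\<dots> = 0"
      by (rule integral_eq_zero_AE) (use AE_lborel_singleton[of 0] in \<open>eventually_elim, simp\<close>)
    finally show False using ch[OF j] ne[OF j] by simp
  qed
  have mono: "S i \<le> S j" if "1 \<le> i" "i \<le> j" "j \<le> m" for i j
    by (rule steps_mono[where m=m]) (use that SL L0 in \<open>auto intro: less_imp_le\<close>)
  have strict: "S i < S j" if "1 \<le> i" "i < j" "j \<le> m" for i j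
    using mono[of "Suc i" j] SL[of i] L0[of i] that by auto
  define b where "b = S m"
  have b0: "0 < b" using strict[of 1 m] S1 m by (simp add: b_def)
  \<comment> \<open>Adjacent angles match only modulo 2 pi, so increments are summed instead of
    values. Each \<theta> j is frozen outside its piece, hence on piece j the sum differs from
    \<theta> j by a constant multiple of 2 pi.\<close>
  define \<Theta> where "\<Theta> = (\<lambda>s. \<theta> 1 0 + (\<Sum>j\<in>{1..<m}. \<theta> j (s - S j) - \<theta> j 0))"
  have cis\<Theta>: "cis (\<Theta> (S j + u)) = cis (\<theta> j u)" if j: "j \<in> {1..<m}" and u: "u \<in> {0..L j}" for j u
  proof -
    define T where "T = (\<lambda>j. \<theta> 1 0 + (\<Sum>i\<in>{1..<j}. \<theta> i (L i) - \<theta> i 0))"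
    have cisT: "n \<in> {1..<m} \<Longrightarrow> cis (T n) = cis (\<theta> n 0)" for n
    proof (induction n)
      case (Suc n)
      show ?case
      proof (cases "n = 0")
        case True thus ?thesis by (simp add: T_def)
      next
        case False
        hence n: "n \<in> {1..<m}" using Suc.prems by auto
        have "T (Suc n) = T n + (\<theta> n (L n) - \<theta> n 0)" using n by (simp add: T_def)
        hence "cis (T (Suc n)) = cis (T n) * cis (\<theta> n (L n) - \<theta> n 0)" by (simp add: cis_mult)
        also have "\<dots> = cis (\<theta> n (L n))" using Suc.IH[OF n] by (simp add: cis_mult)
        finally show ?thesis using match[OF n Suc.prems] by simp
      qed
    qed simp
    have split: "(\<Sum>i\<in>{1..<m}. g i) = (\<Sum>i\<in>{1..<j}. g i) + g j + (\<Sum>i\<in>{Suc j..<m}. g i)" for g :: "nat \<Rightarrow> real"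
      using sum.atLeastLessThan_concat[of 1 j m g] sum.atLeast_Suc_lessThan[of j m g] j by simp
    have 1: "\<theta> i (S j + u - S i) = \<theta> i (L i)" if "i \<in> {1..<j}" for i
      by (rule bend_const(2)[OF bd]) (use that j u SL[of i] mono[of "Suc i" j] in auto)
    have 2: "\<theta> i (S j + u - S i) = \<theta> i 0" if "i \<in> {Suc j..<m}" for i
      by (rule bend_const(1)[OF bd]) (use that j u SL[of j] mono[of "Suc j" i] in auto)
    have "\<Theta> (S j + u) = T j + (\<theta> j u - \<theta> j 0)"
      unfolding \<Theta>_def T_def split using 1 2 by simp
    hence "cis (\<Theta> (S j + u)) = cis (T j) * cis (\<theta> j u - \<theta> j 0)" by (simp add: cis_mult)
    also have "\<dots> = cis (\<theta> j u)" using cisT[OF j] by (simp add: cis_mult)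
    finally show ?thesis .
  qed
  \<comment> \<open>The factor m comes from Cauchy-Schwarz for the square of a sum of m - 1
    increments. This energy bound serves only to prove absolute continuity, so a lossy constant is
    harmless.\<close>
  define \<Phi> where "\<Phi> = (\<lambda>s. real m * (\<Sum>j\<in>{1..<m}. primitive (\<lambda>u. (k j u)\<^sup>2) (s - S j)))"
  note inc = bend_increment_square_le[OF bd k2]
  have \<Phi>m: "mono \<Phi>" unfolding \<Phi>_def
    by (intro monoI mult_left_mono sum_mono monoD[OF inc(1)]) auto
  have key: "(\<Theta> t - \<Theta> s)\<^sup>2 \<le> (t - s) * (\<Phi> t - \<Phi> s)" if "s \<le> t" for s t
  proof -
    have "(\<Theta> t - \<Theta> s)\<^sup>2 = (\<Sum>j\<in>{1..<m}. 1 * (\<theta> j (t - S j) - \<theta> j (s - S j)))\<^sup>2"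
      by (simp add: \<Theta>_def sum_subtractf[symmetric])
    also have "\<dots> \<le> (\<Sum>j\<in>{1..<m}. 1\<^sup>2) * (\<Sum>j\<in>{1..<m}. (\<theta> j (t - S j) - \<theta> j (s - S j))\<^sup>2)"
      by (rule Cauchy_Schwarz_ineq_sum)
    also have "\<dots> \<le> real m * (\<Sum>j\<in>{1..<m}. (t - s) * (primitive (\<lambda>u. (k j u)\<^sup>2) (t - S j) - primitive (\<lambda>u. (k j u)\<^sup>2) (s - S j)))"
    proof (intro mult_mono sum_mono sum_nonneg)
      fix j assume j: "j \<in> {1..<m}"
      show "(\<theta> j (t - S j) - \<theta> j (s - S j))\<^sup>2 \<le> (t - s) * (primitive (\<lambda>u. (k j u)\<^sup>2) (t - S j) - primitive (\<lambda>u. (k j u)\<^sup>2) (s - S j))"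
        using inc(4)[OF j j, of "s - S j" "t - S j"] that by simp
    qed auto
    also have "\<dots> = (t - s) * (\<Phi> t - \<Phi> s)"
      by (simp add: \<Phi>_def sum_distrib_left[symmetric] sum_subtractf right_diff_distrib[symmetric])
    finally show ?thesis .
  qed
  have "continuous_on {0..b} \<Theta>"
    by (rule absolutely_continuous_imp_continuous_on[OF absolutely_continuous_if_energy_bound[where \<Phi>=\<Phi>]])
       (use b0 key \<Phi>m in \<open>auto intro: mono_imp_mono_on\<close>)
  define v where "v = (\<lambda>s. cis (\<Theta> s))"
  have vc: "continuous_on {0..b} v" unfolding v_def by (rule continuous_on_cis) fact
  have nv: "norm (v s) = 1" for s by (simp add: v_def)
  define F where "F = (\<lambda>s. P 1 + integral {0..s} v)"
  have Fd: "(F has_vector_derivative v s) (at s within {0..b})" if "s \<in> {0..b}" for s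
    unfolding F_def using integral_has_vector_derivative[OF vc that]
    by (auto intro!: derivative_eq_intros)
  have vel: "velocity 0 b F s = v s" if "s \<in> {0..b}" for s by (rule velocity_eqI[OF b0 that Fd[OF that]])
  have cv: "curve 0 b F" unfolding curve_def
  proof (intro conjI ballI b0)
    show "F differentiable_on {0..b}" unfolding differentiable_on_def
      using Fd differentiableI_vector by blast
    show "absolutely_continuous_on_interval 0 b (velocity 0 b F)"
    proof (rule absolutely_continuous_if_energy_bound[where \<Phi>=\<Phi>])
      fix s t assume st: "0 \<le> s" "s \<le> t" "t \<le> b"
      have "norm (velocity 0 b F t - velocity 0 b F s) \<le> \<bar>\<Theta> t - \<Theta> s\<bar>"
        using vel[of s] vel[of t] st norm_cis_diff_le[of "\<Theta> t" "\<Theta> s"] by (simp add: v_def)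
      hence "(norm (velocity 0 b F t - velocity 0 b F s))\<^sup>2 \<le> \<bar>\<Theta> t - \<Theta> s\<bar>\<^sup>2" by (intro power_mono) auto
      also have "\<dots> \<le> (t - s) * (\<Phi> t - \<Phi> s)" using key[OF st(2)] by simp
      finally show "(norm (velocity 0 b F t - velocity 0 b F s))\<^sup>2 \<le> (t - s) * (\<Phi> t - \<Phi> s)" .
    qed (use b0 \<Phi>m in \<open>auto intro: mono_imp_mono_on\<close>)
    show "velocity 0 b F s \<noteq> 0" if "s \<in> {0..b}" for s using vel[OF that] nv[of s] by auto
  qed
  have al: "arclength_upto 0 b F s = s" if s: "s \<in> {0..b}" for s
  proof -
    have "integral {0..s} (\<lambda>u. norm (velocity 0 b F u)) = integral {0..s} (\<lambda>_. 1)"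
      by (rule integral_cong) (use s vel nv in auto)
    thus ?thesis using s by (simp add: arclength_upto_def)
  qed
  have alb: "arclength 0 b F = b" using al[of b] b0 by (simp add: arclength_def)
  have utv: "unit_tangent 0 b F s = v s" if s: "s \<in> {0..b}" for s
    using time_at_arclength_facts(1)[OF cv s] al[OF s] vel[OF s] nv[of s] by (simp add: unit_tangent_def sgn_div_norm)
  have inb: "S j + u \<in> {0..b}" if "j \<in> {1..<m}" "u \<in> {0..L j}" for j u
    using that mono[of 1 j] mono[of "Suc j" m] SL[of j] S1 by (auto simp: b_def)
  have FS: "F (S (Suc j)) - F (S j) = P (Suc j) - P j" if j: "j \<in> {1..<m}" for j
  proof -
    have sub: "{0..S (Suc j)} \<subseteq> {0..b}" "0 \<le> S j" using mono[of 1 j] mono[of "Suc j" m] j S1 by (auto simp: b_def)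
    have "v integrable_on {0..S (Suc j)}" by (intro integrable_continuous_real continuous_on_subset[OF vc sub(1)])
    hence "F (S (Suc j)) - F (S j) = integral {S j..S (Suc j)} v"
      using Henstock_Kurzweil_Integration.integral_combine[of 0 "S j" "S (Suc j)" v] sub mono[of j "Suc j"] j
      by (simp add: F_def algebra_simps)
    also have "\<dots> = integral {0..L j} (v \<circ> ((+) (S j)))"
      using integral_shift_Icc_real[of 0 "L j" v "S j"] SL[OF j] by (simp add: add.commute)
    also have "\<dots> = integral {0..L j} (\<lambda>u. cis (\<theta> j u))"
      by (rule integral_cong) (use cis\<Theta>[OF j] in \<open>auto simp: v_def\<close>)
    also have "\<dots> = chord (L j) (\<theta> j)" unfolding chord_def
    proof (rule set_borel_integral_eq_integral(2)[symmetric])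
      show "set_integrable lborel {0..L j} (\<lambda>s. cis (\<theta> j s))"
        by (intro borel_integrable_atLeastAtMost' continuous_on_cis bend_continuous[OF bd[OF j]])
    qed
    finally show ?thesis using ch[OF j] by simp
  qed
  have FP: "F (S j) = P j" if "j \<in> {1..m}" for j
  proof -
    have "1 \<le> j" "j \<le> m" using that by auto
    thus ?thesis
    proof (induction j rule: dec_induct)
      case base thus ?case by (simp add: F_def S1[unfolded One_nat_def])
    next
      case (step n)
      thus ?case using FS[of n] by simp
    qed
  qed
  have pieces: "s_curve (S j) (S (Suc j)) F \<and> \<bar>Arg (velocity (S j) (S (Suc j)) F (S j) / (F (S (Suc j)) - F (S j)))\<bar> \<le> pi / 2 \<and>
      \<bar>Arg (velocity (S j) (S (Suc j)) F (S (Suc j)) / (F (S (Suc j)) - F (S j)))\<bar> \<le> pi / 2" if j: "j \<in> {1..<m}" for j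
  proof -
    note B = bd[OF j]
    note f = bend_facts[OF B]
    have sub: "0 \<le> S j" "S j < S (Suc j)" "S (Suc j) \<le> b" using mono[of 1 j] strict[of j "Suc j"] mono[of "Suc j" m] j S1 by (auto simp: b_def)
    have vel': "velocity (S j) (S (Suc j)) F s = cis (\<theta> j (s - S j))" if s: "s \<in> {S j..S (Suc j)}" for s
    proof -
      have "velocity (S j) (S (Suc j)) F s = v s"
        using velocity_restrict[OF cv sub s] vel[of s] s sub by auto
      also have "v s = cis (\<Theta> (S j + (s - S j)))" by (simp add: v_def)
      also have "\<dots> = cis (\<theta> j (s - S j))" using s SL[OF j] by (intro cis\<Theta>[OF j]) auto
      finally show ?thesis .
    qed
    have "s_curve (S j) (S (Suc j)) F"
      unfolding s_curve_def
    proof (intro conjI exI[of _ "\<lambda>s. \<theta> j (s - S j)"] exI[of _ "S j + c j"])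
      show "curve (S j) (S (Suc j)) F" by (rule curve_restrict[OF cv sub])
      show "tangent_angle (S j) (S (Suc j)) F (\<lambda>s. \<theta> j (s - S j))" unfolding tangent_angle_def
      proof (intro conjI ballI)
        show "continuous_on {S j..S (Suc j)} (\<lambda>s. \<theta> j (s - S j))"
          by (intro continuous_on_compose2[OF bend_continuous(1)[OF B, of UNIV]] continuous_intros) auto
      qed (simp add: vel')
      show "S j + c j \<in> {S j..S (Suc j)}" using f(2,3) SL[OF j] by simp
      have up: "\<sigma> j * \<theta> j (s - S j) \<le> \<sigma> j * \<theta> j (t - S j)" if "s \<le> t" "t \<le> S j + c j" for s t
        by (rule bend_mono(1)[OF B]) (use that in auto)
      have dn: "\<sigma> j * \<theta> j (t - S j) \<le> \<sigma> j * \<theta> j (s - S j)" if "s \<le> t" "S j + c j \<le> s" for s t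
        by (rule bend_mono(2)[OF B]) (use that in auto)
      show "mono_on {S j..S j + c j} (\<lambda>s. \<theta> j (s - S j)) \<and> antimono_on {S j + c j..S (Suc j)} (\<lambda>s. \<theta> j (s - S j)) \<or>
        antimono_on {S j..S j + c j} (\<lambda>s. \<theta> j (s - S j)) \<and> mono_on {S j + c j..S (Suc j)} (\<lambda>s. \<theta> j (s - S j))"
        using f(1)
      proof
        assume "\<sigma> j = 1" thus ?thesis using up dn by (intro disjI1) (auto simp: monotone_on_def)
      next
        assume "\<sigma> j = -1" thus ?thesis using up dn by (intro disjI2) (auto simp: monotone_on_def)
      qed
      show "\<bar>\<theta> j (S j + c j - S j) - \<theta> j (S j - S j)\<bar> \<le> pi" "\<bar>\<theta> j (S (Suc j) - S j) - \<theta> j (S j + c j - S j)\<bar> \<le> pi"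
        using f(11,12) SL[OF j] by simp_all
    qed
    moreover have "F (S (Suc j)) - F (S j) = P (Suc j) - P j" by (rule FS[OF j])
    moreover have "P (Suc j) - P j \<noteq> 0" using ne[OF j] by simp
    moreover have "velocity (S j) (S (Suc j)) F (S j) = cis (\<theta> j 0)" "velocity (S j) (S (Suc j)) F (S (Suc j)) = cis (\<theta> j (L j))"
      using vel'[of "S j"] vel'[of "S (Suc j)"] sub SL[OF j] by auto
    ultimately show ?thesis using re(1)[OF j] re(2)[OF j] abs_Arg_div_le_iff by presburger
  qed
  have "admissible_times (pi / 2) P m 0 b F S"
    unfolding admissible_times_def interpolating_def
    using cv S1 FP pieces m by (auto simp: b_def chord_angles_def strict_mono_on_def intro: strict)
  moreover have "bending_energy 0 b F = (\<Sum>j\<in>{1..<m}. \<integral>\<^sup>+s. ennreal ((k j s)\<^sup>2) \<partial>lborel) / 4"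
    by (rule bending_energy_pieces[OF cv _ S1 _ bd SL])
       (use m alb utv inb cis\<Theta> in \<open>auto simp: b_def v_def\<close>)
  ultimately show ?thesis by (rule that)
qed

section \<open>Minimizing over the directions at the interpolation points\<close>

text \<open>An upper bound e instead of the exact energy makes the relation closed under limits: a
  limit curve may lose energy.\<close>

definition reaches :: "complex \<Rightarrow> complex \<Rightarrow> complex \<Rightarrow> real \<Rightarrow> bool" where
  "reaches z d d' e \<longleftrightarrow> (\<exists>\<sigma> L c \<theta> k. bend \<sigma> L c \<theta> k \<and> integrable lborel (\<lambda>u. (k u)\<^sup>2) \<and>
     (LINT u|lborel. (k u)\<^sup>2) \<le> e \<and> chord L \<theta> = z \<and> cis (\<theta> 0) = d \<and> cis (\<theta> L) = d')"

text \<open>The direction d j is shared by the pieces on both sides of P j; this is the only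
  coupling between pieces.\<close>

definition feasible :: "(nat \<Rightarrow> complex) \<Rightarrow> nat \<Rightarrow> (nat \<Rightarrow> complex) \<Rightarrow> (nat \<Rightarrow> real) \<Rightarrow> bool" where
  "feasible P m d E \<longleftrightarrow> (\<forall>j\<in>{1..<m}. reaches (P (Suc j) - P j) (d j) (d (Suc j)) (E j) \<and>
     0 \<le> Re (d j * cnj (P (Suc j) - P j)) \<and> 0 \<le> Re (d (Suc j) * cnj (P (Suc j) - P j)))"

lemma reaches_facts:
  assumes "reaches z d d' e"
  shows "0 \<le> e" "norm d = 1" "norm d' = 1"
proof -
  obtain L and \<theta> k :: "real \<Rightarrow> real" where "(LINT u|lborel. (k u)\<^sup>2) \<le> e" "cis (\<theta> 0) = d" "cis (\<theta> L) = d'"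
    using assms unfolding reaches_def by blast
  moreover have "0 \<le> (LINT u|lborel. (k u)\<^sup>2)" by simp
  ultimately show "0 \<le> e" "norm d = 1" "norm d' = 1" by (linarith, auto)
qed

text \<open>Shortening comes first: it bounds all lengths by a multiple of the fixed chord without
  raising the energy, which is the bound that the compactness argument requires.\<close>

lemma reaches_closed:
  assumes r: "\<And>n. reaches z (d n) (d' n) (E n)" and "d \<longlonglongrightarrow> d0" "d' \<longlonglongrightarrow> d1" "E \<longlonglongrightarrow> e"
  shows "reaches z d0 d1 e"
proof -
  define Q where "Q n \<sigma> L c \<theta> k \<longleftrightarrow> bend \<sigma> L c \<theta> k \<and> integrable lborel (\<lambda>u. (k u)\<^sup>2) \<and>
     (LINT u|lborel. (k u)\<^sup>2) \<le> E n \<and> chord L \<theta> = z \<and> cis (\<theta> 0) = d n \<and> cis (\<theta> L) = d' n \<and> L \<le> length_const * norm z"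
    for n \<sigma> L c \<theta> k
  have "\<exists>\<sigma> L c \<theta> k. Q n \<sigma> L c \<theta> k" for n
  proof -
    obtain \<sigma> L c \<theta> k where a: "bend \<sigma> L c \<theta> k" "integrable lborel (\<lambda>u. (k u)\<^sup>2)"
     "(LINT u|lborel. (k u)\<^sup>2) \<le> E n" "chord L \<theta> = z" "cis (\<theta> 0) = d n" "cis (\<theta> L) = d' n"
      using r[of n] unfolding reaches_def by blast
    obtain L' c' \<theta>' k' where "bend \<sigma> L' c' \<theta>' k'" "\<theta>' 0 = \<theta> 0" "\<theta>' L' = \<theta> L" "chord L' \<theta>' = chord L \<theta>"
      "integrable lborel (\<lambda>u. (k' u)\<^sup>2)" "(LINT u|lborel. (k' u)\<^sup>2) \<le> (LINT u|lborel. (k u)\<^sup>2)"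
      "L' \<le> length_const * norm (chord L \<theta>)"
      by (rule bend_shorten[OF a(1,2)])
    hence "Q n \<sigma> L' c' \<theta>' k'" using a by (auto simp: Q_def)
    thus ?thesis by blast
  qed
  then obtain \<sigma> L c \<theta> k where "\<And>n. Q n (\<sigma> n) (L n) (c n) (\<theta> n) (k n)" by metis
  hence a: "\<And>n. bend (\<sigma> n) (L n) (c n) (\<theta> n) (k n)" "\<And>n. integrable lborel (\<lambda>u. (k n u)\<^sup>2)"
     "\<And>n. (LINT u|lborel. (k n u)\<^sup>2) \<le> E n" "\<And>n. chord (L n) (\<theta> n) = z" "\<And>n. cis (\<theta> n 0) = d n" "\<And>n. cis (\<theta> n (L n)) = d' n"
     "\<And>n. L n \<le> length_const * norm z"
    unfolding Q_def by blast+
  have "(\<lambda>n. cis (\<theta> n 0)) \<longlonglongrightarrow> d0" "(\<lambda>n. cis (\<theta> n (L n))) \<longlonglongrightarrow> d1" using assms a(5,6) by auto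
  then obtain \<sigma>' L' c' \<theta>' k' where "bend \<sigma>' L' c' \<theta>' k'" "integrable lborel (\<lambda>u. (k' u)\<^sup>2)"
    "(LINT u|lborel. (k' u)\<^sup>2) \<le> e" "chord L' \<theta>' = z" "cis (\<theta>' 0) = d0" "cis (\<theta>' L') = d1"
    by (rule bend_limit[OF a(1-3) assms(4) a(7,4)])
  thus ?thesis unfolding reaches_def by blast
qed

lemma ennreal_quarter: "0 \<le> x \<Longrightarrow> ennreal x / 4 = ennreal (x / 4)"
  using divide_ennreal[of x 4] by simp

lemma feasible_imp_curve:
  assumes m: "2 \<le> m" and ne: "\<And>j. j \<in> {1..<m} \<Longrightarrow> P j \<noteq> P (Suc j)" and fe: "feasible P m d E"
  obtains b F t where "admissible_times (pi / 2) P m 0 b F t" "bending_energy 0 b F \<le> ennreal (\<Sum>j\<in>{1..<m}. E j) / 4"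
proof -
  define Q where "Q j \<sigma> L c \<theta> k \<longleftrightarrow> bend \<sigma> L c \<theta> k \<and> integrable lborel (\<lambda>u. (k u)\<^sup>2) \<and> (LINT u|lborel. (k u)\<^sup>2) \<le> E j \<and>
     chord L \<theta> = P (Suc j) - P j \<and> cis (\<theta> 0) = d j \<and> cis (\<theta> L) = d (Suc j)" for j \<sigma> L c \<theta> k
  have "\<exists>\<sigma> L c \<theta> k. Q j \<sigma> L c \<theta> k" if "j \<in> {1..<m}" for j
    using fe that by (simp add: feasible_def reaches_def Q_def)
  then obtain \<sigma> L c \<theta> k where "\<And>j. j \<in> {1..<m} \<Longrightarrow> Q j (\<sigma> j) (L j) (c j) (\<theta> j) (k j)" by metis
  hence a: "\<And>j. j \<in> {1..<m} \<Longrightarrow> bend (\<sigma> j) (L j) (c j) (\<theta> j) (k j)"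
    "\<And>j. j \<in> {1..<m} \<Longrightarrow> integrable lborel (\<lambda>u. (k j u)\<^sup>2)"
    "\<And>j. j \<in> {1..<m} \<Longrightarrow> (LINT u|lborel. (k j u)\<^sup>2) \<le> E j"
    "\<And>j. j \<in> {1..<m} \<Longrightarrow> chord (L j) (\<theta> j) = P (Suc j) - P j"
    "\<And>j. j \<in> {1..<m} \<Longrightarrow> cis (\<theta> j 0) = d j" "\<And>j. j \<in> {1..<m} \<Longrightarrow> cis (\<theta> j (L j)) = d (Suc j)"
    unfolding Q_def by blast+
  obtain b F t where bF: "admissible_times (pi / 2) P m 0 b F t"
    "bending_energy 0 b F = (\<Sum>j\<in>{1..<m}. \<integral>\<^sup>+s. ennreal ((k j s)\<^sup>2) \<partial>lborel) / 4"
    by (rule bend_chain_curve[of m P \<sigma> L c \<theta> k, OF m ne a(1,2,4)]) (use a(5,6) fe in \<open>auto simp: feasible_def\<close>)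
  have "(\<Sum>j\<in>{1..<m}. \<integral>\<^sup>+s. ennreal ((k j s)\<^sup>2) \<partial>lborel) \<le> (\<Sum>j\<in>{1..<m}. ennreal (E j))"
    using a(2,3) by (intro sum_mono) (simp add: nn_integral_eq_integral ennreal_leI)
  also have "\<dots> = ennreal (\<Sum>j\<in>{1..<m}. E j)"
    using fe by (intro sum_ennreal) (auto simp: feasible_def dest: reaches_facts)
  finally show ?thesis using bF by (intro that[of b F t]) (auto intro: divide_right_mono_ennreal)
qed

text \<open>The total energy is the sum over the pieces, so its finiteness makes every density
  square integrable, and the energies can be handled as real numbers.\<close>

lemma curve_imp_feasible:
  assumes m: "2 \<le> m" and ne: "\<And>j. j \<in> {1..<m} \<Longrightarrow> P j \<noteq> P (Suc j)"
    and ad: "admissible_times (pi / 2) P m a b F t" and fin: "bending_energy a b F \<noteq> top"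
  obtains \<sigma> c \<theta> k d where
    "\<forall>j\<in>{1..<m}. bend (\<sigma> j) (arclength (t j) (t (Suc j)) F) (c j) (\<theta> j) (k j) \<and> integrable lborel (\<lambda>u. (k j u)\<^sup>2) \<and>
       (\<forall>s\<in>{0..arclength (t j) (t (Suc j)) F}. unit_tangent (t j) (t (Suc j)) F s = cis (\<theta> j s)) \<and>
       chord (arclength (t j) (t (Suc j)) F) (\<theta> j) = P (Suc j) - P j \<and>
       cis (\<theta> j 0) = d j \<and> cis (\<theta> j (arclength (t j) (t (Suc j)) F)) = d (Suc j)"
    "feasible P m d (\<lambda>j. LINT u|lborel. (k j u)\<^sup>2)"
    "bending_energy a b F = ennreal (\<Sum>j\<in>{1..<m}. LINT u|lborel. (k j u)\<^sup>2) / 4"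
proof -
  have cv: "curve a b F" and tm: "strict_mono_on {1..m} t" "t 1 = a" "t m = b" and FP: "\<And>j. j \<in> {1..m} \<Longrightarrow> F (t j) = P j"
    and sc: "\<And>j. j \<in> {1..<m} \<Longrightarrow> s_curve (t j) (t (Suc j)) F"
    and ca: "\<And>j. j \<in> {1..<m} \<Longrightarrow> \<bar>Arg (velocity (t j) (t (Suc j)) F (t j) / (F (t (Suc j)) - F (t j)))\<bar> \<le> pi / 2"
      "\<And>j. j \<in> {1..<m} \<Longrightarrow> \<bar>Arg (velocity (t j) (t (Suc j)) F (t (Suc j)) / (F (t (Suc j)) - F (t j)))\<bar> \<le> pi / 2"
    using ad by (auto simp: admissible_times_def interpolating_def chord_angles_def)
  define l where "l = (\<lambda>j. arclength (t j) (t (Suc j)) F)"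
  have sub: "a \<le> t j" "t j < t (Suc j)" "t (Suc j) \<le> b" if "j \<in> {1..<m}" for j
  proof -
    have le: "t i \<le> t j" if "i \<in> {1..m}" "j \<in> {1..m}" "i \<le> j" for i j
      using strict_mono_onD[OF tm(1), of i j] that by (cases "i = j") auto
    show "a \<le> t j" "t (Suc j) \<le> b" using le[of 1 j] le[of "Suc j" m] that tm m by auto
    show "t j < t (Suc j)" using strict_mono_onD[OF tm(1), of j "Suc j"] that by auto
  qed
  define Q where "Q j \<sigma> c \<theta> k \<longleftrightarrow> bend \<sigma> (l j) c \<theta> k \<and>
     (\<forall>s\<in>{0..l j}. unit_tangent (t j) (t (Suc j)) F s = cis (\<theta> s)) \<and> chord (l j) \<theta> = F (t (Suc j)) - F (t j)" for j \<sigma> c \<theta> k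
  have "\<exists>\<sigma> c \<theta> k. Q j \<sigma> c \<theta> k" if j: "j \<in> {1..<m}" for j
    unfolding Q_def l_def by (rule s_curve_bend[OF sc[OF j]]) blast
  then obtain \<sigma> c \<theta> k where "\<And>j. j \<in> {1..<m} \<Longrightarrow> Q j (\<sigma> j) (c j) (\<theta> j) (k j)" by metis
  hence bd: "\<And>j. j \<in> {1..<m} \<Longrightarrow> bend (\<sigma> j) (l j) (c j) (\<theta> j) (k j)"
    and ut: "\<And>j s. j \<in> {1..<m} \<Longrightarrow> s \<in> {0..l j} \<Longrightarrow> unit_tangent (t j) (t (Suc j)) F s = cis (\<theta> j s)"
    and ch: "\<And>j. j \<in> {1..<m} \<Longrightarrow> chord (l j) (\<theta> j) = F (t (Suc j)) - F (t j)"
    unfolding Q_def by blast+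
  have [measurable]: "k j \<in> borel_measurable borel" if "j \<in> {1..<m}" for j by (rule bend_facts(6)[OF bd[OF that]])
  have ch': "chord (l j) (\<theta> j) = P (Suc j) - P j" if "j \<in> {1..<m}" for j
    using ch[OF that] FP[of j] FP[of "Suc j"] that by simp
  note restr = arclength_restrict[OF cv sub]
  have energy: "bending_energy a b F = (\<Sum>j\<in>{1..<m}. \<integral>\<^sup>+s. ennreal ((k j s)\<^sup>2) \<partial>lborel) / 4"
  proof (rule bending_energy_pieces[OF cv _ _ _ bd, where S="\<lambda>j. arclength_upto a b F (t j)"])
    show "arclength_upto a b F (t (Suc j)) = arclength_upto a b F (t j) + l j" if "j \<in> {1..<m}" for j
      using restr(2)[OF that that that] by (simp add: l_def)
    show "unit_tangent a b F (arclength_upto a b F (t j) + s) = cis (\<theta> j s)" if "j \<in> {1..<m}" "s \<in> {0..l j}" for j s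
      using restr(3)[OF that(1) that(1) that(1), of s] ut[OF that] that(2) by (simp add: l_def)
    show "arclength_upto a b F (t m) = arclength a b F" using tm(3) by (simp add: arclength_def)
    show "arclength_upto a b F (t 1) = 0" using tm(2) arclength_upto_facts(1)[OF cv] by simp
  qed (use m in auto)
  have fin_j: "(\<integral>\<^sup>+s. ennreal ((k j s)\<^sup>2) \<partial>lborel) \<noteq> top" if j: "j \<in> {1..<m}" for j
  proof
    assume "(\<integral>\<^sup>+s. ennreal ((k j s)\<^sup>2) \<partial>lborel) = top"
    hence "(\<Sum>j\<in>{1..<m}. \<integral>\<^sup>+s. ennreal ((k j s)\<^sup>2) \<partial>lborel) = top"
      by (subst sum.remove[OF _ j]) auto
    thus False using fin unfolding energy by (simp only: ennreal_divide_eq_top_iff) simp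
  qed
  have k2: "integrable lborel (\<lambda>u. (k j u)\<^sup>2)" if j: "j \<in> {1..<m}" for j
    using fin_j[OF j] j by (intro integrableI_nonneg) (auto simp: less_top[symmetric])
  have "(\<Sum>j\<in>{1..<m}. \<integral>\<^sup>+s. ennreal ((k j s)\<^sup>2) \<partial>lborel) = (\<Sum>j\<in>{1..<m}. ennreal (LINT u|lborel. (k j u)\<^sup>2))"
    using k2 by (intro sum.cong) (auto simp: nn_integral_eq_integral)
  also have "\<dots> = ennreal (\<Sum>j\<in>{1..<m}. LINT u|lborel. (k j u)\<^sup>2)" by (rule sum_ennreal) simp
  finally have energy': "bending_energy a b F = ennreal (\<Sum>j\<in>{1..<m}. LINT u|lborel. (k j u)\<^sup>2) / 4" using energy by simp
  \<comment> \<open>Taking the directions from the velocity of the whole curve makes them agree for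
    the two pieces that meet at a node.\<close>
  define d where "d = (\<lambda>j. sgn (velocity a b F (t j)))"
  have ends: "cis (\<theta> j 0) = d j" "cis (\<theta> j (l j)) = d (Suc j)"
    and vend: "velocity (t j) (t (Suc j)) F (t j) = velocity a b F (t j)"
      "velocity (t j) (t (Suc j)) F (t (Suc j)) = velocity a b F (t (Suc j))" if j: "j \<in> {1..<m}" for j
  proof -
    show v: "velocity (t j) (t (Suc j)) F (t j) = velocity a b F (t j)"
      "velocity (t j) (t (Suc j)) F (t (Suc j)) = velocity a b F (t (Suc j))"
      using velocity_restrict[OF cv sub[OF j], of "t j"] velocity_restrict[OF cv sub[OF j], of "t (Suc j)"] sub[OF j] by auto
    have cj: "curve (t j) (t (Suc j)) F" by (rule curve_restrict[OF cv sub[OF j]])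
    show "cis (\<theta> j 0) = d j" "cis (\<theta> j (l j)) = d (Suc j)"
      using unit_tangent_ends[OF cj] ut[OF j, of 0] ut[OF j, of "l j"] arclength_pos[OF cj] v by (auto simp: d_def l_def)
  qed
  have re: "0 \<le> Re (sgn v * cnj z)" if "\<bar>Arg (v / z)\<bar> \<le> pi / 2" "z \<noteq> 0" for v z :: complex
  proof -
    have "0 \<le> Re (v * cnj z)" using that abs_Arg_div_le_iff by blast
    hence "0 \<le> inverse (norm v) * Re (v * cnj z)" by (intro mult_nonneg_nonneg) auto
    also have "\<dots> = Re (sgn v * cnj z)" by (simp add: sgn_div_norm algebra_simps)
    finally show ?thesis .
  qed
  have "feasible P m d (\<lambda>j. LINT u|lborel. (k j u)\<^sup>2)"
    unfolding feasible_def
  proof (intro ballI conjI)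
    fix j assume j: "j \<in> {1..<m}"
    show "reaches (P (Suc j) - P j) (d j) (d (Suc j)) (LINT u|lborel. (k j u)\<^sup>2)"
      unfolding reaches_def using bd[OF j] k2[OF j] ch'[OF j] ends[OF j] by blast
    have z: "F (t (Suc j)) - F (t j) = P (Suc j) - P j" "P (Suc j) - P j \<noteq> 0" using FP[of j] FP[of "Suc j"] j ne[OF j] by auto
    show "0 \<le> Re (d j * cnj (P (Suc j) - P j))" "0 \<le> Re (d (Suc j) * cnj (P (Suc j) - P j))"
      unfolding d_def
      by (rule re[OF ca(1)[OF j, unfolded vend[OF j] z(1)] z(2)] re[OF ca(2)[OF j, unfolded vend[OF j] z(1)] z(2)])+
  qed
  moreover have "\<forall>j\<in>{1..<m}. bend (\<sigma> j) (l j) (c j) (\<theta> j) (k j) \<and> integrable lborel (\<lambda>u. (k j u)\<^sup>2) \<and>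
       (\<forall>s\<in>{0..l j}. unit_tangent (t j) (t (Suc j)) F s = cis (\<theta> j s)) \<and>
       chord (l j) (\<theta> j) = P (Suc j) - P j \<and> cis (\<theta> j 0) = d j \<and> cis (\<theta> j (l j)) = d (Suc j)"
    using bd k2 ut ch' ends by blast
  ultimately show ?thesis using energy' unfolding l_def by (intro that)
qed

text \<open>The bisector forms an angle of at most \<pi>/2 with each of two directions. For opposite
  directions a perpendicular has to be taken, so the angle \<pi>/2 itself must be allowed.\<close>

lemma common_direction_exists:
  fixes z z' :: complex
  assumes "z \<noteq> 0" "z' \<noteq> 0"
  shows "\<exists>d. norm d = 1 \<and> 0 \<le> Re (d * cnj z) \<and> 0 \<le> Re (d * cnj z')"
proof -
  define u u' where "u = sgn z" and "u' = sgn z'"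
  have n: "norm u = 1" "norm u' = 1" using assms by (simp_all add: u_def u'_def norm_sgn)
  have z: "z = norm z *\<^sub>R u" "z' = norm z' *\<^sub>R u'" using assms by (simp_all add: u_def u'_def sgn_div_norm)
  have "\<exists>d. norm d = 1 \<and> 0 \<le> Re (d * cnj u) \<and> 0 \<le> Re (d * cnj u')"
  proof (cases "u + u' = 0")
    case True
    hence u': "u' = - u" by (simp add: eq_neg_iff_add_eq_0 add.commute)
    show ?thesis by (rule exI[of _ "\<i> * u"]) (simp add: n u' norm_mult algebra_simps)
  next
    case False
    define s where "s = Re (u * cnj u')"
    have s: "- 1 \<le> s" using abs_Re_le_cmod[of "u * cnj u'"] n by (simp add: s_def norm_mult)
    have uu: "Re (u * cnj u) = 1" "Re (u' * cnj u') = 1" using n by (simp_all only: complex_norm_square[symmetric]) simp_all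
    have "Re (u' * cnj u) = s" by (simp add: s_def algebra_simps)
    hence 1: "Re ((u + u') * cnj u) = 1 + s" "Re ((u + u') * cnj u') = 1 + s" using uu unfolding distrib_right by (simp_all add: s_def)
    have "0 \<le> inverse (norm (u + u')) * Re ((u + u') * cnj u)" "0 \<le> inverse (norm (u + u')) * Re ((u + u') * cnj u')"
      unfolding 1 using s by (intro mult_nonneg_nonneg; simp)+
    hence "0 \<le> Re (sgn (u + u') * cnj u)" "0 \<le> Re (sgn (u + u') * cnj u')"
      by (simp_all add: sgn_div_norm algebra_simps)
    thus ?thesis using False by (intro exI[of _ "sgn (u + u')"]) (auto simp: norm_sgn)
  qed
  then obtain d where d: "norm d = 1" "0 \<le> Re (d * cnj u)" "0 \<le> Re (d * cnj u')" by blast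
  have "0 \<le> Re (d * cnj (r *\<^sub>R w))" if "0 \<le> r" "0 \<le> Re (d * cnj w)" for r w
  proof -
    have "Re (d * cnj (r *\<^sub>R w)) = r * Re (d * cnj w)" by (simp add: algebra_simps)
    thus ?thesis using that by simp
  qed
  from this[OF norm_ge_zero d(2), of z] this[OF norm_ge_zero d(3), of z'] show ?thesis
    using d(1) z by (intro exI[of _ d]) simp
qed

section \<open>Existence of optimal node directions\<close>

lemma feasible_exists:
  assumes m: "2 \<le> m" and ne: "\<And>j. j \<in> {1..<m} \<Longrightarrow> P j \<noteq> P (Suc j)"
  shows "\<exists>d E. feasible P m d E"
proof -
  define z where "z = (\<lambda>j. P (Suc j) - P j)"
  have z0: "z j \<noteq> 0" if "j \<in> {1..<m}" for j using ne[OF that] by (simp add: z_def)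
  \<comment> \<open>The indices are clamped to 1, ..., m - 1, so that at the two end nodes the
    single adjacent chord is counted twice.\<close>
  have "\<exists>d. norm d = 1 \<and> 0 \<le> Re (d * cnj (z (max 1 (j - 1)))) \<and> 0 \<le> Re (d * cnj (z (min j (m - 1))))" if "j \<in> {1..m}" for j
    by (rule common_direction_exists; rule z0) (use that m in auto)
  then obtain d where d: "\<And>j. j \<in> {1..m} \<Longrightarrow> norm (d j) = 1 \<and> 0 \<le> Re (d j * cnj (z (max 1 (j - 1)))) \<and> 0 \<le> Re (d j * cnj (z (min j (m - 1))))"
    by metis
  have dj: "norm (d j) = 1" "0 \<le> Re (d j * cnj (z j))" "norm (d (Suc j)) = 1" "0 \<le> Re (d (Suc j) * cnj (z j))" if j: "j \<in> {1..<m}" for j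
  proof -
    have "min j (m - 1) = j" "max 1 (Suc j - 1) = j" using j by auto
    thus "norm (d j) = 1" "0 \<le> Re (d j * cnj (z j))" "norm (d (Suc j)) = 1" "0 \<le> Re (d (Suc j) * cnj (z j))"
      using d[of j] d[of "Suc j"] j by auto
  qed
  have "\<exists>e. reaches (z j) (d j) (d (Suc j)) e" if j: "j \<in> {1..<m}" for j
  proof -
    obtain \<sigma> L c \<theta> k where "bend \<sigma> L c \<theta> k" "integrable lborel (\<lambda>u. (k u)\<^sup>2)" "chord L \<theta> = z j"
      "cis (\<theta> 0) = d j" "cis (\<theta> L) = d (Suc j)"
      by (rule bend_between_exists[OF z0[OF j] dj[OF j]])
    thus ?thesis unfolding reaches_def by blast
  qed
  then obtain E where "\<And>j. j \<in> {1..<m} \<Longrightarrow> reaches (z j) (d j) (d (Suc j)) (E j)" by metis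
  hence "feasible P m d E" using dj unfolding feasible_def z_def by blast
  thus ?thesis by blast
qed

lemma simultaneous_convergent_subsequence:
  fixes f :: "nat \<Rightarrow> 'i \<Rightarrow> 'a::heine_borel"
  assumes "finite J" "\<And>j. j \<in> J \<Longrightarrow> bounded (range (\<lambda>n. f n j))"
  shows "\<exists>l r. strict_mono (r :: nat \<Rightarrow> nat) \<and> (\<forall>j\<in>J. (\<lambda>n. f (r n) j) \<longlonglongrightarrow> l j)"
  using assms
proof (induction J rule: finite_induct)
  case empty
  show ?case by (rule exI, rule exI[of _ id]) (auto simp: strict_mono_def)
next
  case (insert i J)
  then obtain l r where r: "strict_mono r" "\<And>j. j \<in> J \<Longrightarrow> (\<lambda>n. f (r n) j) \<longlonglongrightarrow> l j" by auto
  have "range (\<lambda>n. f (r n) i) \<subseteq> range (\<lambda>n. f n i)" by auto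
  hence "bounded (range (\<lambda>n. f (r n) i))" using insert.prems[of i] bounded_subset by blast
  then obtain l' r' where r': "strict_mono (r' :: nat \<Rightarrow> nat)" "((\<lambda>n. f (r n) i) \<circ> r') \<longlonglongrightarrow> l'"
    using bounded_imp_convergent_subsequence by metis
  have "(\<lambda>n. f (r (r' n)) j) \<longlonglongrightarrow> (l(i := l')) j" if "j \<in> insert i J" for j
  proof (cases "j = i")
    case True thus ?thesis using r'(2) by (simp add: o_def)
  next
    case False
    thus ?thesis using LIMSEQ_subseq_LIMSEQ[OF r(2) r'(1), of j] that by (simp add: o_def)
  qed
  moreover have "strict_mono (\<lambda>n. r (r' n))" using r(1) r'(1) by (simp add: strict_mono_def)
  ultimately show ?case by (intro exI[of _ "l(i := l')"] exI[of _ "\<lambda>n. r (r' n)"]) blast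
qed

text \<open>Along a minimizing sequence, unit directions and energy bounds form a bounded sequence
  in a finite dimensional space. A convergent subsequence exists, and closedness of
  \<open>reaches\<close> makes its limit feasible.\<close>

lemma feasible_minimum:
  assumes m: "2 \<le> m" and ne: "\<And>j. j \<in> {1..<m} \<Longrightarrow> P j \<noteq> P (Suc j)"
  obtains d E where "feasible P m d E"
    "\<forall>d' E'. feasible P m d' E' \<longrightarrow> (\<Sum>j\<in>{1..<m}. E j) \<le> (\<Sum>j\<in>{1..<m}. E' j)"
proof -
  define X where "X = {(\<Sum>j\<in>{1..<m}. E j) |d E. feasible P m d E}"
  have nn: "0 \<le> E j" if "feasible P m d E" "j \<in> {1..<m}" for d E j
    using that by (auto simp: feasible_def dest: reaches_facts)
  have X0: "X \<noteq> {}" using feasible_exists[of m P] m ne unfolding X_def by blast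
  have Xb: "bdd_below X"
  proof (rule bdd_belowI[of _ 0])
    fix x assume "x \<in> X"
    then obtain d E where "x = (\<Sum>j\<in>{1..<m}. E j)" "feasible P m d E" unfolding X_def by blast
    thus "0 \<le> x" using nn by (auto intro!: sum_nonneg)
  qed
  define I where "I = Inf X"
  have "\<exists>d E. feasible P m d E \<and> (\<Sum>j\<in>{1..<m}. E j) < I + 1 / real (Suc n)" for n
  proof -
    have "Inf X < I + 1 / real (Suc n)" by (simp add: I_def)
    then obtain x where "x \<in> X" "x < I + 1 / real (Suc n)" using cInf_lessD[OF X0] by blast
    thus ?thesis unfolding X_def by blast
  qed
  then obtain d E where fe: "\<And>n. feasible P m (d n) (E n)" and lt: "\<And>n. (\<Sum>j\<in>{1..<m}. E n j) < I + 1 / real (Suc n)"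
    by metis
  \<comment> \<open>Direction and energy bound are paired so that one subsequence serves both. There
    are m directions but only m - 1 bounds, hence the dummy value 0 at index m.\<close>
  define f where "f = (\<lambda>n j. (d n j, if j < m then E n j else 0))"
  \<comment> \<open>The last node starts no piece, so its direction is seen to be a unit vector from
    the end of piece m - 1.\<close>
  have nd: "norm (d n j) = 1" if "j \<in> {1..m}" for n j
  proof (cases "j < m")
    case True
    thus ?thesis using fe[of n] that by (auto simp: feasible_def dest: reaches_facts)
  next
    case False
    hence j: "j = Suc (m - 1)" "m - 1 \<in> {1..<m}" using that m by auto
    have "reaches (P (Suc (m - 1)) - P (m - 1)) (d n (m - 1)) (d n (Suc (m - 1))) (E n (m - 1))"
      using fe[of n] j(2) unfolding feasible_def by blast
    from reaches_facts(3)[OF this] show ?thesis unfolding j(1) .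
  qed
  have Eb: "E n j \<le> I + 1" if "j \<in> {1..<m}" for n j
  proof -
    have "E n j \<le> (\<Sum>j\<in>{1..<m}. E n j)" by (rule member_le_sum[OF that]) (use nn[OF fe] in auto)
    also have "\<dots> \<le> I + 1" using lt[of n] by (smt (verit) divide_le_eq_1 of_nat_Suc of_nat_0_le_iff)
    finally show ?thesis .
  qed
  have "bounded (range (\<lambda>n. f n j))" if j: "j \<in> {1..m}" for j
  proof (rule boundedI)
    fix x assume "x \<in> range (\<lambda>n. f n j)"
    then obtain n where x: "x = f n j" by blast
    have "\<bar>if j < m then E n j else 0\<bar> \<le> \<bar>I\<bar> + 1"
      using Eb[of j n] nn[OF fe, of j n] j by (cases "j < m") auto
    moreover have "norm x \<le> norm (d n j) + norm (if j < m then E n j else 0)"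
      unfolding x f_def by (rule norm_Pair_le)
    ultimately show "norm x \<le> 1 + (\<bar>I\<bar> + 1)" unfolding nd[OF j] real_norm_def by linarith
  qed
  then obtain l r where r: "strict_mono (r :: nat \<Rightarrow> nat)" "\<And>j. j \<in> {1..m} \<Longrightarrow> (\<lambda>n. f (r n) j) \<longlonglongrightarrow> l j"
    using simultaneous_convergent_subsequence[of "{1..m}" f] by blast
  define d0 where "d0 = (\<lambda>j. fst (l j))"
  define E0 where "E0 = (\<lambda>j. snd (l j))"
  have dl: "(\<lambda>n. d (r n) j) \<longlonglongrightarrow> d0 j" if "j \<in> {1..m}" for j
    using tendsto_fst[OF r(2)[OF that]] by (simp add: f_def d0_def)
  have El: "(\<lambda>n. E (r n) j) \<longlonglongrightarrow> E0 j" if "j \<in> {1..<m}" for j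
    using tendsto_snd[OF r(2)[of j]] that by (simp add: f_def E0_def)
  have "feasible P m d0 E0" unfolding feasible_def
  proof (intro ballI conjI)
    fix j assume j: "j \<in> {1..<m}"
    hence jj: "j \<in> {1..m}" "Suc j \<in> {1..m}" by auto
    show "reaches (P (Suc j) - P j) (d0 j) (d0 (Suc j)) (E0 j)"
      by (rule reaches_closed[OF _ dl[OF jj(1)] dl[OF jj(2)] El[OF j]]) (use fe j in \<open>auto simp: feasible_def\<close>)
    have "(\<lambda>n. Re (d (r n) i * cnj (P (Suc j) - P j))) \<longlonglongrightarrow> Re (d0 i * cnj (P (Suc j) - P j))" if "i \<in> {1..m}" for i
      by (intro tendsto_Re tendsto_mult dl[OF that] tendsto_const)
    note lim = LIMSEQ_le_const[OF this[OF jj(1)]] LIMSEQ_le_const[OF this[OF jj(2)]]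
    have "0 \<le> Re (d (r n) j * cnj (P (Suc j) - P j)) \<and> 0 \<le> Re (d (r n) (Suc j) * cnj (P (Suc j) - P j))" for n
      using fe[of "r n"] j unfolding feasible_def by blast
    thus "0 \<le> Re (d0 j * cnj (P (Suc j) - P j))" "0 \<le> Re (d0 (Suc j) * cnj (P (Suc j) - P j))"
      by (intro lim; blast)+
  qed
  moreover have "(\<Sum>j\<in>{1..<m}. E0 j) \<le> (\<Sum>j\<in>{1..<m}. E' j)" if "feasible P m d' E'" for d' E'
  proof -
    have "(\<lambda>n. \<Sum>j\<in>{1..<m}. E (r n) j) \<longlonglongrightarrow> (\<Sum>j\<in>{1..<m}. E0 j)" by (intro tendsto_sum El)
    moreover have "(\<lambda>n. I + 1 / real (Suc (r n))) \<longlonglongrightarrow> I + 0"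
    proof (intro tendsto_add tendsto_const)
      have "(\<lambda>n. 1 / real (Suc n)) \<longlonglongrightarrow> 0" using LIMSEQ_inverse_real_of_nat by (simp add: inverse_eq_divide)
      from LIMSEQ_subseq_LIMSEQ[OF this r(1)] show "(\<lambda>n. 1 / real (Suc (r n))) \<longlonglongrightarrow> 0" by (simp add: o_def)
    qed
    ultimately have "(\<Sum>j\<in>{1..<m}. E0 j) \<le> I + 0"
      by (rule LIMSEQ_le) (use lt in \<open>auto intro: less_imp_le\<close>)
    also have "I + 0 \<le> (\<Sum>j\<in>{1..<m}. E' j)" unfolding I_def add_0_right
      by (rule cInf_lower[OF _ Xb]) (use that in \<open>auto simp: X_def\<close>)
    finally show ?thesis .
  qed
  ultimately show ?thesis by (intro that[of d0 E0]) auto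
qed

lemma G2_if_C1_angle:
  assumes cv: "curve a b f" and ut: "\<And>s. s \<in> {0..arclength a b f} \<Longrightarrow> unit_tangent a b f s = cis (\<theta> s)"
    and \<kappa>: "continuous_on {0..arclength a b f} \<kappa>"
    and d: "\<And>s. s \<in> {0..arclength a b f} \<Longrightarrow> (\<theta> has_real_derivative \<kappa> s) (at s within {0..arclength a b f})"
  shows "G2 a b f"
proof -
  note L = arclength_pos[OF cv]
  have D: "(unit_tangent a b f has_vector_derivative \<kappa> s *\<^sub>R (\<i> * cis (\<theta> s))) (at s within {0..arclength a b f})"
    if "s \<in> {0..arclength a b f}" for s
    by (rule cis_vector_derivative_within[OF L that ut d[OF that]])
  hence df: "unit_tangent a b f differentiable_on {0..arclength a b f}"
    unfolding differentiable_on_def using differentiableI_vector by blast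
  have "signed_curvature a b f s = \<kappa> s" if "s \<in> {0..arclength a b f}" for s
    by (rule signed_curvature_eqI[OF refl refl L that ut[OF that] D[OF that]])
  hence "continuous_on {0..arclength a b f} (signed_curvature a b f)"
    by (intro continuous_on_eq[OF \<kappa>]) simp
  thus ?thesis unfolding G2_def using df differentiable_imp_continuous_on by blast
qed

theorem proposition1p1:
  fixes m :: nat and P :: "nat \<Rightarrow> complex"
  assumes "m \<ge> 2" and "\<forall>j\<in>{1..<m}. P j \<noteq> P (Suc j)"
  shows "(\<exists>a b F\<^sub>o\<^sub>p\<^sub>t. energy_minimal (admissible_curves (pi / 2) P m) a b F\<^sub>o\<^sub>p\<^sub>t) \<and>
    (\<forall>a b F t. energy_minimal (admissible_curves (pi / 2) P m) a b F \<longrightarrow>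
       admissible_times (pi / 2) P m a b F t \<longrightarrow>
       (\<forall>j\<in>{1..<m}. G2 (t j) (t (Suc j)) F))"
proof (intro conjI allI impI ballI)
  note m = assms(1)
  have ne: "P j \<noteq> P (Suc j)" if "j \<in> {1..<m}" for j using assms(2) that by blast
  obtain d E where fe: "feasible P m d E"
    and least: "\<forall>d' E'. feasible P m d' E' \<longrightarrow> (\<Sum>j\<in>{1..<m}. E j) \<le> (\<Sum>j\<in>{1..<m}. E' j)"
    by (rule feasible_minimum[of m P, OF m ne])
  obtain b0 F0 t0 where F0: "admissible_times (pi / 2) P m 0 b0 F0 t0"
    "bending_energy 0 b0 F0 \<le> ennreal (\<Sum>j\<in>{1..<m}. E j) / 4"
    by (rule feasible_imp_curve[of m P, OF m ne fe])
  show "\<exists>a b F. energy_minimal (admissible_curves (pi / 2) P m) a b F"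
  proof (rule exI[of _ 0], rule exI[of _ b0], rule exI[of _ F0])
    have "bending_energy 0 b0 F0 \<le> bending_energy a b F" if ad: "admissible_times (pi / 2) P m a b F t" for a b F t
    \<comment> \<open>A competitor of infinite energy is trivially no better; one of finite energy
      yields feasible data to compare with.\<close>
    proof (cases "bending_energy a b F = top")
      case False
      obtain k :: "nat \<Rightarrow> real \<Rightarrow> real" and d' where "feasible P m d' (\<lambda>j. LINT u|lborel. (k j u)\<^sup>2)"
        "bending_energy a b F = ennreal (\<Sum>j\<in>{1..<m}. LINT u|lborel. (k j u)\<^sup>2) / 4"
        by (rule curve_imp_feasible[of m P, OF m ne ad False])
      thus ?thesis using F0(2) least by (auto intro!: order_trans[OF F0(2)] divide_right_mono_ennreal ennreal_leI)
    qed simp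
    thus "energy_minimal (admissible_curves (pi / 2) P m) 0 b0 F0"
      using F0(1) by (auto simp: energy_minimal_def admissible_curves_def)
  qed
  fix a b F t j
  assume min: "energy_minimal (admissible_curves (pi / 2) P m) a b F"
    and ad: "admissible_times (pi / 2) P m a b F t" and j: "j \<in> {1..<m}"
  have le: "bending_energy a b F \<le> bending_energy a' b' F'" if "admissible_times (pi / 2) P m a' b' F' t'" for a' b' F' t'
    using min that by (auto simp: energy_minimal_def admissible_curves_def)
  \<comment> \<open>The curve built from feasible data shows that the minimal energy is finite, so
    the densities of an arbitrary minimizer are square integrable.\<close>
  have "bending_energy a b F \<le> ennreal (\<Sum>j\<in>{1..<m}. E j) / 4" using le[OF F0(1)] F0(2) by simp
  also have "\<dots> < top" by (simp add: ennreal_quarter least sum_nonneg ennreal_divide_eq_top_iff less_top[symmetric])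
  finally have fin: "bending_energy a b F \<noteq> top" by simp
  define l where "l = arclength (t j) (t (Suc j)) F"
  obtain \<sigma> c \<theta> k \<delta> where D:
    "\<forall>j\<in>{1..<m}. bend (\<sigma> j) (arclength (t j) (t (Suc j)) F) (c j) (\<theta> j) (k j) \<and> integrable lborel (\<lambda>u. (k j u)\<^sup>2) \<and>
       (\<forall>s\<in>{0..arclength (t j) (t (Suc j)) F}. unit_tangent (t j) (t (Suc j)) F s = cis (\<theta> j s)) \<and>
       chord (arclength (t j) (t (Suc j)) F) (\<theta> j) = P (Suc j) - P j \<and>
       cis (\<theta> j 0) = \<delta> j \<and> cis (\<theta> j (arclength (t j) (t (Suc j)) F)) = \<delta> (Suc j)"
    "feasible P m \<delta> (\<lambda>j. LINT u|lborel. (k j u)\<^sup>2)"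
    "bending_energy a b F = ennreal (\<Sum>j\<in>{1..<m}. LINT u|lborel. (k j u)\<^sup>2) / 4"
    by (rule curve_imp_feasible[of m P, OF m ne ad fin])
  have Dj: "bend (\<sigma> j) l (c j) (\<theta> j) (k j)" "integrable lborel (\<lambda>u. (k j u)\<^sup>2)"
    "\<And>s. s \<in> {0..l} \<Longrightarrow> unit_tangent (t j) (t (Suc j)) F s = cis (\<theta> j s)" "chord l (\<theta> j) = P (Suc j) - P j"
    "cis (\<theta> j 0) = \<delta> j" "cis (\<theta> j l) = \<delta> (Suc j)"
    using D(1) j unfolding l_def by blast+
  have "least_energy l (\<theta> j) (LINT u|lborel. (k j u)\<^sup>2)"
    unfolding least_energy_def
  proof (intro allI impI)
    fix \<sigma>' L' c' \<theta>' k'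
    assume c: "bend \<sigma>' L' c' \<theta>' k'" "integrable lborel (\<lambda>u. (k' u)\<^sup>2)" "chord L' \<theta>' = chord l (\<theta> j)"
      "\<theta>' 0 = \<theta> j 0" "\<theta>' L' = \<theta> j l"
    \<comment> \<open>Only piece j is exchanged. Its chord and end directions stay the same, so the
      data remain feasible, and subtracting the common terms leaves the comparison for this piece
      alone.\<close>
    define E' where "E' = (\<lambda>i. LINT u|lborel. (k i u)\<^sup>2)(j := LINT u|lborel. (k' u)\<^sup>2)"
    have "reaches (P (Suc j) - P j) (\<delta> j) (\<delta> (Suc j)) (LINT u|lborel. (k' u)\<^sup>2)"
      unfolding reaches_def using c Dj(4-6)
      by (intro exI[of _ \<sigma>'] exI[of _ L'] exI[of _ c'] exI[of _ \<theta>'] exI[of _ k']) auto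
    hence fe': "feasible P m \<delta> E'" using D(2) by (auto simp: feasible_def E'_def)
    obtain b' F' t' where "admissible_times (pi / 2) P m 0 b' F' t'"
      "bending_energy 0 b' F' \<le> ennreal (\<Sum>j\<in>{1..<m}. E' j) / 4"
      by (rule feasible_imp_curve[of m P, OF m ne fe'])
    hence "ennreal (\<Sum>j\<in>{1..<m}. LINT u|lborel. (k j u)\<^sup>2) / 4 \<le> ennreal (\<Sum>j\<in>{1..<m}. E' j) / 4"
      using le D(3) order_trans by metis
    moreover have "0 \<le> (\<Sum>j\<in>{1..<m}. E' j)" by (rule sum_nonneg) (simp add: E'_def)
    ultimately have "(\<Sum>j\<in>{1..<m}. LINT u|lborel. (k j u)\<^sup>2) \<le> (\<Sum>j\<in>{1..<m}. E' j)"
      by (simp add: ennreal_quarter sum_nonneg)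
    moreover have "(\<Sum>i\<in>{1..<m} - {j}. LINT u|lborel. (k i u)\<^sup>2) = (\<Sum>i\<in>{1..<m} - {j}. E' i)"
      by (rule sum.cong) (auto simp: E'_def)
    ultimately show "(LINT u|lborel. (k j u)\<^sup>2) \<le> (LINT u|lborel. (k' u)\<^sup>2)"
      using sum.remove[OF finite_atLeastLessThan j, of "\<lambda>i. LINT u|lborel. (k i u)\<^sup>2"]
        sum.remove[OF finite_atLeastLessThan j, of E'] by (simp add: E'_def)
  qed
  moreover have cj: "curve (t j) (t (Suc j)) F"
    using ad j by (auto simp: admissible_times_def s_curve_def)
  ultimately obtain \<kappa> where \<kappa>: "continuous_on {0..l} \<kappa>"
    "\<And>s. s \<in> {0..l} \<Longrightarrow> (\<theta> j has_real_derivative \<kappa> s) (at s within {0..l})"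
    using least_energy_imp_C1[OF Dj(1,2)] arclength_pos unfolding l_def by metis
  show "G2 (t j) (t (Suc j)) F"
  proof (rule G2_if_C1_angle[OF cj, folded l_def])
    show "unit_tangent (t j) (t (Suc j)) F s = cis (\<theta> j s)" if "s \<in> {0..l}" for s using that by (rule Dj(3))
    show "continuous_on {0..l} \<kappa>" by (rule \<kappa>(1))
    show "(\<theta> j has_real_derivative \<kappa> s) (at s within {0..l})" if "s \<in> {0..l}" for s using that by (rule \<kappa>(2))
  qed
qed

end
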